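(* Let $\hbar$ be an allowed value, i.e. $2\hbar\in\mathbb{C}\setminus\{0,-1,-\tfrac12,-\tfrac13,\dots\}$. (i) The $\mathrm{SU}(1,n)$-action $(U,a)\mapsto U^*a$ on $\widehat{\mathcal{A}}_\hbar(C_{n+1}^+)$ by automorphisms of $\tilde\star$ is smooth, and the smooth topology with respect to this action coincides with the original one. (ii) The action of $\mathrm{SU}(1,n)$ descends to a smooth action on $\widehat{\mathcal{A}}_\hbar(\mathbb{D}_n)$ by automorphisms, and the smooth topology coincides with the original one. (iii) In both cases the corresponding Lie algebra action of $\mathfrak{su}(1,n)$ is inner via the equivariant momentum map $J$, i.e. $\frac{d}{dt}\big|_{t=0}\exp(t\xi)^*a=\frac{\mathrm{i}}{\hbar}[J_\xi,a]$ for all $\xi\in\mathfrak{su}(1,n)$, with the commutator with respect to $\tilde\star$ for $a\in\widehat{\mathcal{A}}_\hbar(C_{n+1}^+)$, and with respect to $\star_{\mathbb{D}_n}$ and with $J_\xi$ replaced by its class for $a\in\widehat{\mathcal{A}}_\hbar(\mathbb{D}_n)$. (iv) If in addition $\hbar$ is real, then $\mathrm{SU}(1,n)$ acts by $^*$-automorphisms (the $^*$-involution being pointwise complex conjugation).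
   Context: Fix $n\ge1$. On $\mathbb{C}^{n+1}$ with coordinates $z^0,\dots,z^n$ let $\mathsf{g}=\mathrm{diag}(-1,1,\dots,1)$, $y(z)=|z^0|^2-|z^1|^2-\dots-|z^n|^2$, $C_{n+1}^+=\{z: y(z)>0\}$, $\mathbb{D}_n=\{v\in\mathbb{C}^n:|v|^2<1\}$, and $\pi\colon C_{n+1}^+\to\mathbb{D}_n$, $\pi(z)=(z^1/z^0,\dots,z^n/z^0)$. An index triple is $(P,Q,\alpha)$ with $P,Q\in\mathbb{N}_0^n$, $\alpha\in\mathbb{N}_0$, $|P|,|Q|\le\alpha$. Put $\mathsf{e}_{P,Q,\alpha}(z)=(z^0)^{\alpha-|P|}z^P(\bar z^0)^{\alpha-|Q|}\bar z^Q$ where $z^P=(z^1)^{P_1}\cdots(z^n)^{P_n}$; these form a basis of the $\mathrm{U}(1)$-invariant polynomials in $z,\bar z$. For $\hbar\ne0$ the Wick product of polynomials is $f\star g=\sum_{r\ge0}\frac{(2\hbar)^r}{r!}\sum_{i_1,\dots,i_r,j_1,\dots,j_r=0}^n\mathsf{g}^{i_1j_1}\cdots\mathsf{g}^{i_rj_r}\frac{\partial^rf}{\partial z^{i_1}\cdots\partial z^{i_r}}\frac{\partial^rg}{\partial\bar z^{j_1}\cdots\partial\bar z^{j_r}}$; it preserves $\mathrm{U}(1)$-invariant polynomials. With $(x)_r=x(x+1)\cdots(x+r-1)$, let $S$ be the (injective) linear map from $\mathrm{U}(1)$-invariant polynomials to $C^\infty(C_{n+1}^+)$ with $S\mathsf{e}_{P,Q,\alpha}=(2\hbar)^\alpha\big(\tfrac{y}{2\hbar}\big)_\alpha\frac{\mathsf{e}_{P,Q,\alpha}}{y^\alpha}$,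 and $\mathsf{f}_{P,Q,\alpha}=\frac{1}{P!(\alpha-|P|)!Q!(\alpha-|Q|)!}\big(\frac{y}{2\hbar}\big)_\alpha\frac{\mathsf{e}_{P,Q,\alpha}}{y^\alpha}$. $\mathcal{A}_\hbar(C_{n+1}^+)$ is the span of the (linearly independent) $\mathsf{f}_{P,Q,\alpha}$, with product $a\,\tilde\star\,b=S(S^{-1}a\star S^{-1}b)$. Topology of $\mathcal{A}_\hbar(C_{n+1}^+)$: given by the seminorms $\|a\|_\epsilon=\sup_{(P,Q,\alpha)}|a_{P,Q,\alpha}|/(\alpha!)^\epsilon$, $0<\epsilon<1$, for $a=\sum a_{P,Q,\alpha}\mathsf{f}_{P,Q,\alpha}$. (This is equivalent to the following system: with structure constants $\mathsf{f}_\tau\tilde\star\mathsf{f}_\sigma=\sum_\rho C^\rho_{\tau\sigma}\mathsf{f}_\rho$ over index triples, $h_{0,0,\rho}(a)=|a_\rho|$, $h_{m+1,2\ell,\rho}(a)=\sum_\tau h_{m,\ell,\tau}(a)^2\sum_\sigma|C^\rho_{\tau\sigma}|$, $h_{m+1,2\ell+1,\rho}(a)=\sum_\sigma h_{m,\ell,\sigma}(a)^2\sum_\tau|C^\rho_{\tau\sigma}|$, take $h_{m,\ell,\rho}(a)^{1/2^m}$ and $(\sum_\rho|\mathsf{f}_\rho(w)|h_{m,\ell,\rho}(a))^{1/2^m}$, $w\in C_{n+1}^+$.) The product and all evaluations $\delta_w(a)=a(w)$ are continuous; the completion $\widehat{\mathcal{A}}_\hbar(C_{n+1}^+)$ is a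 Fréchet algebra of functions on $C_{n+1}^+$, consisting of all $\sum a_{P,Q,\alpha}\mathsf{f}_{P,Q,\alpha}$ with all $\|a\|_\epsilon$ finite. For allowed $\hbar$, $\mathcal{J}_{y=1}=\bigcap_{y(w)=1}\ker\delta_w$ is a closed two-sided ideal of it and $\widehat{\mathcal{A}}_\hbar(\mathbb{D}_n)=\widehat{\mathcal{A}}_\hbar(C_{n+1}^+)/\mathcal{J}_{y=1}$ with quotient topology and induced product $\star_{\mathbb{D}_n}$; its elements are functions on $\mathbb{D}_n$ via $[a](v)=a(w)$ for any $w$ with $\pi(w)=v$, $y(w)=1$. $\mathrm{SU}(1,n)=\{U\in M_{n+1}(\mathbb{C}):U^\dagger\mathsf{g}U=\mathsf{g},\det U=1\}$ acts linearly on $\mathbb{C}^{n+1}$ preserving $y$ and $C_{n+1}^+$; $U^*a=a\circ U$ maps $\mathcal{A}_\hbar(C_{n+1}^+)$ to itself, is an automorphism of $\tilde\star$ and extends continuously to $\widehat{\mathcal{A}}_\hbar(C_{n+1}^+)$. Its Lie algebra is $\mathfrak{su}(1,n)=\{\xi\in M_{n+1}(\mathbb{C}):\xi^\dagger\mathsf{g}+\mathsf{g}\xi=0,\ \mathrm{tr}\,\xi=0\}$, and the momentum map is $J_\xi(z)=\frac{\mathrm{i}}{2}\sum_{i,j,k}\bar z^k\mathsf{g}^{ki}\xi_{ij}z^j$, an element of $\mathcal{A}_\hbar(C_{n+1}^+)$. The action is smooth if for every $a$ the map $U\mapsto U^*a$ is $C^\infty$; the smooth topology is then defined by the seminorms $a\mapsto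 p(L_{\xi_1}\cdots L_{\xi_k}a)$, with $p$ a continuous seminorm, $k\in\mathbb{N}_0$, $\xi_i\in\mathfrak{su}(1,n)$ and $L_\xi a=\frac{d}{dt}\big|_{t=0}\exp(t\xi)^*a$. *)

theory Defs
  imports "HOL-Analysis.Analysis"
begin

section \<open>Coordinates, indefinite metric, cone and disc\<close>

text \<open>
  The type \<^typ>\<open>'n::finite\<close> is the index set \<open>{1,...,n}\<close> and \<^typ>\<open>'n option\<close> is
  \<open>{0,...,n}\<close>: the coordinate \<open>z\<^sup>0\<close> is \<open>z $ None\<close> and \<open>z\<^sup>i\<close> is \<open>z $ Some i\<close>.
\<close>

type_synonym 'n cvec = "(complex, 'n option) vec"
type_synonym 'n cmat = "((complex, 'n option) vec, 'n option) vec"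

definition gmetric :: "'n::finite cmat" where
  "gmetric = (\<chi> i j. if i = j then (if i = None then - 1 else 1) else 0)"

definition yfun :: "'n::finite cvec \<Rightarrow> real" where
  "yfun z = (cmod (z $ None))\<^sup>2 - (\<Sum>i\<in>UNIV. (cmod (z $ Some i))\<^sup>2)"

definition pos_cone :: "'n::finite cvec set" where
  "pos_cone = {z. yfun z > 0}"

definition disc :: "(complex, 'n::finite) vec set" where
  "disc = {v. (norm v)\<^sup>2 < 1}"

definition disc_proj :: "'n::finite cvec \<Rightarrow> (complex, 'n) vec" where
  "disc_proj z = (\<chi> i. z $ Some i / z $ None)"

section \<open>Invariant polynomials and the Wick product\<close>

type_synonym 'n triple = "('n \<Rightarrow> nat) \<times> ('n \<Rightarrow> nat) \<times> nat"

definition mdeg :: "('n::finite \<Rightarrow> nat) \<Rightarrow> nat" where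
  "mdeg P = (\<Sum>i\<in>UNIV. P i)"

definition mfact :: "('n::finite \<Rightarrow> nat) \<Rightarrow> nat" where
  "mfact P = (\<Prod>i\<in>UNIV. fact (P i))"

definition triples :: "'n::finite triple set" where
  "triples = {(P, Q, \<alpha>). mdeg P \<le> \<alpha> \<and> mdeg Q \<le> \<alpha>}"

fun ebasis :: "'n::finite triple \<Rightarrow> 'n cvec \<Rightarrow> complex" where
  "ebasis (P, Q, \<alpha>) z =
     (z $ None) ^ (\<alpha> - mdeg P) * (\<Prod>i\<in>UNIV. (z $ Some i) ^ P i) *
     (cnj (z $ None)) ^ (\<alpha> - mdeg Q) * (\<Prod>i\<in>UNIV. (cnj (z $ Some i)) ^ Q i)"

definition fin_coeffs :: "('n::finite triple \<Rightarrow> complex) set" where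
  "fin_coeffs = {c. finite {\<tau>. c \<tau> \<noteq> 0} \<and> {\<tau>. c \<tau> \<noteq> 0} \<subseteq> triples}"

definition lincomb :: "('i \<Rightarrow> 'p \<Rightarrow> complex) \<Rightarrow> ('i \<Rightarrow> complex) \<Rightarrow> 'p \<Rightarrow> complex" where
  "lincomb B c = (\<lambda>z. \<Sum>\<tau> | c \<tau> \<noteq> 0. c \<tau> * B \<tau> z)"

text \<open>The \<open>U(1)\<close>-invariant polynomials in \<open>z\<close> and its conjugate, as functions.\<close>

definition inv_polys :: "('n::finite cvec \<Rightarrow> complex) set" where
  "inv_polys = lincomb ebasis ` fin_coeffs"

definition ecoeffs :: "('n::finite cvec \<Rightarrow> complex) \<Rightarrow> 'n triple \<Rightarrow> complex" where
  "ecoeffs p = (THE c. c \<in> fin_coeffs \<and> p = lincomb ebasis c)"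

text \<open>Wirtinger derivatives with respect to \<open>z\<^sup>i\<close> and its conjugate;
  \<^const>\<open>frechet_derivative\<close> is the real derivative.\<close>

definition dz :: "'n::finite option \<Rightarrow> ('n cvec \<Rightarrow> complex) \<Rightarrow> 'n cvec \<Rightarrow> complex" where
  "dz i f = (\<lambda>z. (frechet_derivative f (at z) (axis i 1)
                  - \<i> * frechet_derivative f (at z) (axis i \<i>)) / 2)"

definition dzbar :: "'n::finite option \<Rightarrow> ('n cvec \<Rightarrow> complex) \<Rightarrow> 'n cvec \<Rightarrow> complex" where
  "dzbar i f = (\<lambda>z. (frechet_derivative f (at z) (axis i 1)
                  + \<i> * frechet_derivative f (at z) (axis i \<i>)) / 2)"

text \<open>For polynomials only finitely many terms of the series over \<open>r\<close> are nonzero.\<close>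

definition wick ::
  "complex \<Rightarrow> ('n::finite cvec \<Rightarrow> complex) \<Rightarrow> ('n cvec \<Rightarrow> complex) \<Rightarrow> 'n cvec \<Rightarrow> complex" where
  "wick \<h> f g = (\<lambda>z. \<Sum>r. (2 * \<h>) ^ r / fact r *
     (\<Sum>I | length I = r. \<Sum>J | length J = r.
        (\<Prod>k<r. gmetric $ (I ! k) $ (J ! k)) * foldr dz I f z * foldr dzbar J g z))"

section \<open>The algebra on the cone\<close>

text \<open>Functions on the cone are represented by functions on the whole space that vanish
  outside the cone.\<close>

definition sbasis :: "complex \<Rightarrow> 'n::finite triple \<Rightarrow> 'n cvec \<Rightarrow> complex" where
  "sbasis \<h> = (\<lambda>(P, Q, \<alpha>) z. if z \<in> pos_cone then
     (2 * \<h>) ^ \<alpha> * pochhammer (of_real (yfun z) / (2 * \<h>)) \<alpha> *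
       (ebasis (P, Q, \<alpha>) z / of_real (yfun z) ^ \<alpha>) else 0)"

definition Smap :: "complex \<Rightarrow> ('n::finite cvec \<Rightarrow> complex) \<Rightarrow> 'n cvec \<Rightarrow> complex" where
  "Smap \<h> p = lincomb (sbasis \<h>) (ecoeffs p)"

definition fbasis :: "complex \<Rightarrow> 'n::finite triple \<Rightarrow> 'n cvec \<Rightarrow> complex" where
  "fbasis \<h> = (\<lambda>(P, Q, \<alpha>) z. if z \<in> pos_cone then
     1 / of_nat (mfact P * fact (\<alpha> - mdeg P) * mfact Q * fact (\<alpha> - mdeg Q)) *
       pochhammer (of_real (yfun z) / (2 * \<h>)) \<alpha> *
       (ebasis (P, Q, \<alpha>) z / of_real (yfun z) ^ \<alpha>) else 0)"

definition cone_alg0 :: "complex \<Rightarrow> ('n::finite cvec \<Rightarrow> complex) set" where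
  "cone_alg0 \<h> = lincomb (fbasis \<h>) ` fin_coeffs"

definition cone_mult0 ::
  "complex \<Rightarrow> ('n::finite cvec \<Rightarrow> complex) \<Rightarrow> ('n cvec \<Rightarrow> complex) \<Rightarrow> 'n cvec \<Rightarrow> complex" where
  "cone_mult0 \<h> a b =
     Smap \<h> (wick \<h> (inv_into inv_polys (Smap \<h>) a) (inv_into inv_polys (Smap \<h>) b))"

section \<open>Topologies on vector spaces of functions\<close>

text \<open>The locally convex topology on the space \<open>V\<close> defined by a nonempty family of seminorms.\<close>

definition seminorm_topology ::
  "('p \<Rightarrow> complex) set \<Rightarrow> (('p \<Rightarrow> complex) \<Rightarrow> real) set \<Rightarrow> ('p \<Rightarrow> complex) topology" where
  "seminorm_topology V \<P> = topology_generated_by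
     {{x \<in> V. p (\<lambda>z. x z - a z) < r} | p a r. p \<in> \<P> \<and> a \<in> V \<and> 0 < r}"

definition continuous_seminorm ::
  "('p \<Rightarrow> complex) set \<Rightarrow> ('p \<Rightarrow> complex) topology \<Rightarrow> (('p \<Rightarrow> complex) \<Rightarrow> real) \<Rightarrow> bool" where
  "continuous_seminorm V T p \<longleftrightarrow>
     (\<forall>a\<in>V. 0 \<le> p a) \<and>
     (\<forall>a\<in>V. \<forall>b\<in>V. p (\<lambda>z. a z + b z) \<le> p a + p b) \<and>
     (\<forall>c. \<forall>a\<in>V. p (\<lambda>z. c * a z) = cmod c * p a) \<and>
     continuous_map T euclideanreal p"

definition quotient_topology :: "'a topology \<Rightarrow> ('a \<Rightarrow> 'b) \<Rightarrow> 'b topology" where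
  "quotient_topology T q =
     topology (\<lambda>W. W \<subseteq> q ` topspace T \<and> openin T {x \<in> topspace T. q x \<in> W})"

lemma openin_quotient_topology:
  "openin (quotient_topology T q) W \<longleftrightarrow>
     W \<subseteq> q ` topspace T \<and> openin T {x \<in> topspace T. q x \<in> W}"
proof -
  have "istopology (\<lambda>W. W \<subseteq> q ` topspace T \<and> openin T {x \<in> topspace T. q x \<in> W})"
    unfolding istopology_def
  proof (intro conjI allI impI)
    fix S R
    assume *: "S \<subseteq> q ` topspace T \<and> openin T {x \<in> topspace T. q x \<in> S}"
      "R \<subseteq> q ` topspace T \<and> openin T {x \<in> topspace T. q x \<in> R}"
    show "S \<inter> R \<subseteq> q ` topspace T" using * by blast
    have "{x \<in> topspace T. q x \<in> S \<inter> R} =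
      {x \<in> topspace T. q x \<in> S} \<inter> {x \<in> topspace T. q x \<in> R}" by blast
    then show "openin T {x \<in> topspace T. q x \<in> S \<inter> R}" using * by (simp add: openin_Int)
  next
    fix K
    assume *: "\<forall>S\<in>K. S \<subseteq> q ` topspace T \<and> openin T {x \<in> topspace T. q x \<in> S}"
    show "\<Union>K \<subseteq> q ` topspace T" using * by blast
    have "{x \<in> topspace T. q x \<in> \<Union>K} = \<Union>((\<lambda>S. {x \<in> topspace T. q x \<in> S}) ` K)" by blast
    then show "openin T {x \<in> topspace T. q x \<in> \<Union>K}" using * by (auto intro!: openin_Union)
  qed
  then show ?thesis
    unfolding quotient_topology_def by (simp add: topology_inverse')
qed

lemma topspace_quotient_topology [simp]: "topspace (quotient_topology T q) = q ` topspace T"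
proof -
  have "{x \<in> topspace T. q x \<in> q ` topspace T} = topspace T" by blast
  then have "openin (quotient_topology T q) (q ` topspace T)"
    by (simp add: openin_quotient_topology)
  then show ?thesis
    by (metis openin_quotient_topology openin_subset openin_topspace subset_antisym)
qed

lemma quotient_map_quotient_topology: "quotient_map T (quotient_topology T q) q"
  unfolding quotient_map_def by (auto simp: openin_quotient_topology)

section \<open>The completed algebra on the cone\<close>

text \<open>Coefficient families all of whose seminorms are finite.\<close>

definition hat_coeffs :: "('n::finite triple \<Rightarrow> complex) set" where
  "hat_coeffs = {c. (\<forall>\<tau>. \<tau> \<notin> triples \<longrightarrow> c \<tau> = 0) \<and>
     (\<forall>\<epsilon>::real. 0 < \<epsilon> \<and> \<epsilon> < 1 \<longrightarrow>
        bdd_above ((\<lambda>(P, Q, \<alpha>). cmod (c (P, Q, \<alpha>)) / fact \<alpha> powr \<epsilon>) ` triples))}"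

definition fseries :: "complex \<Rightarrow> ('n::finite triple \<Rightarrow> complex) \<Rightarrow> 'n cvec \<Rightarrow> complex" where
  "fseries \<h> c = (\<lambda>z. \<Sum>\<^sub>\<infinity>\<tau>\<in>triples. c \<tau> * fbasis \<h> \<tau> z)"

definition cone_alg :: "complex \<Rightarrow> ('n::finite cvec \<Rightarrow> complex) set" where
  "cone_alg \<h> = fseries \<h> ` hat_coeffs"

definition fcoeffs :: "complex \<Rightarrow> ('n::finite cvec \<Rightarrow> complex) \<Rightarrow> 'n triple \<Rightarrow> complex" where
  "fcoeffs \<h> a = (THE c. c \<in> hat_coeffs \<and> a = fseries \<h> c)"

definition eps_norm :: "complex \<Rightarrow> real \<Rightarrow> ('n::finite cvec \<Rightarrow> complex) \<Rightarrow> real" where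
  "eps_norm \<h> \<epsilon> a = (SUP (P, Q, \<alpha>)\<in>triples. cmod (fcoeffs \<h> a (P, Q, \<alpha>)) / fact \<alpha> powr \<epsilon>)"

definition cone_top :: "complex \<Rightarrow> ('n::finite cvec \<Rightarrow> complex) topology" where
  "cone_top \<h> = seminorm_topology (cone_alg \<h>) (eps_norm \<h> ` {0<..<1})"

text \<open>The product of the completion is the extension by continuity of \<^const>\<open>cone_mult0\<close>.
  Sequences suffice because the topology is metrizable.\<close>

definition cone_mult ::
  "complex \<Rightarrow> ('n::finite cvec \<Rightarrow> complex) \<Rightarrow> ('n cvec \<Rightarrow> complex) \<Rightarrow> 'n cvec \<Rightarrow> complex" where
  "cone_mult \<h> a b = (THE c. c \<in> cone_alg \<h> \<and>
     (\<forall>X Y. range X \<subseteq> cone_alg0 \<h> \<and> range Y \<subseteq> cone_alg0 \<h> \<and>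
        limitin (cone_top \<h>) X a sequentially \<and> limitin (cone_top \<h>) Y b sequentially \<longrightarrow>
        limitin (cone_top \<h>) (\<lambda>k. cone_mult0 \<h> (X k) (Y k)) c sequentially))"

section \<open>The quotient algebra on the disc\<close>

definition vanishing_ideal :: "complex \<Rightarrow> ('n::finite cvec \<Rightarrow> complex) set" where
  "vanishing_ideal \<h> = {a \<in> cone_alg \<h>. \<forall>w. yfun w = 1 \<longrightarrow> a w = 0}"

text \<open>The point over \<open>v\<close> in the level set \<open>y = 1\<close> whose zeroth coordinate is positive.\<close>

definition lift_pt :: "(complex, 'n::finite) vec \<Rightarrow> 'n cvec" where
  "lift_pt v = (\<chi> i. (case i of None \<Rightarrow> 1 | Some j \<Rightarrow> v $ j) / of_real (sqrt (1 - (norm v)\<^sup>2)))"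

text \<open>The class of \<open>a\<close> modulo \<^const>\<open>vanishing_ideal\<close>, as a function on the disc (and zero
  outside the disc).  The lemmas \<open>disc_class_eq\<close> and \<open>disc_class_eq_iff\<close> below show that the
  value does not depend on the choice of the point over \<open>v\<close>, and that two elements have the
  same class if and only if their difference vanishes on \<open>y = 1\<close>.\<close>

definition disc_class :: "('n::finite cvec \<Rightarrow> complex) \<Rightarrow> (complex, 'n) vec \<Rightarrow> complex" where
  "disc_class a = (\<lambda>v. if v \<in> disc then a (lift_pt v) else 0)"

lemma ebasis_unimodular:
  assumes "\<tau> \<in> triples" "cmod c = 1"
  shows "ebasis \<tau> (c *s z) = ebasis \<tau> z"
proof -
  obtain P Q \<alpha> where \<tau>: "\<tau> = (P, Q, \<alpha>)" by (cases \<tau>)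
  have le: "mdeg P \<le> \<alpha>" "mdeg Q \<le> \<alpha>" using assms(1) by (auto simp: \<tau> triples_def)
  have 1: "(\<Prod>i\<in>UNIV. (c * z $ Some i) ^ P i) = c ^ mdeg P * (\<Prod>i\<in>UNIV. (z $ Some i) ^ P i)"
    by (simp add: power_mult_distrib prod.distrib mdeg_def power_sum)
  have 2: "(\<Prod>i\<in>UNIV. (cnj c * cnj (z $ Some i)) ^ Q i) =
      cnj c ^ mdeg Q * (\<Prod>i\<in>UNIV. (cnj (z $ Some i)) ^ Q i)"
    by (simp add: power_mult_distrib prod.distrib mdeg_def power_sum)
  have 3: "c ^ (\<alpha> - mdeg P) * c ^ mdeg P = c ^ \<alpha>"
    "cnj c ^ (\<alpha> - mdeg Q) * cnj c ^ mdeg Q = cnj c ^ \<alpha>"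
    using le by (simp_all flip: power_add)
  have "c * cnj c = 1"
    using assms(2) by (simp add: complex_norm_square [symmetric])
  then have 4: "c ^ \<alpha> * cnj c ^ \<alpha> = 1" by (simp flip: power_mult_distrib)
  have "ebasis \<tau> (c *s z) =
      (c ^ (\<alpha> - mdeg P) * c ^ mdeg P) * (cnj c ^ (\<alpha> - mdeg Q) * cnj c ^ mdeg Q) * ebasis \<tau> z"
    unfolding \<tau> ebasis.simps vector_smult_component complex_cnj_mult 1 2
    by (simp add: power_mult_distrib)
  then show ?thesis by (simp add: 3 4)
qed

lemma yfun_unimodular: "cmod c = 1 \<Longrightarrow> yfun (c *s z) = yfun z"
  by (simp add: yfun_def norm_mult)

lemma cone_alg_unimodular:
  assumes "a \<in> cone_alg \<h>" "cmod c = 1"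
  shows "a (c *s z) = a z"
proof -
  have "fbasis \<h> \<tau> (c *s z) = fbasis \<h> \<tau> z" if "\<tau> \<in> triples" for \<tau>
    using ebasis_unimodular [OF that assms(2)] yfun_unimodular [OF assms(2), of z]
    by (cases \<tau>) (simp add: fbasis_def pos_cone_def)
  then show ?thesis
    using assms(1) by (auto simp: cone_alg_def fseries_def intro!: infsum_cong)
qed

lemma yfun_eq_1:
  fixes w :: "'n::finite cvec"
  assumes "yfun w = 1"
  shows "w $ None \<noteq> 0" "(norm (disc_proj w))\<^sup>2 = 1 - 1 / (cmod (w $ None))\<^sup>2"
proof -
  have s: "(\<Sum>i\<in>UNIV. (cmod (w $ Some i))\<^sup>2) = (cmod (w $ None))\<^sup>2 - 1"
    using assms by (simp add: yfun_def)
  moreover have "(\<Sum>i\<in>UNIV. (cmod (w $ Some i))\<^sup>2) \<ge> 0" by (intro sum_nonneg) simp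
  ultimately show nz: "w $ None \<noteq> 0" by auto
  have "(norm (disc_proj w))\<^sup>2 = (\<Sum>i\<in>UNIV. (cmod (w $ Some i))\<^sup>2 / (cmod (w $ None))\<^sup>2)"
    by (simp add: norm_vec_def L2_set_def sum_nonneg disc_proj_def norm_divide power_divide)
  also have "\<dots> = ((cmod (w $ None))\<^sup>2 - 1) / (cmod (w $ None))\<^sup>2"
    by (simp add: s flip: sum_divide_distrib)
  finally show "(norm (disc_proj w))\<^sup>2 = 1 - 1 / (cmod (w $ None))\<^sup>2"
    using nz by (simp add: field_simps)
qed

lemma proj_in_disc: "yfun w = 1 \<Longrightarrow> disc_proj w \<in> disc"
  using yfun_eq_1 [of w] by (simp add: disc_def)

lemma lift_pt_proj:
  assumes "yfun w = 1"
  shows "lift_pt (disc_proj w) = (of_real (cmod (w $ None)) / w $ None) *s w"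
proof -
  have nz: "w $ None \<noteq> 0" and *: "1 - (norm (disc_proj w))\<^sup>2 = (1 / cmod (w $ None))\<^sup>2"
    using yfun_eq_1 [OF assms] by (simp_all add: power_divide)
  have "sqrt (1 - (norm (disc_proj w))\<^sup>2) = 1 / cmod (w $ None)"
    unfolding * by (simp add: real_sqrt_divide)
  with nz show ?thesis
    by (auto simp: vec_eq_iff lift_pt_def disc_proj_def split: option.split)
qed

lemma disc_class_eq:
  assumes "a \<in> cone_alg \<h>" "yfun w = 1"
  shows "disc_class a (disc_proj w) = a w"
proof -
  have "cmod (of_real (cmod (w $ None)) / w $ None) = 1"
    using yfun_eq_1 [OF assms(2)] by (simp add: norm_divide)
  then show ?thesis
    using cone_alg_unimodular [OF assms(1)] proj_in_disc [OF assms(2)] lift_pt_proj [OF assms(2)]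
    by (simp add: disc_class_def)
qed

lemma lift_pt_disc:
  assumes "v \<in> disc"
  shows "yfun (lift_pt v) = 1" "disc_proj (lift_pt v) = v"
proof -
  define s where "s = 1 - (norm v)\<^sup>2"
  have s: "s > 0" using assms by (simp add: disc_def s_def)
  have n: "(norm v)\<^sup>2 = (\<Sum>i\<in>UNIV. (cmod (v $ i))\<^sup>2)"
    by (simp add: norm_vec_def L2_set_def sum_nonneg)
  have "yfun (lift_pt v) = 1 / s - (\<Sum>i\<in>UNIV. (cmod (v $ i))\<^sup>2) / s"
    using s by (simp add: yfun_def lift_pt_def norm_divide power_divide sum_divide_distrib
        flip: s_def)
  also have "\<dots> = 1" using s by (simp add: s_def flip: n diff_divide_distrib)
  finally show "yfun (lift_pt v) = 1" .
  show "disc_proj (lift_pt v) = v"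
    using s by (simp add: vec_eq_iff disc_proj_def lift_pt_def flip: s_def)
qed

lemma disc_class_eq_iff:
  assumes "a \<in> cone_alg \<h>" "b \<in> cone_alg \<h>"
  shows "disc_class a = disc_class b \<longleftrightarrow> (\<forall>w. yfun w = 1 \<longrightarrow> a w - b w = 0)"
proof
  assume "disc_class a = disc_class b"
  then show "\<forall>w. yfun w = 1 \<longrightarrow> a w - b w = 0"
    using disc_class_eq assms by (metis diff_self)
next
  assume "\<forall>w. yfun w = 1 \<longrightarrow> a w - b w = 0"
  then show "disc_class a = disc_class b"
    by (auto simp: disc_class_def lift_pt_disc)
qed

definition disc_alg :: "complex \<Rightarrow> ((complex, 'n::finite) vec \<Rightarrow> complex) set" where
  "disc_alg \<h> = disc_class ` cone_alg \<h>"

definition disc_top :: "complex \<Rightarrow> ((complex, 'n::finite) vec \<Rightarrow> complex) topology" where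
  "disc_top \<h> = quotient_topology (cone_top \<h>) disc_class"

definition disc_rep ::
  "complex \<Rightarrow> ((complex, 'n::finite) vec \<Rightarrow> complex) \<Rightarrow> 'n cvec \<Rightarrow> complex" where
  "disc_rep \<h> f = (SOME a. a \<in> cone_alg \<h> \<and> disc_class a = f)"

definition disc_mult ::
  "complex \<Rightarrow> ((complex, 'n::finite) vec \<Rightarrow> complex) \<Rightarrow> ((complex, 'n) vec \<Rightarrow> complex)
     \<Rightarrow> (complex, 'n) vec \<Rightarrow> complex" where
  "disc_mult \<h> f g = disc_class (cone_mult \<h> (disc_rep \<h> f) (disc_rep \<h> g))"

section \<open>The group, its Lie algebra and the momentum map\<close>

definition adjoint_mat :: "'n::finite cmat \<Rightarrow> 'n cmat" where
  "adjoint_mat U = map_matrix cnj (transpose U)"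

definition SU :: "'n::finite cmat set" where
  "SU = {U. adjoint_mat U ** gmetric ** U = gmetric \<and> det U = 1}"

definition su :: "'n::finite cmat set" where
  "su = {\<xi>. adjoint_mat \<xi> ** gmetric + gmetric ** \<xi> = 0 \<and> trace \<xi> = 0}"

definition mexp :: "'n::finite cmat \<Rightarrow> 'n cmat" where
  "mexp X = (\<Sum>k. (1 / fact k) *\<^sub>R ((\<lambda>Y. X ** Y) ^^ k) (mat 1))"

definition pullback :: "'n::finite cmat \<Rightarrow> ('n cvec \<Rightarrow> complex) \<Rightarrow> 'n cvec \<Rightarrow> complex" where
  "pullback U a = (\<lambda>z. a (U *v z))"

definition disc_act ::
  "complex \<Rightarrow> 'n::finite cmat \<Rightarrow> ((complex, 'n) vec \<Rightarrow> complex) \<Rightarrow> (complex, 'n) vec \<Rightarrow> complex" where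
  "disc_act \<h> U f = disc_class (pullback U (disc_rep \<h> f))"

definition momentum :: "'n::finite cmat \<Rightarrow> 'n cvec \<Rightarrow> complex" where
  "momentum \<xi> = (\<lambda>z. if z \<in> pos_cone then
     \<i> / 2 * (\<Sum>i\<in>UNIV. \<Sum>j\<in>UNIV. \<Sum>k\<in>UNIV. cnj (z $ k) * gmetric $ k $ i * \<xi> $ i $ j * z $ j)
     else 0)"

section \<open>Smooth actions on topological vector spaces of functions\<close>

text \<open>The derivative at \<open>0\<close>, in the topology \<open>T\<close>, of a curve of functions.\<close>

definition has_velocity ::
  "('p \<Rightarrow> complex) topology \<Rightarrow> (real \<Rightarrow> 'p \<Rightarrow> complex) \<Rightarrow> ('p \<Rightarrow> complex) \<Rightarrow> bool" where
  "has_velocity T c b \<longleftrightarrow> limitin T (\<lambda>t z. (c t z - c 0 z) / of_real t) b (at 0)"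

text \<open>\<open>C\<^sup>k\<close>-maps from a relatively open subset \<open>S\<close> of a finite-dimensional real subspace \<open>E\<close>
  into a function space: all iterated directional derivatives up to order \<open>k\<close> exist and are
  continuous.\<close>

primrec Ck_on ::
  "nat \<Rightarrow> ('p \<Rightarrow> complex) topology \<Rightarrow> 'v::euclidean_space set \<Rightarrow> 'v set \<Rightarrow>
     ('v \<Rightarrow> 'p \<Rightarrow> complex) \<Rightarrow> bool" where
  "Ck_on 0 T E S F \<longleftrightarrow> continuous_map (top_of_set S) T F"
| "Ck_on (Suc k) T E S F \<longleftrightarrow> continuous_map (top_of_set S) T F \<and>
     (\<forall>v\<in>E. \<exists>G. (\<forall>x\<in>S. has_velocity T (\<lambda>t. F (x + t *\<^sub>R v)) (G x)) \<and> Ck_on k T E S G)"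

text \<open>Smoothness of a map on the Lie group \<^const>\<open>SU\<close>, in the exponential chart around
  every group element.\<close>

definition smooth_on_SU ::
  "('p \<Rightarrow> complex) topology \<Rightarrow> ('n::finite cmat \<Rightarrow> 'p \<Rightarrow> complex) \<Rightarrow> bool" where
  "smooth_on_SU T F \<longleftrightarrow> (\<forall>U\<in>SU. \<exists>N. open N \<and> 0 \<in> N \<and>
     (\<forall>k. Ck_on k T su (N \<inter> su) (\<lambda>\<xi>. F (U ** mexp \<xi>))))"

definition smooth_action ::
  "('p \<Rightarrow> complex) set \<Rightarrow> ('p \<Rightarrow> complex) topology \<Rightarrow>
     ('n::finite cmat \<Rightarrow> ('p \<Rightarrow> complex) \<Rightarrow> 'p \<Rightarrow> complex) \<Rightarrow> bool" where
  "smooth_action V T A \<longleftrightarrow> (\<forall>a\<in>V. smooth_on_SU T (\<lambda>U. A U a))"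

definition lie_deriv ::
  "('p \<Rightarrow> complex) topology \<Rightarrow> ('n::finite cmat \<Rightarrow> ('p \<Rightarrow> complex) \<Rightarrow> 'p \<Rightarrow> complex) \<Rightarrow>
     'n cmat \<Rightarrow> ('p \<Rightarrow> complex) \<Rightarrow> 'p \<Rightarrow> complex" where
  "lie_deriv T A \<xi> a = (THE b. has_velocity T (\<lambda>t. A (mexp (t *\<^sub>R \<xi>)) a) b)"

definition smooth_topology ::
  "('p \<Rightarrow> complex) set \<Rightarrow> ('p \<Rightarrow> complex) topology \<Rightarrow>
     ('n::finite cmat \<Rightarrow> ('p \<Rightarrow> complex) \<Rightarrow> 'p \<Rightarrow> complex) \<Rightarrow> ('p \<Rightarrow> complex) topology" where
  "smooth_topology V T A = seminorm_topology V
     {(\<lambda>a. p (foldr (lie_deriv T A) \<xi>s a)) | p \<xi>s. continuous_seminorm V T p \<and> set \<xi>s \<subseteq> su}"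

definition alg_automorphism ::
  "('p \<Rightarrow> complex) set \<Rightarrow> ('p \<Rightarrow> complex) topology \<Rightarrow>
     (('p \<Rightarrow> complex) \<Rightarrow> ('p \<Rightarrow> complex) \<Rightarrow> 'p \<Rightarrow> complex) \<Rightarrow>
     (('p \<Rightarrow> complex) \<Rightarrow> 'p \<Rightarrow> complex) \<Rightarrow> bool" where
  "alg_automorphism V T m \<phi> \<longleftrightarrow>
     bij_betw \<phi> V V \<and>
     (\<forall>a\<in>V. \<forall>b\<in>V. \<phi> (\<lambda>z. a z + b z) = (\<lambda>z. \<phi> a z + \<phi> b z)) \<and>
     (\<forall>c. \<forall>a\<in>V. \<phi> (\<lambda>z. c * a z) = (\<lambda>z. c * \<phi> a z)) \<and>
     (\<forall>a\<in>V. \<forall>b\<in>V. \<phi> (m a b) = m (\<phi> a) (\<phi> b)) \<and>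
     homeomorphic_map T T \<phi>"

text \<open>Since \<open>U\<close> acts by precomposition, the group law is that of a right action.\<close>

definition acts_by_automorphisms ::
  "('p \<Rightarrow> complex) set \<Rightarrow> ('p \<Rightarrow> complex) topology \<Rightarrow>
     (('p \<Rightarrow> complex) \<Rightarrow> ('p \<Rightarrow> complex) \<Rightarrow> 'p \<Rightarrow> complex) \<Rightarrow>
     ('n::finite cmat \<Rightarrow> ('p \<Rightarrow> complex) \<Rightarrow> 'p \<Rightarrow> complex) \<Rightarrow> bool" where
  "acts_by_automorphisms V T m A \<longleftrightarrow>
     (\<forall>U\<in>SU. alg_automorphism V T m (A U)) \<and>
     (\<forall>a\<in>V. A (mat 1) a = a) \<and>
     (\<forall>U\<in>SU. \<forall>W\<in>SU. \<forall>a\<in>V. A (U ** W) a = A W (A U a))"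

text \<open>The infinitesimal action is inner via \<open>J\<close>, which takes values in the algebra and is
  equivariant for the adjoint action.\<close>

definition inner_via ::
  "complex \<Rightarrow> ('p \<Rightarrow> complex) set \<Rightarrow> ('p \<Rightarrow> complex) topology \<Rightarrow>
     (('p \<Rightarrow> complex) \<Rightarrow> ('p \<Rightarrow> complex) \<Rightarrow> 'p \<Rightarrow> complex) \<Rightarrow>
     ('n::finite cmat \<Rightarrow> ('p \<Rightarrow> complex) \<Rightarrow> 'p \<Rightarrow> complex) \<Rightarrow>
     ('n cmat \<Rightarrow> 'p \<Rightarrow> complex) \<Rightarrow> bool" where
  "inner_via \<h> V T m A J \<longleftrightarrow>
     (\<forall>\<xi>\<in>su. J \<xi> \<in> V) \<and>
     (\<forall>U\<in>SU. \<forall>\<xi>\<in>su. A U (J \<xi>) = J (matrix_inv U ** \<xi> ** U)) \<and>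
     (\<forall>\<xi>\<in>su. \<forall>a\<in>V. has_velocity T (\<lambda>t. A (mexp (t *\<^sub>R \<xi>)) a)
        (\<lambda>z. \<i> / \<h> * (m (J \<xi>) a z - m a (J \<xi>) z)))"

definition conj_fun :: "('p \<Rightarrow> complex) \<Rightarrow> 'p \<Rightarrow> complex" where
  "conj_fun a = (\<lambda>z. cnj (a z))"

definition acts_by_star_automorphisms ::
  "('p \<Rightarrow> complex) set \<Rightarrow> ('p \<Rightarrow> complex) topology \<Rightarrow>
     (('p \<Rightarrow> complex) \<Rightarrow> ('p \<Rightarrow> complex) \<Rightarrow> 'p \<Rightarrow> complex) \<Rightarrow>
     ('n::finite cmat \<Rightarrow> ('p \<Rightarrow> complex) \<Rightarrow> 'p \<Rightarrow> complex) \<Rightarrow> bool" where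
  "acts_by_star_automorphisms V T m A \<longleftrightarrow>
     acts_by_automorphisms V T m A \<and>
     (\<forall>a\<in>V. conj_fun a \<in> V) \<and>
     (\<forall>a\<in>V. \<forall>b\<in>V. conj_fun (m a b) = m (conj_fun b) (conj_fun a)) \<and>
     (\<forall>U\<in>SU. \<forall>a\<in>V. A U (conj_fun a) = conj_fun (A U a))"

definition allowed :: "complex \<Rightarrow> bool" where
  "allowed \<h> \<longleftrightarrow> 2 * \<h> \<notin> {0} \<union> {- 1 / of_nat m | m. 1 \<le> m}"

end

theory Submission
  imports Defs "HOL-Complex_Analysis.Complex_Analysis"
begin

no_notation fps_nth (infixl "$" 75)

text \<open>
  Everything is transported to coefficient families.  In terms of lists of indices the coefficients of an
  element are the mixed derivatives at \<open>0\<close> of its preimage under \<open>S\<close>, so the Leibniz and the chain rule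
  give explicit formulas for the product and for the action of a linear map, in which a coefficient of
  level \<open>\<alpha>\<close> depends only on coefficients of lower or equal level.  Bounds of the form
  \<open>K\<^sup>\<alpha> M \<alpha>!\<^sup>\<epsilon>\<close> give continuity, and algebraic identities for polynomials extend to the completion.

  Along \<open>U exp \<xi>\<close> the coefficients are entire functions of \<open>\<xi>\<close> and its conjugate that are bounded, in
  every seminorm, on bounded sets.  Cauchy's estimates turn this into convergence of all difference
  quotients, hence smoothness; the first derivative is computed on polynomials, where it is a commutator
  with \<open>J\<^sub>\<xi>\<close>.  As the commutator with a fixed element is continuous, the smooth topology is the original one.

  That the vanishing ideal is two-sided follows from the action of \<open>u(1,n)\<close>: for \<open>e = cnj z\<^sub>j z\<^sub>i\<close> the
  element \<open>y (e \<star> a) - y e a\<close> is a combination of commutators with functions as coefficients, and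
  commutators preserve the ideal because the action does.  The elements \<open>e\<close> generate a dense subalgebra, and
  transposition exchanges left and right.
\<close>

section \<open>Wirtinger calculus on polynomials\<close>

text \<open>\<open>fcoeffs\<close>, \<open>cone_mult\<close> and \<open>lie_deriv\<close> are
  definite descriptions, so little can be computed before the expansion in \<open>fbasis\<close> is
  known to be unique for infinite series. The factors
  \<open>pochhammer (y / (2 * \<h>)) \<alpha>\<close> mix the levels, so uniqueness for polynomials
  does not simply pass to the limit; along rays it becomes a statement about entire functions of
  \<open>y\<close>. The factorials in \<open>fbasis\<close> are those of Taylor's formula. With them
  no multinomial coefficients appear in the formulas for product and action, the structure constants
  are free of \<h>, and \<open>fbasis\<close> has size K^\<alpha> / \<alpha>!, which beats
  coefficients of size \<alpha>!^\<epsilon>. Counting index lists costs factors K^\<alpha>, absorbed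
  into \<alpha>!^\<delta>. Hence an estimate in the seminorm of exponent \<epsilon> takes a smaller
  exponent on its inputs. The product on the disc is defined through chosen representatives.
  Evaluation on y = 1 is not multiplicative, so independence of the choice cannot be checked
  pointwise; this is why the ideal property needs an argument.\<close>

lemma has_derivative_dz:
  assumes "(f has_derivative f') (at z)"
  shows "dz i f z = (f' (axis i 1) - \<i> * f' (axis i \<i>)) / 2"
    and "dzbar i f z = (f' (axis i 1) + \<i> * f' (axis i \<i>)) / 2"
  using frechet_derivative_at [OF assms] by (simp_all add: dz_def dzbar_def)

text \<open>A real derivative is determined by its values on the real basis \<open>axis i 1\<close>,
  \<open>axis i \<i>\<close>, and these are recovered from the two Wirtinger derivatives. This is
  the chain rule used for linear substitutions and for curves.\<close>

lemma derivative_via_dz: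
  fixes f :: "'n::finite cvec \<Rightarrow> complex"
  assumes "(f has_derivative f') (at z)"
  shows "f' v = (\<Sum>i\<in>UNIV. v $ i * dz i f z + cnj (v $ i) * dzbar i f z)"
proof -
  interpret bounded_linear f' using assms by (rule has_derivative_bounded_linear)
  have v: "v = (\<Sum>i\<in>UNIV. Re (v $ i) *\<^sub>R axis i 1 + Im (v $ i) *\<^sub>R axis i \<i>)"
  proof -
    have "(\<Sum>i\<in>UNIV. Re (v $ i) *\<^sub>R axis i 1 + Im (v $ i) *\<^sub>R axis i \<i>) $ j = v $ j" for j
    proof -
      have "(\<Sum>i\<in>UNIV. Re (v $ i) *\<^sub>R axis i 1 + Im (v $ i) *\<^sub>R axis i \<i>) $ j
        = (\<Sum>i\<in>UNIV. if i = j then v $ j else 0)"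
        unfolding sum_component
        by (rule sum.cong) (auto simp: axis_def complex_eq_iff)
      then show ?thesis by simp
    qed
    then show ?thesis by (simp add: vec_eq_iff)
  qed
  have "f' v = (\<Sum>i\<in>UNIV. Re (v $ i) *\<^sub>R f' (axis i 1) + Im (v $ i) *\<^sub>R f' (axis i \<i>))"
    by (subst v) (simp add: sum add scale)
  also have "\<dots> = (\<Sum>i\<in>UNIV. v $ i * dz i f z + cnj (v $ i) * dzbar i f z)"
  proof (rule sum.cong)
    fix i
    define a b where "a = f' (axis i 1)" and "b = f' (axis i \<i>)"
    have "v $ i * ((a - \<i> * b) / 2) + cnj (v $ i) * ((a + \<i> * b) / 2) =
      (v $ i + cnj (v $ i)) / 2 * a - \<i> * (v $ i - cnj (v $ i)) / 2 * b"
      by (simp add: field_simps)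
    also have "\<dots> = Re (v $ i) *\<^sub>R a + Im (v $ i) *\<^sub>R b"
      by (simp add: complex_eq_iff)
    finally show "Re (v $ i) *\<^sub>R f' (axis i 1) + Im (v $ i) *\<^sub>R f' (axis i \<i>) =
      v $ i * dz i f z + cnj (v $ i) * dzbar i f z"
      by (simp add: has_derivative_dz [OF assms] a_def b_def)
  qed simp
  finally show ?thesis .
qed

text \<open>\<open>pol d k\<close>: polynomials of degree at most \<open>d\<close> and of \<open>U(1)\<close>-charge \<open>k\<close>.\<close>

inductive pol :: "nat \<Rightarrow> int \<Rightarrow> ('n::finite cvec \<Rightarrow> complex) \<Rightarrow> bool" where
  pol_const: "pol d 0 (\<lambda>z. c)"
| pol_null: "pol d k (\<lambda>z. 0)"
| pol_z: "pol d k f \<Longrightarrow> pol (Suc d) (k + 1) (\<lambda>z. z $ i * f z)"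
| pol_zb: "pol d k f \<Longrightarrow> pol (Suc d) (k - 1) (\<lambda>z. cnj (z $ i) * f z)"
| pol_add: "pol d k f \<Longrightarrow> pol d k g \<Longrightarrow> pol d k (\<lambda>z. f z + g z)"

lemma coord_has_derivative [derivative_intros]:
  "((\<lambda>z::'n::finite cvec. z $ i) has_derivative (\<lambda>v. v $ i)) (at z within S)"
  by (rule bounded_linear_imp_has_derivative) (rule bounded_linear_vec_nth)

lemma cnj_coord_has_derivative [derivative_intros]:
  "((\<lambda>z::'n::finite cvec. cnj (z $ i)) has_derivative (\<lambda>v. cnj (v $ i))) (at z within S)"
  by (rule bounded_linear_imp_has_derivative)
    (rule bounded_linear_compose [OF bounded_linear_cnj bounded_linear_vec_nth])

lemma pol_differentiable: "pol d k f \<Longrightarrow> f differentiable (at z)"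
proof (induction rule: pol.induct)
  case (pol_z d k f i)
  then show ?case
    by (intro differentiable_mult) (auto simp: differentiable_def intro: coord_has_derivative)
next
  case (pol_zb d k f i)
  then show ?case
    by (intro differentiable_mult) (auto simp: differentiable_def intro: cnj_coord_has_derivative)
qed auto

lemma dz_add:
  assumes "f differentiable (at z)" "g differentiable (at z)"
  shows "dz i (\<lambda>z. f z + g z) z = dz i f z + dz i g z"
    "dzbar i (\<lambda>z. f z + g z) z = dzbar i f z + dzbar i g z"
proof -
  obtain f' g' where "(f has_derivative f') (at z)" "(g has_derivative g') (at z)"
    using assms by (auto simp: differentiable_def)
  note d = this has_derivative_add [OF this]
  show "dz i (\<lambda>z. f z + g z) z = dz i f z + dz i g z"
    "dzbar i (\<lambda>z. f z + g z) z = dzbar i f z + dzbar i g z"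
    by (simp_all add: has_derivative_dz [OF d(1)] has_derivative_dz [OF d(2)]
        has_derivative_dz [OF d(3)] field_simps)
qed

lemma dz_mult:
  assumes "f differentiable (at z)" "g differentiable (at z)"
  shows "dz i (\<lambda>z. f z * g z) z = dz i f z * g z + f z * dz i g z"
    "dzbar i (\<lambda>z. f z * g z) z = dzbar i f z * g z + f z * dzbar i g z"
proof -
  obtain f' g' where "(f has_derivative f') (at z)" "(g has_derivative g') (at z)"
    using assms by (auto simp: differentiable_def)
  note d = this has_derivative_mult [OF this]
  show "dz i (\<lambda>z. f z * g z) z = dz i f z * g z + f z * dz i g z"
    "dzbar i (\<lambda>z. f z * g z) z = dzbar i f z * g z + f z * dzbar i g z"
    by (simp_all add: has_derivative_dz [OF d(1)] has_derivative_dz [OF d(2)]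
        has_derivative_dz [OF d(3)] field_simps)
qed

lemma dz_const [simp]: "dz i (\<lambda>z. c) = (\<lambda>z. 0)" "dzbar i (\<lambda>z. c) = (\<lambda>z. 0)"
  by (auto simp: fun_eq_iff has_derivative_dz [OF has_derivative_const])

lemma dz_coord [simp]:
  "dz i (\<lambda>z. z $ l) = (\<lambda>z. if i = l then 1 else 0)"
  "dzbar i (\<lambda>z. z $ l) = (\<lambda>z. 0)"
  "dz i (\<lambda>z. cnj (z $ l)) = (\<lambda>z. 0)"
  "dzbar i (\<lambda>z. cnj (z $ l)) = (\<lambda>z. if i = l then 1 else 0)"
  by (auto simp: fun_eq_iff has_derivative_dz [OF coord_has_derivative]
      has_derivative_dz [OF cnj_coord_has_derivative] axis_def)

lemma coord_differentiable [simp]: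
  "(\<lambda>z::'n::finite cvec. z $ i) differentiable (at z)"
  "(\<lambda>z::'n::finite cvec. cnj (z $ i)) differentiable (at z)"
  by (auto simp: differentiable_def intro: coord_has_derivative cnj_coord_has_derivative)

lemma pol_dz_rules:
  assumes "pol d k f"
  shows "dz i (\<lambda>z. z $ l * f z) = (\<lambda>z. (if i = l then f z else 0) + z $ l * dz i f z)"
    "dzbar i (\<lambda>z. z $ l * f z) = (\<lambda>z. z $ l * dzbar i f z)"
    "dz i (\<lambda>z. cnj (z $ l) * f z) = (\<lambda>z. cnj (z $ l) * dz i f z)"
    "dzbar i (\<lambda>z. cnj (z $ l) * f z) = (\<lambda>z. (if i = l then f z else 0) + cnj (z $ l) * dzbar i f z)"
    "dz i (\<lambda>z. c * f z) = (\<lambda>z. c * dz i f z)"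
    "dzbar i (\<lambda>z. c * f z) = (\<lambda>z. c * dzbar i f z)"
  using pol_differentiable [OF assms] by (auto simp: fun_eq_iff dz_mult)

lemma pol_dz_add:
  assumes "pol d k f" "pol d' k' g"
  shows "dz i (\<lambda>z. f z + g z) = (\<lambda>z. dz i f z + dz i g z)"
    "dzbar i (\<lambda>z. f z + g z) = (\<lambda>z. dzbar i f z + dzbar i g z)"
  using pol_differentiable [OF assms(1)] pol_differentiable [OF assms(2)]
  by (auto simp: fun_eq_iff dz_add)

lemma pol_mono: "pol d k f \<Longrightarrow> d \<le> d' \<Longrightarrow> pol d' k f"
proof (induction arbitrary: d' rule: pol.induct)
  case (pol_z d k f i)
  then obtain e where "d' = Suc e" "d \<le> e" by (cases d') auto
  with pol_z show ?case by (auto intro: pol.intros)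
next
  case (pol_zb d k f i)
  then obtain e where "d' = Suc e" "d \<le> e" by (cases d') auto
  with pol_zb show ?case by (auto intro: pol.intros)
qed (auto intro: pol.intros)

lemma pol_scale: "pol d k f \<Longrightarrow> pol d k (\<lambda>z. c * f z)"
proof (induction rule: pol.induct)
  case (pol_z d k f i)
  then show ?case using pol.pol_z [of d k "\<lambda>z. c * f z" i] by (simp add: mult.left_commute)
next
  case (pol_zb d k f i)
  then show ?case using pol.pol_zb [of d k "\<lambda>z. c * f z" i] by (simp add: mult.left_commute)
qed (auto intro: pol.intros simp: distrib_left)

lemma pol_sum:
  "(\<And>x. x \<in> A \<Longrightarrow> pol d k (f x)) \<Longrightarrow> pol d k (\<lambda>z. \<Sum>x\<in>A. f x z)"
proof (induction A rule: infinite_finite_induct)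
  case (insert x F)
  then show ?case using pol_add [of d k "f x" "\<lambda>z. \<Sum>x\<in>F. f x z"] by simp
qed (auto intro: pol.intros)

lemma pol_mult: "pol d k f \<Longrightarrow> pol d' k' g \<Longrightarrow> pol (d + d') (k + k') (\<lambda>z. f z * g z)"
proof (induction arbitrary: d' k' rule: pol.induct)
  case (pol_const d c)
  then show ?case using pol_mono [OF pol_scale] by fastforce
next
  case (pol_z d k f i)
  then show ?case using pol.pol_z [of "d + d'" "k + k'" "\<lambda>z. f z * g z" i]
    by (simp add: mult.assoc algebra_simps)
next
  case (pol_zb d k f i)
  then show ?case using pol.pol_zb [of "d + d'" "k + k'" "\<lambda>z. f z * g z" i]
    by (simp add: mult.assoc algebra_simps)
next
  case (pol_add d k f g)
  then show ?case by (auto intro: pol.pol_add simp: distrib_right)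
qed (auto intro: pol.intros)

text \<open>The degree \<open>d - 1\<close> is truncated subtraction, so the induction must carry
  the stronger statement for \<open>d = 0\<close>: without it the term
  \<open>z $ l * dz i f z\<close> in the product rule would be assigned degree 1 instead of
  0.\<close>

lemma pol_dz_aux:
  "pol d k f \<Longrightarrow> (if d = 0 then dz i f = (\<lambda>z. 0) \<and> dzbar i f = (\<lambda>z. 0)
     else pol (d - 1) (k - 1) (dz i f) \<and> pol (d - 1) (k + 1) (dzbar i f))"
proof (induction rule: pol.induct)
  case (pol_z d k f l)
  have 1: "pol d k (\<lambda>z. if i = l then f z else 0)" 
    using pol_z by (cases "i = l") (auto intro: pol_null)
  have 2: "pol d k (\<lambda>z. z $ l * dz i f z)" "pol d (k + 2) (\<lambda>z. z $ l * dzbar i f z)"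
    using pol_z.IH pol.pol_z [of "d - 1" "k - 1" "dz i f" l] 
      pol.pol_z [of "d - 1" "k + 1" "dzbar i f" l]
    by (auto intro: pol_null split: if_splits simp: add.assoc)
  show ?case
    using pol_add [OF 1 2(1)] 2(2) by (simp add: pol_dz_rules [OF pol_z.hyps] add.assoc)
next
  case (pol_zb d k f l)
  have 1: "pol d k (\<lambda>z. if i = l then f z else 0)" 
    using pol_zb by (cases "i = l") (auto intro: pol_null)
  have 2: "pol d k (\<lambda>z. cnj (z $ l) * dzbar i f z)" "pol d (k - 2) (\<lambda>z. cnj (z $ l) * dz i f z)"
    using pol_zb.IH pol.pol_zb [of "d - 1" "k + 1" "dzbar i f" l] 
      pol.pol_zb [of "d - 1" "k - 1" "dz i f" l]
    by (auto intro: pol_null split: if_splits)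
  show ?case
    using pol_add [OF 1 2(1)] 2(2) by (simp add: pol_dz_rules [OF pol_zb.hyps])
next
  case (pol_add d k f g)
  then show ?case
    by (auto simp: pol_dz_add [OF pol_add.hyps] intro: pol.pol_add split: if_splits)
qed (auto intro: pol.intros)

lemma pol_dz: "pol d k f \<Longrightarrow> pol (d - 1) (k - 1) (dz i f)"
  and pol_dzbar: "pol d k f \<Longrightarrow> pol (d - 1) (k + 1) (dzbar i f)"
  using pol_dz_aux [of d k f i] by (auto intro: pol_null split: if_splits)

lemma pol_0_dz: "pol 0 k f \<Longrightarrow> dz i f = (\<lambda>z. 0)" "pol 0 k f \<Longrightarrow> dzbar i f = (\<lambda>z. 0)"
  using pol_dz_aux [of 0 k f i] by auto

lemma pol_foldr_dz: "pol d k f \<Longrightarrow> pol (d - length I) (k - int (length I)) (foldr dz I f)"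
proof (induction I)
  case (Cons i I)
  then show ?case using pol_dz [of "d - length I" "k - int (length I)" "foldr dz I f" i]
    by (simp add: diff_diff_eq algebra_simps)
qed simp

lemma pol_foldr_dzbar: "pol d k f \<Longrightarrow> pol (d - length I) (k + int (length I)) (foldr dzbar I f)"
proof (induction I)
  case (Cons i I)
  then show ?case using pol_dzbar [of "d - length I" "k + int (length I)" "foldr dzbar I f" i]
    by (simp add: diff_diff_eq algebra_simps)
qed simp

lemma foldr_dz_0 [simp]: "foldr dz I (\<lambda>z. 0) = (\<lambda>z. 0)" "foldr dzbar I (\<lambda>z. 0) = (\<lambda>z. 0)"
  by (induction I) auto

text \<open>\<open>foldr\<close> applies the last entries first. The last d of them lower the degree
  to 0, the next derivative gives zero, and the remaining ones act on zero.\<close>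

lemma pol_foldr_dz_0:
  assumes "pol d k f" "d < length I"
  shows "foldr dz I f = (\<lambda>z. 0)" "foldr dzbar I f = (\<lambda>z. 0)"
proof -
  define I1 where "I1 = drop (length I - Suc d) I"
  have l: "length I1 = Suc d" using assms(2) by (simp add: I1_def)
  then obtain i I'' where I1: "I1 = i # I''" by (cases I1) auto
  define I' where "I' = take (length I - Suc d) I"
  have I: "I = I' @ i # I''" "length I'' = d"
    using l append_take_drop_id [of "length I - Suc d" I] by (auto simp: I'_def I1 simp flip: I1_def)
  have "dz i (foldr dz I'' f) = (\<lambda>z. 0)" "dzbar i (foldr dzbar I'' f) = (\<lambda>z. 0)"
    using pol_foldr_dz [OF assms(1), of I''] pol_foldr_dzbar [OF assms(1), of I''] I
    by (auto intro: pol_0_dz)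
  then show "foldr dz I f = (\<lambda>z. 0)" "foldr dzbar I f = (\<lambda>z. 0)"
    by (simp_all add: I)
qed

text \<open>Induction over the generation of polynomials replaces the symmetry theorem for second
  derivatives: a coordinate factor contributes only through the product rule, whose extra terms are
  symmetric.\<close>

lemma dz_commute: "pol d k f \<Longrightarrow> dz i (dz j f) = dz j (dz i f)"
  and dzbar_commute: "pol d k f \<Longrightarrow> dzbar i (dzbar j f) = dzbar j (dzbar i f)"
  and dz_dzbar_commute: "pol d k f \<Longrightarrow> dz i (dzbar j f) = dzbar j (dz i f)"
proof -
  have "dz i (dz j f) = dz j (dz i f) \<and> dzbar i (dzbar j f) = dzbar j (dzbar i f) \<and>
    dz i (dzbar j f) = dzbar j (dz i f)" if "pol d k f"
    using that
  proof (induction rule: pol.induct)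
    case (pol_z d k f l)
    note p = pol_z.hyps pol_dz [OF pol_z.hyps] pol_dzbar [OF pol_z.hyps] 
      pol.pol_z [OF pol_dz [OF pol_z.hyps]]
    have "(\<lambda>z. if i = l then f z else 0) differentiable at z" for i z
      using pol_differentiable [OF p(1)] by (cases "i = l") auto
    then have d: "\<And>i z. dz i f differentiable at z" "\<And>i z. f differentiable at z"
      "\<And>i z. (\<lambda>z. z $ l * dz i f z) differentiable at z"
      "\<And>i z. (\<lambda>z. if i = l then f z else 0) differentiable at z"
      using pol_differentiable [OF p(1)] pol_differentiable [OF p(2)] by auto
    show ?case using pol_z.IH
      by (auto simp: fun_eq_iff pol_dz_rules [OF p(1)] pol_dz_rules [OF p(2)]
          pol_dz_rules [OF p(3)] dz_add [OF d(4,3)] if_distrib [of "dz _"])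
  next
    case (pol_zb d k f l)
    note p = pol_zb.hyps pol_dz [OF pol_zb.hyps] pol_dzbar [OF pol_zb.hyps]
    have "(\<lambda>z. if i = l then f z else 0) differentiable at z" for i z
      using pol_differentiable [OF p(1)] by (cases "i = l") auto
    then have d: "\<And>i z. dzbar i f differentiable at z" "\<And>i z. f differentiable at z"
      "\<And>i z. (\<lambda>z. cnj (z $ l) * dzbar i f z) differentiable at z"
      "\<And>i z. (\<lambda>z. if i = l then f z else 0) differentiable at z"
      using pol_differentiable [OF p(1)] pol_differentiable [OF p(3)] by auto
    show ?case using pol_zb.IH
      by (auto simp: fun_eq_iff pol_dz_rules [OF p(1)] pol_dz_rules [OF p(2)]
          pol_dz_rules [OF p(3)] dz_add [OF d(4,3)])
  next
    case (pol_add d k f g)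
    note p = pol_dz_add [OF pol_add.hyps] pol_dz_add [OF pol_dz pol_dz, OF pol_add.hyps]
      pol_dz_add [OF pol_dzbar pol_dzbar, OF pol_add.hyps]
    show ?case using pol_add.IH by (simp add: p)
  qed auto
  then show "pol d k f \<Longrightarrow> dz i (dz j f) = dz j (dz i f)"
    "pol d k f \<Longrightarrow> dzbar i (dzbar j f) = dzbar j (dzbar i f)"
    "pol d k f \<Longrightarrow> dz i (dzbar j f) = dzbar j (dz i f)" by auto
qed

lemma dz_foldr_commute:
  assumes "pol d k f"
  shows "dz i (foldr dz I f) = foldr dz I (dz i f)"
    "dzbar i (foldr dzbar I f) = foldr dzbar I (dzbar i f)"
    "dz i (foldr dzbar I f) = foldr dzbar I (dz i f)"
    "dzbar i (foldr dz I f) = foldr dz I (dzbar i f)"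
proof (induction I)
  case (Cons j I)
  note p = pol_foldr_dz [OF assms, of I] pol_foldr_dzbar [OF assms, of I]
  { case 1 show ?case using Cons dz_commute [OF p(1), of i j] by simp }
  { case 2 show ?case using Cons dzbar_commute [OF p(2), of i j] by simp }
  { case 3 show ?case using Cons dz_dzbar_commute [OF p(2), of i j] by simp }
  { case 4 show ?case using Cons dz_dzbar_commute [OF p(1), of j i] by simp }
qed auto

lemma foldr_dz_dzbar_commute:
  assumes "pol d k f"
  shows "foldr dzbar J (foldr dz I f) = foldr dz I (foldr dzbar J f)"
proof (induction J)
  case (Cons j J)
  then show ?case using dz_foldr_commute(4) [OF pol_foldr_dzbar [OF assms]] by simp
qed simp

section \<open>The Wick product of polynomials\<close>

definition gsign :: "'n option \<Rightarrow> complex" where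
  "gsign i = (if i = None then - 1 else 1)"

definition gsigns :: "'n option list \<Rightarrow> complex" where
  "gsigns K = (\<Prod>k\<leftarrow>K. gsign k)"

text \<open>The contraction of order \<open>r\<close> in the Wick product, without the factor
  \<open>(2 * \<h>) ^ r / fact r\<close>. The metric is diagonal, so both index lists agree and only
  its signs remain.\<close>

definition wterm :: "nat \<Rightarrow> ('n::finite cvec \<Rightarrow> complex) \<Rightarrow> ('n cvec \<Rightarrow> complex) \<Rightarrow> 'n cvec \<Rightarrow> complex" where
  "wterm r f g z = (\<Sum>K | length K = r. gsigns K * foldr dz K f z * foldr dzbar K g z)"

lemma gsl_simps [simp]: "gsigns [] = 1" "gsigns (i # K) = gsign i * gsigns K" "gsigns (K @ L) = gsigns K * gsigns L"
  by (simp_all add: gsigns_def)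

lemma gs_square [simp]: "gsign i * gsign i = 1" "gsign i * (gsign i * x) = x" "cnj (gsign i) = gsign i" "norm (gsign i) = 1"
  by (auto simp: gsign_def)

lemma cnj_gsl [simp]: "cnj (gsigns K) = gsigns K" "norm (gsigns K) = 1"
  by (induction K) (simp_all add: norm_mult)

lemma gmetric_gs: "gmetric $ i $ j = (if i = j then gsign i else 0)"
  by (simp add: gmetric_def gsign_def)

lemma finite_lists [simp]: "finite {K::'a::finite list. length K = r}"
  using finite_lists_length_eq [of "UNIV::'a set" r] by simp

text \<open>The new index is split off at the end because \<open>foldr\<close> lets the last entry
  act first; this yields the recursion \<open>wterm_Suc\<close>, in which one pair of derivatives is
  moved into the arguments.\<close>

lemma sum_lists_Suc:
  "(\<Sum>K::'a::finite list | length K = Suc r. F K) = (\<Sum>i\<in>UNIV. \<Sum>K | length K = r. F (K @ [i]))"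
proof -
  have 1: "{K::'a list. length K = Suc r} = (\<lambda>(i, K). K @ [i]) ` (UNIV \<times> {K. length K = r})"
    by (auto simp: length_Suc_conv_rev image_iff)
  show ?thesis
    unfolding 1 by (subst sum.reindex) (auto simp: inj_on_def sum.cartesian_product intro!: sum.cong)
qed

lemma sum_lists_Cons:
  "(\<Sum>K::'a::finite list | length K = Suc r. F K) = (\<Sum>i\<in>UNIV. \<Sum>K | length K = r. F (i # K))"
proof -
  have 1: "{K::'a list. length K = Suc r} = (\<lambda>(i, K). i # K) ` (UNIV \<times> {K. length K = r})"
    by (auto simp: length_Suc_conv image_iff)
  show ?thesis
    unfolding 1 by (subst sum.reindex) (auto simp: inj_on_def sum.cartesian_product intro!: sum.cong)
qed

lemma wick_wterm:
  "wick \<h> f g z = (\<Sum>r. (2 * \<h>) ^ r / fact r * wterm r f g z)"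
proof -
  have 1: "(\<Prod>k<r. gmetric $ (I ! k) $ (J ! k)) = (if J = I then gsigns I else 0)"
    if "length I = r" "length J = r" for r and I J :: "'a option list"
  proof (cases "J = I")
    case True
    then show ?thesis using that
      by (simp add: gmetric_gs gsigns_def prod.list_conv_set_nth atLeast0LessThan)
  next
    case False
    then have "\<exists>k<r. I ! k \<noteq> J ! k"
      using that by (metis nth_equalityI)
    then obtain k where "k < r" "I ! k \<noteq> J ! k" by blast

    then show ?thesis using False by (auto simp: gmetric_gs intro!: bexI [of _ k])
  qed
  have "(\<Sum>I | length I = r. \<Sum>J | length J = r.
        (\<Prod>k<r. gmetric $ (I ! k) $ (J ! k)) * foldr dz I f z * foldr dzbar J g z) = wterm r f g z" for r
    unfolding wterm_def
  proof (rule sum.cong)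
    fix I :: "'a option list" assume I: "I \<in> {I. length I = r}"
    have "(\<Sum>J | length J = r. (\<Prod>k<r. gmetric $ (I ! k) $ (J ! k)) * foldr dz I f z * foldr dzbar J g z)
      = (\<Sum>J | length J = r. if J = I then gsigns I * foldr dz I f z * foldr dzbar I g z else 0)"
      using I by (intro sum.cong) (auto simp: 1)
    then show "(\<Sum>J | length J = r. (\<Prod>k<r. gmetric $ (I ! k) $ (J ! k)) * foldr dz I f z * foldr dzbar J g z)
      = gsigns I * foldr dz I f z * foldr dzbar I g z"
      using I by simp
  qed simp
  then show ?thesis by (simp add: wick_def)
qed

lemma wterm_Suc: "wterm (Suc r) f g z = (\<Sum>i\<in>UNIV. gsign i * wterm r (dz i f) (dzbar i g) z)"
  by (simp add: wterm_def sum_lists_Suc sum_distrib_left mult_ac)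

lemma wterm_0 [simp]: "wterm 0 f g z = f z * g z"
  by (simp add: wterm_def)

lemma wterm_eq_0:
  assumes "pol d k f \<or> pol d k g" "d < r"
  shows "wterm r f g z = 0"
  using assms pol_foldr_dz_0 [of d k f] pol_foldr_dz_0 [of d k g] by (auto simp: wterm_def)

lemma wick_finite:
  assumes "pol d k f \<or> pol d k g"
  shows "wick \<h> f g z = (\<Sum>r\<le>d. (2 * \<h>) ^ r / fact r * wterm r f g z)"
  unfolding wick_wterm
  by (rule suminf_finite) (use wterm_eq_0 [OF assms] in \<open>auto simp: not_le\<close>)

lemma wterm_add_left:
  assumes "pol d k f" "pol d' k' f'"
  shows "wterm r (\<lambda>z. f z + f' z) g z = wterm r f g z + wterm r f' g z"
  using assms
proof (induction r arbitrary: d d' k k' f f' g)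
  case (Suc r)
  then show ?case
    by (simp add: wterm_Suc pol_dz_add [OF Suc.prems] Suc.IH [OF pol_dz pol_dz, OF Suc.prems]
        sum.distrib distrib_left)
qed (simp add: algebra_simps)

lemma wterm_add_right:
  assumes "pol d k g" "pol d' k' g'"
  shows "wterm r f (\<lambda>z. g z + g' z) z = wterm r f g z + wterm r f g' z"
  using assms
proof (induction r arbitrary: d d' k k' f g g')
  case (Suc r)
  then show ?case
    by (simp add: wterm_Suc pol_dz_add [OF Suc.prems] Suc.IH [OF pol_dzbar pol_dzbar, OF Suc.prems]
        sum.distrib distrib_left)
qed (simp add: algebra_simps)

lemma wterm_scale_left:
  assumes "pol d k f"
  shows "wterm r (\<lambda>z. c * f z) g z = c * wterm r f g z"
  using assms
proof (induction r arbitrary: d k f g)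
  case (Suc r)
  then show ?case
    by (simp add: wterm_Suc pol_dz_rules [OF Suc.prems] Suc.IH [OF pol_dz, OF Suc.prems]
        sum_distrib_left mult_ac)
qed simp

lemma wterm_scale_right:
  assumes "pol d k g"
  shows "wterm r f (\<lambda>z. c * g z) z = c * wterm r f g z"
  using assms
proof (induction r arbitrary: d k f g)
  case (Suc r)
  then show ?case
    by (simp add: wterm_Suc pol_dz_rules [OF Suc.prems] Suc.IH [OF pol_dzbar, OF Suc.prems]
        sum_distrib_left mult_ac)
qed simp

lemma wick_add_left:
  assumes "pol d k f" "pol d' k' f'"
  shows "wick \<h> (\<lambda>z. f z + f' z) g = (\<lambda>z. wick \<h> f g z + wick \<h> f' g z)"
proof
  fix z
  have *: "pol (max d d') k f" "pol (max d d') k' f'" using assms by (auto intro: pol_mono)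
  \<comment> \<open>The two charges may differ, so the sum need not satisfy \<open>pol\<close> and
    \<open>wick_finite\<close> does not apply to it; its high terms are shown to vanish
    separately.\<close>
  have 0: "wterm r (\<lambda>z. f z + f' z) g z = 0" if "r > max d d'" for r
    using wterm_eq_0 [OF disjI1 [OF *(1)]] wterm_eq_0 [OF disjI1 [OF *(2)]] that
    by (simp add: wterm_add_left [OF *])
  have "wick \<h> (\<lambda>z. f z + f' z) g z = (\<Sum>r\<le>max d d'. (2 * \<h>) ^ r / fact r * wterm r (\<lambda>z. f z + f' z) g z)"
    unfolding wick_wterm by (rule suminf_finite) (auto simp: not_le intro!: 0)
  then show "wick \<h> (\<lambda>z. f z + f' z) g z = wick \<h> f g z + wick \<h> f' g z"
    by (simp only: wick_finite [OF disjI1 [OF *(1)]] wick_finite [OF disjI1 [OF *(2)]])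
       (simp add: wterm_add_left [OF *] distrib_left sum.distrib)
qed

lemma wick_add_right:
  assumes "pol d k g" "pol d' k' g'"
  shows "wick \<h> f (\<lambda>z. g z + g' z) = (\<lambda>z. wick \<h> f g z + wick \<h> f g' z)"
proof
  fix z
  have *: "pol (max d d') k g" "pol (max d d') k' g'" using assms by (auto intro: pol_mono)
  have 0: "wterm r f (\<lambda>z. g z + g' z) z = 0" if "r > max d d'" for r
    using wterm_eq_0 [OF disjI2 [OF *(1)]] wterm_eq_0 [OF disjI2 [OF *(2)]] that
    by (simp add: wterm_add_right [OF *])
  have "wick \<h> f (\<lambda>z. g z + g' z) z = (\<Sum>r\<le>max d d'. (2 * \<h>) ^ r / fact r * wterm r f (\<lambda>z. g z + g' z) z)"
    unfolding wick_wterm by (rule suminf_finite) (auto simp: not_le intro!: 0)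
  then show "wick \<h> f (\<lambda>z. g z + g' z) z = wick \<h> f g z + wick \<h> f g' z"
    by (simp only: wick_finite [OF disjI2 [OF *(1)]] wick_finite [OF disjI2 [OF *(2)]])
       (simp add: wterm_add_right [OF *] distrib_left sum.distrib)
qed

lemma wick_scale:
  assumes "pol d k f"
  shows "wick \<h> (\<lambda>z. c * f z) g = (\<lambda>z. c * wick \<h> f g z)"
    "wick \<h> g (\<lambda>z. c * f z) = (\<lambda>z. c * wick \<h> g f z)"
  using pol_scale [OF assms, of c]
  by (auto simp: fun_eq_iff wick_finite [OF disjI1 [OF assms]] wick_finite [OF disjI2 [OF assms]]
      wick_finite [OF disjI1, OF pol_scale [OF assms, of c]] wick_finite [OF disjI2, OF pol_scale [OF assms, of c]]
      wterm_scale_left [OF assms] wterm_scale_right [OF assms] sum_distrib_left mult_ac intro!: sum.cong)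

lemma wick_0 [simp]: "wick \<h> (\<lambda>z. 0) g = (\<lambda>z. 0)" "wick \<h> g (\<lambda>z. 0) = (\<lambda>z. 0)"
  using wick_scale [OF pol_null, where c = 0] by auto

lemma pol_wterm: "pol d k f \<Longrightarrow> pol d' k' g \<Longrightarrow> pol (d + d') (k + k') (wterm r f g)"
proof (induction r arbitrary: d k f d' k' g)
  case 0
  then show ?case using pol_mult by (simp add: wterm_def) 
next
  case (Suc r)
  have "pol (d + d') (k + k') (\<lambda>z. gsign i * wterm r (dz i f) (dzbar i g) z)" for i
    using Suc.IH [OF pol_dz [OF Suc.prems(1)] pol_dzbar [OF Suc.prems(2)]]
    by (intro pol_scale) (rule pol_mono [where d = "d - 1 + (d' - 1)"], auto)
  then have "pol (d + d') (k + k') (\<lambda>z. \<Sum>i\<in>UNIV. gsign i * wterm r (dz i f) (dzbar i g) z)"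
    by (rule pol_sum)
  then show ?case by (simp add: wterm_Suc [abs_def])
qed

lemma pol_wick:
  assumes "pol d k f" "pol d' k' g"
  shows "pol (d + d') (k + k') (wick \<h> f g)"
  unfolding wick_finite [OF disjI1 [OF assms(1)], abs_def]
  by (intro pol_sum pol_scale pol_wterm assms)

section \<open>Wirtinger derivatives as derivations of the Wick product\<close>

lemma pol_dz_sum:
  assumes "\<And>x. x \<in> A \<Longrightarrow> pol d k (f x)"
  shows "dz i (\<lambda>z. \<Sum>x\<in>A. f x z) = (\<lambda>z. \<Sum>x\<in>A. dz i (f x) z)"
    "dzbar i (\<lambda>z. \<Sum>x\<in>A. f x z) = (\<lambda>z. \<Sum>x\<in>A. dzbar i (f x) z)"
proof -
  have "dz i (\<lambda>z. \<Sum>x\<in>A. f x z) = (\<lambda>z. \<Sum>x\<in>A. dz i (f x) z) \<and>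
    dzbar i (\<lambda>z. \<Sum>x\<in>A. f x z) = (\<lambda>z. \<Sum>x\<in>A. dzbar i (f x) z)"
    using assms
  proof (induction A rule: infinite_finite_induct)
    case (insert x F)
    have p: "pol d k (f x)" "pol d k (\<lambda>z. \<Sum>x\<in>F. f x z)"
      using insert.prems by (auto intro: pol_sum)
    show ?case using insert by (simp add: pol_dz_add [OF p])
  qed auto
  then show "dz i (\<lambda>z. \<Sum>x\<in>A. f x z) = (\<lambda>z. \<Sum>x\<in>A. dz i (f x) z)"
    "dzbar i (\<lambda>z. \<Sum>x\<in>A. f x z) = (\<lambda>z. \<Sum>x\<in>A. dzbar i (f x) z)" by auto
qed

text \<open>A contraction is a bidifferential operator with constant coefficients, so it commutes
  with derivatives up to the Leibniz rule. Iterating this at the origin produces the coefficients of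
  a product.\<close>

lemma dz_wterm:
  assumes "pol d k f" "pol d' k' g"
  shows "dz i (wterm r f g) = (\<lambda>z. wterm r (dz i f) g z + wterm r f (dz i g) z)"
    "dzbar i (wterm r f g) = (\<lambda>z. wterm r (dzbar i f) g z + wterm r f (dzbar i g) z)"
proof -
  have "dz i (wterm r f g) = (\<lambda>z. wterm r (dz i f) g z + wterm r f (dz i g) z) \<and>
    dzbar i (wterm r f g) = (\<lambda>z. wterm r (dzbar i f) g z + wterm r f (dzbar i g) z)"
    using assms
  proof (induction r arbitrary: d k f d' k' g)
    case 0
    note df = pol_differentiable [OF 0(1)] pol_differentiable [OF 0(2)]
    show ?case using df by (auto simp: wterm_0 [abs_def] fun_eq_iff dz_mult)
  next
    case (Suc r)
    have p: "pol (d - 1 + (d' - 1)) (k + k') (wterm r (dz j f) (dzbar j g))" for j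
      using pol_wterm [OF pol_dz [OF Suc.prems(1)] pol_dzbar [OF Suc.prems(2)]] by simp
    note s = pol_dz_sum [of UNIV, OF pol_scale [OF p]]
    have c: "dz i (dz j f) = dz j (dz i f)" "dz i (dzbar j g) = dzbar j (dz i g)"
      "dzbar i (dz j f) = dz j (dzbar i f)" "dzbar i (dzbar j g) = dzbar j (dzbar i g)" for j
      using dz_commute [OF Suc.prems(1), of i j] dzbar_commute [OF Suc.prems(2), of i j]
        dz_dzbar_commute [OF Suc.prems(2), of i j] dz_dzbar_commute [OF Suc.prems(1), of j i] by auto
    have IH: "dz i (wterm r (dz j f) (dzbar j g)) = 
        (\<lambda>z. wterm r (dz j (dz i f)) (dzbar j g) z + wterm r (dz j f) (dzbar j (dz i g)) z)"
      "dzbar i (wterm r (dz j f) (dzbar j g)) = 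
        (\<lambda>z. wterm r (dz j (dzbar i f)) (dzbar j g) z + wterm r (dz j f) (dzbar j (dzbar i g)) z)" for j
      using Suc.IH [OF pol_dz [OF Suc.prems(1), of j] pol_dzbar [OF Suc.prems(2), of j]]
      by (auto simp: c)
    show ?case
      by (simp add: wterm_Suc [abs_def] s pol_dz_rules [OF p] IH distrib_left sum.distrib)
  qed
  then show "dz i (wterm r f g) = (\<lambda>z. wterm r (dz i f) g z + wterm r f (dz i g) z)"
    "dzbar i (wterm r f g) = (\<lambda>z. wterm r (dzbar i f) g z + wterm r f (dzbar i g) z)" by auto
qed

lemma dz_wick:
  assumes "pol d k f" "pol d' k' g"
  shows "dz i (wick \<h> f g) = (\<lambda>z. wick \<h> (dz i f) g z + wick \<h> f (dz i g) z)"
    "dzbar i (wick \<h> f g) = (\<lambda>z. wick \<h> (dzbar i f) g z + wick \<h> f (dzbar i g) z)"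
proof -
  note w = wick_finite [OF disjI1 [OF assms(1)]]
  \<comment> \<open>The derivatives are kept at degree \<open>d\<close> so that all three Wick
    products are sums over the same range of \<open>r\<close>.\<close>
  have *: "pol d (k - 1) (dz i f)" "pol d (k + 1) (dzbar i f)"
    by (rule pol_mono [OF pol_dz [OF assms(1)]], simp, rule pol_mono [OF pol_dzbar [OF assms(1)]], simp)
  note s = pol_dz_sum [of "{..d}", OF pol_scale [OF pol_wterm [OF assms]]]
  show "dz i (wick \<h> f g) = (\<lambda>z. wick \<h> (dz i f) g z + wick \<h> f (dz i g) z)"
    "dzbar i (wick \<h> f g) = (\<lambda>z. wick \<h> (dzbar i f) g z + wick \<h> f (dzbar i g) z)"
    by (simp_all only: w [abs_def] wick_finite [OF disjI1, OF *(1)] wick_finite [OF disjI1, OF *(2)]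
       s pol_dz_rules [OF pol_wterm [OF assms]] dz_wterm [OF assms] distrib_left sum.distrib)
qed

section \<open>Coordinate factors inside a Wick product\<close>

lemma wterm_commute_right:
  assumes "pol d k g"
  shows "(\<Sum>l\<in>UNIV. gsign l * wterm r (dz l f) (dzbar i (dzbar l g)) z) = wterm (Suc r) f (dzbar i g) z"
  by (simp add: wterm_Suc dzbar_commute [OF assms, of i])

lemma wterm_commute_left:
  assumes "pol d k f"
  shows "(\<Sum>l\<in>UNIV. gsign l * wterm r (dz i (dz l f)) (dzbar l g) z) = wterm (Suc r) (dz i f) g z"
  by (simp add: wterm_Suc dz_commute [OF assms, of i])

text \<open>The left argument is differentiated only with respect to \<open>z\<close>, so a
  conjugate coordinate there passes through; the next lemma is the mirror statement.\<close>

lemma wterm_zb_left: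
  assumes "pol d k f"
  shows "wterm r (\<lambda>z. cnj (z $ i) * f z) g z = cnj (z $ i) * wterm r f g z"
  using assms
proof (induction r arbitrary: d k f g)
  case (Suc r)
  show ?case
    by (simp add: wterm_Suc pol_dz_rules [OF Suc.prems] Suc.IH [OF pol_dz [OF Suc.prems]]
        sum_distrib_left mult.left_commute)
qed simp

lemma wterm_z_right:
  assumes "pol d k g"
  shows "wterm r f (\<lambda>z. z $ i * g z) z = z $ i * wterm r f g z"
  using assms
proof (induction r arbitrary: d k f g)
  case (Suc r)
  show ?case
    by (simp add: wterm_Suc pol_dz_rules [OF Suc.prems] Suc.IH [OF pol_dzbar [OF Suc.prems]]
        sum_distrib_left mult.left_commute)
qed simp

lemma pol_if: "pol d k f \<Longrightarrow> pol d k (\<lambda>z. if b then f z else 0)"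
  by (cases b) (auto intro: pol_null)

lemma wterm_null [simp]: "wterm r (\<lambda>z. 0) g z = 0" "wterm r g (\<lambda>z. 0) z = 0"
  using wterm_scale_left [OF pol_null, where c = 0] wterm_scale_right [OF pol_null, where c = 0] by auto

lemma wterm_if:
  "wterm r (\<lambda>z. if b then f z else 0) g z = (if b then wterm r f g z else 0)"
  "wterm r g (\<lambda>z. if b then f z else 0) z = (if b then wterm r g f z else 0)"
  by auto

text \<open>Each of the \<open>r\<close> derivatives may hit the coordinate. It then leaves its sign
  and its partner \<open>dzbar i\<close> on the other argument, and \<open>r - 1\<close>
  contractions remain.\<close>

lemma wterm_z_left:
  assumes "pol d k f" "pol d' k' g"
  shows "wterm r (\<lambda>z. z $ i * f z) g z =
    z $ i * wterm r f g z + of_nat r * gsign i * wterm (r - 1) f (dzbar i g) z"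
  using assms
proof (induction r arbitrary: d k f d' k' g)
  case (Suc r)
  note p = pol_dz [OF Suc.prems(1)] pol_dzbar [OF Suc.prems(2)]
  have p2: "pol d k (\<lambda>z. if l = i then f z else 0)" "pol (Suc (d - 1)) (k - 1 + 1) (\<lambda>z. z $ i * dz l f z)" for l
    by (rule pol_if [OF Suc.prems(1)], rule pol_z [OF p(1)])
  have "wterm (Suc r) (\<lambda>z. z $ i * f z) g z =
    (\<Sum>l\<in>UNIV. gsign l * ((if l = i then wterm r f (dzbar l g) z else 0)
      + (z $ i * wterm r (dz l f) (dzbar l g) z
         + of_nat r * gsign i * wterm (r - 1) (dz l f) (dzbar i (dzbar l g)) z)))"
    by (simp only: wterm_Suc pol_dz_rules [OF Suc.prems(1)] wterm_add_left [OF p2] wterm_if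
        Suc.IH [OF p])
  also have "\<dots> = (\<Sum>l\<in>UNIV. if l = i then gsign i * wterm r f (dzbar i g) z else 0)
     + z $ i * wterm (Suc r) f g z
     + of_nat r * gsign i * (\<Sum>l\<in>UNIV. gsign l * wterm (r - 1) (dz l f) (dzbar i (dzbar l g)) z)"
    unfolding wterm_Suc sum_distrib_left sum.distrib [symmetric]
    by (intro sum.cong) (auto simp: algebra_simps)
  also have "of_nat r * gsign i * (\<Sum>l\<in>UNIV. gsign l * wterm (r - 1) (dz l f) (dzbar i (dzbar l g)) z) =
    of_nat r * gsign i * wterm r f (dzbar i g) z"
    using wterm_commute_right [OF Suc.prems(2), of "r - 1" f i z] by (cases r) auto
  finally show ?case by (simp add: algebra_simps)
qed simp

lemma wterm_zb_right:
  assumes "pol d k f" "pol d' k' g"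
  shows "wterm r f (\<lambda>z. cnj (z $ i) * g z) z =
    cnj (z $ i) * wterm r f g z + of_nat r * gsign i * wterm (r - 1) (dz i f) g z"
  using assms
proof (induction r arbitrary: d k f d' k' g)
  case (Suc r)
  note p = pol_dz [OF Suc.prems(1)] pol_dzbar [OF Suc.prems(2)]
  have p2: "pol d' k' (\<lambda>z. if l = i then g z else 0)" "pol (Suc (d' - 1)) (k' + 1 - 1) (\<lambda>z. cnj (z $ i) * dzbar l g z)" for l
    by (rule pol_if [OF Suc.prems(2)], rule pol_zb [OF p(2)])
  have "wterm (Suc r) f (\<lambda>z. cnj (z $ i) * g z) z =
    (\<Sum>l\<in>UNIV. gsign l * ((if l = i then wterm r (dz l f) g z else 0)
      + (cnj (z $ i) * wterm r (dz l f) (dzbar l g) z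
         + of_nat r * gsign i * wterm (r - 1) (dz i (dz l f)) (dzbar l g) z)))"
    by (simp only: wterm_Suc pol_dz_rules [OF Suc.prems(2)] wterm_add_right [OF p2] wterm_if
        Suc.IH [OF p])
  also have "\<dots> = (\<Sum>l\<in>UNIV. if l = i then gsign i * wterm r (dz i f) g z else 0)
     + cnj (z $ i) * wterm (Suc r) f g z
     + of_nat r * gsign i * (\<Sum>l\<in>UNIV. gsign l * wterm (r - 1) (dz i (dz l f)) (dzbar l g) z)"
    unfolding wterm_Suc sum_distrib_left sum.distrib [symmetric]
    by (intro sum.cong) (auto simp: algebra_simps)
  also have "of_nat r * gsign i * (\<Sum>l\<in>UNIV. gsign l * wterm (r - 1) (dz i (dz l f)) (dzbar l g) z) =
    of_nat r * gsign i * wterm r (dz i f) g z"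
    using wterm_commute_left [OF Suc.prems(1), of "r - 1" i g z] by (cases r) auto
  finally show ?case by (simp add: algebra_simps)
qed simp

lemma wick_zb_left:
  assumes "pol d k f"
  shows "wick \<h> (\<lambda>z. cnj (z $ i) * f z) g = (\<lambda>z. cnj (z $ i) * wick \<h> f g z)"
  using pol_zb [OF assms, of i] pol_mono [OF assms, of "Suc d"]
  by (simp add: fun_eq_iff wick_finite [of "Suc d" "k - 1"] wick_finite [of "Suc d" k] wterm_zb_left [OF assms]
      sum_distrib_left mult.left_commute del: sum.atMost_Suc)

lemma wick_z_right:
  assumes "pol d k g"
  shows "wick \<h> f (\<lambda>z. z $ i * g z) = (\<lambda>z. z $ i * wick \<h> f g z)"
  using pol_z [OF assms, of i] pol_mono [OF assms, of "Suc d"]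
  by (simp add: fun_eq_iff wick_finite [of "Suc d" "k + 1"] wick_finite [of "Suc d" k] wterm_z_right [OF assms]
      sum_distrib_left mult.left_commute del: sum.atMost_Suc)

text \<open>The factor \<open>r\<close> removes the term at 0 and turns \<open>fact r\<close> into
  \<open>fact (r - 1)\<close>, which shifts the summation index. It sums the correction terms of the
  coordinate rules.\<close>

lemma sum_shift_fact:
  fixes h :: complex
  shows "(\<Sum>r\<le>Suc d. h ^ r / fact r * (of_nat r * g * F (r - 1))) = h * g * (\<Sum>r\<le>d. h ^ r / fact r * F r)"
proof -
  have *: "h ^ Suc r / fact (Suc r) * (of_nat (Suc r) * g * F (Suc r - 1)) = h * g * (h ^ r / fact r * F r)" for r
  proof -
    have "of_nat (Suc r) \<noteq> (0::complex)" by (simp del: of_nat_Suc)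
    then show ?thesis by (simp add: fact_Suc divide_simps del: of_nat_Suc)
  qed
  show ?thesis
    unfolding sum.atMost_Suc_shift * by (simp add: sum_distrib_left)
qed

lemma wick_z_left:
  assumes "pol d k f" "pol d' k' g"
  shows "wick \<h> (\<lambda>z. z $ i * f z) g = (\<lambda>z. z $ i * wick \<h> f g z + 2 * \<h> * gsign i * wick \<h> f (dzbar i g) z)"
proof
  fix z
  have p: "pol (Suc d) (k + 1) (\<lambda>z. z $ i * f z)" "pol (Suc d) k f"
    using assms by (auto intro: pol.intros pol_mono)
  note w = wick_finite [OF disjI1]
  show "wick \<h> (\<lambda>z. z $ i * f z) g z = z $ i * wick \<h> f g z + 2 * \<h> * gsign i * wick \<h> f (dzbar i g) z"
    unfolding w [OF p(1)] w [OF p(2), of \<h> g] w [OF assms(1), of \<h> "dzbar i g"] wterm_z_left [OF assms]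
    by (subst sum_shift_fact [symmetric])
      (simp add: distrib_left sum.distrib sum_distrib_left mult_ac del: sum.atMost_Suc)
qed

lemma wick_zb_right:
  assumes "pol d k f" "pol d' k' g"
  shows "wick \<h> f (\<lambda>z. cnj (z $ i) * g z) = (\<lambda>z. cnj (z $ i) * wick \<h> f g z + 2 * \<h> * gsign i * wick \<h> (dz i f) g z)"
proof
  fix z
  have p: "pol (Suc d') (k' - 1) (\<lambda>z. cnj (z $ i) * g z)" "pol (Suc d') k' g"
    using assms by (auto intro: pol.intros pol_mono)
  note w = wick_finite [OF disjI2]
  show "wick \<h> f (\<lambda>z. cnj (z $ i) * g z) z = cnj (z $ i) * wick \<h> f g z + 2 * \<h> * gsign i * wick \<h> (dz i f) g z"
    unfolding w [OF p(1)] w [OF p(2), of \<h> f] w [OF assms(2), of \<h> "dz i f"] wterm_zb_right [OF assms]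
    by (subst sum_shift_fact [symmetric])
      (simp add: distrib_left sum.distrib sum_distrib_left mult_ac del: sum.atMost_Suc)
qed

lemma wick_const:
  "wick \<h> (\<lambda>z. c) g = (\<lambda>z. c * g z)" "wick \<h> g (\<lambda>z. c) = (\<lambda>z. c * g z)"
  using wick_finite [OF disjI1 [OF pol_const [of 0 c]]] wick_finite [OF disjI2 [OF pol_const [of 0 c]]]
  by (auto simp: fun_eq_iff mult.commute)

text \<open>The invariant monomials of level one. They generate the algebra, and their commutators
  realise gl(n+1), the complexification of u(1,n).\<close>

definition eij :: "'n option \<Rightarrow> 'n option \<Rightarrow> 'n::finite cvec \<Rightarrow> complex" where
  "eij i j z = cnj (z $ j) * (z $ i)"

lemma pol_eij: "pol 2 0 (eij i j)"
  using pol_zb [OF pol_z [OF pol_const [of 0 1], of i], of j]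
  by (simp add: eij_def [abs_def] numeral_2_eq_2)

lemma wick_eij_left:
  assumes "pol d k f"
  shows "wick \<h> (eij i j) f = (\<lambda>z. cnj (z $ j) * (z $ i * f z + 2 * \<h> * gsign i * dzbar i f z))"
proof -
  have p: "pol 1 1 (\<lambda>z. z $ i * 1)" using pol_z [OF pol_const [of 0 1], of i] by simp
  have "eij i j = (\<lambda>z. cnj (z $ j) * (z $ i * 1))" by (simp add: eij_def [abs_def])
  then show ?thesis
    by (simp only: wick_zb_left [OF p] wick_z_left [OF pol_const assms] wick_const) simp
qed

lemma wick_eij_right:
  assumes "pol d k f"
  shows "wick \<h> f (eij i j) = (\<lambda>z. z $ i * (cnj (z $ j) * f z + 2 * \<h> * gsign j * dz j f z))"
proof -
  have p: "pol 1 (-1) (\<lambda>z. cnj (z $ j) * 1)" using pol_zb [OF pol_const [of 0 1], of j] by simp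
  have "eij i j = (\<lambda>z. z $ i * (cnj (z $ j) * 1))" by (simp add: eij_def [abs_def] mult.commute)
  then show ?thesis
    by (simp only: wick_z_right [OF p] wick_zb_right [OF assms pol_const] wick_const) simp
qed

text \<open>Left multiplication by \<open>eij i j\<close> is the first order operator built from
  \<open>cnj z_j\<close>, \<open>z_i\<close> and \<open>dzbar i\<close>. On the left side the
  correction for moving \<open>z_i\<close> out of the product supplies the derivative of
  \<open>g\<close>; on the right side it comes from the Leibniz rule.\<close>

lemma wick_eij_assoc:
  assumes "pol d k f" "pol d' k' g"
  shows "wick \<h> (wick \<h> (eij i j) f) g = wick \<h> (eij i j) (wick \<h> f g)"
proof -
  have p: "pol (Suc d) (k + 1) (\<lambda>z. z $ i * f z)" "pol d (k + 1) (\<lambda>z. 2 * \<h> * gsign i * dzbar i f z)"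
    "pol d (k + 1) (dzbar i f)"
    using pol_mono [OF pol_dzbar [OF assms(1)]] by (auto intro: pol.intros pol_scale assms)
  have p2: "pol (Suc d) (k + 1) (\<lambda>z. z $ i * f z + 2 * \<h> * gsign i * dzbar i f z)"
    using p by (intro pol_add) (auto intro: pol_mono)
  show ?thesis
    unfolding wick_eij_left [OF assms(1)] wick_eij_left [OF pol_wick [OF assms]] wick_zb_left [OF p2]
      wick_add_left [OF p(1,2)] wick_scale(1) [OF p(3)] wick_z_left [OF assms] dz_wick [OF assms]
    by (simp add: fun_eq_iff distrib_left add.assoc add.left_commute add.commute)
qed

subsection \<open>Linear substitutions and the transposition\<close>

lemma has_derivative_pullback:
  assumes "(f has_derivative f') (at (U *v z))"
  shows "(pullback U f has_derivative (\<lambda>v. f' (U *v v))) (at z)"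
proof -
  have "((\<lambda>z. U *v z) has_derivative (\<lambda>v. U *v v)) (at z)"
    by (rule bounded_linear_imp_has_derivative) (rule matrix_vector_mul_bounded_linear)
  from diff_chain_at [OF this assms] show ?thesis
    by (simp add: pullback_def o_def)
qed

lemma pol_pullback: "pol d k f \<Longrightarrow> pol d k (pullback U f)"
proof (induction rule: pol.induct)
  case (pol_z d k f i)
  have "pullback U (\<lambda>z. z $ i * f z) = (\<lambda>z. \<Sum>j\<in>UNIV. U $ i $ j * (z $ j * pullback U f z))"
    by (simp add: pullback_def matrix_vector_mult_def sum_distrib_right mult_ac)
  moreover have "pol (Suc d) (k + 1) \<dots>"
    using pol_z.IH by (intro pol_sum pol_scale pol.pol_z)
  ultimately show ?case by simp
next
  case (pol_zb d k f i)
  have "pullback U (\<lambda>z. cnj (z $ i) * f z) = (\<lambda>z. \<Sum>j\<in>UNIV. cnj (U $ i $ j) * (cnj (z $ j) * pullback U f z))"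
    by (simp add: pullback_def matrix_vector_mult_def sum_distrib_right mult_ac)
  moreover have "pol (Suc d) (k - 1) \<dots>"
    using pol_zb.IH by (intro pol_sum pol_scale pol.pol_zb)
  ultimately show ?case by simp
qed (auto simp: pullback_def intro: pol.intros)

lemma matrix_axis: "(U *v axis i c) $ j = U $ j $ i * (c::complex)"
  by (simp add: matrix_vector_mult_def axis_def if_distrib cong: if_cong)

lemma dz_pullback:
  fixes f :: "'n::finite cvec \<Rightarrow> complex"
  assumes "pol d k f"
  shows "dz i (pullback U f) = (\<lambda>z. \<Sum>j\<in>UNIV. U $ j $ i * pullback U (dz j f) z)"
    "dzbar i (pullback U f) = (\<lambda>z. \<Sum>j\<in>UNIV. cnj (U $ j $ i) * pullback U (dzbar j f) z)"
proof -
  have "dz i (pullback U f) z = (\<Sum>j\<in>UNIV. U $ j $ i * pullback U (dz j f) z) \<and>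
    dzbar i (pullback U f) z = (\<Sum>j\<in>UNIV. cnj (U $ j $ i) * pullback U (dzbar j f) z)" for z
  proof -
    obtain f' where f': "(f has_derivative f') (at (U *v z))"
      using pol_differentiable [OF assms] by (auto simp: differentiable_def)
    note d = has_derivative_dz [OF has_derivative_pullback [OF f']]
    have "dz i (pullback U f) z = (\<Sum>j\<in>UNIV. U $ j $ i * pullback U (dz j f) z)"
      unfolding d derivative_via_dz [OF f'] matrix_axis sum_distrib_left sum_subtractf [symmetric]
        sum_divide_distrib
      by (intro sum.cong) (auto simp: pullback_def field_simps)
    moreover have "dzbar i (pullback U f) z = (\<Sum>j\<in>UNIV. cnj (U $ j $ i) * pullback U (dzbar j f) z)"
      unfolding d derivative_via_dz [OF f'] matrix_axis sum_distrib_left sum.distrib [symmetric]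
        sum_divide_distrib
      by (intro sum.cong) (auto simp: pullback_def field_simps)
    ultimately show ?thesis by simp
  qed
  then show "dz i (pullback U f) = (\<lambda>z. \<Sum>j\<in>UNIV. U $ j $ i * pullback U (dz j f) z)"
    "dzbar i (pullback U f) = (\<lambda>z. \<Sum>j\<in>UNIV. cnj (U $ j $ i) * pullback U (dzbar j f) z)"
    by auto
qed

lemma wterm_sum_left:
  "(\<And>x. x \<in> A \<Longrightarrow> pol d k (f x)) \<Longrightarrow> wterm r (\<lambda>z. \<Sum>x\<in>A. f x z) g z = (\<Sum>x\<in>A. wterm r (f x) g z)"
proof (induction A rule: infinite_finite_induct)
  case (insert x F)
  have "pol d k (\<lambda>z. \<Sum>x\<in>F. f x z)" using insert by (auto intro: pol_sum)
  then show ?case using insert by (simp add: wterm_add_left [of d k _ d k])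
qed auto

lemma wterm_sum_right:
  "(\<And>x. x \<in> A \<Longrightarrow> pol d k (f x)) \<Longrightarrow> wterm r g (\<lambda>z. \<Sum>x\<in>A. f x z) z = (\<Sum>x\<in>A. wterm r g (f x) z)"
proof (induction A rule: infinite_finite_induct)
  case (insert x F)
  have "pol d k (\<lambda>z. \<Sum>x\<in>F. f x z)" using insert by (auto intro: pol_sum)
  then show ?case using insert by (simp add: wterm_add_right [of d k _ d k])
qed auto

text \<open>The hypothesis is invariance of the inverse metric, \<open>U g U^* = g\<close>; this is
  the combination that appears when the chain rule is applied to both arguments of a
  contraction.\<close>

lemma wterm_pullback:
  assumes U: "\<And>j l. (\<Sum>i\<in>UNIV. gsign i * U $ j $ i * cnj (U $ l $ i)) = (if j = l then gsign j else 0)"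
  shows "pol d k f \<Longrightarrow> pol d' k' g \<Longrightarrow> wterm r (pullback U f) (pullback U g) z = wterm r f g (U *v z)"
proof (induction r arbitrary: d k f d' k' g)
  case 0
  then show ?case by (simp add: pullback_def)
next
  case (Suc r)
  note p = pol_dz [OF Suc.prems(1)] pol_dzbar [OF Suc.prems(2)]
  note q = pol_pullback [OF p(1), of U] pol_pullback [OF p(2), of U]
  have "wterm r (dz i (pullback U f)) (dzbar i (pullback U g)) z =
     (\<Sum>j\<in>UNIV. \<Sum>l\<in>UNIV. U $ j $ i * cnj (U $ l $ i) * wterm r (dz j f) (dzbar l g) (U *v z))" for i
    unfolding dz_pullback [OF Suc.prems(1)] dz_pullback [OF Suc.prems(2)]
    by (simp add: wterm_sum_left [OF pol_scale [OF q(1)]] wterm_sum_right [OF pol_scale [OF q(2)]]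
        wterm_scale_left [OF q(1)] wterm_scale_right [OF q(2)] Suc.IH [OF p] sum_distrib_left mult_ac)
  then have "wterm (Suc r) (pullback U f) (pullback U g) z =
    (\<Sum>i\<in>UNIV. \<Sum>j\<in>UNIV. \<Sum>l\<in>UNIV. (gsign i * U $ j $ i * cnj (U $ l $ i)) * wterm r (dz j f) (dzbar l g) (U *v z))"
    by (simp add: wterm_Suc sum_distrib_left mult_ac)
  also have "\<dots> = (\<Sum>j\<in>UNIV. \<Sum>l\<in>UNIV. \<Sum>i\<in>UNIV. (gsign i * U $ j $ i * cnj (U $ l $ i)) * wterm r (dz j f) (dzbar l g) (U *v z))"
    by (subst sum.swap) (intro sum.cong refl sum.swap)
  also have "\<dots> = (\<Sum>j\<in>UNIV. \<Sum>l\<in>UNIV. if j = l then gsign j * wterm r (dz j f) (dzbar l g) (U *v z) else 0)"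
    by (intro sum.cong) (simp_all add: sum_distrib_right [symmetric] U)
  finally show ?case by (simp add: wterm_Suc)
qed

lemma wick_pullback:
  assumes "\<And>j l. (\<Sum>i\<in>UNIV. gsign i * U $ j $ i * cnj (U $ l $ i)) = (if j = l then gsign j else 0)"
    and "pol d k f" "pol d' k' g"
  shows "wick \<h> (pullback U f) (pullback U g) = pullback U (wick \<h> f g)"
  using wterm_pullback [OF assms]
  by (simp add: fun_eq_iff wick_finite [OF disjI1, OF assms(2)] pullback_def
     wick_finite [OF disjI1, OF pol_pullback [OF assms(2)], unfolded pullback_def])

definition cnj_vec :: "'n::finite cvec \<Rightarrow> 'n cvec" where
  "cnj_vec z = (\<chi> i. cnj (z $ i))"

lemma cj_nth [simp]: "cnj_vec z $ i = cnj (z $ i)" by (simp add: cnj_vec_def)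

section \<open>Coefficients as derivatives at the origin\<close>

definition idx :: "'n option list \<Rightarrow> 'n \<Rightarrow> nat" where
  "idx I = (\<lambda>i. count_list I (Some i))"

text \<open>Index triples are represented by pairs of lists of equal length \<open>\<alpha>\<close> over \<open>{0,...,n}\<close>, so that the zeroth
  coordinate is treated like the others.\<close>

definition tri :: "'n option list \<Rightarrow> 'n option list \<Rightarrow> 'n triple" where
  "tri I J = (idx I, idx J, length I)"

definition level :: "'n triple \<Rightarrow> nat" where
  "level \<tau> = snd (snd \<tau>)"

lemma level_tri [simp]: "level (tri I J) = length I"
  by (simp add: level_def tri_def)

lemma prod_UNIV_option:
  fixes f :: "'n::finite option \<Rightarrow> 'a::comm_monoid_mult"
  shows "(\<Prod>i\<in>UNIV. f i) = f None * (\<Prod>i\<in>UNIV. f (Some i))"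
  unfolding UNIV_option_conv by (simp add: prod.reindex)

lemma sum_UNIV_option:
  fixes f :: "'n::finite option \<Rightarrow> 'a::comm_monoid_add"
  shows "(\<Sum>i\<in>UNIV. f i) = f None + (\<Sum>i\<in>UNIV. f (Some i))"
  unfolding UNIV_option_conv by (simp add: sum.reindex)

lemma sum_count_list: "(\<Sum>i\<in>UNIV. count_list (I::'a::finite list) i) = length I"
  using sum_count_set [of I UNIV] by simp

lemma length_idx: "length (I::'n::finite option list) = count_list I None + mdeg (idx I)"
  using sum_count_list [of I] by (simp add: sum_UNIV_option mdeg_def idx_def)

lemma tri_triples [simp]: "length (I::'n::finite option list) = length J \<Longrightarrow> tri I J \<in> triples"
  using length_idx [of I] length_idx [of J] by (auto simp: tri_def triples_def)

lemma idx_eq_iff: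
  assumes "length (I::'n::finite option list) = length I'"
  shows "idx I = idx I' \<longleftrightarrow> count_list I = count_list I'"
proof
  assume e: "idx I = idx I'"
  have "count_list I i = count_list I' i" for i
  proof (cases i)
    case None
    then show ?thesis using length_idx [of I] length_idx [of I'] assms e by simp
  next
    case (Some a)
    then show ?thesis using fun_cong [OF e, of a] by (simp add: idx_def)
  qed
  then show "count_list I = count_list I'" by auto
qed (auto simp: idx_def)

lemma ex_list_idx: "mdeg (P::'n::finite \<Rightarrow> nat) \<le> \<alpha> \<Longrightarrow> \<exists>I. length I = \<alpha> \<and> idx I = P"
proof (induction "mdeg P" arbitrary: P \<alpha>)
  case 0
  then have "P = (\<lambda>i. 0)" by (auto simp: mdeg_def)
  then show ?case by (intro exI [of _ "replicate \<alpha> None"]) (auto simp: idx_def count_list_0_iff)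
next
  case (Suc m)
  then obtain i where i: "P i > 0" by (metis mdeg_def sum.neutral neq0_conv nat.distinct(1))
  define P' where "P' = P(i := P i - 1)"
  have "P = (\<lambda>j. P' j + (if j = i then 1 else 0))" using i by (auto simp: P'_def)
  then have "mdeg P = mdeg P' + 1" by (simp add: mdeg_def sum.distrib)
  moreover obtain \<beta> where "\<alpha> = Suc \<beta>" using Suc by (cases \<alpha>) auto
  ultimately obtain I where "length I = \<beta>" "idx I = P'" using Suc.hyps(1) [of P' \<beta>] Suc by auto
  then show ?case using i \<open>\<alpha> = Suc \<beta>\<close>
    by (intro exI [of _ "Some i # I"]) (auto simp: idx_def P'_def fun_eq_iff split: if_splits)
qed

text \<open>An arbitrary ordering of the prescribed multiset; mixed derivatives of polynomials do
  not depend on it.\<close>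

definition rl :: "('n::finite \<Rightarrow> nat) \<Rightarrow> nat \<Rightarrow> 'n option list" where
  "rl P \<alpha> = (SOME I. length I = \<alpha> \<and> idx I = P)"

definition repI :: "'n::finite triple \<Rightarrow> 'n option list" where
  "repI \<tau> = rl (fst \<tau>) (snd (snd \<tau>))"

definition repJ :: "'n::finite triple \<Rightarrow> 'n option list" where
  "repJ \<tau> = rl (fst (snd \<tau>)) (snd (snd \<tau>))"

lemma rl: "mdeg P \<le> \<alpha> \<Longrightarrow> length (rl P \<alpha>) = \<alpha>" "mdeg P \<le> \<alpha> \<Longrightarrow> idx (rl P \<alpha>) = P"
  using someI_ex [OF ex_list_idx [of P \<alpha>]] by (auto simp: rl_def)

lemma rep:
  assumes "\<tau> \<in> triples"
  shows "length (repI \<tau>) = level \<tau>" "length (repJ \<tau>) = level \<tau>" "tri (repI \<tau>) (repJ \<tau>) = \<tau>"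
  using assms rl by (auto simp: repI_def repJ_def level_def tri_def triples_def)

lemma prod_list_count:
  fixes f :: "'a::finite \<Rightarrow> 'b::comm_monoid_mult"
  shows "(\<Prod>i\<leftarrow>I. f i) = (\<Prod>i\<in>UNIV. f i ^ count_list I i)"
proof (induction I)
  case (Cons x I)
  have "(\<Prod>i\<in>UNIV. f i ^ count_list (x # I) i) =
    (\<Prod>i\<in>UNIV. (if i = x then f x else 1) * f i ^ count_list I i)"
    by (rule prod.cong) auto
  then show ?case using Cons by (simp add: prod.distrib)
qed simp

definition monomial :: "('n option \<Rightarrow> nat) \<Rightarrow> ('n option \<Rightarrow> nat) \<Rightarrow> 'n::finite cvec \<Rightarrow> complex" where
  "monomial A B z = (\<Prod>i\<in>UNIV. (z $ i) ^ A i) * (\<Prod>i\<in>UNIV. (cnj (z $ i)) ^ B i)"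

definition mon :: "'n option list \<Rightarrow> 'n option list \<Rightarrow> 'n::finite cvec \<Rightarrow> complex" where
  "mon I J z = (\<Prod>i\<leftarrow>I. z $ i) * (\<Prod>j\<leftarrow>J. cnj (z $ j))"

lemma mon_simps:
  "mon [] [] = (\<lambda>z. 1)" "mon (i # I) J = (\<lambda>z. z $ i * mon I J z)" "mon I (j # J) = (\<lambda>z. cnj (z $ j) * mon I J z)"
  by (auto simp: mon_def fun_eq_iff)

lemma mon_zz: "mon I J = monomial (count_list I) (count_list J)"
  by (simp add: fun_eq_iff mon_def monomial_def prod_list_count)

lemma ebasis_zz:
  "ebasis (P, Q, \<alpha>) = monomial (case_option (\<alpha> - mdeg P) P) (case_option (\<alpha> - mdeg Q) Q)"
  by (simp add: fun_eq_iff monomial_def prod_UNIV_option)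

lemma count_list_idx: "count_list I = case_option (length I - mdeg (idx I)) (idx I)" for I :: "'n::finite option list"
  using length_idx [of I] by (auto simp: fun_eq_iff idx_def split: option.split)

lemma ebasis_tri: "length I = length J \<Longrightarrow> ebasis (tri I J) = mon I J"
  using count_list_idx [of I] count_list_idx [of J] by (simp add: tri_def ebasis_zz mon_zz)

lemma pol_mon: "pol (length I + length J) (int (length I) - int (length J)) (mon I J)"
proof (induction I)
  case Nil
  show ?case
  proof (induction J)
    case (Cons j J)
    have e: "int (length ([] :: 'a option list)) - int (length J) - 1 =
      int (length ([] :: 'a option list)) - int (Suc (length J))" by simp
    show ?case using pol_zb [OF Cons, of j] by (simp only: e mon_simps length_Cons add_Suc_right)
  qed (simp add: mon_simps pol_const)
next
  case (Cons i I)
  then show ?case using pol_z [OF Cons, of i] by (simp add: mon_simps algebra_simps)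
qed

lemma pol_ebasis: "\<tau> \<in> triples \<Longrightarrow> pol (2 * level \<tau>) 0 (ebasis \<tau>)"
  using pol_mon [of "repI \<tau>" "repJ \<tau>"] ebasis_tri [of "repI \<tau>" "repJ \<tau>"] rep [of \<tau>]
  by (simp add: mult_2)

text \<open>The denominator in \<open>fbasis\<close>. It is also the mixed derivative of
  \<open>ebasis \<tau>\<close> in the directions of \<tau>, so coefficients with respect to
  \<open>fbasis\<close> become derivatives without combinatorial factors.\<close>

definition nfac :: "'n::finite triple \<Rightarrow> nat" where
  "nfac = (\<lambda>(P, Q, \<alpha>). mfact P * fact (\<alpha> - mdeg P) * mfact Q * fact (\<alpha> - mdeg Q))"

lemma nfac_pos [simp]: "nfac \<tau> > 0" "nfac \<tau> \<noteq> 0"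
proof -
  show "nfac \<tau> > 0" by (cases \<tau>) (auto simp: nfac_def mfact_def intro!: prod_pos)
  then show "nfac \<tau> \<noteq> 0" by simp
qed

lemma nfac_tri:
  "length I = length J \<Longrightarrow> nfac (tri I J) = (\<Prod>i\<in>UNIV. fact (count_list I i)) * (\<Prod>i\<in>UNIV. fact (count_list J i))"
proof -
  assume l: "length I = length J"
  have "length I - mdeg (idx I) = count_list I None" "length I - mdeg (idx J) = count_list J None"
    using length_idx [of I] length_idx [of J] l by auto
  then show ?thesis
    by (simp add: nfac_def tri_def mfact_def prod_UNIV_option) (simp add: idx_def)
qed

text \<open>The falling factorial a (a - 1) ... (a - c + 1), the factor produced by the c-th
  derivative of an a-th power; it is zero for c > a.\<close>

definition dff :: "nat \<Rightarrow> nat \<Rightarrow> complex" where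
  "dff a c = (if c \<le> a then fact a / fact (a - c) else 0)"

lemma dff_0 [simp]: "dff a 0 = 1" by (simp add: dff_def)

lemma dff_Suc: "of_nat (a - c) * dff a c = dff a (Suc c)"
proof (cases "Suc c \<le> a")
  case True
  then have "a - c = Suc (a - Suc c)" by simp
  then have f: "fact (a - c) = of_nat (a - c) * (fact (a - Suc c) :: complex)"
    by (metis fact_Suc)
  have "of_nat (a - c) \<noteq> (0::complex)" using True by simp
  then show ?thesis using True by (simp add: dff_def f)
qed (simp add: dff_def)

lemma dz_pow:
  "dz i (\<lambda>z. z $ l ^ m) = (\<lambda>z. if i = l then of_nat m * z $ l ^ (m - 1) else 0)"
  "dzbar i (\<lambda>z. z $ l ^ m) = (\<lambda>z. 0)"
  "dz i (\<lambda>z. cnj (z $ l) ^ m) = (\<lambda>z. 0)"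
  "dzbar i (\<lambda>z. cnj (z $ l) ^ m) = (\<lambda>z. if i = l then of_nat m * cnj (z $ l) ^ (m - 1) else 0)"
proof -
  have "dz i (\<lambda>z. z $ l ^ m) = (\<lambda>z. if i = l then of_nat m * z $ l ^ (m - 1) else 0) \<and>
    dzbar i (\<lambda>z. z $ l ^ m) = (\<lambda>z. 0) \<and> dz i (\<lambda>z. cnj (z $ l) ^ m) = (\<lambda>z. 0) \<and>
    dzbar i (\<lambda>z. cnj (z $ l) ^ m) = (\<lambda>z. if i = l then of_nat m * cnj (z $ l) ^ (m - 1) else 0)"
  proof (induction m)
    case (Suc m)
    have d: "(\<lambda>z. z $ l ^ m) differentiable at z" "(\<lambda>z. cnj (z $ l) ^ m) differentiable at z" for z :: "'a cvec"
      using differentiable_power [OF coord_differentiable(1)] differentiable_power [OF coord_differentiable(2)] by auto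
    show ?case using Suc.IH
      by (cases m) (auto simp: fun_eq_iff dz_mult d algebra_simps)
  qed auto
  then show "dz i (\<lambda>z. z $ l ^ m) = (\<lambda>z. if i = l then of_nat m * z $ l ^ (m - 1) else 0)"
  "dzbar i (\<lambda>z. z $ l ^ m) = (\<lambda>z. 0)"
  "dz i (\<lambda>z. cnj (z $ l) ^ m) = (\<lambda>z. 0)"
  "dzbar i (\<lambda>z. cnj (z $ l) ^ m) = (\<lambda>z. if i = l then of_nat m * cnj (z $ l) ^ (m - 1) else 0)" by auto
qed

lemma dz_prod_0:
  assumes "finite S" "\<And>l. l \<in> S \<Longrightarrow> (\<forall>z. f l differentiable at z) \<and> dz i (f l) = (\<lambda>z. 0)"
  shows "(\<forall>z. (\<lambda>z. \<Prod>l\<in>S. f l z) differentiable at z) \<and> dz i (\<lambda>z. \<Prod>l\<in>S. f l z) = (\<lambda>z. 0)"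
  using assms
proof (induction S)
  case (insert l S)
  then show ?case by (auto simp: fun_eq_iff dz_mult intro!: differentiable_mult)
qed auto

lemma dzbar_prod_0:
  assumes "finite S" "\<And>l. l \<in> S \<Longrightarrow> (\<forall>z. f l differentiable at z) \<and> dzbar i (f l) = (\<lambda>z. 0)"
  shows "(\<forall>z. (\<lambda>z. \<Prod>l\<in>S. f l z) differentiable at z) \<and> dzbar i (\<lambda>z. \<Prod>l\<in>S. f l z) = (\<lambda>z. 0)"
  using assms
proof (induction S)
  case (insert l S)
  then show ?case by (auto simp: fun_eq_iff dz_mult intro!: differentiable_mult)
qed auto

lemma dz_zz:
  "dz i (\<lambda>z. c * monomial A B z) = (\<lambda>z. (c * of_nat (A i)) * monomial (A(i := A i - 1)) B z)"
  "dzbar i (\<lambda>z. c * monomial A B z) = (\<lambda>z. (c * of_nat (B i)) * monomial A (B(i := B i - 1)) z)"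
proof -
  have d: "(\<lambda>z. z $ l ^ m) differentiable at z" "(\<lambda>z. cnj (z $ l) ^ m) differentiable at z" for z :: "'a cvec" and l m
    using differentiable_power [OF coord_differentiable(1)] differentiable_power [OF coord_differentiable(2)] by auto
  define R where "R = (\<lambda>z::'a cvec. (\<Prod>l\<in>UNIV - {i}. (z $ l) ^ A l) * (\<Prod>l\<in>UNIV. (cnj (z $ l)) ^ B l))"
  define S where "S = (\<lambda>z::'a cvec. (\<Prod>l\<in>UNIV - {i}. (cnj (z $ l)) ^ B l) * (\<Prod>l\<in>UNIV. (z $ l) ^ A l))"
  have 1: "\<forall>z. R differentiable at z" "dz i R = (\<lambda>z. 0)"
    using dz_prod_0 [of "UNIV - {i}" "\<lambda>l z. (z $ l) ^ A l" i] dz_prod_0 [of UNIV "\<lambda>l z. (cnj (z $ l)) ^ B l" i] d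
    by (auto simp: R_def fun_eq_iff dz_mult dz_pow intro!: differentiable_mult)
  have 2: "\<forall>z. S differentiable at z" "dzbar i S = (\<lambda>z. 0)"
    using dzbar_prod_0 [of "UNIV - {i}" "\<lambda>l z. (cnj (z $ l)) ^ B l" i] dzbar_prod_0 [of UNIV "\<lambda>l z. (z $ l) ^ A l" i] d
    by (auto simp: S_def fun_eq_iff dz_mult dz_pow intro!: differentiable_mult)
  have e: "monomial A B = (\<lambda>z. z $ i ^ A i * R z)" "monomial A B = (\<lambda>z. cnj (z $ i) ^ B i * S z)"
    "monomial (A(i := A i - 1)) B = (\<lambda>z. z $ i ^ (A i - 1) * R z)"
    "monomial A (B(i := B i - 1)) = (\<lambda>z. cnj (z $ i) ^ (B i - 1) * S z)"
    by (auto simp: fun_eq_iff monomial_def R_def S_def prod.remove [of UNIV i])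
  have p: "dz i (\<lambda>z. c * (z $ i ^ A i * R z)) = (\<lambda>z. c * of_nat (A i) * (z $ i ^ (A i - 1) * R z))"
    using 1 d by (auto simp: fun_eq_iff dz_mult dz_pow intro!: differentiable_mult)
  have q: "dzbar i (\<lambda>z. c * (cnj (z $ i) ^ B i * S z)) = (\<lambda>z. c * of_nat (B i) * (cnj (z $ i) ^ (B i - 1) * S z))"
    using 2 d by (auto simp: fun_eq_iff dz_mult dz_pow intro!: differentiable_mult)
  show "dz i (\<lambda>z. c * monomial A B z) = (\<lambda>z. (c * of_nat (A i)) * monomial (A(i := A i - 1)) B z)"
    unfolding e(1,3) by (rule p)
  show "dzbar i (\<lambda>z. c * monomial A B z) = (\<lambda>z. (c * of_nat (B i)) * monomial A (B(i := B i - 1)) z)"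
    unfolding e(2,4) by (rule q)
qed

lemma dff_step:
  fixes A :: "'a::finite \<Rightarrow> nat"
  shows "(\<Prod>l\<in>UNIV. dff (A l) (count_list I l)) * of_nat (A i - count_list I i) =
    (\<Prod>l\<in>UNIV. dff (A l) (count_list (i # I) l))"
proof -
  have "(\<Prod>l\<in>UNIV - {i}. dff (A l) (count_list (i # I) l)) = (\<Prod>l\<in>UNIV - {i}. dff (A l) (count_list I l))"
    by (rule prod.cong) auto
  then show ?thesis
    by (simp add: prod.remove [of UNIV i] dff_Suc [symmetric] mult_ac)
qed

text \<open>When more derivatives are taken than an exponent allows, the truncated exponent on the
  right is meaningless but the falling factorial vanishes, so the formula holds for all
  lists.\<close>

lemma foldr_dz_zz:
  "foldr dz I (foldr dzbar J (\<lambda>z. c * monomial A B z)) =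
    (\<lambda>z. (c * (\<Prod>l\<in>UNIV. dff (B l) (count_list J l)) * (\<Prod>l\<in>UNIV. dff (A l) (count_list I l))) *
       monomial (\<lambda>l. A l - count_list I l) (\<lambda>l. B l - count_list J l) z)"
proof -
  have 1: "foldr dzbar J (\<lambda>z. c * monomial A B z) =
    (\<lambda>z. (c * (\<Prod>l\<in>UNIV. dff (B l) (count_list J l))) * monomial A (\<lambda>l. B l - count_list J l) z)"
  proof (induction J)
    case (Cons j J)
    have "(\<lambda>l. B l - count_list J l)(j := B j - count_list J j - 1) = (\<lambda>l. B l - count_list (j # J) l)"
      by auto
    then show ?case
      by (simp only: foldr.simps o_apply Cons dz_zz mult.assoc [of _ _ "of_nat _"] dff_step)
  qed simp
  show ?thesis unfolding 1
  proof (induction I)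
    case (Cons i I)
    have "(\<lambda>l. A l - count_list I l)(i := A i - count_list I i - 1) = (\<lambda>l. A l - count_list (i # I) l)"
      by auto
    then show ?case
      by (simp only: foldr.simps o_apply Cons dz_zz mult.assoc [of _ _ "of_nat _"] dff_step)
  qed simp
qed

definition dcoef :: "('n::finite cvec \<Rightarrow> complex) \<Rightarrow> 'n option list \<Rightarrow> 'n option list \<Rightarrow> complex" where
  "dcoef f I J = foldr dz I (foldr dzbar J f) 0"

lemma zz_0: "monomial A B 0 = (if A = (\<lambda>i. 0) \<and> B = (\<lambda>i. 0) then 1 else 0)"
  by (auto simp: monomial_def fun_eq_iff)

lemma prod_dff_same: "(\<Prod>l\<in>(UNIV::'a::finite set). dff (A l) (A l)) = of_nat (\<Prod>l\<in>UNIV. fact (A l))"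
  by (simp add: dff_def)

lemma tri_eq_iff:
  assumes "length (I::'n::finite option list) = length J" "\<tau> \<in> triples" "length I = level \<tau>"
  shows "tri I J = \<tau> \<longleftrightarrow> count_list I = count_list (repI \<tau>) \<and> count_list J = count_list (repJ \<tau>)"
proof -
  have "tri I J = \<tau> \<longleftrightarrow> idx I = idx (repI \<tau>) \<and> idx J = idx (repJ \<tau>)"
    using rep [OF assms(2)] assms by (metis Pair_inject tri_def)
  then show ?thesis using idx_eq_iff rep [OF assms(2)] assms by metis
qed

text \<open>At the origin a derivative of a monomial survives only if it uses up every exponent
  exactly. Hence mixed derivatives at 0 are dual to the monomial basis, up to
  \<open>nfac\<close>.\<close>

lemma dcoef_ebasis:
  assumes "\<tau> \<in> triples"
  shows "dcoef (ebasis \<tau>) I J = (if length I = length J \<and> tri I J = \<tau> then of_nat (nfac \<tau>) else 0)"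
proof -
  define A B where "A = count_list (repI \<tau>)" and "B = count_list (repJ \<tau>)"
  have e: "ebasis \<tau> = (\<lambda>z. 1 * monomial A B z)"
    using rep [OF assms] ebasis_tri [of "repI \<tau>" "repJ \<tau>"] by (simp add: mon_zz A_def B_def)
  have n: "nfac \<tau> = (\<Prod>i\<in>UNIV. fact (A i)) * (\<Prod>i\<in>UNIV. fact (B i))"
    using rep [OF assms] nfac_tri [of "repI \<tau>" "repJ \<tau>"] by (simp add: A_def B_def)
  have c: "length I = length J \<and> tri I J = \<tau> \<longleftrightarrow> count_list I = A \<and> count_list J = B"
  proof
    assume *: "count_list I = A \<and> count_list J = B"
    then have "length I = level \<tau>" "length J = level \<tau>"
      using sum_count_list [of I] sum_count_list [of J] sum_count_list [of "repI \<tau>"]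
        sum_count_list [of "repJ \<tau>"] rep [OF assms] by (auto simp: A_def B_def)
    then show "length I = length J \<and> tri I J = \<tau>"
      using * tri_eq_iff [OF _ assms, of I J] by (auto simp: A_def B_def)
  next
    assume "length I = length J \<and> tri I J = \<tau>"
    then show "count_list I = A \<and> count_list J = B"
      using tri_eq_iff [OF _ assms, of I J] by (auto simp: A_def B_def)
  qed
  show ?thesis
  proof (cases "count_list I = A \<and> count_list J = B")
    case True
    then show ?thesis
      unfolding dcoef_def e foldr_dz_zz c by (simp add: prod_dff_same zz_0 n del: of_nat_prod)
  next
    case False
    then obtain l where l: "count_list I l \<noteq> A l \<or> count_list J l \<noteq> B l" by auto
    have "(\<Prod>l\<in>UNIV. dff (B l) (count_list J l)) * (\<Prod>l\<in>UNIV. dff (A l) (count_list I l)) *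
       monomial (\<lambda>l. A l - count_list I l) (\<lambda>l. B l - count_list J l) 0 = 0"
    proof (cases "count_list I l \<le> A l \<and> count_list J l \<le> B l")
      case True
      with l have "A l - count_list I l \<noteq> 0 \<or> B l - count_list J l \<noteq> 0" by auto
      then show ?thesis by (auto simp: zz_0 fun_eq_iff)
    next
      case False
      then have "dff (B l) (count_list J l) = 0 \<or> dff (A l) (count_list I l) = 0" by (auto simp: dff_def)
      then show ?thesis by auto
    qed
    then show ?thesis
      unfolding dcoef_def e foldr_dz_zz c if_not_P [OF False] by (simp only: mult_1)
  qed
qed

text \<open>For derivatives of the full order the duality holds at every point, because a different
  multi-index of the same total order exceeds some exponent. This is needed since the origin does
  not lie in the cone.\<close>

lemma top_derivative_ebasis:
  assumes "\<tau> \<in> triples" "length I = level \<tau>" "length J = level \<tau>"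
  shows "foldr dz I (foldr dzbar J (ebasis \<tau>)) z = (if tri I J = \<tau> then of_nat (nfac \<tau>) else 0)"
proof -
  define A B where "A = count_list (repI \<tau>)" and "B = count_list (repJ \<tau>)"
  have e: "ebasis \<tau> = (\<lambda>z. 1 * monomial A B z)"
    using rep [OF assms(1)] ebasis_tri [of "repI \<tau>" "repJ \<tau>"] by (simp add: mon_zz A_def B_def)
  have n: "nfac \<tau> = (\<Prod>i\<in>UNIV. fact (A i)) * (\<Prod>i\<in>UNIV. fact (B i))"
    using rep [OF assms(1)] nfac_tri [of "repI \<tau>" "repJ \<tau>"] by (simp add: A_def B_def)
  have c: "tri I J = \<tau> \<longleftrightarrow> count_list I = A \<and> count_list J = B"
    using tri_eq_iff [OF _ assms(1), of I J] assms by (auto simp: A_def B_def)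
  have s: "sum (count_list I) UNIV = sum A UNIV" "sum (count_list J) UNIV = sum B UNIV"
    using sum_count_list [of I] sum_count_list [of J] sum_count_list [of "repI \<tau>"]
      sum_count_list [of "repJ \<tau>"] rep [OF assms(1)] assms by (auto simp: A_def B_def)
  \<comment> \<open>Two different count functions with equal sums cannot be ordered, so in each
    direction one of them is smaller somewhere.\<close>
  have *: "\<exists>l. C l < D l" if eq: "sum C UNIV = sum D UNIV" and neq: "C \<noteq> D" for C D :: "'a option \<Rightarrow> nat"
  proof (rule ccontr)
    assume "\<not> (\<exists>l. C l < D l)"
    then have le: "\<And>l. D l \<le> C l" by (meson not_le)
    moreover obtain l where "D l \<noteq> C l" using neq by (metis ext)
    ultimately have "sum D UNIV < sum C UNIV" by (intro sum_strict_mono_ex1) (auto intro!: exI [of _ l] simp: order.strict_iff_order)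
    with eq show False by simp
  qed
  show ?thesis
  proof (cases "count_list I = A \<and> count_list J = B")
    case True
    then show ?thesis
      unfolding e foldr_dz_zz c by (simp add: prod_dff_same monomial_def n del: of_nat_prod)
  next
    case False
    then obtain l where "A l < count_list I l \<or> B l < count_list J l"
      using * [of A "count_list I"] * [of B "count_list J"] s by metis
    then have "dff (B l) (count_list J l) = 0 \<or> dff (A l) (count_list I l) = 0" by (auto simp: dff_def)
    then have "(\<Prod>l\<in>UNIV. dff (B l) (count_list J l)) * (\<Prod>l\<in>UNIV. dff (A l) (count_list I l)) = 0"
      by auto
    then show ?thesis
      unfolding e foldr_dz_zz c if_not_P [OF False] by (simp only: mult_1 mult_zero_left)
  qed
qed

subsection \<open>Invariant polynomials and their coefficients\<close>

lemma lincomb_superset: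
  assumes "finite S" "{\<tau>. c \<tau> \<noteq> 0} \<subseteq> S"
  shows "lincomb B c z = (\<Sum>\<tau>\<in>S. c \<tau> * B \<tau> z)"
  unfolding lincomb_def using assms by (intro sum.mono_neutral_left) auto

lemma fin_coeffs_add: "c \<in> fin_coeffs \<Longrightarrow> d \<in> fin_coeffs \<Longrightarrow> (\<lambda>\<tau>. c \<tau> + d \<tau>) \<in> fin_coeffs"
proof -
  assume *: "c \<in> fin_coeffs" "d \<in> fin_coeffs"
  have "{\<tau>. c \<tau> + d \<tau> \<noteq> 0} \<subseteq> {\<tau>. c \<tau> \<noteq> 0} \<union> {\<tau>. d \<tau> \<noteq> 0}" by auto
  with * show ?thesis
    unfolding fin_coeffs_def mem_Collect_eq by (meson finite_UnI finite_subset le_sup_iff subset_trans)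
qed

lemma fin_coeffs_scale: "c \<in> fin_coeffs \<Longrightarrow> (\<lambda>\<tau>. x \<tau> * c \<tau>) \<in> fin_coeffs"
proof -
  assume *: "c \<in> fin_coeffs"
  have "{\<tau>. x \<tau> * c \<tau> \<noteq> 0} \<subseteq> {\<tau>. c \<tau> \<noteq> 0}" by auto
  with * show ?thesis
    unfolding fin_coeffs_def mem_Collect_eq by (meson finite_subset subset_trans)
qed

lemma fin_coeffs_outside: "c \<in> fin_coeffs \<Longrightarrow> \<tau> \<notin> triples \<Longrightarrow> c \<tau> = 0"
  by (auto simp: fin_coeffs_def)

lemma lincomb_add:
  assumes "c \<in> fin_coeffs" "d \<in> fin_coeffs"
  shows "lincomb B (\<lambda>\<tau>. c \<tau> + d \<tau>) = (\<lambda>z. lincomb B c z + lincomb B d z)"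
proof
  fix z
  let ?S = "{\<tau>. c \<tau> \<noteq> 0} \<union> {\<tau>. d \<tau> \<noteq> 0}"
  have f: "finite ?S" using assms by (auto simp: fin_coeffs_def)
  show "lincomb B (\<lambda>\<tau>. c \<tau> + d \<tau>) z = lincomb B c z + lincomb B d z"
    by (subst lincomb_superset [OF f], force)+ (simp add: distrib_right sum.distrib)
qed

lemma lincomb_scale:
  assumes "c \<in> fin_coeffs"
  shows "lincomb B (\<lambda>\<tau>. x * c \<tau>) = (\<lambda>z. x * lincomb B c z)"
proof
  fix z
  have f: "finite {\<tau>. c \<tau> \<noteq> 0}" using assms by (auto simp: fin_coeffs_def)
  show "lincomb B (\<lambda>\<tau>. x * c \<tau>) z = x * lincomb B c z"
    by (subst lincomb_superset [OF f], force)+ (simp add: sum_distrib_left mult_ac)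
qed

lemma inv_polys_add: "f \<in> inv_polys \<Longrightarrow> g \<in> inv_polys \<Longrightarrow> (\<lambda>z. f z + g z) \<in> inv_polys"
  unfolding inv_polys_def by (auto simp: lincomb_add [symmetric] intro: fin_coeffs_add)

lemma inv_polys_scale: "f \<in> inv_polys \<Longrightarrow> (\<lambda>z. x * f z) \<in> inv_polys"
  unfolding inv_polys_def by (auto simp: lincomb_scale [symmetric] intro: fin_coeffs_scale)

lemma inv_polys_0: "(\<lambda>z. 0) \<in> inv_polys"
proof -
  have "(\<lambda>z. 0) = lincomb ebasis (\<lambda>\<tau>::'a triple. 0)" "(\<lambda>\<tau>::'a triple. 0) \<in> fin_coeffs"
    by (auto simp: lincomb_def fin_coeffs_def)
  then show ?thesis unfolding inv_polys_def by blast
qed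

lemma ebasis_inv_polys:
  assumes "\<tau> \<in> triples"
  shows "ebasis \<tau> \<in> inv_polys"
proof -
  have "ebasis \<tau> = lincomb ebasis (\<lambda>\<sigma>. if \<sigma> = \<tau> then 1 else 0)"
    by (auto simp: lincomb_def fun_eq_iff)
  moreover have "(\<lambda>\<sigma>. if \<sigma> = \<tau> then 1 else 0) \<in> fin_coeffs"
    using assms by (auto simp: fin_coeffs_def)
  ultimately show ?thesis unfolding inv_polys_def by blast
qed

lemma pol_expansion:
  assumes "pol d k f"
  shows "\<exists>L. (\<forall>(c, I, J)\<in>set L. int (length I) - int (length J) = k) \<and>
    f = (\<lambda>z. \<Sum>(c, I, J)\<leftarrow>L. c * mon I J z)"
  using assms
proof (induction rule: pol.induct)
  case (pol_const d c)
  show ?case by (rule exI [of _ "[(c, [], [])]"]) (simp add: mon_simps)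
next
  case (pol_null d k)
  show ?case by (rule exI [of _ "[]"]) simp
next
  case (pol_z d k f i)
  then obtain L where L: "\<forall>(c, I, J)\<in>set L. int (length I) - int (length J) = k"
    "f = (\<lambda>z. \<Sum>(c, I, J)\<leftarrow>L. c * mon I J z)" by blast
  show ?case
    by (rule exI [of _ "map (\<lambda>(c, I, J). (c, i # I, J)) L"])
       (use L(1) in \<open>auto simp: L(2) mon_simps sum_list_const_mult [symmetric] case_prod_beta o_def mult_ac\<close>)
next
  case (pol_zb d k f i)
  then obtain L where L: "\<forall>(c, I, J)\<in>set L. int (length I) - int (length J) = k"
    "f = (\<lambda>z. \<Sum>(c, I, J)\<leftarrow>L. c * mon I J z)" by blast
  show ?case
    by (rule exI [of _ "map (\<lambda>(c, I, J). (c, I, i # J)) L"])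
       (use L(1) in \<open>auto simp: L(2) mon_simps sum_list_const_mult [symmetric] case_prod_beta o_def mult_ac\<close>)
next
  case (pol_add d k f g)
  then obtain L M where L: "\<forall>(c, I, J)\<in>set L. int (length I) - int (length J) = k"
    "f = (\<lambda>z. \<Sum>(c, I, J)\<leftarrow>L. c * mon I J z)" and
    M: "\<forall>(c, I, J)\<in>set M. int (length I) - int (length J) = k"
    "g = (\<lambda>z. \<Sum>(c, I, J)\<leftarrow>M. c * mon I J z)" by blast
  show ?case
    by (rule exI [of _ "L @ M"]) (use L(1) M(1) in \<open>auto simp: L(2) M(2)\<close>)
qed

lemma pol_inv_polys:
  assumes "pol d 0 f"
  shows "f \<in> inv_polys"
proof -
  obtain L where L: "\<forall>(c, I, J)\<in>set L. int (length I) - int (length J) = 0"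
    "f = (\<lambda>z. \<Sum>(c, I, J)\<leftarrow>L. c * mon I J z)" using pol_expansion [OF assms] by blast
  have "(\<lambda>z. \<Sum>(c, I, J)\<leftarrow>L. c * mon I J z) \<in> inv_polys"
    using L(1)
  proof (induction L)
    case (Cons x L)
    obtain c I J where x: "x = (c, I, J)" by (cases x)
    have l: "length I = length J" using Cons.prems by (simp add: x)
    have "mon I J \<in> inv_polys"
      using ebasis_inv_polys [OF tri_triples [OF l]] by (simp add: ebasis_tri [OF l])
    then show ?case
      using inv_polys_add [OF inv_polys_scale [of "mon I J" c]] Cons by (simp add: x)
  qed (simp add: inv_polys_0)
  then show ?thesis by (simp add: L(2))
qed

text \<open>\<open>pw \<h> c\<close> is \<open>S\<^sup>-\<^sup>1\<close> applied to the combination of the \<open>fbasis\<close> functions with coefficients \<open>c\<close>.\<close>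

definition pw :: "complex \<Rightarrow> ('n::finite triple \<Rightarrow> complex) \<Rightarrow> 'n cvec \<Rightarrow> complex" where
  "pw \<h> = lincomb (\<lambda>\<tau> z. ebasis \<tau> z / ((2 * \<h>) ^ level \<tau> * of_nat (nfac \<tau>)))"

text \<open>Extended by zero to lists of unequal length, in accordance with the vanishing of the
  corresponding derivatives of invariant polynomials at 0; this lets the Leibniz rule run over all
  splittings.\<close>

definition list_coeff :: "('n triple \<Rightarrow> complex) \<Rightarrow> 'n option list \<Rightarrow> 'n option list \<Rightarrow> complex" where
  "list_coeff c I J = (if length I = length J then c (tri I J) else 0)"

lemma foldr_dz_add:
  assumes "pol d k f" "pol d' k' g"
  shows "foldr dz I (foldr dzbar J (\<lambda>z. f z + g z)) =
    (\<lambda>z. foldr dz I (foldr dzbar J f) z + foldr dz I (foldr dzbar J g) z)"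
proof -
  have "foldr dzbar J (\<lambda>z. f z + g z) = (\<lambda>z. foldr dzbar J f z + foldr dzbar J g z)"
    by (induction J) (simp_all add: pol_dz_add [OF pol_foldr_dzbar pol_foldr_dzbar, OF assms])
  moreover have "foldr dz I (\<lambda>z. foldr dzbar J f z + foldr dzbar J g z) =
    (\<lambda>z. foldr dz I (foldr dzbar J f) z + foldr dz I (foldr dzbar J g) z)"
    by (induction I) (simp_all add: pol_dz_add [OF pol_foldr_dz pol_foldr_dz, OF pol_foldr_dzbar pol_foldr_dzbar, OF assms])
  ultimately show ?thesis by simp
qed

lemma foldr_dz_scale:
  assumes "pol d k f"
  shows "foldr dz I (foldr dzbar J (\<lambda>z. c * f z)) = (\<lambda>z. c * foldr dz I (foldr dzbar J f) z)"
proof -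
  have "foldr dzbar J (\<lambda>z. c * f z) = (\<lambda>z. c * foldr dzbar J f z)"
    by (induction J) (simp_all add: pol_dz_rules [OF pol_foldr_dzbar, OF assms])
  moreover have "foldr dz I (\<lambda>z. c * foldr dzbar J f z) = (\<lambda>z. c * foldr dz I (foldr dzbar J f) z)"
    by (induction I) (simp_all add: pol_dz_rules [OF pol_foldr_dz, OF pol_foldr_dzbar, OF assms])
  ultimately show ?thesis by simp
qed

lemma foldr_dz_sum:
  assumes "\<And>x. x \<in> A \<Longrightarrow> pol d k (f x)"
  shows "foldr dz I (foldr dzbar J (\<lambda>z. \<Sum>x\<in>A. f x z)) =
    (\<lambda>z. \<Sum>x\<in>A. foldr dz I (foldr dzbar J (f x)) z)"
  using assms
proof (induction A rule: infinite_finite_induct)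
  case (insert x F)
  have "pol d k (\<lambda>z. \<Sum>x\<in>F. f x z)" using insert.prems by (auto intro: pol_sum)
  then show ?case using insert by (simp add: foldr_dz_add [of d k _ d k])
qed simp_all

lemma dcoef_scale: "pol d k f \<Longrightarrow> dcoef (\<lambda>z. c * f z) I J = c * dcoef f I J"
  by (simp add: dcoef_def foldr_dz_scale)

lemma dcoef_sum:
  "(\<And>x. x \<in> A \<Longrightarrow> pol d k (f x)) \<Longrightarrow> dcoef (\<lambda>z. \<Sum>x\<in>A. f x z) I J = (\<Sum>x\<in>A. dcoef (f x) I J)"
  unfolding dcoef_def by (subst foldr_dz_sum) auto

lemma fin_level_bound:
  assumes "c \<in> fin_coeffs"
  obtains N where "\<And>\<tau>. c \<tau> \<noteq> 0 \<Longrightarrow> level \<tau> \<le> N"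
proof
  have "finite {\<tau>. c \<tau> \<noteq> 0}" using assms by (auto simp: fin_coeffs_def)
  then show "c \<tau> \<noteq> 0 \<Longrightarrow> level \<tau> \<le> Max (level ` {\<tau>. c \<tau> \<noteq> 0})" for \<tau>
    by (intro Max_ge) auto
qed

lemma pol_term:
  assumes "\<tau> \<in> triples" "level \<tau> \<le> N"
  shows "pol (2 * N) 0 (\<lambda>z. c * (ebasis \<tau> z / x))"
proof -
  have "pol (2 * N) 0 (\<lambda>z. (c / x) * ebasis \<tau> z)"
    by (rule pol_scale [OF pol_mono [OF pol_ebasis [OF assms(1)]]]) (use assms in simp)
  moreover have "(\<lambda>z. (c / x) * ebasis \<tau> z) = (\<lambda>z. c * (ebasis \<tau> z / x))" by simp
  ultimately show ?thesis by (simp only:)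
qed

lemma pol_pw:
  assumes "c \<in> fin_coeffs"
  obtains N where "pol N 0 (pw \<h> c)"
proof -
  obtain N where N: "\<And>\<tau>. c \<tau> \<noteq> 0 \<Longrightarrow> level \<tau> \<le> N" using fin_level_bound [OF assms] by blast
  have "pol (2 * N) 0 (pw \<h> c)"
    unfolding pw_def lincomb_def [abs_def]
    by (intro pol_sum pol_term) (use N assms in \<open>auto simp: fin_coeffs_def\<close>)
  then show ?thesis by (rule that)
qed

text \<open>The \<open>nfac\<close> in \<open>pw\<close> cancels the one from
  \<open>dcoef_ebasis\<close>, and only the power of \<open>2 * \<h>\<close> is left. Injectivity of
  \<open>pw\<close> and all coefficient formulas rest on this.\<close>

lemma dcoef_pw:
  assumes "c \<in> fin_coeffs"
  shows "dcoef (pw \<h> c) I J = list_coeff c I J / (2 * \<h>) ^ length I"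
proof -
  obtain N where N: "\<And>\<tau>. c \<tau> \<noteq> 0 \<Longrightarrow> level \<tau> \<le> N" using fin_level_bound [OF assms] by blast
  have f: "finite {\<tau>. c \<tau> \<noteq> 0}" and t: "\<And>\<tau>. c \<tau> \<noteq> 0 \<Longrightarrow> \<tau> \<in> triples" using assms by (auto simp: fin_coeffs_def)
  have "dcoef (pw \<h> c) I J = (\<Sum>\<tau> | c \<tau> \<noteq> 0. dcoef (\<lambda>z. c \<tau> * (ebasis \<tau> z / ((2 * \<h>) ^ level \<tau> * of_nat (nfac \<tau>)))) I J)"
    unfolding pw_def lincomb_def [abs_def]
    by (rule dcoef_sum [OF pol_term]) (use N t in auto)
  also have "\<dots> = (\<Sum>\<tau> | c \<tau> \<noteq> 0. if length I = length J \<and> tri I J = \<tau> then c \<tau> / (2 * \<h>) ^ level \<tau> else 0)"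
  proof (rule sum.cong)
    fix \<tau> assume "\<tau> \<in> {\<tau>. c \<tau> \<noteq> 0}"
    then have \<tau>: "\<tau> \<in> triples" using t by simp
    have "dcoef (\<lambda>z. c \<tau> * (ebasis \<tau> z / ((2 * \<h>) ^ level \<tau> * of_nat (nfac \<tau>)))) I J =
      dcoef (\<lambda>z. (c \<tau> / ((2 * \<h>) ^ level \<tau> * of_nat (nfac \<tau>))) * ebasis \<tau> z) I J" by simp
    also have "\<dots> = (c \<tau> / ((2 * \<h>) ^ level \<tau> * of_nat (nfac \<tau>))) * dcoef (ebasis \<tau>) I J"
      by (rule dcoef_scale [OF pol_ebasis [OF \<tau>]])
    finally show "dcoef (\<lambda>z. c \<tau> * (ebasis \<tau> z / ((2 * \<h>) ^ level \<tau> * of_nat (nfac \<tau>)))) I J =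
      (if length I = length J \<and> tri I J = \<tau> then c \<tau> / (2 * \<h>) ^ level \<tau> else 0)"
      by (simp add: dcoef_ebasis [OF \<tau>])
  qed simp
  also have "\<dots> = list_coeff c I J / (2 * \<h>) ^ length I"
    using f by (cases "length I = length J") (auto simp: list_coeff_def)
  finally show ?thesis .
qed

lemma pw_inj:
  assumes "\<h> \<noteq> 0" "c \<in> fin_coeffs" "c' \<in> fin_coeffs" "pw \<h> c = pw \<h> c'"
  shows "c = c'"
proof
  fix \<tau>
  show "c \<tau> = c' \<tau>"
  proof (cases "\<tau> \<in> triples")
    case True
    have "list_coeff c (repI \<tau>) (repJ \<tau>) = list_coeff c' (repI \<tau>) (repJ \<tau>)"
      using dcoef_pw [OF assms(2), of \<h>] dcoef_pw [OF assms(3), of \<h>] assms(1,4) by simp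
    then show ?thesis using rep [OF True] by (simp add: list_coeff_def)
  next
    case False
    then show ?thesis using assms by (simp add: fin_coeffs_outside)
  qed
qed

lemma pw_surj:
  assumes "\<h> \<noteq> 0" "f \<in> inv_polys"
  obtains c where "c \<in> fin_coeffs" "f = pw \<h> c"
proof -
  obtain d where d: "d \<in> fin_coeffs" "f = lincomb ebasis d" using assms by (auto simp: inv_polys_def)
  define c where "c = (\<lambda>\<tau>. ((2 * \<h>) ^ level \<tau> * of_nat (nfac \<tau>)) * d \<tau>)"
  have "c \<in> fin_coeffs" unfolding c_def by (rule fin_coeffs_scale [OF d(1)])
  moreover have "f = pw \<h> c"
  proof
    fix z
    have f: "finite {\<tau>. d \<tau> \<noteq> 0}" using d by (auto simp: fin_coeffs_def)
    show "f z = pw \<h> c z" unfolding d(2) pw_def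
      by (subst (1 2) lincomb_superset [OF f]) (use assms(1) in \<open>auto simp: c_def intro!: sum.cong\<close>)
  qed
  ultimately show ?thesis by (rule that)
qed

lemma pw_inv_polys: "c \<in> fin_coeffs \<Longrightarrow> pw \<h> c \<in> inv_polys"
  by (rule pol_pw [of c \<h>]) (auto intro: pol_inv_polys)

text \<open>Taylor coefficients determine an invariant polynomial. Applied to Wick products and
  pullbacks it gives the coefficient formula and the finiteness of the support at once.\<close>

lemma pol_eq_pw:
  assumes "\<h> \<noteq> 0" "pol d 0 f"
    and "\<And>\<tau>. \<tau> \<in> triples \<Longrightarrow> c \<tau> = (2 * \<h>) ^ level \<tau> * dcoef f (repI \<tau>) (repJ \<tau>)"
    and "\<And>\<tau>. \<tau> \<notin> triples \<Longrightarrow> c \<tau> = 0"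
  shows "c \<in> fin_coeffs \<and> f = pw \<h> c"
proof -
  obtain c' where c': "c' \<in> fin_coeffs" "f = pw \<h> c'"
    using pw_surj [OF assms(1) pol_inv_polys [OF assms(2)]] by blast
  have "c \<tau> = c' \<tau>" for \<tau>
  proof (cases "\<tau> \<in> triples")
    case True
    then show ?thesis
      using assms(1,3) rep [OF True] by (simp add: c'(2) dcoef_pw [OF c'(1)] list_coeff_def)
  next
    case False
    then show ?thesis using c'(1) assms(4) by (simp add: fin_coeffs_outside)
  qed
  then have "c = c'" by auto
  then show ?thesis using c' by simp
qed

section \<open>Convergence and uniqueness of the expansions\<close>

text \<open>This absorbs every geometric constant of the later estimates. It is the s-th power of
  \<open>L ^ n \<le> exp L * fact n\<close> with \<open>L = K powr (1 / s)\<close>.\<close>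

lemma power_le_fact_powr:
  fixes K s :: real
  assumes "0 \<le> K" "0 < s"
  obtains C where "C > 0" "\<And>n. K ^ n \<le> C * fact n powr s"
proof
  define L where "L = K powr (1 / s)"
  have "L \<ge> 0" by (simp add: L_def)
  show "exp L powr s > 0" by simp
  fix n :: nat
  have "L ^ n / fact n \<le> exp L"
  proof -
    have "(\<Sum>k\<in>{n}. L ^ k /\<^sub>R fact k) \<le> (\<Sum>k. L ^ k /\<^sub>R fact k)"
      using \<open>L \<ge> 0\<close> summable_exp_generic [of L] by (intro sum_le_suminf) auto
    then show ?thesis by (simp add: exp_def field_simps)
  qed
  then have "L ^ n \<le> exp L * fact n" by (simp add: field_simps)
  then have "(L ^ n) powr s \<le> (exp L * fact n) powr s"
    using \<open>L \<ge> 0\<close> assms(2) by (intro powr_mono2) auto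
  moreover have "(L ^ n) powr s = K ^ n"
  proof (cases "K = 0")
    case True
    then show ?thesis using assms by (cases n) (auto simp: L_def)
  next
    case False
    then have "L > 0" "K > 0" using assms by (auto simp: L_def)
    then show ?thesis using assms
      by (simp add: L_def powr_powr flip: powr_realpow)
  qed
  ultimately show "K ^ n \<le> exp L powr s * fact n powr s" by (simp add: powr_mult)
qed

lemma summable_power_div_fact_powr:
  fixes K s :: real
  assumes "0 \<le> K" "0 < s"
  shows "summable (\<lambda>n. K ^ n / fact n powr s)"
proof -
  \<comment> \<open>The doubled base leaves the convergent geometric factor
    \<open>(1 / 2) ^ n\<close>.\<close>
  obtain C where C: "\<And>n. (2 * K) ^ n \<le> C * fact n powr s"
    using power_le_fact_powr [of "2 * K" s] assms by auto
  have "norm (K ^ n / fact n powr s) \<le> C * (1 / 2) ^ n" for n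
    using C [of n] assms by (simp add: power_mult_distrib power_divide field_simps)
  moreover have "summable (\<lambda>n. C * (1 / 2) ^ n)"
    by (rule summable_mult) (rule summable_geometric, simp)
  ultimately show ?thesis
    by (meson summable_comparison_test')
qed

definition levels :: "nat \<Rightarrow> 'n::finite triple set" where
  "levels \<alpha> = {\<tau> \<in> triples. level \<tau> = \<alpha>}"

definition levels_upto :: "nat \<Rightarrow> 'n::finite triple set" where
  "levels_upto N = {\<tau> \<in> triples. level \<tau> \<le> N}"

lemma levels_image: "levels \<alpha> = (\<lambda>(I, J). tri I J) ` ({I. length I = \<alpha>} \<times> {J. length J = \<alpha>})"
proof -
  have "\<tau> \<in> (\<lambda>(I, J). tri I J) ` ({I. length I = \<alpha>} \<times> {J. length J = \<alpha>})" if "\<tau> \<in> levels \<alpha>" for \<tau> :: "'a triple"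
    using rep [of \<tau>] that by (intro image_eqI [of _ _ "(repI \<tau>, repJ \<tau>)"]) (auto simp: levels_def)
  then show ?thesis by (auto simp: levels_def)
qed

lemma finite_levels [simp]: "finite (levels \<alpha>)"
  by (simp add: levels_image)

lemma card_levels: "card (levels \<alpha> :: 'n::finite triple set) \<le> (CARD('n option)\<^sup>2) ^ \<alpha>"
proof -
  have "card (levels \<alpha> :: 'n triple set) \<le> card ({I::'n option list. length I = \<alpha>} \<times> {J::'n option list. length J = \<alpha>})"
    unfolding levels_image by (rule card_image_le) simp
  also have "\<dots> = (CARD('n option) ^ \<alpha>) ^ 2"
    using card_lists_length_eq [of "UNIV :: 'n option set" \<alpha>] by (simp add: card_cartesian_product power2_eq_square)
  finally show ?thesis by (simp add: power_mult [symmetric] mult.commute)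
qed

lemma levels_upto_Union: "levels_upto N = (\<Union>\<alpha>\<le>N. levels \<alpha>)"
  by (auto simp: levels_upto_def levels_def)

lemma finite_levels_upto [simp]: "finite (levels_upto N)"
  unfolding levels_upto_Union by (intro finite_UN_I finite_levels finite_atMost)

lemma sum_levels_upto: "sum f (levels_upto N) = (\<Sum>\<alpha>\<le>N. sum f (levels \<alpha>))"
  unfolding levels_upto_Union by (rule sum.UNION_disjoint) (simp_all, auto simp: levels_def)

text \<open>The sets of triples up to a given level are finite and cofinal among the finite subsets,
  so an unordered sum may be computed level by level.\<close>

lemma has_sum_levels:
  fixes f :: "'n::finite triple \<Rightarrow> complex"
  assumes "(f has_sum s) triples"
  shows "(\<lambda>N. sum f (levels_upto N)) \<longlonglongrightarrow> s"
proof -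
  have "filterlim levels_upto (finite_subsets_at_top (triples::'n triple set)) sequentially"
  proof (rule filterlim_finite_subsets_at_top [THEN iffD2], intro allI impI)
    fix X :: "'n triple set" assume X: "finite X \<and> X \<subseteq> triples"
    then have *: "X \<subseteq> levels_upto N" if "N \<ge> Max (insert 0 (level ` X))" for N
      using that by (auto simp: levels_upto_def)
    have "levels_upto N \<subseteq> (triples :: 'n triple set)" for N by (auto simp: levels_upto_def)
    with * show "\<forall>\<^sub>F N in sequentially. finite (levels_upto N :: 'n triple set) \<and> X \<subseteq> levels_upto N \<and> levels_upto N \<subseteq> (triples :: 'n triple set)"
      unfolding eventually_sequentially
      by (intro exI [of _ "Max (insert 0 (level ` X))"]) auto
  qed
  then show ?thesis
    using filterlim_compose [of "sum f" "nhds s" "finite_subsets_at_top triples" levels_upto sequentially] assms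
    unfolding has_sum_def by blast
qed

text \<open>The number of triples at a level grows only geometrically, so the sum over triples is
  dominated by a one-dimensional series with a larger base.\<close>

lemma summable_on_levels:
  fixes K s :: real
  assumes "0 \<le> K" "0 < s"
  shows "(\<lambda>\<tau>::'n::finite triple. K ^ level \<tau> / fact (level \<tau>) powr s) summable_on triples"
proof -
  let ?c = "real (CARD('n option)\<^sup>2)"
  let ?f = "\<lambda>\<tau>::'n triple. K ^ level \<tau> / fact (level \<tau>) powr s"
  have sm: "summable (\<lambda>n. (?c * K) ^ n / fact n powr s)"
    using assms by (intro summable_power_div_fact_powr) auto
  have bound: "sum ?f F \<le> (\<Sum>n. (?c * K) ^ n / fact n powr s)" if F: "finite F" "F \<subseteq> triples" for F
  proof -
    have "F \<subseteq> levels_upto (Max (insert 0 (level ` F)))" (is "_ \<subseteq> levels_upto ?N")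
      using F by (auto simp: levels_upto_def)
    then have "sum ?f F \<le> sum ?f (levels_upto ?N)"
      using assms by (intro sum_mono2) auto
    also have "\<dots> = (\<Sum>\<alpha>\<le>?N. sum ?f (levels \<alpha>))" by (rule sum_levels_upto)
    also have "\<dots> = (\<Sum>\<alpha>\<le>?N. real (card (levels \<alpha> :: 'n triple set)) * (K ^ \<alpha> / fact \<alpha> powr s))"
      by (intro sum.cong refl) (simp add: levels_def)
    also have "\<dots> \<le> (\<Sum>\<alpha>\<le>?N. ?c ^ \<alpha> * (K ^ \<alpha> / fact \<alpha> powr s))"
    proof (intro sum_mono mult_right_mono)
      fix \<alpha>
      show "real (card (levels \<alpha> :: 'n triple set)) \<le> ?c ^ \<alpha>"
        using card_levels [where ?'n = 'n, of \<alpha>] by (metis of_nat_le_iff of_nat_power)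
    qed (use assms in auto)
    also have "\<dots> = (\<Sum>\<alpha>\<le>?N. (?c * K) ^ \<alpha> / fact \<alpha> powr s)"
      by (simp add: power_mult_distrib)
    also have "\<dots> \<le> (\<Sum>n. (?c * K) ^ n / fact n powr s)"
      by (rule sum_le_suminf [OF sm]) (use assms in auto)
    finally show ?thesis .
  qed
  show ?thesis
    by (rule nonneg_bounded_partial_sums_imp_summable_on [where C = "\<Sum>n. (?c * K) ^ n / fact n powr s"])
       (use assms bound in \<open>auto intro!: eventually_finite_subsets_at_top_weakI\<close>)
qed

subsection \<open>Bounds for the basis functions\<close>

text \<open>A multinomial coefficient is a product of binomial coefficients, each at most a power of
  2.\<close>

lemma fact_sum_le:
  "finite S \<Longrightarrow> fact (sum A S) \<le> (2 ^ card S) ^ sum A S * (\<Prod>i\<in>S. fact (A i) :: nat)"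
proof (induction S rule: finite_induct)
  case (insert x F)
  let ?a = "A x" and ?s = "sum A F"
  have c: "(?a + ?s) choose ?a \<le> 2 ^ (?a + ?s)" by (rule binomial_le_pow2)
  have "fact (?a + ?s) = fact ?a * fact ?s * ((?a + ?s) choose ?a)"
    using binomial_fact_lemma [of ?a "?a + ?s"] by simp
  also have "\<dots> \<le> fact ?a * ((2 ^ card F) ^ ?s * (\<Prod>i\<in>F. fact (A i))) * 2 ^ (?a + ?s)"
    by (intro mult_mono insert.IH c) auto
  also have "\<dots> = (2 ^ card F) ^ ?s * 2 ^ (?a + ?s) * (fact ?a * (\<Prod>i\<in>F. fact (A i)))"
    by (simp add: mult_ac)
  also have "\<dots> \<le> (2 ^ card F) ^ (?a + ?s) * 2 ^ (?a + ?s) * (fact ?a * (\<Prod>i\<in>F. fact (A i)))"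
    by (intro mult_right_mono power_increasing) auto
  also have "\<dots> = (2 ^ card (insert x F)) ^ (?a + ?s) * (fact ?a * (\<Prod>i\<in>F. fact (A i)))"
    using insert by (simp add: power_mult_distrib mult_ac)
  finally show ?case using insert by simp
qed simp

text \<open>\<open>fact_sum_le\<close> for both multi-indices, each extended by the zeroth
  coordinate: up to a geometric factor the normalisation is worth two factorials.\<close>

lemma nfac_ge:
  assumes "\<tau> \<in> triples"
  shows "(fact (level \<tau>))\<^sup>2 \<le> (4 ^ CARD('n option)) ^ level (\<tau> :: 'n::finite triple) * real (nfac \<tau>)"
proof -
  let ?I = "repI \<tau>" and ?J = "repJ \<tau>"
  have *: "fact (length I) \<le> (2 ^ CARD('n option)) ^ length I * (\<Prod>i\<in>UNIV. fact (count_list I i) :: nat)"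
    for I :: "'n option list"
    using fact_sum_le [of UNIV "count_list I"] by (simp add: sum_count_list)
  have "fact (level \<tau>) * fact (level \<tau>) \<le>
     ((2 ^ CARD('n option)) ^ level \<tau> * (\<Prod>i\<in>UNIV. fact (count_list ?I i))) *
     ((2 ^ CARD('n option)) ^ level \<tau> * (\<Prod>i\<in>UNIV. fact (count_list ?J i) :: nat))"
    using * [of ?I] * [of ?J] rep [OF assms] by (intro mult_mono) auto
  also have "\<dots> = (4 ^ CARD('n option)) ^ level \<tau> * nfac \<tau>"
  proof -
    have "(4::nat) ^ CARD('n option) = 2 ^ CARD('n option) * 2 ^ CARD('n option)"
      by (simp flip: power_mult_distrib)
    moreover have "nfac \<tau> = (\<Prod>i\<in>UNIV. fact (count_list ?I i)) * (\<Prod>i\<in>UNIV. fact (count_list ?J i))"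
      using nfac_tri [of ?I ?J] rep [OF assms] by simp
    ultimately show ?thesis by (simp only: power_mult_distrib mult_ac)
  qed
  finally have "real (fact (level \<tau>) * fact (level \<tau>)) \<le> real ((4 ^ CARD('n option)) ^ level \<tau> * nfac \<tau>)"
    by (simp only: of_nat_le_iff)
  then show ?thesis by (simp add: power2_eq_square)
qed

lemma norm_mon_le:
  fixes z :: "'n::finite cvec"
  assumes "\<And>i. norm (z $ i) \<le> R"
  shows "norm (mon I J z) \<le> R ^ (length I + length J)"
proof -
  have "R \<ge> 0" using assms norm_ge_zero order_trans by blast
  have 1: "norm (\<Prod>i\<leftarrow>I. z $ i) \<le> R ^ length I"
    using \<open>R \<ge> 0\<close> assms by (induction I) (auto simp: norm_mult intro!: mult_mono)
  have 2: "norm (\<Prod>i\<leftarrow>J. cnj (z $ i)) \<le> R ^ length J"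
    using \<open>R \<ge> 0\<close> assms by (induction J) (auto simp: norm_mult intro!: mult_mono)
  show ?thesis unfolding mon_def norm_mult power_add
    using 1 2 \<open>R \<ge> 0\<close> by (intro mult_mono) auto
qed

lemma norm_ebasis_le:
  assumes "\<tau> \<in> triples"
  shows "norm (ebasis \<tau> z) \<le> ((norm z)\<^sup>2) ^ level \<tau>"
proof -
  have "norm (mon (repI \<tau>) (repJ \<tau>) z) \<le> norm z ^ (length (repI \<tau>) + length (repJ \<tau>))"
    by (rule norm_mon_le) (rule Finite_Cartesian_Product.norm_nth_le)
  then show ?thesis
    using rep [OF assms] ebasis_tri [of "repI \<tau>" "repJ \<tau>"]
    by (simp add: power2_eq_square power_add power_mult_distrib)
qed

lemma norm_pochhammer_le: "norm (pochhammer (x::complex) n) \<le> (norm x + 1) ^ n * fact n"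
proof (induction n)
  case (Suc n)
  have "norm (x + of_nat n) \<le> norm x + of_nat n" by (metis norm_triangle_ineq norm_of_nat)
  also have "\<dots> \<le> (norm x + 1) * of_nat (Suc n)" by (simp add: algebra_simps)
  finally have "norm (pochhammer x (Suc n)) \<le> ((norm x + 1) ^ n * fact n) * ((norm x + 1) * of_nat (Suc n))"
    unfolding pochhammer_Suc norm_mult using Suc by (intro mult_mono) auto
  then show ?case by (simp add: mult_ac)
qed simp

lemma fbasis_eq:
  assumes "z \<in> pos_cone"
  shows "fbasis \<h> \<tau> z = pochhammer (of_real (yfun z) / (2 * \<h>)) (level \<tau>) / of_real (yfun z) ^ level \<tau>
    * (ebasis \<tau> z / of_nat (nfac \<tau>))"
proof (cases \<tau>)
  case (fields P Q \<alpha>)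
  then show ?thesis using assms
    by (simp add: fbasis_def nfac_def level_def)
qed

lemma fbasis_outside: "z \<notin> pos_cone \<Longrightarrow> fbasis \<h> \<tau> z = 0"
  by (cases \<tau>) (simp add: fbasis_def)

lemma ebasis_div_nfac_le:
  assumes "\<tau> \<in> triples"
  shows "norm (ebasis \<tau> z / of_nat (nfac (\<tau>::'n::finite triple))) \<le>
    ((norm z)\<^sup>2 * 4 ^ CARD('n option)) ^ level \<tau> / (fact (level \<tau>))\<^sup>2"
proof -
  have 1: "(fact (level \<tau>))\<^sup>2 \<le> (4 ^ CARD('n option)) ^ level \<tau> * real (nfac \<tau>)"
    by (rule nfac_ge [OF assms])
  have "norm (ebasis \<tau> z) / real (nfac \<tau>) \<le> ((norm z)\<^sup>2) ^ level \<tau> / real (nfac \<tau>)"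
    by (intro divide_right_mono norm_ebasis_le assms) auto
  also have "\<dots> \<le> ((norm z)\<^sup>2 * 4 ^ CARD('n option)) ^ level \<tau> / (fact (level \<tau>))\<^sup>2"
    using mult_left_mono [OF 1, of "((norm z)\<^sup>2) ^ level \<tau>"] nfac_pos [of \<tau>]
    by (simp add: divide_simps power_mult_distrib mult_ac del: nfac_pos)
  finally show ?thesis by (simp add: norm_divide)
qed

text \<open>The normalisation gains two factorials by \<open>nfac_ge\<close> and the Pochhammer
  symbol costs one, so one factorial remains in the denominator.\<close>

lemma fbasis_bound:
  obtains K where "K \<ge> 0" "\<And>\<tau>. \<tau> \<in> triples \<Longrightarrow> norm (fbasis \<h> \<tau> (z :: 'n::finite cvec)) \<le> K ^ level \<tau> / fact (level \<tau>)"
proof (cases "z \<in> pos_cone")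
  case True
  define x where "x = of_real (yfun z) / (2 * \<h>)"
  define A where "A = (norm z)\<^sup>2 * 4 ^ CARD('n option)"
  have y: "yfun z > 0" using True by (simp add: pos_cone_def)
  define K where "K = (norm x + 1) * A / yfun z"
  have "A \<ge> 0" by (simp add: A_def)
  show ?thesis
  proof (rule that)
    show "K \<ge> 0" using y \<open>A \<ge> 0\<close> by (simp add: K_def)
    fix \<tau> :: "'n triple" assume \<tau>: "\<tau> \<in> triples"
    let ?\<alpha> = "level \<tau>"
    have "norm (fbasis \<h> \<tau> z) = norm (pochhammer x ?\<alpha>) / yfun z ^ ?\<alpha> * norm (ebasis \<tau> z / of_nat (nfac \<tau>))"
      using y unfolding fbasis_eq [OF True] x_def by (simp add: norm_mult norm_divide norm_power)
    also have "\<dots> \<le> ((norm x + 1) ^ ?\<alpha> * fact ?\<alpha>) / yfun z ^ ?\<alpha> * (A ^ ?\<alpha> / (fact ?\<alpha>)\<^sup>2)"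
      using y ebasis_div_nfac_le [OF \<tau>, of z] norm_pochhammer_le [of x ?\<alpha>]
      by (intro mult_mono divide_right_mono) (auto simp: A_def)
    also have "\<dots> = K ^ ?\<alpha> / fact ?\<alpha>"
      by (simp add: K_def power_mult_distrib power_divide power2_eq_square)
    finally show "norm (fbasis \<h> \<tau> z) \<le> K ^ level \<tau> / fact (level \<tau>)" .
  qed
next
  case False
  then show ?thesis by (intro that [of 0]) (auto simp: fbasis_outside)
qed

subsection \<open>Coefficient families of the completion\<close>

text \<open>The inequality for the seminorm of exponent \<epsilon> without the supremum, so that it
  can be stated before finiteness is known.\<close>

definition hbound :: "real \<Rightarrow> real \<Rightarrow> ('n::finite triple \<Rightarrow> complex) \<Rightarrow> bool" where
  "hbound \<epsilon> M c \<longleftrightarrow> (\<forall>\<tau>\<in>triples. norm (c \<tau>) \<le> M * fact (level \<tau>) powr \<epsilon>)"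

lemma hat_coeffs_iff:
  "c \<in> hat_coeffs \<longleftrightarrow> (\<forall>\<tau>. \<tau> \<notin> triples \<longrightarrow> c \<tau> = 0) \<and> (\<forall>\<epsilon>. 0 < \<epsilon> \<and> \<epsilon> < 1 \<longrightarrow> (\<exists>M. hbound \<epsilon> M c))"
proof -
  have *: "bdd_above ((\<lambda>(P, Q, \<alpha>). cmod (c (P, Q, \<alpha>)) / fact \<alpha> powr \<epsilon>) ` triples) \<longleftrightarrow> (\<exists>M. hbound \<epsilon> M c)" for \<epsilon>
    unfolding bdd_above_def hbound_def
    by (intro arg_cong [where f = Ex] ext) (force simp: level_def field_simps)
  show ?thesis by (simp add: hat_coeffs_def *)
qed

lemma hat_outside: "c \<in> hat_coeffs \<Longrightarrow> \<tau> \<notin> triples \<Longrightarrow> c \<tau> = 0"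
  unfolding hat_coeffs_iff by blast

lemma hat_bound:
  assumes "c \<in> hat_coeffs" "0 < \<epsilon>" "\<epsilon> < 1"
  obtains M where "M \<ge> 0" "hbound \<epsilon> M c"
proof -
  obtain M where M: "hbound \<epsilon> M c" using assms by (auto simp: hat_coeffs_iff)
  have "tri [] [] \<in> (triples :: 'a triple set)" by simp
  with M have "norm (c (tri [] [])) \<le> M" unfolding hbound_def by fastforce
  then have "M \<ge> 0" using norm_ge_zero order_trans by blast
  then show ?thesis using M that by blast
qed

lemma hat_summable:
  assumes "c \<in> hat_coeffs"
  shows "(\<lambda>\<tau>. c \<tau> * fbasis \<h> \<tau> z) summable_on triples"
proof -
  \<comment> \<open>Any exponent strictly between 0 and 1 works; 1/2 leaves the square root of the
    factorial in the denominator.\<close>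
  obtain M where M: "M \<ge> 0" "hbound (1/2) M c" using hat_bound [OF assms, of "1/2"] by auto
  obtain K where K: "K \<ge> 0" "\<And>\<tau>. \<tau> \<in> triples \<Longrightarrow> norm (fbasis \<h> \<tau> z) \<le> K ^ level \<tau> / fact (level \<tau>)"
    using fbasis_bound [of \<h> z] by blast
  have *: "norm (c \<tau> * fbasis \<h> \<tau> z) \<le> M * (K ^ level \<tau> / fact (level \<tau>) powr (1/2))" if "\<tau> \<in> triples" for \<tau>
  proof -
    have f: "fact (level \<tau>) = fact (level \<tau>) powr (1/2) * (fact (level \<tau>) powr (1/2) :: real)"
      by (simp flip: powr_add)
    have "norm (c \<tau> * fbasis \<h> \<tau> z) \<le> (M * fact (level \<tau>) powr (1/2)) * (K ^ level \<tau> / fact (level \<tau>))"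
      unfolding norm_mult using M K that by (intro mult_mono) (auto simp: hbound_def)
    also have "\<dots> = M * (K ^ level \<tau> / fact (level \<tau>) powr (1/2))"
      by (subst (2) f) simp
    finally show ?thesis .
  qed
  have "(\<lambda>\<tau>. M * (K ^ level \<tau> / fact (level \<tau>) powr (1/2))) summable_on (triples :: 'a triple set)"
    by (intro summable_on_cmult_right summable_on_levels) (use K in auto)
  then have "(\<lambda>\<tau>. norm (c \<tau> * fbasis \<h> \<tau> z)) summable_on triples"
    by (rule Infinite_Sum.abs_summable_on_comparison_test') (rule *)
  then show ?thesis by (rule abs_summable_summable)
qed

lemma fseries_lim:
  assumes "c \<in> hat_coeffs"
  shows "(\<lambda>N. \<Sum>\<tau>\<in>levels_upto N. c \<tau> * fbasis \<h> \<tau> z) \<longlonglongrightarrow> fseries \<h> c z"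
  unfolding fseries_def by (intro has_sum_levels has_sum_infsum hat_summable assms)

text \<open>The homogeneous component of level \<alpha> without its factor depending on
  \<open>yfun z\<close>: a polynomial of bidegree (\<alpha>, \<alpha>).\<close>

definition level_part :: "('n::finite triple \<Rightarrow> complex) \<Rightarrow> nat \<Rightarrow> 'n cvec \<Rightarrow> complex" where
  "level_part c \<alpha> z = (\<Sum>\<tau>\<in>levels \<alpha>. c \<tau> * (ebasis \<tau> z / of_nat (nfac \<tau>)))"

lemma fseries_sums:
  assumes "c \<in> hat_coeffs" "z \<in> pos_cone"
  shows "(\<lambda>\<alpha>. pochhammer (of_real (yfun z) / (2 * \<h>)) \<alpha> / of_real (yfun z) ^ \<alpha> * level_part c \<alpha> z)
    sums fseries \<h> c z"
proof -
  have "(\<Sum>\<tau>\<in>levels \<alpha>. c \<tau> * fbasis \<h> \<tau> z) =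
    pochhammer (of_real (yfun z) / (2 * \<h>)) \<alpha> / of_real (yfun z) ^ \<alpha> * level_part c \<alpha> z" for \<alpha>
    unfolding level_part_def sum_distrib_left
    by (intro sum.cong refl) (simp add: fbasis_eq [OF assms(2)] levels_def)
  then show ?thesis
    using fseries_lim [OF assms(1), of \<h> z] by (simp add: sums_def_le sum_levels_upto)
qed

text \<open>The exponent 3/2 is the two factorials of \<open>nfac_ge\<close> minus the half conceded
  to the coefficients. It exceeds 1, as \<open>newton_series_unique\<close> requires, because a
  Pochhammer symbol costs a full factorial.\<close>

lemma level_part_bound:
  assumes "c \<in> hat_coeffs"
  obtains M K where "M \<ge> 0" "K \<ge> 0" "\<And>\<alpha>. norm (level_part c \<alpha> z) \<le> M * (K ^ \<alpha> / fact \<alpha> powr (3/2))"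
proof -
  obtain M where M: "M \<ge> 0" "hbound (1/2) M c" using hat_bound [OF assms, of "1/2"] by auto
  let ?c = "real (CARD('a option)\<^sup>2)"
  define A where "A = (norm z)\<^sup>2 * 4 ^ CARD('a option)"
  have "A \<ge> 0" by (simp add: A_def)
  have "norm (level_part c \<alpha> z) \<le> M * ((?c * A) ^ \<alpha> / fact \<alpha> powr (3/2))" for \<alpha>
  proof -
    have f: "(fact \<alpha>)\<^sup>2 = fact \<alpha> powr (1/2) * (fact \<alpha> powr (3/2) :: real)"
      by (simp add: powr_add [symmetric] powr_numeral)
    have 1: "norm (c \<tau> * (ebasis \<tau> z / of_nat (nfac \<tau>))) \<le> M * (A ^ \<alpha> / fact \<alpha> powr (3/2))" if "\<tau> \<in> levels \<alpha>" for \<tau>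
    proof -
      have "norm (c \<tau> * (ebasis \<tau> z / of_nat (nfac \<tau>))) \<le> (M * fact \<alpha> powr (1/2)) * (A ^ \<alpha> / (fact \<alpha>)\<^sup>2)"
        unfolding norm_mult using M that ebasis_div_nfac_le [of \<tau> z]
        by (intro mult_mono) (auto simp: hbound_def A_def levels_def)
      then show ?thesis by (simp add: f)
    qed
    have "norm (level_part c \<alpha> z) \<le> real (card (levels \<alpha> :: 'a triple set)) * (M * (A ^ \<alpha> / fact \<alpha> powr (3/2)))"
      unfolding level_part_def by (rule sum_norm_bound) (rule 1)
    also have "\<dots> \<le> ?c ^ \<alpha> * (M * (A ^ \<alpha> / fact \<alpha> powr (3/2)))"
    proof (intro mult_right_mono)
      show "real (card (levels \<alpha> :: 'a triple set)) \<le> ?c ^ \<alpha>"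
        using card_levels [where ?'n = 'a, of \<alpha>] by (metis of_nat_le_iff of_nat_power)
    qed (use M \<open>A \<ge> 0\<close> in auto)
    finally show ?thesis by (simp add: power_mult_distrib mult_ac)
  qed
  then show ?thesis using M \<open>A \<ge> 0\<close> by (intro that [of M "?c * A"]) auto
qed

text \<open>Along a ray the series is a Newton-type series in \<open>y / (2 \<h>)\<close>, which is entire; evaluating it at the
  nonpositive integers isolates the terms one after another.\<close>

lemma newton_series_unique:
  fixes H :: "nat \<Rightarrow> complex"
  assumes "\<h> \<noteq> 0" "M \<ge> 0" "K \<ge> 0"
    and H: "\<And>\<alpha>. norm (H \<alpha>) \<le> M * (K ^ \<alpha> / fact \<alpha> powr (3/2))"
    and zero: "\<And>r::real. r > 0 \<Longrightarrow> (\<lambda>\<alpha>. pochhammer (of_real r / (2 * \<h>)) \<alpha> * H \<alpha>) sums 0"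
  shows "H \<alpha> = 0"
proof -
  define t where "t = (\<lambda>\<alpha> x. pochhammer (x / (2 * \<h>)) \<alpha> * H \<alpha>)"
  define \<Phi> where "\<Phi> = (\<lambda>x. \<Sum>\<alpha>. t \<alpha> x)"
  define L where "L = (\<lambda>R. (R / norm (2 * \<h>) + 1) * K)"
  \<comment> \<open>One of the 3/2 factorials pays for the Pochhammer symbol; the remaining half
    gives uniform convergence on bounded discs.\<close>
  have tb: "norm (t \<alpha> x) \<le> M * (L R ^ \<alpha> / fact \<alpha> powr (1/2))" if "norm x \<le> R" for \<alpha> x R
  proof -
    have f: "fact \<alpha> powr (3/2) = fact \<alpha> * (fact \<alpha> powr (1/2) :: real)"
      using powr_add [of "fact \<alpha> :: real" 1 "1/2"] by simp
    have "norm (t \<alpha> x) \<le> ((norm (x / (2 * \<h>)) + 1) ^ \<alpha> * fact \<alpha>) * (M * (K ^ \<alpha> / fact \<alpha> powr (3/2)))"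
      unfolding t_def norm_mult by (intro mult_mono norm_pochhammer_le H) (use assms in auto)
    also have "\<dots> \<le> ((R / norm (2 * \<h>) + 1) ^ \<alpha> * fact \<alpha>) * (M * (K ^ \<alpha> / fact \<alpha> powr (3/2)))"
      using that assms
      by (intro mult_right_mono power_mono add_right_mono) (auto simp: norm_divide divide_right_mono)
    finally show ?thesis by (simp add: f L_def power_mult_distrib mult_ac)
  qed
  have Lsum: "summable (\<lambda>\<alpha>. M * (L R ^ \<alpha> / fact \<alpha> powr (1/2)))" if "R \<ge> 0" for R
    using that assms by (intro summable_mult summable_power_div_fact_powr) (auto simp: L_def)
  have hol: "\<Phi> holomorphic_on UNIV"
  proof (rule holomorphic_uniform_sequence [of UNIV "\<lambda>N x. \<Sum>\<alpha><N. t \<alpha> x"])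
    show "(\<lambda>x. \<Sum>\<alpha><N. t \<alpha> x) holomorphic_on UNIV" for N
      unfolding t_def pochhammer_prod using assms by (intro holomorphic_intros) auto
    fix x :: complex
    have "uniform_limit (cball x 1) (\<lambda>N y. \<Sum>\<alpha><N. t \<alpha> y) (\<lambda>y. \<Sum>\<alpha>. t \<alpha> y) sequentially"
    proof (rule Weierstrass_m_test [OF _ Lsum [of "norm x + 1"]])
      fix \<alpha> y assume "y \<in> cball x 1"
      then have "norm y \<le> norm x + 1"
        by (smt (verit) dist_norm mem_cball norm_minus_commute norm_triangle_sub)
      then show "norm (t \<alpha> y) \<le> M * (L (norm x + 1) ^ \<alpha> / fact \<alpha> powr (1/2))" by (rule tb)
    qed simp
    then show "\<exists>d>0. cball x d \<subseteq> UNIV \<and> uniform_limit (cball x d) (\<lambda>N y. \<Sum>\<alpha><N. t \<alpha> y) \<Phi> sequentially"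
      unfolding \<Phi>_def by (intro exI [of _ 1]) auto
  qed simp
  \<comment> \<open>The sum vanishes on the positive reals, which accumulate at 1, hence
    everywhere.\<close>
  have z: "\<Phi> x = 0" for x
  proof (rule analytic_continuation [OF hol, of "of_real ` {0<..}" 1])
    show "(1::complex) islimpt (of_real ` {0<..} :: complex set)"
    proof (rule islimptI)
      fix T :: "complex set" assume "1 \<in> T" "open T"
      then obtain e where e: "e > 0" "ball 1 e \<subseteq> T" by (meson open_contains_ball)
      then have "of_real (1 + e / 2) \<in> T" by (auto simp: dist_norm intro!: subsetD [OF e(2)])
      then show "\<exists>y\<in>of_real ` {0<..}. y \<in> T \<and> y \<noteq> (1::complex)"
        using e by (intro bexI [of _ "of_real (1 + e / 2)"] imageI) auto
    qed
    fix w :: complex assume "w \<in> of_real ` {0<..}"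
    then show "\<Phi> w = 0" using zero by (auto simp: \<Phi>_def t_def sums_iff)
  qed auto
  show ?thesis
  proof (induction \<alpha> rule: less_induct)
    case (less m)
    \<comment> \<open>At this point the Pochhammer symbol has the argument -m and vanishes for
      \<alpha> > m; the terms below m vanish by the induction hypothesis.\<close>
    have "t \<alpha> (- (2 * \<h>) * of_nat m) = 0" if "\<alpha> \<noteq> m" for \<alpha>
    proof (cases "\<alpha> < m")
      case True
      then show ?thesis using less by (simp add: t_def)
    next
      case False
      then have "pochhammer (- of_nat m :: complex) \<alpha> = 0"
        using that by (simp add: pochhammer_of_nat_eq_0_iff)
      then show ?thesis using assms(1) by (simp add: t_def)
    qed
    then have "(\<Sum>\<alpha>. t \<alpha> (- (2 * \<h>) * of_nat m)) = (\<Sum>\<alpha>\<in>{m}. t \<alpha> (- (2 * \<h>) * of_nat m))"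
      by (intro suminf_finite) auto
    then have "pochhammer (- of_nat m) m * H m = 0"
      using z [of "- (2 * \<h>) * of_nat m"] assms(1) by (simp add: \<Phi>_def t_def)
    then show ?case by (simp add: pochhammer_of_nat_eq_0_iff)
  qed
qed

lemma yfun_scale: "yfun (of_real s *s z) = s\<^sup>2 * yfun z"
  by (simp add: yfun_def norm_mult power_mult_distrib sum_distrib_left right_diff_distrib)

lemma mon_scale: "mon I J (c *s z) = c ^ length I * cnj c ^ length J * mon I J z"
  unfolding mon_def
proof -
  have "(\<Prod>i\<leftarrow>I. (c *s z) $ i) = c ^ length I * (\<Prod>i\<leftarrow>I. z $ i)" by (induction I) auto
  moreover have "(\<Prod>i\<leftarrow>J. cnj ((c *s z) $ i)) = cnj c ^ length J * (\<Prod>i\<leftarrow>J. cnj (z $ i))" by (induction J) auto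
  ultimately show "(\<Prod>i\<leftarrow>I. (c *s z) $ i) * (\<Prod>j\<leftarrow>J. cnj ((c *s z) $ j)) =
    c ^ length I * cnj c ^ length J * ((\<Prod>i\<leftarrow>I. z $ i) * (\<Prod>j\<leftarrow>J. cnj (z $ j)))" by simp
qed

lemma level_part_scale: "level_part c \<alpha> (of_real s *s z) = of_real (s\<^sup>2) ^ \<alpha> * level_part c \<alpha> z"
proof -
  have "ebasis \<tau> (of_real s *s z) = of_real (s\<^sup>2) ^ \<alpha> * ebasis \<tau> z" if "\<tau> \<in> levels \<alpha>" for \<tau>
    using that rep [of \<tau>] ebasis_tri [of "repI \<tau>" "repJ \<tau>"] mon_scale [of "repI \<tau>" "repJ \<tau>" "of_real s" z]
    by (simp add: levels_def power2_eq_square power_mult_distrib)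
  then show ?thesis by (simp add: level_part_def sum_distrib_left mult_ac)
qed

lemma open_pos_cone: "open (pos_cone :: 'n::finite cvec set)"
proof -
  have "continuous_on UNIV (yfun :: 'n cvec \<Rightarrow> real)"
    unfolding yfun_def by (intro continuous_intros)
  then have "open (yfun -` {0<..} :: 'n cvec set)" by (intro open_vimage) auto
  then show ?thesis by (simp add: pos_cone_def vimage_def)
qed

lemma axis_pos_cone: "(axis None 1 :: 'n::finite cvec) \<in> pos_cone" "yfun (axis None 1 :: 'n::finite cvec) = 1"
  by (auto simp: pos_cone_def yfun_def axis_def)

lemma dz_zero_on_open:
  assumes "open S" "\<And>z. z \<in> S \<Longrightarrow> f z = 0" "z \<in> S"
  shows "dz i f z = 0" "dzbar i f z = 0"
proof -
  have "(f has_derivative (\<lambda>v. 0)) (at z)"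
    by (rule has_derivative_transform_within_open [OF has_derivative_const [of 0] assms(1,3)])
       (simp add: assms(2))
  then show "dz i f z = 0" "dzbar i f z = 0" by (simp_all add: has_derivative_dz)
qed

text \<open>A polynomial vanishing on the open cone has vanishing derivatives there, and by
  \<open>top_derivative_ebasis\<close> a derivative of top order picks out one coefficient at any
  point of the cone.\<close>

lemma level_part_inj:
  assumes "\<And>z. z \<in> pos_cone \<Longrightarrow> level_part c \<alpha> z = 0" "\<tau> \<in> levels \<alpha>"
  shows "c \<tau> = 0"
proof -
  let ?z = "axis None 1 :: 'a cvec"
  have \<tau>: "\<tau> \<in> triples" "level \<tau> = \<alpha>" using assms(2) by (auto simp: levels_def)
  have 1: "foldr dzbar J (level_part c \<alpha>) z = 0" if "z \<in> pos_cone" for J z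
    using that by (induction J arbitrary: z) (auto simp: assms(1) intro: dz_zero_on_open [OF open_pos_cone])
  have 2: "foldr dz I (foldr dzbar J (level_part c \<alpha>)) z = 0" if "z \<in> pos_cone" for I J z
    using that by (induction I arbitrary: z) (auto simp: 1 intro: dz_zero_on_open [OF open_pos_cone])
  have "0 = foldr dz (repI \<tau>) (foldr dzbar (repJ \<tau>) (level_part c \<alpha>)) ?z"
    using 2 axis_pos_cone by metis
  also have "\<dots> = (\<Sum>\<sigma>\<in>levels \<alpha>. foldr dz (repI \<tau>) (foldr dzbar (repJ \<tau>) (\<lambda>z. c \<sigma> * (ebasis \<sigma> z / of_nat (nfac \<sigma>)))) ?z)"
    unfolding level_part_def [abs_def]
    by (subst foldr_dz_sum [OF pol_term [where N = \<alpha>]]) (auto simp: levels_def)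
  also have "\<dots> = (\<Sum>\<sigma>\<in>levels \<alpha>. if \<sigma> = \<tau> then c \<sigma> else 0)"
  proof (rule sum.cong)
    fix \<sigma> :: "'a triple" assume "\<sigma> \<in> levels \<alpha>"
    then have \<sigma>: "\<sigma> \<in> triples" "level \<sigma> = \<alpha>" by (auto simp: levels_def)
    have "(\<lambda>z. c \<sigma> * (ebasis \<sigma> z / of_nat (nfac \<sigma>))) = (\<lambda>z. (c \<sigma> / of_nat (nfac \<sigma>)) * ebasis \<sigma> z)" by simp
    then have "foldr dz (repI \<tau>) (foldr dzbar (repJ \<tau>) (\<lambda>z. c \<sigma> * (ebasis \<sigma> z / of_nat (nfac \<sigma>)))) ?z =
      (c \<sigma> / of_nat (nfac \<sigma>)) * foldr dz (repI \<tau>) (foldr dzbar (repJ \<tau>) (ebasis \<sigma>)) ?z"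
      by (simp only: foldr_dz_scale [OF pol_ebasis [OF \<sigma>(1)]])
    also have "\<dots> = (if \<sigma> = \<tau> then c \<sigma> else 0)"
      using rep [OF \<tau>(1)] \<sigma> \<tau> by (auto simp: top_derivative_ebasis)
    finally show "foldr dz (repI \<tau>) (foldr dzbar (repJ \<tau>) (\<lambda>z. c \<sigma> * (ebasis \<sigma> z / of_nat (nfac \<sigma>)))) ?z = 
      (if \<sigma> = \<tau> then c \<sigma> else 0)" .
  qed simp
  also have "\<dots> = c \<tau>" using assms(2) by simp
  finally show ?thesis by simp
qed

text \<open>Along the ray through \<open>z\<close> the homogeneity of \<open>level_part\<close>
  cancels the powers of \<open>y\<close>, so only the Pochhammer symbols vary.
  \<open>newton_series_unique\<close> then separates the levels and \<open>level_part_inj\<close>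
  the coefficients within a level.\<close>

lemma fseries_eq_0:
  fixes c :: "'n::finite triple \<Rightarrow> complex"
  assumes "\<h> \<noteq> 0" "c \<in> hat_coeffs" "\<And>z. z \<in> pos_cone \<Longrightarrow> fseries \<h> c z = 0"
  shows "c = (\<lambda>\<tau>. 0)"
proof
  fix \<tau> :: "'n triple"
  have lp: "level_part c \<alpha> z = 0" if z: "z \<in> pos_cone" for \<alpha> z
  proof -
    have y: "yfun z > 0" using z by (simp add: pos_cone_def)
    obtain M K where MK: "M \<ge> 0" "K \<ge> 0" "\<And>\<alpha>. norm (level_part c \<alpha> z) \<le> M * (K ^ \<alpha> / fact \<alpha> powr (3/2))"
      using level_part_bound [OF assms(2), of z] by blast
    define H where "H = (\<lambda>\<alpha>. level_part c \<alpha> z / of_real (yfun z) ^ \<alpha>)"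
    have "H \<alpha> = 0" for \<alpha>
    proof (rule newton_series_unique [OF assms(1) MK(1), of "K / yfun z" H])
      show "K / yfun z \<ge> 0" using MK y by simp
      show "norm (H \<alpha>) \<le> M * ((K / yfun z) ^ \<alpha> / fact \<alpha> powr (3/2))" for \<alpha>
        using divide_right_mono [OF MK(3) [of \<alpha>], of "yfun z ^ \<alpha>"] y
        by (simp add: H_def norm_divide norm_power power_divide mult_ac)
      fix r :: real assume r: "r > 0"
      \<comment> \<open>The scaling that brings the point of the ray to
        \<open>y = r\<close>.\<close>
      define s where "s = sqrt (r / yfun z)"
      have s: "s > 0" "s\<^sup>2 = r / yfun z" using r y by (auto simp: s_def)
      then have yr: "yfun (of_real s *s z) = r" using y by (simp add: yfun_scale)
      then have c: "of_real s *s z \<in> pos_cone" using r by (simp add: pos_cone_def)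
      have "(\<lambda>\<alpha>. pochhammer (of_real r / (2 * \<h>)) \<alpha> / of_real r ^ \<alpha> * level_part c \<alpha> (of_real s *s z)) sums 0"
        using fseries_sums [OF assms(2) c, of \<h>] assms(3) [OF c] by (simp add: yr)
      moreover have "pochhammer (of_real r / (2 * \<h>)) \<alpha> / of_real r ^ \<alpha> * level_part c \<alpha> (of_real s *s z) =
        pochhammer (of_real r / (2 * \<h>)) \<alpha> * H \<alpha>" for \<alpha>
        unfolding level_part_scale s(2) H_def using r y by (simp add: power_divide)
      ultimately show "(\<lambda>\<alpha>. pochhammer (of_real r / (2 * \<h>)) \<alpha> * H \<alpha>) sums 0" by simp
    qed
    then show ?thesis using y by (simp add: H_def)
  qed
  show "c \<tau> = 0"
  proof (cases "\<tau> \<in> triples")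
    case True
    then show ?thesis using level_part_inj [of c "level \<tau>" \<tau>] lp by (simp add: levels_def)
  qed (simp add: hat_outside [OF assms(2)])
qed

section \<open>Linear structure and uniqueness for infinite expansions\<close>

lemma hat_add:
  assumes "c \<in> hat_coeffs" "d \<in> hat_coeffs"
  shows "(\<lambda>\<tau>. c \<tau> + d \<tau>) \<in> hat_coeffs"
  unfolding hat_coeffs_iff
proof (intro conjI allI impI)
  fix \<epsilon> :: real assume e: "0 < \<epsilon> \<and> \<epsilon> < 1"
  obtain M where M: "hbound \<epsilon> M c" using hat_bound assms(1) e by blast
  obtain N where N: "hbound \<epsilon> N d" using hat_bound assms(2) e by blast
  have "hbound \<epsilon> (M + N) (\<lambda>\<tau>. c \<tau> + d \<tau>)"
    unfolding hbound_def distrib_right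
    using M N by (auto simp: hbound_def intro!: norm_triangle_mono)
  then show "\<exists>M. hbound \<epsilon> M (\<lambda>\<tau>. c \<tau> + d \<tau>)" by blast
qed (simp add: hat_outside assms)

lemma hbound_scale: "hbound \<epsilon> M c \<Longrightarrow> hbound \<epsilon> (norm x * M) (\<lambda>\<tau>. x * c \<tau>)"
  by (auto simp: hbound_def norm_mult mult.assoc intro!: mult_left_mono)

lemma hat_scale: "c \<in> hat_coeffs \<Longrightarrow> (\<lambda>\<tau>. x * c \<tau>) \<in> hat_coeffs"
  unfolding hat_coeffs_iff using hbound_scale by fastforce

lemma hat_diff: "c \<in> hat_coeffs \<Longrightarrow> d \<in> hat_coeffs \<Longrightarrow> (\<lambda>\<tau>. c \<tau> - d \<tau>) \<in> hat_coeffs"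
  using hat_add [OF _ hat_scale [of d "-1"], of c] by simp

lemma hat_0 [simp]: "(\<lambda>\<tau>. 0) \<in> hat_coeffs"
  by (auto simp: hat_coeffs_iff hbound_def intro: exI [of _ 0])

lemma fseries_add:
  assumes "c \<in> hat_coeffs" "d \<in> hat_coeffs"
  shows "fseries \<h> (\<lambda>\<tau>. c \<tau> + d \<tau>) = (\<lambda>z. fseries \<h> c z + fseries \<h> d z)"
  using assms by (simp add: fun_eq_iff fseries_def distrib_right infsum_add hat_summable)

lemma fseries_scale: "fseries \<h> (\<lambda>\<tau>. x * c \<tau>) = (\<lambda>z. x * fseries \<h> c z)"
  by (simp add: fun_eq_iff fseries_def mult.assoc infsum_cmult_right')

lemma fseries_diff:
  assumes "c \<in> hat_coeffs" "d \<in> hat_coeffs"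
  shows "fseries \<h> (\<lambda>\<tau>. c \<tau> - d \<tau>) = (\<lambda>z. fseries \<h> c z - fseries \<h> d z)"
  using fseries_add [OF assms(1) hat_scale [OF assms(2)], of \<h> "-1"]
  by (simp add: fseries_scale [of \<h> "-1", simplified])

lemma fseries_inj:
  assumes "\<h> \<noteq> 0" "c \<in> hat_coeffs" "d \<in> hat_coeffs" "fseries \<h> c = fseries \<h> d"
  shows "c = d"
  using fseries_eq_0 [OF assms(1) hat_diff [OF assms(2,3)]] assms(4)
  by (simp add: fseries_diff [OF assms(2,3)] fun_eq_iff)

lemma fcoeffs_fseries:
  assumes "\<h> \<noteq> 0" "c \<in> hat_coeffs"
  shows "fcoeffs \<h> (fseries \<h> c) = c"
  unfolding fcoeffs_def using fseries_inj [OF assms(1)] assms(2) by (intro the_equality) auto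

lemma fin_hat:
  assumes "c \<in> fin_coeffs"
  shows "c \<in> hat_coeffs"
  unfolding hat_coeffs_iff
proof (intro conjI allI impI)
  fix \<epsilon> :: real assume e: "0 < \<epsilon> \<and> \<epsilon> < 1"
  have f: "finite {\<tau>. c \<tau> \<noteq> 0}" using assms by (simp add: fin_coeffs_def)
  have "hbound \<epsilon> (\<Sum>\<tau> | c \<tau> \<noteq> 0. norm (c \<tau>)) c"
    unfolding hbound_def
  proof
    fix \<tau> :: "'a triple"
    have "norm (c \<tau>) \<le> (\<Sum>\<tau> | c \<tau> \<noteq> 0. norm (c \<tau>))"
    proof (cases "c \<tau> = 0")
      case False
      then show ?thesis using f by (intro member_le_sum) auto
    qed (auto intro: sum_nonneg)
    also have "\<dots> \<le> (\<Sum>\<tau> | c \<tau> \<noteq> 0. norm (c \<tau>)) * fact (level \<tau>) powr \<epsilon>"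
      using e mult_left_mono [OF ge_one_powr_ge_zero [of "fact (level \<tau>)" \<epsilon>], of "\<Sum>\<tau> | c \<tau> \<noteq> 0. norm (c \<tau>)"]
      by (simp add: sum_nonneg fact_ge_1)
    finally show "norm (c \<tau>) \<le> (\<Sum>\<tau> | c \<tau> \<noteq> 0. norm (c \<tau>)) * fact (level \<tau>) powr \<epsilon>" .
  qed
  then show "\<exists>M. hbound \<epsilon> M c" by blast
qed (simp add: fin_coeffs_outside assms)

lemma fseries_fin:
  assumes "c \<in> fin_coeffs"
  shows "fseries \<h> c = lincomb (fbasis \<h>) c"
proof
  fix z
  have f: "finite {\<tau>. c \<tau> \<noteq> 0}" "{\<tau>. c \<tau> \<noteq> 0} \<subseteq> triples" using assms by (simp_all add: fin_coeffs_def)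
  have "fseries \<h> c z = (\<Sum>\<^sub>\<infinity>\<tau>\<in>{\<tau>. c \<tau> \<noteq> 0}. c \<tau> * fbasis \<h> \<tau> z)"
    unfolding fseries_def using f by (intro infsum_cong_neutral) auto
  then show "fseries \<h> c z = lincomb (fbasis \<h>) c z"
    using f by (simp add: lincomb_def)
qed

section \<open>The product on coefficients\<close>

text \<open>All distributions of the entries over two sublists, with multiplicity: the index set of
  the iterated Leibniz rule.\<close>

fun splits :: "'a list \<Rightarrow> ('a list \<times> 'a list) list" where
  "splits [] = [([], [])]"
| "splits (x # xs) = map (\<lambda>(S, T). (x # S, T)) (splits xs) @ map (\<lambda>(S, T). (S, x # T)) (splits xs)"

lemma length_splits: "length (splits xs) = 2 ^ length xs"
  by (induction xs) auto

lemma splits_length: "(S, T) \<in> set (splits xs) \<Longrightarrow> length S + length T = length xs"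
  by (induction xs arbitrary: S T) fastforce+

lemma dz_sum_list:
  assumes "\<And>x. x \<in> set L \<Longrightarrow> \<exists>d k. pol d k (F x)"
  shows "dz i (\<lambda>z. \<Sum>x\<leftarrow>L. F x z) = (\<lambda>z. \<Sum>x\<leftarrow>L. dz i (F x) z)"
    "dzbar i (\<lambda>z. \<Sum>x\<leftarrow>L. F x z) = (\<lambda>z. \<Sum>x\<leftarrow>L. dzbar i (F x) z)"
proof -
  have "(\<forall>z. (\<lambda>z. \<Sum>x\<leftarrow>L. F x z) differentiable at z) \<and>
    dz i (\<lambda>z. \<Sum>x\<leftarrow>L. F x z) = (\<lambda>z. \<Sum>x\<leftarrow>L. dz i (F x) z) \<and>
    dzbar i (\<lambda>z. \<Sum>x\<leftarrow>L. F x z) = (\<lambda>z. \<Sum>x\<leftarrow>L. dzbar i (F x) z)"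
    using assms
  proof (induction L)
    case (Cons x L)
    then obtain d k where "pol d k (F x)" by fastforce
    then have "\<forall>z. F x differentiable at z" using pol_differentiable by blast
    then show ?case using Cons by (auto simp: fun_eq_iff dz_add)
  qed auto
  then show "dz i (\<lambda>z. \<Sum>x\<leftarrow>L. F x z) = (\<lambda>z. \<Sum>x\<leftarrow>L. dz i (F x) z)"
    "dzbar i (\<lambda>z. \<Sum>x\<leftarrow>L. F x z) = (\<lambda>z. \<Sum>x\<leftarrow>L. dzbar i (F x) z)" by auto
qed

lemma foldr_dz_sum_list:
  assumes "\<And>x. x \<in> set L \<Longrightarrow> \<exists>d k. pol d k (F x)"
  shows "foldr dz I (\<lambda>z. \<Sum>x\<leftarrow>L. F x z) = (\<lambda>z. \<Sum>x\<leftarrow>L. foldr dz I (F x) z)"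
proof (induction I)
  case (Cons i I)
  have "\<exists>d k. pol d k (foldr dz I (F x))" if "x \<in> set L" for x
    using assms [OF that] pol_foldr_dz by blast
  then show ?case by (simp add: Cons dz_sum_list)
qed simp

lemma foldr_dzbar_wick:
  assumes "pol d k f" "pol d' k' g"
  shows "foldr dzbar J (wick \<h> f g) =
    (\<lambda>z. \<Sum>(T, T')\<leftarrow>splits J. wick \<h> (foldr dzbar T f) (foldr dzbar T' g) z)"
proof (induction J)
  case (Cons j J)
  have p: "\<exists>d k. pol d k (case x of (T, T') \<Rightarrow> wick \<h> (foldr dzbar T f) (foldr dzbar T' g))" for x
    using pol_wick [OF pol_foldr_dzbar [OF assms(1)] pol_foldr_dzbar [OF assms(2)]]
    by (cases x) (simp only: prod.case, blast)
  have eq: "(\<lambda>z. \<Sum>(T, T')\<leftarrow>splits J. wick \<h> (foldr dzbar T f) (foldr dzbar T' g) z) =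
    (\<lambda>z. \<Sum>x\<leftarrow>splits J. (case x of (T, T') \<Rightarrow> wick \<h> (foldr dzbar T f) (foldr dzbar T' g)) z)"
    by (simp add: case_prod_unfold)
  have "foldr dzbar (j # J) (wick \<h> f g) = (\<lambda>z. \<Sum>(T, T')\<leftarrow>splits J.
      wick \<h> (dzbar j (foldr dzbar T f)) (foldr dzbar T' g) z
      + wick \<h> (foldr dzbar T f) (dzbar j (foldr dzbar T' g)) z)"
    unfolding foldr.simps o_apply Cons eq dz_sum_list(2) [OF p]
    by (simp add: case_prod_unfold dz_wick [OF pol_foldr_dzbar [OF assms(1)] pol_foldr_dzbar [OF assms(2)]])
  then show ?case by (simp add: sum_list_addf case_prod_unfold o_def)
qed simp

lemma foldr_dz_wick:
  assumes "pol d k f" "pol d' k' g"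
  shows "foldr dz I (wick \<h> f g) =
    (\<lambda>z. \<Sum>(T, T')\<leftarrow>splits I. wick \<h> (foldr dz T f) (foldr dz T' g) z)"
proof (induction I)
  case (Cons j J)
  have p: "\<exists>d k. pol d k (case x of (T, T') \<Rightarrow> wick \<h> (foldr dz T f) (foldr dz T' g))" for x
    using pol_wick [OF pol_foldr_dz [OF assms(1)] pol_foldr_dz [OF assms(2)]]
    by (cases x) (simp only: prod.case, blast)
  have eq: "(\<lambda>z. \<Sum>(T, T')\<leftarrow>splits J. wick \<h> (foldr dz T f) (foldr dz T' g) z) =
    (\<lambda>z. \<Sum>x\<leftarrow>splits J. (case x of (T, T') \<Rightarrow> wick \<h> (foldr dz T f) (foldr dz T' g)) z)"
    by (simp add: case_prod_unfold)
  have "foldr dz (j # J) (wick \<h> f g) = (\<lambda>z. \<Sum>(T, T')\<leftarrow>splits J.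
      wick \<h> (dz j (foldr dz T f)) (foldr dz T' g) z
      + wick \<h> (foldr dz T f) (dz j (foldr dz T' g)) z)"
    unfolding foldr.simps o_apply Cons eq dz_sum_list(1) [OF p]
    by (simp add: case_prod_unfold dz_wick [OF pol_foldr_dz [OF assms(1)] pol_foldr_dz [OF assms(2)]])
  then show ?case by (simp add: sum_list_addf case_prod_unfold o_def)
qed simp

lemma dcoef_wick:
  assumes "pol d k f" "pol d' k' g"
  shows "dcoef (wick \<h> f g) I J = (\<Sum>(T, T')\<leftarrow>splits J. \<Sum>(S, S')\<leftarrow>splits I.
    wick \<h> (foldr dz S (foldr dzbar T f)) (foldr dz S' (foldr dzbar T' g)) 0)"
proof -
  have p: "\<exists>d k. pol d k (case x of (T, T') \<Rightarrow> wick \<h> (foldr dzbar T f) (foldr dzbar T' g))" for x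
    using pol_wick [OF pol_foldr_dzbar [OF assms(1)] pol_foldr_dzbar [OF assms(2)]]
    by (cases x) (simp only: prod.case, blast)
  have eq: "(\<lambda>z. \<Sum>(T, T')\<leftarrow>splits J. wick \<h> (foldr dzbar T f) (foldr dzbar T' g) z) =
    (\<lambda>z. \<Sum>x\<leftarrow>splits J. (case x of (T, T') \<Rightarrow> wick \<h> (foldr dzbar T f) (foldr dzbar T' g)) z)"
    by (simp add: case_prod_unfold)
  show ?thesis
    unfolding dcoef_def foldr_dzbar_wick [OF assms] eq foldr_dz_sum_list [OF p]
    by (simp add: case_prod_unfold foldr_dz_wick [OF pol_foldr_dzbar [OF assms(1)] pol_foldr_dzbar [OF assms(2)]])
qed

text \<open>\<open>S\<close> and \<open>T\<close> list the derivatives falling on the first factor,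
  \<open>S'\<close> and \<open>T'\<close> those on the second, and \<open>K\<close> the contracted
  indices. All powers of \<open>2 * \<h>\<close> have cancelled, so the structure constants are real
  numbers free of \<h>.\<close>

definition cterm ::
  "('n::finite triple \<Rightarrow> complex) \<Rightarrow> ('n triple \<Rightarrow> complex) \<Rightarrow> 'n option list \<Rightarrow> 'n option list
    \<Rightarrow> 'n option list \<Rightarrow> 'n option list \<Rightarrow> complex" where
  "cterm a b S S' T T' = (if length S \<le> length T then
     (\<Sum>K | length K = length T - length S. gsigns K / fact (length T - length S) * list_coeff a (K @ S) T * list_coeff b S' (K @ T')) else 0)"

text \<open>The structure constants of the product, read off from the Leibniz rule for the derivatives of a Wick
  product at \<open>0\<close>.  The sum over \<open>r\<close> collapses to one term because invariant polynomials have
  nonzero derivatives at \<open>0\<close> only for equal numbers of \<open>z\<close> and conjugate variables.\<close>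

definition cprod ::
  "('n::finite triple \<Rightarrow> complex) \<Rightarrow> ('n triple \<Rightarrow> complex) \<Rightarrow> 'n triple \<Rightarrow> complex" where
  "cprod a b \<tau> = (if \<tau> \<in> triples then
     (\<Sum>(T, T')\<leftarrow>splits (repJ \<tau>). \<Sum>(S, S')\<leftarrow>splits (repI \<tau>). cterm a b S S' T T') else 0)"

text \<open>The factor \<open>(2 * \<h>) ^ r\<close> of the Wick series cancels the normalisation of
  the \<open>r\<close> contracted derivatives on the first factor. On the second factor the
  normalisation is counted by its \<open>z\<close>-derivatives \<open>S'\<close>, which the
  contraction does not change.\<close>

lemma wick_at_0:
  assumes "\<h> \<noteq> 0" "a \<in> fin_coeffs" "b \<in> fin_coeffs"
  shows "wick \<h> (foldr dz S (foldr dzbar T (pw \<h> a))) (foldr dz S' (foldr dzbar T' (pw \<h> b))) 0 =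
    cterm a b S S' T T' / (2 * \<h>) ^ (length S + length S')"
proof -
  let ?F = "foldr dz S (foldr dzbar T (pw \<h> a))" and ?G = "foldr dz S' (foldr dzbar T' (pw \<h> b))"
  obtain d where d: "pol d 0 (pw \<h> b)" using pol_pw [OF assms(3)] by blast
  have 1: "foldr dz K ?F 0 = list_coeff a (K @ S) T / (2 * \<h>) ^ (length K + length S)" for K
    using dcoef_pw [OF assms(2), of \<h> "K @ S" T] by (simp add: dcoef_def)
  have 2: "foldr dzbar K ?G 0 = list_coeff b S' (K @ T') / (2 * \<h>) ^ length S'" for K
    using dcoef_pw [OF assms(3), of \<h> S' "K @ T'"]
    by (simp add: dcoef_def foldr_dz_dzbar_commute [OF pol_foldr_dzbar [OF d]])
  have w: "wterm r ?F ?G 0 = (\<Sum>K | length K = r. gsigns K * list_coeff a (K @ S) T * list_coeff b S' (K @ T')) / (2 * \<h>) ^ (r + length S + length S')" for r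
    unfolding wterm_def sum_divide_distrib 1 2 by (rule sum.cong) (auto simp: power_add)
  have 0: "wterm r ?F ?G 0 = 0" if "r + length S \<noteq> length T" for r
    using that unfolding w by (auto simp: list_coeff_def)
  show ?thesis
  proof (cases "length S \<le> length T")
    case True
    define r where "r = length T - length S"
    have "wick \<h> ?F ?G 0 = (\<Sum>r\<in>{r}. (2 * \<h>) ^ r / fact r * wterm r ?F ?G 0)"
      unfolding wick_wterm using True by (intro suminf_finite) (auto intro!: 0 simp: r_def)
    also have "\<dots> = cterm a b S S' T T' / (2 * \<h>) ^ (length S + length S')"
      using assms(1) True unfolding w
      by (simp add: cterm_def power_add sum_divide_distrib sum_distrib_left mult_ac flip: r_def)
    finally show ?thesis .
  next
    case False
    then have "wterm r ?F ?G 0 = 0" for r by (intro 0) auto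
    then show ?thesis using False by (simp add: wick_wterm cterm_def)
  qed
qed

lemma sum_list_cong_set: "(\<And>x. x \<in> set L \<Longrightarrow> F x = G x) \<Longrightarrow> (\<Sum>x\<leftarrow>L. F x) = (\<Sum>x\<leftarrow>L. G x)"
  by (simp cong: map_cong)

text \<open>In every splitting the lengths of \<open>S\<close> and \<open>S'\<close> add up to the
  level, so the remaining powers of \<open>2 * \<h>\<close> are exactly those in
  \<open>dcoef_pw\<close>.\<close>

lemma wick_pw:
  assumes "\<h> \<noteq> 0" "a \<in> fin_coeffs" "b \<in> fin_coeffs"
  shows "cprod a b \<in> fin_coeffs \<and> wick \<h> (pw \<h> a) (pw \<h> b) = pw \<h> (cprod a b)"
proof -
  obtain d d' where p: "pol d 0 (pw \<h> a)" "pol d' 0 (pw \<h> b)" using pol_pw assms by metis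
  have pw: "pol (d + d') 0 (wick \<h> (pw \<h> a) (pw \<h> b))" using pol_wick [OF p] by simp
  show ?thesis
  proof (rule pol_eq_pw [OF assms(1) pw])
    fix \<tau> :: "'a triple" assume \<tau>: "\<tau> \<in> triples"
    have "dcoef (wick \<h> (pw \<h> a) (pw \<h> b)) (repI \<tau>) (repJ \<tau>) =
      (\<Sum>(T, T')\<leftarrow>splits (repJ \<tau>). \<Sum>(S, S')\<leftarrow>splits (repI \<tau>). cterm a b S S' T T' / (2 * \<h>) ^ level \<tau>)"
      unfolding dcoef_wick [OF p] wick_at_0 [OF assms]
      by (intro sum_list_cong_set) (auto simp: case_prod_unfold rep [OF \<tau>] dest!: splits_length intro!: sum_list_cong_set)
    also have "\<dots> = cprod a b \<tau> / (2 * \<h>) ^ level \<tau>"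
      using \<tau> by (simp add: cprod_def case_prod_unfold divide_inverse sum_list_mult_const)
    finally show "cprod a b \<tau> = (2 * \<h>) ^ level \<tau> * dcoef (wick \<h> (pw \<h> a) (pw \<h> b)) (repI \<tau>) (repJ \<tau>)"
      using assms(1) by simp
  qed (simp add: cprod_def)
qed

lemma cprod_outside: "\<tau> \<notin> triples \<Longrightarrow> cprod a b \<tau> = 0"
  by (simp add: cprod_def)

text \<open>\<open>list_coeff\<close> vanishes on lists of unequal length, so in
  \<open>cterm\<close> the levels that occur are the lengths of \<open>T\<close> and
  \<open>S'\<close>, bounded by the level of the result. Algebraic identities can therefore be
  checked on truncations, that is on polynomials.\<close>

lemma cprod_cong:
  assumes "\<And>\<sigma>. level \<sigma> \<le> level \<tau> \<Longrightarrow> a \<sigma> = a' \<sigma>" "\<And>\<sigma>. level \<sigma> \<le> level \<tau> \<Longrightarrow> b \<sigma> = b' \<sigma>"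
  shows "cprod a b \<tau> = cprod a' b' \<tau>"
proof (cases "\<tau> \<in> triples")
  case True
  have "cterm a b S S' T T' = cterm a' b' S S' T T'"
    if "length T \<le> level \<tau>" "length S' \<le> level \<tau>" for S S' T T'
  proof -
    have "list_coeff a (K @ S) T = list_coeff a' (K @ S) T" "list_coeff b S' (K @ T') = list_coeff b' S' (K @ T')" for K
      using that by (auto simp: list_coeff_def intro!: assms)
    then show ?thesis by (simp add: cterm_def)
  qed
  then show ?thesis using rep [OF True]
    by (auto simp: cprod_def case_prod_unfold dest!: splits_length intro!: sum_list_cong_set)
qed (simp add: cprod_def)

definition trunc :: "nat \<Rightarrow> ('n::finite triple \<Rightarrow> complex) \<Rightarrow> 'n triple \<Rightarrow> complex" where
  "trunc N a \<tau> = (if level \<tau> \<le> N then a \<tau> else 0)"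

lemma trunc_fin:
  assumes "\<And>\<tau>. \<tau> \<notin> triples \<Longrightarrow> a \<tau> = 0"
  shows "trunc N a \<in> fin_coeffs"
proof -
  have *: "{\<tau>. trunc N a \<tau> \<noteq> 0} \<subseteq> levels_upto N"
    using assms by (auto simp: trunc_def levels_upto_def split: if_splits)
  moreover have "levels_upto N \<subseteq> (triples :: 'a triple set)" by (auto simp: levels_upto_def)
  ultimately show ?thesis
    unfolding fin_coeffs_def mem_Collect_eq using finite_subset [OF * finite_levels_upto] by blast
qed

lemma cprod_trunc: "level \<tau> \<le> N \<Longrightarrow> cprod (trunc N a) (trunc N b) \<tau> = cprod a b \<tau>"
  "level \<tau> \<le> N \<Longrightarrow> cprod a (trunc N b) \<tau> = cprod a b \<tau>"
  "level \<tau> \<le> N \<Longrightarrow> cprod (trunc N a) b \<tau> = cprod a b \<tau>"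
  by (rule cprod_cong; simp add: trunc_def)+

subsection \<open>Bilinearity and bounds\<close>

lemma al_add: "list_coeff (\<lambda>\<tau>. a \<tau> + b \<tau>) I J = list_coeff a I J + list_coeff b I J"
  and al_scale: "list_coeff (\<lambda>\<tau>. c * a \<tau>) I J = c * list_coeff a I J"
  by (simp_all add: list_coeff_def)

lemma cprod_add_left: "cprod (\<lambda>\<tau>. a \<tau> + a' \<tau>) b = (\<lambda>\<tau>. cprod a b \<tau> + cprod a' b \<tau>)"
proof -
  have "cterm (\<lambda>\<tau>. a \<tau> + a' \<tau>) b S S' T T' = cterm a b S S' T T' + cterm a' b S S' T T'" for S S' T T'
    by (simp add: cterm_def al_add distrib_left distrib_right sum.distrib)
  then show ?thesis by (auto simp: fun_eq_iff cprod_def case_prod_unfold sum_list_addf)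
qed

lemma cprod_add_right: "cprod b (\<lambda>\<tau>. a \<tau> + a' \<tau>) = (\<lambda>\<tau>. cprod b a \<tau> + cprod b a' \<tau>)"
proof -
  have "cterm b (\<lambda>\<tau>. a \<tau> + a' \<tau>) S S' T T' = cterm b a S S' T T' + cterm b a' S S' T T'" for S S' T T'
    by (simp add: cterm_def al_add distrib_left distrib_right sum.distrib)
  then show ?thesis by (auto simp: fun_eq_iff cprod_def case_prod_unfold sum_list_addf)
qed

lemma cprod_scale_left: "cprod (\<lambda>\<tau>. c * a \<tau>) b = (\<lambda>\<tau>. c * cprod a b \<tau>)"
proof -
  have "cterm (\<lambda>\<tau>. c * a \<tau>) b S S' T T' = c * cterm a b S S' T T'" for S S' T T'
    by (simp add: cterm_def al_scale sum_distrib_left mult_ac)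
  then show ?thesis by (auto simp: fun_eq_iff cprod_def case_prod_unfold sum_list_const_mult)
qed

lemma cprod_scale_right: "cprod b (\<lambda>\<tau>. c * a \<tau>) = (\<lambda>\<tau>. c * cprod b a \<tau>)"
proof -
  have "cterm b (\<lambda>\<tau>. c * a \<tau>) S S' T T' = c * cterm b a S S' T T'" for S S' T T'
    by (simp add: cterm_def al_scale sum_distrib_left mult_ac)
  then show ?thesis by (auto simp: fun_eq_iff cprod_def case_prod_unfold sum_list_const_mult)
qed

lemma cprod_diff_left: "cprod (\<lambda>\<tau>. a \<tau> - a' \<tau>) b = (\<lambda>\<tau>. cprod a b \<tau> - cprod a' b \<tau>)"
  using cprod_add_left [of a "\<lambda>\<tau>. -1 * a' \<tau>" b] cprod_scale_left [of "-1" a' b] by simp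

lemma cprod_diff_right: "cprod b (\<lambda>\<tau>. a \<tau> - a' \<tau>) = (\<lambda>\<tau>. cprod b a \<tau> - cprod b a' \<tau>)"
  using cprod_add_right [of b a "\<lambda>\<tau>. -1 * a' \<tau>"] cprod_scale_right [of b "-1" a'] by simp

lemma norm_sum_list_bound:
  assumes "\<And>x. x \<in> set L \<Longrightarrow> norm (F x) \<le> B"
  shows "norm (\<Sum>x\<leftarrow>L. F x) \<le> of_nat (length L) * B"
  using assms
proof (induction L)
  case (Cons x L)
  have "norm (\<Sum>x\<leftarrow>x # L. F x) \<le> norm (F x) + norm (\<Sum>x\<leftarrow>L. F x)" by (simp add: norm_triangle_ineq)
  also have "\<dots> \<le> B + of_nat (length L) * B" using Cons by (intro add_mono) auto
  finally show ?case by (simp add: algebra_simps)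
qed simp

lemma card_lists [simp]: "card {K::'a::finite list. length K = r} = CARD('a) ^ r"
  using card_lists_length_eq [of "UNIV :: 'a set" r] by simp

lemma power_div_fact_le_exp: "0 \<le> (x::real) \<Longrightarrow> x ^ n / fact n \<le> exp x"
proof -
  assume x: "0 \<le> x"
  have "(\<Sum>k\<in>{n}. x ^ k /\<^sub>R fact k) \<le> (\<Sum>k. x ^ k /\<^sub>R fact k)"
    using x summable_exp_generic [of x] by (intro sum_le_suminf) auto
  then show ?thesis by (simp add: exp_def field_simps)
qed

lemma norm_al_le:
  assumes "hbound \<epsilon> M a" "M \<ge> 0" "\<epsilon> \<ge> 0" "length J \<le> n"
  shows "norm (list_coeff a I J) \<le> M * fact n powr \<epsilon>"
proof (cases "length I = length J")
  case True
  then have "norm (list_coeff a I J) \<le> M * fact (length J) powr \<epsilon>"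
    using assms(1) unfolding hbound_def by (metis list_coeff_def level_tri tri_triples)
  also have "\<dots> \<le> M * fact n powr \<epsilon>"
    using assms by (intro mult_left_mono powr_mono2 fact_mono) auto
  finally show ?thesis .
qed (use assms in \<open>simp add: list_coeff_def\<close>)

lemma norm_al_le':
  assumes "hbound \<epsilon> M a" "M \<ge> 0" "\<epsilon> \<ge> 0" "length I \<le> n"
  shows "norm (list_coeff a I J) \<le> M * fact n powr \<epsilon>"
proof (cases "length I = length J")
  case True
  then show ?thesis using norm_al_le [OF assms(1-3), of J n I] assms(4) by simp
qed (use assms in \<open>simp add: list_coeff_def\<close>)

text \<open>The number of contracted lists of length r is N^r with N = n + 1, and together with
  \<open>1 / fact r\<close> this stays below \<open>exp N\<close> for all r.\<close>

lemma norm_cterm_le: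
  fixes a b :: "'n::finite triple \<Rightarrow> complex"
  assumes "hbound \<epsilon> M a" "hbound \<epsilon> N b" "M \<ge> 0" "N \<ge> 0" "\<epsilon> \<ge> 0" "length T \<le> n" "length S' \<le> n"
  shows "norm (cterm a b S S' T T') \<le> exp (CARD('n option)) * (M * N * (fact n powr \<epsilon>)\<^sup>2)"
proof (cases "length S \<le> length T")
  case True
  define r where "r = length T - length S"
  let ?B = "M * N * (fact n powr \<epsilon>)\<^sup>2"
  have "norm (\<Sum>K | length K = r. gsigns K / fact r * list_coeff a (K @ S) T * list_coeff b S' (K @ T')) \<le>
    of_nat (card {K::'n option list. length K = r}) * (?B / fact r)"
  proof (rule sum_norm_bound)
    fix K :: "'n option list"
    have "norm (list_coeff a (K @ S) T) * norm (list_coeff b S' (K @ T')) \<le> (M * fact n powr \<epsilon>) * (N * fact n powr \<epsilon>)"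
      using assms norm_al_le [OF assms(1,3,5,6)] norm_al_le' [OF assms(2,4,5,7)] by (intro mult_mono) auto
    then have "1 / fact r * (norm (list_coeff a (K @ S) T) * norm (list_coeff b S' (K @ T'))) \<le> 1 / fact r * ?B"
      by (intro mult_left_mono) (auto simp: power2_eq_square mult_ac)
    then show "norm (gsigns K / fact r * list_coeff a (K @ S) T * list_coeff b S' (K @ T')) \<le> ?B / fact r"
      by (simp add: norm_mult norm_divide)
  qed
  also have "\<dots> = (of_nat CARD('n option) ^ r / fact r) * ?B" by simp
  also have "\<dots> \<le> exp (CARD('n option)) * ?B"
    using assms by (intro mult_right_mono power_div_fact_le_exp) auto
  finally show ?thesis using True by (simp add: cterm_def r_def)
next
  case False
  then show ?thesis using assms by (simp add: cterm_def)
qed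

lemma norm_cprod_le:
  fixes a b :: "'n::finite triple \<Rightarrow> complex"
  assumes "hbound \<epsilon> M a" "hbound \<epsilon> N b" "M \<ge> 0" "N \<ge> 0" "\<epsilon> \<ge> 0" "\<tau> \<in> triples"
  shows "norm (cprod a b \<tau>) \<le> 4 ^ level \<tau> * (exp (CARD('n option)) * (M * N * (fact (level \<tau>) powr \<epsilon>)\<^sup>2))"
    (is "_ \<le> _ * ?B")
proof -
  let ?n = "level \<tau>"
  define B where "B = ?B"
  have 0: "norm (cterm a b S S' T T') \<le> B" if "length T \<le> ?n" "length S' \<le> ?n" for S S' T T'
    unfolding B_def by (rule norm_cterm_le [OF assms(1-5) that])
  have 1: "norm (\<Sum>(S, S')\<leftarrow>splits (repI \<tau>). cterm a b S S' T T') \<le> of_nat (length (splits (repI \<tau>))) * B"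
    if "(T, T') \<in> set (splits (repJ \<tau>))" for T T'
    using that rep [OF assms(6)]
    by (intro norm_sum_list_bound) (auto dest!: splits_length intro!: 0)
  have "norm (\<Sum>(T, T')\<leftarrow>splits (repJ \<tau>). \<Sum>(S, S')\<leftarrow>splits (repI \<tau>). cterm a b S S' T T') \<le>
    of_nat (length (splits (repJ \<tau>))) * (of_nat (length (splits (repI \<tau>))) * B)"
    by (rule norm_sum_list_bound) (auto intro: 1)
  \<comment> \<open>One factor \<open>2 ^ ?n\<close> for the splittings of each of the two
    lists.\<close>
  moreover have "(4::real) ^ ?n = 2 ^ ?n * 2 ^ ?n" by (simp flip: power_mult_distrib)
  ultimately show ?thesis using assms(6) rep [OF assms(6)]
    unfolding B_def [symmetric] by (simp add: cprod_def length_splits mult_ac)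
qed

text \<open>The budget is one \<epsilon> for each factor and a third one to absorb the geometric
  factor \<open>4 ^ level \<tau>\<close>.\<close>

lemma hbound_cprod:
  assumes "0 < \<epsilon>"
  shows "\<exists>C\<ge>0. \<forall>M N a b. M \<ge> 0 \<and> N \<ge> 0 \<and> hbound \<epsilon> M a \<and> hbound \<epsilon> N b \<longrightarrow>
      hbound (3 * \<epsilon>) (C * M * N) (cprod a (b :: 'n::finite triple \<Rightarrow> complex))"
proof -
  obtain D where D: "D > 0" "\<And>n. (4::real) ^ n \<le> D * fact n powr \<epsilon>"
    using power_le_fact_powr [of 4 \<epsilon>] assms by auto
  show ?thesis
  proof (intro exI [of _ "D * exp (CARD('n option))"] conjI allI impI)
    fix M N :: real and a b :: "'n triple \<Rightarrow> complex"
    assume "M \<ge> 0 \<and> N \<ge> 0 \<and> hbound \<epsilon> M a \<and> hbound \<epsilon> N b"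
    then have *: "M \<ge> 0" "N \<ge> 0" "hbound \<epsilon> M a" "hbound \<epsilon> N b" by auto
    show "hbound (3 * \<epsilon>) (D * exp (CARD('n option)) * M * N) (cprod a b)"
      unfolding hbound_def
    proof
      fix \<tau> :: "'n triple" assume \<tau>: "\<tau> \<in> triples"
      let ?n = "level \<tau>" and ?E = "exp (real CARD('n option))"
      have "norm (cprod a b \<tau>) \<le> 4 ^ ?n * (?E * (M * N * (fact ?n powr \<epsilon>)\<^sup>2))"
        using * assms \<tau> by (intro norm_cprod_le) auto
      also have "\<dots> \<le> (D * fact ?n powr \<epsilon>) * (?E * (M * N * (fact ?n powr \<epsilon>)\<^sup>2))"
        using * D by (intro mult_right_mono) auto
      also have "\<dots> = D * ?E * M * N * (fact ?n powr \<epsilon> * fact ?n powr \<epsilon> * fact ?n powr \<epsilon>)"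
        by (simp add: power2_eq_square)
      also have "fact ?n powr \<epsilon> * fact ?n powr \<epsilon> * fact ?n powr \<epsilon> = (fact ?n powr (3 * \<epsilon>) :: real)"
        by (simp flip: powr_add)
      finally show "norm (cprod a b \<tau>) \<le> D * ?E * M * N * fact ?n powr (3 * \<epsilon>)" .
    qed
  qed (use D in auto)
qed

lemma cprod_hat:
  assumes "a \<in> hat_coeffs" "b \<in> hat_coeffs"
  shows "cprod a b \<in> hat_coeffs"
  unfolding hat_coeffs_iff
proof (intro conjI allI impI)
  fix \<epsilon> :: real assume e: "0 < \<epsilon> \<and> \<epsilon> < 1"
  then have e3: "0 < \<epsilon> / 3" "\<epsilon> / 3 < 1" by auto
  obtain M where M: "M \<ge> 0" "hbound (\<epsilon> / 3) M a" using hat_bound [OF assms(1) e3] .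
  obtain N where N: "N \<ge> 0" "hbound (\<epsilon> / 3) N b" using hat_bound [OF assms(2) e3] .
  show "\<exists>M. hbound \<epsilon> M (cprod a b)"
    using hbound_cprod [OF e3(1), where ?'n = 'a] M N by (metis nonzero_mult_div_cancel_left times_divide_eq_right zero_neq_numeral)
qed (simp add: cprod_outside)

section \<open>The action on coefficients\<close>

definition mprod :: "'n::finite cmat \<Rightarrow> 'n option list \<Rightarrow> 'n option list \<Rightarrow> complex" where
  "mprod V K I = (\<Prod>(k, i)\<leftarrow>zip K I. V $ k $ i)"

definition cnj_mat :: "'n::finite cmat \<Rightarrow> 'n cmat" where
  "cnj_mat U = (\<chi> i j. cnj (U $ i $ j))"

text \<open>The coefficients of \<open>pullback U\<close> are given by \<open>V = U\<close>, \<open>W = cnj_mat U\<close>; keeping \<open>V\<close> and \<open>W\<close>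
  independent makes the action holomorphic.\<close>

definition cact :: "'n::finite cmat \<Rightarrow> 'n cmat \<Rightarrow> ('n triple \<Rightarrow> complex) \<Rightarrow> 'n triple \<Rightarrow> complex" where
  "cact V W a \<tau> = (if \<tau> \<in> triples then
     (\<Sum>K | length K = level \<tau>. \<Sum>L | length L = level \<tau>. mprod V K (repI \<tau>) * mprod W L (repJ \<tau>) * list_coeff a K L) else 0)"

lemma mprod_simps [simp]: "mprod V [] [] = 1" "mprod V (k # K) (i # I) = V $ k $ i * mprod V K I"
  by (simp_all add: mprod_def)

text \<open>The iterated chain rule: each derivative in direction \<open>i\<close> becomes a sum
  over target directions weighted by a column of \<open>U\<close>, and these choices assemble to a
  list \<open>K\<close>.\<close>

lemma foldr_dz_pullback:
  assumes "pol d k f"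
  shows "foldr dz I (pullback U f) = (\<lambda>z. \<Sum>K | length K = length I. mprod U K I * pullback U (foldr dz K f) z)"
proof (induction I)
  case (Cons i I)
  have p: "pol (d - length I) (k - int (length I)) (foldr dz K f)" if "K \<in> {K. length K = length I}" for K
    using pol_foldr_dz [OF assms, of K] that by simp
  have q: "pol (d - length I) (k - int (length I)) (pullback U (foldr dz K f))" if "K \<in> {K. length K = length I}" for K
    using pol_pullback [OF p [OF that]] .
  have "foldr dz (i # I) (pullback U f) =
    (\<lambda>z. \<Sum>K | length K = length I. mprod U K I * (\<Sum>j\<in>UNIV. U $ j $ i * pullback U (dz j (foldr dz K f)) z))"
    unfolding foldr.simps o_apply Cons
    by (subst pol_dz_sum(1) [where d = "d - length I" and k = "k - int (length I)"],
        erule pol_scale [OF q])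
      (intro ext sum.cong refl, simp add: pol_dz_rules [OF q] dz_pullback [OF p])
  also have "\<dots> = (\<lambda>z. \<Sum>j\<in>UNIV. \<Sum>K | length K = length I. mprod U (j # K) (i # I) * pullback U (foldr dz (j # K) f) z)"
    by (subst sum.swap) (simp add: sum_distrib_left mult_ac)
  finally show ?case by (simp add: sum_lists_Cons)
qed (simp add: pullback_def)

lemma foldr_dzbar_pullback:
  assumes "pol d k f"
  shows "foldr dzbar I (pullback U f) = (\<lambda>z. \<Sum>K | length K = length I. mprod (cnj_mat U) K I * pullback U (foldr dzbar K f) z)"
proof (induction I)
  case (Cons i I)
  have p: "pol (d - length I) (k + int (length I)) (foldr dzbar K f)" if "K \<in> {K. length K = length I}" for K
    using pol_foldr_dzbar [OF assms, of K] that by simp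
  have q: "pol (d - length I) (k + int (length I)) (pullback U (foldr dzbar K f))" if "K \<in> {K. length K = length I}" for K
    using pol_pullback [OF p [OF that]] .
  have "foldr dzbar (i # I) (pullback U f) =
    (\<lambda>z. \<Sum>K | length K = length I. mprod (cnj_mat U) K I * (\<Sum>j\<in>UNIV. cnj (U $ j $ i) * pullback U (dzbar j (foldr dzbar K f)) z))"
    unfolding foldr.simps o_apply Cons
    by (subst pol_dz_sum(2) [where d = "d - length I" and k = "k + int (length I)"],
        erule pol_scale [OF q])
      (intro ext sum.cong refl, simp add: pol_dz_rules [OF q] dz_pullback [OF p])
  also have "\<dots> = (\<lambda>z. \<Sum>j\<in>UNIV. \<Sum>K | length K = length I. mprod (cnj_mat U) (j # K) (i # I) * pullback U (foldr dzbar (j # K) f) z)"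
    by (subst sum.swap) (simp add: sum_distrib_left mult_ac cnj_mat_def)
  finally show ?case by (simp add: sum_lists_Cons)
qed (simp add: pullback_def)

lemma dcoef_pullback:
  assumes "pol d k f"
  shows "dcoef (pullback U f) I J =
    (\<Sum>K | length K = length I. \<Sum>L | length L = length J. mprod U K I * mprod (cnj_mat U) L J * dcoef f K L)"
proof -
  have p: "pol (d - length J) (k + int (length J)) (foldr dzbar L f)" if "L \<in> {L. length L = length J}" for L
    using pol_foldr_dzbar [OF assms, of L] that by simp
  have q: "pol (d - length J) (k + int (length J)) (pullback U (foldr dzbar L f))" if "L \<in> {L. length L = length J}" for L
    using pol_pullback [OF p [OF that]] .
  have "dcoef (pullback U f) I J = (\<Sum>L | length L = length J. mprod (cnj_mat U) L J * foldr dz I (pullback U (foldr dzbar L f)) 0)"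
    unfolding dcoef_def foldr_dzbar_pullback [OF assms]
  proof -
    have "foldr dz I (foldr dzbar [] (\<lambda>z. \<Sum>L | length L = length J. mprod (cnj_mat U) L J * pullback U (foldr dzbar L f) z)) =
      (\<lambda>z. \<Sum>L | length L = length J. foldr dz I (foldr dzbar [] (\<lambda>z. mprod (cnj_mat U) L J * pullback U (foldr dzbar L f) z)) z)"
      by (rule foldr_dz_sum) (erule pol_scale [OF q])
    also have "\<dots> = (\<lambda>z. \<Sum>L | length L = length J. mprod (cnj_mat U) L J * foldr dz I (pullback U (foldr dzbar L f)) z)"
      by (intro ext sum.cong refl) (simp add: foldr_dz_scale [OF q, where J = "[]", simplified])
    finally show "foldr dz I (\<lambda>z. \<Sum>L | length L = length J. mprod (cnj_mat U) L J * pullback U (foldr dzbar L f) z) 0 =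
      (\<Sum>L | length L = length J. mprod (cnj_mat U) L J * foldr dz I (pullback U (foldr dzbar L f)) 0)"
      by (simp add: fun_eq_iff)
  qed
  also have "\<dots> = (\<Sum>L | length L = length J. mprod (cnj_mat U) L J *
     (\<Sum>K | length K = length I. mprod U K I * dcoef f K L))"
    by (intro sum.cong refl) (simp add: foldr_dz_pullback [OF p] dcoef_def, simp add: pullback_def)
  also have "\<dots> = (\<Sum>L | length L = length J. \<Sum>K | length K = length I. mprod U K I * mprod (cnj_mat U) L J * dcoef f K L)"
    by (simp add: sum_distrib_left mult_ac)
  finally show ?thesis by (subst sum.swap)
qed

lemma pullback_pw:
  assumes "\<h> \<noteq> 0" "a \<in> fin_coeffs"
  shows "cact U (cnj_mat U) a \<in> fin_coeffs \<and> pullback U (pw \<h> a) = pw \<h> (cact U (cnj_mat U) a)"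
proof -
  obtain d where p: "pol d 0 (pw \<h> a)" using pol_pw assms by metis
  show ?thesis
  proof (rule pol_eq_pw [OF assms(1) pol_pullback [OF p]])
    fix \<tau> :: "'a triple" assume \<tau>: "\<tau> \<in> triples"
    have "dcoef (pullback U (pw \<h> a)) (repI \<tau>) (repJ \<tau>) =
      (\<Sum>K | length K = level \<tau>. \<Sum>L | length L = level \<tau>. mprod U K (repI \<tau>) * mprod (cnj_mat U) L (repJ \<tau>) * list_coeff a K L / (2 * \<h>) ^ level \<tau>)"
      unfolding dcoef_pullback [OF p] rep [OF \<tau>]
      by (intro sum.cong refl) (simp add: dcoef_pw [OF assms(2)])
    then show "cact U (cnj_mat U) a \<tau> = (2 * \<h>) ^ level \<tau> * dcoef (pullback U (pw \<h> a)) (repI \<tau>) (repJ \<tau>)"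
      using assms(1) \<tau> by (simp add: cact_def sum_divide_distrib [symmetric])
  qed (simp add: cact_def)
qed

lemma cact_cong: "(\<And>\<sigma>. level \<sigma> = level \<tau> \<Longrightarrow> a \<sigma> = a' \<sigma>) \<Longrightarrow> cact V W a \<tau> = cact V W a' \<tau>"
  by (auto simp: cact_def list_coeff_def intro!: sum.cong)

lemma cact_outside: "\<tau> \<notin> triples \<Longrightarrow> cact V W a \<tau> = 0"
  by (simp add: cact_def)

definition msum :: "'n::finite cmat \<Rightarrow> real" where
  "msum V = (\<Sum>k\<in>UNIV. \<Sum>i\<in>UNIV. norm (V $ k $ i))"

lemma msum_nonneg: "msum V \<ge> 0"
  by (simp add: msum_def sum_nonneg)

text \<open>The sum over lists factorises into column sums of \<open>V\<close>, each bounded by the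
  sum of all entries.\<close>

lemma sum_mprod_le: "(\<Sum>K | length K = length I. norm (mprod V K I)) \<le> msum V ^ length I"
proof (induction I)
  case (Cons i I)
  have "(\<Sum>K | length K = length (i # I). norm (mprod V K (i # I))) =
    (\<Sum>k\<in>UNIV. norm (V $ k $ i)) * (\<Sum>K | length K = length I. norm (mprod V K I))"
    by (simp add: sum_lists_Cons norm_mult sum_product)
  also have "\<dots> \<le> msum V * msum V ^ length I"
  proof (intro mult_mono Cons)
    show "(\<Sum>k\<in>UNIV. norm (V $ k $ i)) \<le> msum V"
      unfolding msum_def by (intro sum_mono member_le_sum) auto
  qed (auto simp: msum_nonneg intro: sum_nonneg)
  finally show ?case by simp
qed simp

lemma norm_cact_le:
  assumes "hbound \<epsilon> M a" "M \<ge> 0" "\<epsilon> \<ge> 0" "\<tau> \<in> triples"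
  shows "norm (cact V W a \<tau>) \<le> (msum V * msum W) ^ level \<tau> * (M * fact (level \<tau>) powr \<epsilon>)" (is "_ \<le> _ * ?B")
proof -
  have "norm (cact V W a \<tau>) \<le>
    (\<Sum>K | length K = level \<tau>. \<Sum>L | length L = level \<tau>. norm (mprod V K (repI \<tau>)) * norm (mprod W L (repJ \<tau>)) * ?B)"
    unfolding cact_def if_P [OF assms(4)]
    by (intro order_trans [OF norm_sum] sum_mono) (auto simp: norm_mult intro!: mult_left_mono norm_al_le [OF assms(1-3)])
  also have "\<dots> = (\<Sum>K | length K = level \<tau>. norm (mprod V K (repI \<tau>))) *
      (\<Sum>L | length L = level \<tau>. norm (mprod W L (repJ \<tau>))) * ?B"
    unfolding sum_product unfolding sum_distrib_right ..
  also have "\<dots> \<le> msum V ^ level \<tau> * msum W ^ level \<tau> * ?B"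
    using sum_mprod_le [where I = "repI \<tau>" and V = V] sum_mprod_le [where I = "repJ \<tau>" and V = W] rep [OF assms(4)] assms(2)
    by (intro mult_right_mono mult_mono) (auto intro: sum_nonneg simp: msum_nonneg)
  finally show ?thesis by (simp add: power_mult_distrib)
qed

text \<open>The constant depends only on the bound \<open>R\<close> for the matrices. This
  uniformity is what Cauchy's estimates for the holomorphic family require.\<close>

lemma hbound_cact:
  assumes "0 < \<epsilon>" "0 < \<delta>" "R \<ge> 0"
  shows "\<exists>C\<ge>0. \<forall>V W M a. msum V \<le> R \<and> msum W \<le> R \<and> M \<ge> 0 \<and> hbound \<epsilon> M a \<longrightarrow>
       hbound (\<epsilon> + \<delta>) (C * M) (cact V W (a :: 'n::finite triple \<Rightarrow> complex))"
proof -
  obtain D where D: "D > 0" "\<And>n. (R * R) ^ n \<le> D * fact n powr \<delta>"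
    using power_le_fact_powr [of "R * R" \<delta>] assms by auto
  show ?thesis
  proof (intro exI [of _ D] conjI allI impI)
    fix V W :: "'n cmat" and M and a :: "'n triple \<Rightarrow> complex"
    assume "msum V \<le> R \<and> msum W \<le> R \<and> M \<ge> 0 \<and> hbound \<epsilon> M a"
    then have *: "msum V \<le> R" "msum W \<le> R" "M \<ge> 0" "hbound \<epsilon> M a" by auto
    show "hbound (\<epsilon> + \<delta>) (D * M) (cact V W a)"
      unfolding hbound_def
    proof
      fix \<tau> :: "'n triple" assume \<tau>: "\<tau> \<in> triples"
      have "norm (cact V W a \<tau>) \<le> (msum V * msum W) ^ level \<tau> * (M * fact (level \<tau>) powr \<epsilon>)"
        using * assms \<tau> by (intro norm_cact_le) auto
      also have "\<dots> \<le> (R * R) ^ level \<tau> * (M * fact (level \<tau>) powr \<epsilon>)"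
        using * assms by (intro mult_right_mono power_mono mult_mono) (auto simp: msum_nonneg)
      also have "\<dots> \<le> (D * fact (level \<tau>) powr \<delta>) * (M * fact (level \<tau>) powr \<epsilon>)"
        using * D by (intro mult_right_mono) auto
      finally show "norm (cact V W a \<tau>) \<le> D * M * fact (level \<tau>) powr (\<epsilon> + \<delta>)"
        by (simp add: powr_add mult_ac)
    qed
  qed (use D in auto)
qed

lemma cact_hat:
  assumes "a \<in> hat_coeffs"
  shows "cact V W a \<in> hat_coeffs"
  unfolding hat_coeffs_iff
proof (intro conjI allI impI)
  fix \<epsilon> :: real assume e: "0 < \<epsilon> \<and> \<epsilon> < 1"
  then have e2: "0 < \<epsilon> / 2" "\<epsilon> / 2 < 1" by auto
  have R: "0 \<le> max (msum V) (msum W)" using msum_nonneg [of V] by auto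
  obtain M where M: "M \<ge> 0" "hbound (\<epsilon> / 2) M a"
    using hat_bound [OF assms(1) e2] .
  have "max (msum V) (msum W) \<ge> msum V" "max (msum V) (msum W) \<ge> msum W" by auto
  then show "\<exists>M. hbound \<epsilon> M (cact V W a)"
    using hbound_cact [OF e2(1) e2(1) R, where ?'n = 'a] M by (metis field_sum_of_halves)
qed (simp add: cact_outside)

lemma cact_add: "cact V W (\<lambda>\<tau>. a \<tau> + b \<tau>) = (\<lambda>\<tau>. cact V W a \<tau> + cact V W b \<tau>)"
  by (auto simp: fun_eq_iff cact_def al_add distrib_left sum.distrib)

lemma cact_scale: "cact V W (\<lambda>\<tau>. c * a \<tau>) = (\<lambda>\<tau>. c * cact V W a \<tau>)"
  by (auto simp: fun_eq_iff cact_def al_scale sum_distrib_left mult_ac)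

lemma cact_diff: "cact V W (\<lambda>\<tau>. a \<tau> - b \<tau>) = (\<lambda>\<tau>. cact V W a \<tau> - cact V W b \<tau>)"
  using cact_add [of V W a "\<lambda>\<tau>. -1 * b \<tau>"] cact_scale [of V W "-1" b] by simp

definition at_level :: "nat \<Rightarrow> ('n::finite triple \<Rightarrow> complex) \<Rightarrow> 'n triple \<Rightarrow> complex" where
  "at_level \<alpha> a \<tau> = (if level \<tau> = \<alpha> then a \<tau> else 0)"

lemma at_level_fin:
  assumes "a \<in> hat_coeffs"
  shows "at_level \<alpha> a \<in> fin_coeffs"
proof -
  have *: "{\<tau>. at_level \<alpha> a \<tau> \<noteq> 0} \<subseteq> levels \<alpha>"
    using hat_outside [OF assms] by (auto simp: at_level_def levels_def split: if_splits)
  moreover have "levels \<alpha> \<subseteq> (triples :: 'a triple set)" by (auto simp: levels_def)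
  ultimately show ?thesis
    unfolding fin_coeffs_def mem_Collect_eq using finite_subset [OF * finite_levels] by blast
qed

lemma level_part_pw:
  assumes "\<h> \<noteq> 0" "a \<in> hat_coeffs"
  shows "level_part a \<alpha> z = (2 * \<h>) ^ \<alpha> * pw \<h> (at_level \<alpha> a) z"
proof -
  have sub: "{\<tau>. at_level \<alpha> a \<tau> \<noteq> 0} \<subseteq> levels \<alpha>"
    using hat_outside [OF assms(2)] by (auto simp: at_level_def levels_def split: if_splits)
  show ?thesis unfolding level_part_def pw_def lincomb_superset [OF finite_levels sub] sum_distrib_left
    by (rule sum.cong) (use assms(1) in \<open>auto simp: at_level_def levels_def\<close>)
qed

lemma cact_at_level: "cact V W (at_level \<alpha> a) = at_level \<alpha> (cact V W a)"
proof
  fix \<tau>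
  show "cact V W (at_level \<alpha> a) \<tau> = at_level \<alpha> (cact V W a) \<tau>"
  proof (cases "level \<tau> = \<alpha>")
    case True
    then show ?thesis by (simp add: at_level_def cong: cact_cong)
  next
    case False
    have "cact V W (at_level \<alpha> a) \<tau> = cact V W (\<lambda>\<tau>. 0) \<tau>"
      using False by (intro cact_cong) (simp add: at_level_def)
    then show ?thesis using False by (simp add: at_level_def cact_def list_coeff_def)
  qed
qed

text \<open>Since \<open>U\<close> preserves \<open>y\<close>, the scalar factor of each level is
  unchanged, and a linear substitution maps each homogeneous component to one of the same level,
  where \<open>pullback_pw\<close> applies.\<close>

lemma pullback_fseries:
  assumes "\<h> \<noteq> 0" "a \<in> hat_coeffs" "\<And>z. yfun (U *v z) = yfun z"
  shows "pullback U (fseries \<h> a) = fseries \<h> (cact U (cnj_mat U) a)"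
proof
  fix z
  show "pullback U (fseries \<h> a) z = fseries \<h> (cact U (cnj_mat U) a) z"
  proof (cases "z \<in> pos_cone")
    case True
    then have U: "U *v z \<in> pos_cone" by (simp add: pos_cone_def assms(3))
    have "level_part a \<alpha> (U *v z) = level_part (cact U (cnj_mat U) a) \<alpha> z" for \<alpha>
      using pullback_pw [OF assms(1) at_level_fin [OF assms(2), of \<alpha>], of U]
      by (simp add: level_part_pw [OF assms(1,2)] level_part_pw [OF assms(1) cact_hat [OF assms(2)]]
          cact_at_level pullback_def fun_eq_iff)
    then show ?thesis
      using fseries_sums [OF assms(2) U, of \<h>] fseries_sums [OF cact_hat [OF assms(2)] True, of \<h> U "cnj_mat U"]
      by (simp add: assms(3) pullback_def sums_iff)
  next
    case False
    then have "U *v z \<notin> pos_cone" by (simp add: pos_cone_def assms(3))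
    then show ?thesis using False by (simp add: pullback_def fseries_def fbasis_outside)
  qed
qed

subsection \<open>Transposition and conjugation\<close>

text \<open>The transposition: the coefficients of the function composed with
  \<open>cnj_vec\<close>. It is linear and reverses products.\<close>

definition swap_coeffs :: "('n::finite triple \<Rightarrow> complex) \<Rightarrow> 'n triple \<Rightarrow> complex" where
  "swap_coeffs a = (\<lambda>(P, Q, \<alpha>). a (Q, P, \<alpha>))"

lemma ctr_ctr [simp]: "swap_coeffs (swap_coeffs a) = a"
  by (auto simp: swap_coeffs_def)

lemma ctr_hat:
  assumes "a \<in> hat_coeffs"
  shows "swap_coeffs a \<in> hat_coeffs"
proof -
  have t: "(P, Q, \<alpha>) \<in> triples \<longleftrightarrow> (Q, P, \<alpha>) \<in> triples" for P Q :: "'a \<Rightarrow> nat" and \<alpha>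
    by (auto simp: triples_def)
  have "hbound \<epsilon> M (swap_coeffs a)" if "hbound \<epsilon> M a" for \<epsilon> M
    using that t by (fastforce simp: hbound_def swap_coeffs_def level_def)
  moreover have "\<forall>\<tau>. \<tau> \<notin> triples \<longrightarrow> swap_coeffs a \<tau> = 0"
    using hat_outside [OF assms] t by (simp add: swap_coeffs_def split_paired_all)
  ultimately show ?thesis using assms unfolding hat_coeffs_iff by blast
qed

lemma bij_ctr: "bij_betw (\<lambda>(P, Q, \<alpha>). (Q, P, \<alpha>)) triples (triples :: 'n::finite triple set)"
  by (rule bij_betwI [of _ _ _ "\<lambda>(P, Q, \<alpha>). (Q, P, \<alpha>)"]) (auto simp: triples_def)

lemma yfun_cj [simp]: "yfun (cnj_vec z) = yfun z"
  by (simp add: yfun_def)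

lemma fbasis_cj: "fbasis \<h> (Q, P, \<alpha>) (cnj_vec z) = fbasis \<h> (P, Q, \<alpha>) z"
  by (simp add: fbasis_def pos_cone_def mult_ac)

lemma fseries_ctr: "fseries \<h> (swap_coeffs a) z = fseries \<h> a (cnj_vec z)"
  unfolding fseries_def
  using infsum_reindex_bij_betw [OF bij_ctr, of "\<lambda>\<tau>. a \<tau> * fbasis \<h> \<tau> (cnj_vec z)"]
  by (simp add: case_prod_unfold fbasis_cj swap_coeffs_def) 

lemma ctr_al: "list_coeff (swap_coeffs a) I J = list_coeff a J I"
  by (simp add: list_coeff_def swap_coeffs_def tri_def)

lemma splits_swap: "(\<Sum>(S, T)\<leftarrow>splits xs. F S T) = (\<Sum>(S, T)\<leftarrow>splits xs. (F T S :: complex))"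
proof (induction xs arbitrary: F)
  case (Cons x xs)
  show ?case
    using Cons [of "\<lambda>S T. F (x # S) T"] Cons [of "\<lambda>S T. F S (x # T)"]
    by (simp add: o_def case_prod_unfold add.commute)
qed simp

section \<open>Seminorm topologies\<close>

definition fsubspace :: "('p \<Rightarrow> complex) set \<Rightarrow> bool" where
  "fsubspace V \<longleftrightarrow> (\<lambda>z. 0) \<in> V \<and> (\<forall>a\<in>V. \<forall>b\<in>V. (\<lambda>z. a z + b z) \<in> V) \<and> (\<forall>c. \<forall>a\<in>V. (\<lambda>z. c * a z) \<in> V)"

definition fseminorm :: "('p \<Rightarrow> complex) set \<Rightarrow> (('p \<Rightarrow> complex) \<Rightarrow> real) \<Rightarrow> bool" where
  "fseminorm V p \<longleftrightarrow> (\<forall>a\<in>V. 0 \<le> p a) \<and> (\<forall>a\<in>V. \<forall>b\<in>V. p (\<lambda>z. a z + b z) \<le> p a + p b) \<and>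
     (\<forall>c. \<forall>a\<in>V. p (\<lambda>z. c * a z) = cmod c * p a)"

lemma continuous_seminorm_alt:
  "continuous_seminorm V T p \<longleftrightarrow> fseminorm V p \<and> continuous_map T euclideanreal p"
  by (auto simp: continuous_seminorm_def fseminorm_def)

lemma fsubspaceD:
  assumes "fsubspace V"
  shows "(\<lambda>z. 0) \<in> V" "a \<in> V \<Longrightarrow> b \<in> V \<Longrightarrow> (\<lambda>z. a z + b z) \<in> V" "a \<in> V \<Longrightarrow> (\<lambda>z. c * a z) \<in> V"
    "a \<in> V \<Longrightarrow> b \<in> V \<Longrightarrow> (\<lambda>z. a z - b z) \<in> V"
proof -
  show *: "(\<lambda>z. 0) \<in> V" "\<And>a b. a \<in> V \<Longrightarrow> b \<in> V \<Longrightarrow> (\<lambda>z. a z + b z) \<in> V"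
    "\<And>a c. a \<in> V \<Longrightarrow> (\<lambda>z. c * a z) \<in> V"
    using assms by (auto simp: fsubspace_def)
  show "a \<in> V \<Longrightarrow> b \<in> V \<Longrightarrow> (\<lambda>z. a z - b z) \<in> V"
    using *(2) [OF _ *(3) [of b "-1"], of a] by simp
qed

lemma fseminormD:
  assumes "fseminorm V p"
  shows "a \<in> V \<Longrightarrow> 0 \<le> p a" "a \<in> V \<Longrightarrow> b \<in> V \<Longrightarrow> p (\<lambda>z. a z + b z) \<le> p a + p b"
    "a \<in> V \<Longrightarrow> p (\<lambda>z. c * a z) = cmod c * p a"
  using assms by (auto simp: fseminorm_def)

lemma fseminorm_triangle:
  assumes "fsubspace V" "fseminorm V p" "a \<in> V" "b \<in> V" "c \<in> V"
  shows "p (\<lambda>z. a z - c z) \<le> p (\<lambda>z. a z - b z) + p (\<lambda>z. b z - c z)"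
  using fseminormD(2) [OF assms(2) fsubspaceD(4) [OF assms(1,3,4)] fsubspaceD(4) [OF assms(1,4,5)]] by simp

lemma fseminorm_0:
  assumes "fsubspace V" "fseminorm V p"
  shows "p (\<lambda>z. 0) = 0"
  using fseminormD(3) [OF assms(2) fsubspaceD(1) [OF assms(1)], of 0] by simp

lemma fseminorm_minus:
  assumes "fsubspace V" "fseminorm V p" "a \<in> V" "b \<in> V"
  shows "p (\<lambda>z. a z - b z) = p (\<lambda>z. b z - a z)"
  using fseminormD(3) [OF assms(2) fsubspaceD(4) [OF assms(1,4,3)], of "-1"] by simp

lemma fseminorm_diff:
  assumes "fsubspace V" "fseminorm V p" "a \<in> V" "b \<in> V"
  shows "\<bar>p a - p b\<bar> \<le> p (\<lambda>z. a z - b z)"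
proof -
  have "p a \<le> p (\<lambda>z. a z - b z) + p b"
    using fseminorm_triangle [OF assms(1-4) fsubspaceD(1) [OF assms(1)]] by simp
  moreover have "p b \<le> p (\<lambda>z. a z - b z) + p a"
    using fseminorm_triangle [OF assms(1,2,4,3) fsubspaceD(1) [OF assms(1)]]
      fseminorm_minus [OF assms] by simp
  ultimately show ?thesis by linarith
qed

lemma openin_seminorm_ball:
  assumes "p \<in> \<P>" "a \<in> V" "0 < r"
  shows "openin (seminorm_topology V \<P>) {x \<in> V. p (\<lambda>z. x z - a z) < r}"
  unfolding seminorm_topology_def
  by (rule topology_generated_by_Basis) (use assms in blast)

lemma topspace_seminorm_topology:
  assumes "fsubspace V" "\<P> \<noteq> {}" "\<And>p. p \<in> \<P> \<Longrightarrow> fseminorm V p"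
  shows "topspace (seminorm_topology V \<P>) = V"
proof
  show "topspace (seminorm_topology V \<P>) \<subseteq> V"
    unfolding seminorm_topology_def topology_generated_by_topspace by auto
  obtain p where p: "p \<in> \<P>" using assms by blast
  show "V \<subseteq> topspace (seminorm_topology V \<P>)"
  proof
    fix a assume a: "a \<in> V"
    have "a \<in> {x \<in> V. p (\<lambda>z. x z - a z) < 1}"
      using a fseminorm_0 [OF assms(1) assms(3) [OF p]] by simp
    then show "a \<in> topspace (seminorm_topology V \<P>)"
      using openin_subset [OF openin_seminorm_ball [OF p a zero_less_one]] by auto
  qed
qed

text \<open>The ball around \<open>a\<close> contains the ball around \<open>b\<close> of radius
  \<open>r - p (b - a)\<close> by the triangle inequality; finite intersections then give a
  neighbourhood base from the generating sets.\<close>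

lemma openin_seminormD:
  assumes "fsubspace V" "\<And>p. p \<in> \<P> \<Longrightarrow> fseminorm V p" "openin (seminorm_topology V \<P>) U" "b \<in> U"
  shows "b \<in> V \<and> (\<exists>Q r. finite Q \<and> Q \<subseteq> \<P> \<and> 0 < r \<and> {x \<in> V. \<forall>p\<in>Q. p (\<lambda>z. x z - b z) < r} \<subseteq> U)"
proof -
  have "generate_topology_on {{x \<in> V. p (\<lambda>z. x z - a z) < r} | p a r. p \<in> \<P> \<and> a \<in> V \<and> 0 < r} U"
    using assms(3) unfolding seminorm_topology_def openin_topology_generated_by_iff .
  then show ?thesis using assms(4)
  proof (induction arbitrary: b rule: generate_topology_on.induct)
    case Empty
    then show ?case by simp
  next
    case (Int A B)
    obtain Q r where Q: "finite Q" "Q \<subseteq> \<P>" "0 < r" "{x \<in> V. \<forall>p\<in>Q. p (\<lambda>z. x z - b z) < r} \<subseteq> A" and b: "b \<in> V"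
      using Int.IH(1) [of b] Int.prems by blast
    obtain Q' r' where Q': "finite Q'" "Q' \<subseteq> \<P>" "0 < r'" "{x \<in> V. \<forall>p\<in>Q'. p (\<lambda>z. x z - b z) < r'} \<subseteq> B"
      using Int.IH(2) [of b] Int.prems by blast
    have "{x \<in> V. \<forall>p\<in>Q \<union> Q'. p (\<lambda>z. x z - b z) < min r r'} \<subseteq> A \<inter> B"
      using Q(4) Q'(4) by auto
    then show ?case using b Q(1-3) Q'(1-3)
      by (intro conjI exI [of _ "Q \<union> Q'"] exI [of _ "min r r'"]) auto
  next
    case (UN K)
    then obtain k where "k \<in> K" "b \<in> k" by blast
    from UN.IH [OF this] \<open>k \<in> K\<close> show ?case
      by (meson Sup_upper subset_trans)
  next
    case (Basis S)
    then obtain p a r where S: "S = {x \<in> V. p (\<lambda>z. x z - a z) < r}" "p \<in> \<P>" "a \<in> V" "0 < r" by blast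
    have b: "b \<in> V" "p (\<lambda>z. b z - a z) < r" using Basis S by auto
    have "{x \<in> V. \<forall>q\<in>{p}. q (\<lambda>z. x z - b z) < r - p (\<lambda>z. b z - a z)} \<subseteq> S"
      using fseminorm_triangle [OF assms(1) assms(2) [OF S(2)] _ b(1) S(3)] by (force simp: S(1))
    then show ?case using b S(2)
      by (intro conjI exI [of _ "{p}"] exI [of _ "r - p (\<lambda>z. b z - a z)"]) auto
  qed
qed

lemma limitin_seminorm:
  assumes "fsubspace V" "\<P> \<noteq> {}" "\<And>p. p \<in> \<P> \<Longrightarrow> fseminorm V p"
  shows "limitin (seminorm_topology V \<P>) X b F \<longleftrightarrow>
    b \<in> V \<and> (\<forall>\<^sub>F t in F. X t \<in> V) \<and> (\<forall>p\<in>\<P>. \<forall>r>0. \<forall>\<^sub>F t in F. p (\<lambda>z. X t z - b z) < r)"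
proof
  assume l: "limitin (seminorm_topology V \<P>) X b F"
  have b: "b \<in> V" using limitin_topspace [OF l] topspace_seminorm_topology [OF assms] by simp
  have ev: "\<forall>\<^sub>F t in F. X t \<in> {x \<in> V. p (\<lambda>z. x z - b z) < r}" if "p \<in> \<P>" "r > 0" for p r
    using l openin_seminorm_ball [OF that(1) b that(2)] b fseminorm_0 [OF assms(1) assms(3) [OF that(1)]] that
    unfolding limitin_def by fastforce
  obtain p where "p \<in> \<P>" using assms by blast
  show "b \<in> V \<and> (\<forall>\<^sub>F t in F. X t \<in> V) \<and> (\<forall>p\<in>\<P>. \<forall>r>0. \<forall>\<^sub>F t in F. p (\<lambda>z. X t z - b z) < r)"
  proof (intro conjI ballI allI impI b)
    show "\<forall>\<^sub>F t in F. X t \<in> V"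
      using ev [OF \<open>p \<in> \<P>\<close> zero_less_one] by (rule eventually_mono) simp
    fix p and r :: real assume "p \<in> \<P>" "0 < r"
    from ev [OF this] show "\<forall>\<^sub>F t in F. p (\<lambda>z. X t z - b z) < r"
      by (rule eventually_mono) simp
  qed
next
  assume r: "b \<in> V \<and> (\<forall>\<^sub>F t in F. X t \<in> V) \<and> (\<forall>p\<in>\<P>. \<forall>r>0. \<forall>\<^sub>F t in F. p (\<lambda>z. X t z - b z) < r)"
  show "limitin (seminorm_topology V \<P>) X b F"
    unfolding limitin_def
  proof (intro conjI allI impI)
    show "b \<in> topspace (seminorm_topology V \<P>)" using r topspace_seminorm_topology [OF assms] by simp
    fix U assume U: "openin (seminorm_topology V \<P>) U \<and> b \<in> U"
    have "\<exists>Q s. finite Q \<and> Q \<subseteq> \<P> \<and> 0 < s \<and> {x \<in> V. \<forall>p\<in>Q. p (\<lambda>z. x z - b z) < s} \<subseteq> U"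
      by (rule conjunct2 [OF openin_seminormD [OF assms(1)]]) (use assms(3) U in auto)
    then obtain Q s where Q: "finite Q" "Q \<subseteq> \<P>" "0 < s" "{x \<in> V. \<forall>p\<in>Q. p (\<lambda>z. x z - b z) < s} \<subseteq> U"
      by blast
    have "\<forall>\<^sub>F t in F. \<forall>p\<in>Q. p (\<lambda>z. X t z - b z) < s"
      using Q r by (intro eventually_ball_finite) auto
    with r have "\<forall>\<^sub>F t in F. X t \<in> V \<and> (\<forall>p\<in>Q. p (\<lambda>z. X t z - b z) < s)"
      by (auto intro: eventually_conj)
    then show "\<forall>\<^sub>F t in F. X t \<in> U" by eventually_elim (use Q(4) in auto)
  qed
qed

lemma continuous_map_into_seminorm:
  assumes "fsubspace V" "\<P> \<noteq> {}" "\<And>p. p \<in> \<P> \<Longrightarrow> fseminorm V p"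
    and "\<And>x. x \<in> topspace X \<Longrightarrow> f x \<in> V"
    and "\<And>x p r. x \<in> topspace X \<Longrightarrow> p \<in> \<P> \<Longrightarrow> 0 < r \<Longrightarrow>
      \<exists>U. openin X U \<and> x \<in> U \<and> (\<forall>y\<in>U. p (\<lambda>z. f y z - f x z) < r)"
  shows "continuous_map X (seminorm_topology V \<P>) f"
proof -
  have "openin X (f -` S \<inter> topspace X)"
    if "S \<in> {{x \<in> V. p (\<lambda>z. x z - a z) < r} | p a r. p \<in> \<P> \<and> a \<in> V \<and> 0 < r}" for S
  proof -
    from that obtain p a r where S: "S = {x \<in> V. p (\<lambda>z. x z - a z) < r}" "p \<in> \<P>" "a \<in> V" by blast
    show ?thesis
      unfolding openin_subopen [of X "f -` S \<inter> topspace X"]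
    proof
      fix x assume x: "x \<in> f -` S \<inter> topspace X"
      define s where "s = r - p (\<lambda>z. f x z - a z)"
      have fx: "f x \<in> V" and "s > 0" using x S by (auto simp: s_def)
      then obtain U where U: "openin X U" "x \<in> U" "\<forall>y\<in>U. p (\<lambda>z. f y z - f x z) < s"
        using assms(5) [of x p s] x S by blast
      have "U \<subseteq> f -` S \<inter> topspace X"
      proof
        fix y assume y: "y \<in> U"
        then have "y \<in> topspace X" using openin_subset [OF U(1)] by blast
        then show "y \<in> f -` S \<inter> topspace X"
          using fseminorm_triangle [OF assms(1) assms(3) [OF S(2)] assms(4) fx S(3), of y] U(3) y assms(4)
          by (force simp: S(1) s_def)
      qed
      then show "\<exists>T. openin X T \<and> x \<in> T \<and> T \<subseteq> f -` S \<inter> topspace X" using U by blast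
    qed
  qed
  moreover have "topspace (seminorm_topology V \<P>) = V"
    by (rule topspace_seminorm_topology [OF assms(1-3)])
  then have "\<Union> {{x \<in> V. p (\<lambda>z. x z - a z) < r} | p a r. p \<in> \<P> \<and> a \<in> V \<and> 0 < r} = V"
    unfolding seminorm_topology_def topology_generated_by_topspace .
  then have "f \<in> topspace X \<rightarrow> \<Union> {{x \<in> V. p (\<lambda>z. x z - a z) < r} | p a r. p \<in> \<P> \<and> a \<in> V \<and> 0 < r}"
    using assms(4) by (simp only:) simp
  ultimately show ?thesis
    unfolding seminorm_topology_def continuous_on_generated_topo_iff image_subset_iff_funcset
    by (intro conjI allI impI)
qed

lemma continuous_map_linear_seminorm:
  assumes "fsubspace V" "\<P> \<noteq> {}" "\<And>p. p \<in> \<P> \<Longrightarrow> fseminorm V p"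
    and f: "\<And>a. a \<in> V \<Longrightarrow> f a \<in> V" "\<And>a b. a \<in> V \<Longrightarrow> b \<in> V \<Longrightarrow> f (\<lambda>z. a z - b z) = (\<lambda>z. f a z - f b z)"
    and bound: "\<And>p. p \<in> \<P> \<Longrightarrow> \<exists>q\<in>\<P>. \<exists>C\<ge>0. \<forall>a\<in>V. p (f a) \<le> C * q a"
  shows "continuous_map (seminorm_topology V \<P>) (seminorm_topology V \<P>) f"
proof (rule continuous_map_into_seminorm [OF assms(1-3)])
  fix x p and r :: real
  assume x: "x \<in> topspace (seminorm_topology V \<P>)" and p: "p \<in> \<P>" and r: "0 < r"
  have xV: "x \<in> V" using x topspace_seminorm_topology [OF assms(1-3)] by simp
  obtain q C where q: "q \<in> \<P>" "C \<ge> 0" "\<forall>a\<in>V. p (f a) \<le> C * q a" using bound [OF p] by blast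
  have pos: "0 < r / (C + 1)" using q r by simp
  let ?U = "{y \<in> V. q (\<lambda>z. y z - x z) < r / (C + 1)}"
  have "p (\<lambda>z. f y z - f x z) < r" if y: "y \<in> ?U" for y
  proof -
    have yV: "y \<in> V" and qy: "q (\<lambda>z. y z - x z) < r / (C + 1)" using y by auto
    have "p (\<lambda>z. f y z - f x z) \<le> C * q (\<lambda>z. y z - x z)"
      using q(3) fsubspaceD(4) [OF assms(1) yV xV] f(2) [OF yV xV] by metis
    also have "\<dots> \<le> (C + 1) * q (\<lambda>z. y z - x z)"
      using fseminormD(1) [OF assms(3) [OF q(1)] fsubspaceD(4) [OF assms(1) yV xV]]
      by (intro mult_right_mono) auto
    also have "\<dots> < r" using qy q(2) by (simp add: field_simps)
    finally show ?thesis .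
  qed
  then show "\<exists>U. openin (seminorm_topology V \<P>) U \<and> x \<in> U \<and> (\<forall>y\<in>U. p (\<lambda>z. f y z - f x z) < r)"
    using openin_seminorm_ball [OF q(1) xV pos] xV fseminorm_0 [OF assms(1) assms(3) [OF q(1)]] pos
    by (intro exI [of _ ?U]) auto
qed (use f topspace_seminorm_topology [OF assms(1-3)] in auto)

lemma continuous_map_translation:
  assumes "fsubspace V" "\<P> \<noteq> {}" "\<And>p. p \<in> \<P> \<Longrightarrow> fseminorm V p" "a \<in> V"
  shows "continuous_map (seminorm_topology V \<P>) (seminorm_topology V \<P>) (\<lambda>x z. x z - a z)"
proof (rule continuous_map_into_seminorm [OF assms(1-3)])
  fix x p and r :: real
  assume x: "x \<in> topspace (seminorm_topology V \<P>)" and p: "p \<in> \<P>" and r: "0 < r"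
  have xV: "x \<in> V" using x topspace_seminorm_topology [OF assms(1-3)] by simp
  then show "\<exists>U. openin (seminorm_topology V \<P>) U \<and> x \<in> U \<and> (\<forall>y\<in>U. p (\<lambda>z. (y z - a z) - (x z - a z)) < r)"
    using openin_seminorm_ball [OF p xV r] fseminorm_0 [OF assms(1) assms(3) [OF p]] r
    by (intro exI [of _ "{y \<in> V. p (\<lambda>z. y z - x z) < r}"]) auto
qed (use fsubspaceD(4) [OF assms(1)] assms(4) topspace_seminorm_topology [OF assms(1-3)] in auto)

section \<open>The topological algebra on the cone\<close>

lemma eps_norm_le:
  assumes "\<h> \<noteq> 0" "c \<in> hat_coeffs" "hbound \<epsilon> M c"
  shows "eps_norm \<h> \<epsilon> (fseries \<h> c) \<le> M"
proof -
  have "(triples :: 'a triple set) \<noteq> {}" using tri_triples [of "[]" "[]"] by blast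
  then show ?thesis
    unfolding eps_norm_def fcoeffs_fseries [OF assms(1,2)]
    by (rule cSUP_least) (use assms(3) in \<open>force simp: hbound_def level_def field_simps\<close>)
qed

lemma hbound_eps_norm:
  assumes "\<h> \<noteq> 0" "c \<in> hat_coeffs" "0 < \<epsilon>" "\<epsilon> < 1"
  shows "hbound \<epsilon> (eps_norm \<h> \<epsilon> (fseries \<h> c)) c"
  unfolding hbound_def
proof
  fix \<tau> :: "'a triple" assume \<tau>: "\<tau> \<in> triples"
  have "bdd_above ((\<lambda>(P, Q, \<alpha>). cmod (c (P, Q, \<alpha>)) / fact \<alpha> powr \<epsilon>) ` triples)"
    using assms by (auto simp: hat_coeffs_def)
  from cSUP_upper [OF \<tau> this]
  have "norm (c \<tau>) / fact (level \<tau>) powr \<epsilon> \<le> eps_norm \<h> \<epsilon> (fseries \<h> c)"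
    unfolding eps_norm_def fcoeffs_fseries [OF assms(1,2)] by (simp add: level_def case_prod_unfold)
  then show "norm (c \<tau>) \<le> eps_norm \<h> \<epsilon> (fseries \<h> c) * fact (level \<tau>) powr \<epsilon>"
    by (simp add: field_simps)
qed

lemma eps_norm_nonneg:
  assumes "\<h> \<noteq> 0" "c \<in> hat_coeffs" "0 < \<epsilon>" "\<epsilon> < 1"
  shows "0 \<le> eps_norm \<h> \<epsilon> (fseries \<h> (c :: 'n::finite triple \<Rightarrow> complex))"
proof -
  have "norm (c (tri [] [])) \<le> eps_norm \<h> \<epsilon> (fseries \<h> c) * fact (level (tri [] [] :: 'n triple)) powr \<epsilon>"
    using hbound_eps_norm [OF assms] tri_triples [of "[]" "[]"] unfolding hbound_def by blast
  then show ?thesis by (simp add: order_trans [OF norm_ge_zero])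
qed

lemma fsubspace_cone: "fsubspace (cone_alg \<h>)"
  unfolding fsubspace_def cone_alg_def
proof (intro conjI ballI allI)
  have "fseries \<h> (\<lambda>\<tau>::'a triple. 0) = (\<lambda>z. 0)" by (simp add: fun_eq_iff fseries_def)
  then show "(\<lambda>z. 0) \<in> fseries \<h> ` (hat_coeffs :: ('a triple \<Rightarrow> complex) set)"
    by (metis hat_0 imageI)
next
  fix a b :: "'a cvec \<Rightarrow> complex" assume "a \<in> fseries \<h> ` hat_coeffs" "b \<in> fseries \<h> ` hat_coeffs"
  then show "(\<lambda>z. a z + b z) \<in> fseries \<h> ` hat_coeffs"
    by (auto simp: fseries_add [symmetric] intro: hat_add)
next
  fix c and a :: "'a cvec \<Rightarrow> complex" assume "a \<in> fseries \<h> ` hat_coeffs"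
  then show "(\<lambda>z. c * a z) \<in> fseries \<h> ` hat_coeffs"
    by (auto simp: fseries_scale [symmetric] intro: hat_scale)
qed

lemma hbound_add: "hbound \<epsilon> M a \<Longrightarrow> hbound \<epsilon> N b \<Longrightarrow> hbound \<epsilon> (M + N) (\<lambda>\<tau>. a \<tau> + b \<tau>)"
  unfolding hbound_def distrib_right by (auto intro!: norm_triangle_mono)

lemma hbound_mono: "hbound \<epsilon> M a \<Longrightarrow> M \<le> N \<Longrightarrow> hbound \<epsilon> N a"
  unfolding hbound_def by (meson mult_right_mono order_trans powr_ge_zero)

lemma hbound_mono_exp:
  assumes "hbound \<epsilon> M a" "\<epsilon> \<le> \<delta>" "M \<ge> 0"
  shows "hbound \<delta> M a"
  unfolding hbound_def
proof
  fix \<tau> :: "'a triple" assume "\<tau> \<in> triples"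
  then have "norm (a \<tau>) \<le> M * fact (level \<tau>) powr \<epsilon>" using assms by (simp add: hbound_def)
  also have "\<dots> \<le> M * fact (level \<tau>) powr \<delta>"
    using assms by (intro mult_left_mono powr_mono) (auto simp: fact_ge_1)
  finally show "norm (a \<tau>) \<le> M * fact (level \<tau>) powr \<delta>" .
qed

lemma fseminorm_eps:
  assumes "\<h> \<noteq> 0" "0 < \<epsilon>" "\<epsilon> < 1"
  shows "fseminorm (cone_alg \<h>) (eps_norm \<h> \<epsilon> :: ('n::finite cvec \<Rightarrow> complex) \<Rightarrow> real)"
proof -
  have scale: "eps_norm \<h> \<epsilon> (\<lambda>z. x * fseries \<h> c z) \<le> cmod x * eps_norm \<h> \<epsilon> (fseries \<h> c)"
    if c: "c \<in> hat_coeffs" for x and c :: "'n triple \<Rightarrow> complex"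
    unfolding fseries_scale [symmetric]
    by (rule eps_norm_le [OF assms(1) hat_scale [OF c]]) (rule hbound_scale [OF hbound_eps_norm [OF assms(1) c assms(2,3)]])
  have "eps_norm \<h> \<epsilon> (\<lambda>z. x * fseries \<h> c z) = cmod x * eps_norm \<h> \<epsilon> (fseries \<h> c)"
    if c: "c \<in> hat_coeffs" for x and c :: "'n triple \<Rightarrow> complex"
  proof (cases "x = 0")
    case True
    then show ?thesis
      using scale [OF c, of x] eps_norm_nonneg [OF assms(1) hat_scale [OF c, of 0] assms(2,3)]
      by (simp add: fseries_scale [of \<h> 0, simplified])
  next
    case False
    \<comment> \<open>Scaling by the inverse turns the inequality \<open>scale\<close>
      around.\<close>
    have "eps_norm \<h> \<epsilon> (\<lambda>z. inverse x * fseries \<h> (\<lambda>\<tau>. x * c \<tau>) z) \<le> cmod (inverse x) * eps_norm \<h> \<epsilon> (fseries \<h> (\<lambda>\<tau>. x * c \<tau>))"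
      by (rule scale [OF hat_scale [OF c]])
    then have "cmod x * eps_norm \<h> \<epsilon> (fseries \<h> c) \<le> eps_norm \<h> \<epsilon> (\<lambda>z. x * fseries \<h> c z)"
      using False by (simp add: fseries_scale norm_divide field_simps)
    with scale [OF c, of x] show ?thesis by simp
  qed
  moreover have "eps_norm \<h> \<epsilon> (\<lambda>z. fseries \<h> c z + fseries \<h> d z) \<le> eps_norm \<h> \<epsilon> (fseries \<h> c) + eps_norm \<h> \<epsilon> (fseries \<h> d)"
    if c: "c \<in> hat_coeffs" "d \<in> hat_coeffs" for c d :: "'n triple \<Rightarrow> complex"
    unfolding fseries_add [OF c, symmetric]
    by (intro eps_norm_le assms hat_add c hbound_add hbound_eps_norm)
  ultimately show ?thesis
    using eps_norm_nonneg [OF assms(1) _ assms(2,3)] by (auto simp: fseminorm_def cone_alg_def)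
qed

lemma cone_topology_facts:
  assumes "\<h> \<noteq> 0"
  shows "fsubspace (cone_alg \<h> :: ('n::finite cvec \<Rightarrow> complex) set)"
    "(eps_norm \<h> ` {0<..<1} :: (('n cvec \<Rightarrow> complex) \<Rightarrow> real) set) \<noteq> {}"
    "p \<in> (eps_norm \<h> ` {0<..<1} :: (('n cvec \<Rightarrow> complex) \<Rightarrow> real) set) \<Longrightarrow> fseminorm (cone_alg \<h>) p"
proof -
  have "(1/2 :: real) \<in> {0<..<1}" by simp
  then show "(eps_norm \<h> ` {0<..<1} :: (('n cvec \<Rightarrow> complex) \<Rightarrow> real) set) \<noteq> {}" by blast
qed (use fsubspace_cone fseminorm_eps [OF assms] in auto)

lemma topspace_cone_top: "\<h> \<noteq> 0 \<Longrightarrow> topspace (cone_top \<h>) = cone_alg \<h>"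
  unfolding cone_top_def by (rule topspace_seminorm_topology; rule cone_topology_facts)

lemma limitin_cone_top:
  assumes "\<h> \<noteq> 0"
  shows "limitin (cone_top \<h>) X b F \<longleftrightarrow> b \<in> cone_alg \<h> \<and> (\<forall>\<^sub>F t in F. X t \<in> cone_alg \<h>) \<and>
    (\<forall>p\<in>eps_norm \<h> ` {0<..<1}. \<forall>r>0. \<forall>\<^sub>F t in F. p (\<lambda>z. X t z - b z) < r)"
  unfolding cone_top_def
  by (rule limitin_seminorm) (use cone_topology_facts [OF assms] in auto)

lemma limitin_cone_topI:
  fixes d :: "'n::finite triple \<Rightarrow> complex"
  assumes "\<h> \<noteq> 0" "d \<in> hat_coeffs" "\<forall>\<^sub>F t in F. c t \<in> hat_coeffs"
    and "\<And>\<epsilon> r. 0 < \<epsilon> \<Longrightarrow> \<epsilon> < 1 \<Longrightarrow> 0 < r \<Longrightarrow> \<forall>\<^sub>F t in F. hbound \<epsilon> r (\<lambda>\<tau>. c t \<tau> - d \<tau>)"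
  shows "limitin (cone_top \<h>) (\<lambda>t. fseries \<h> (c t)) (fseries \<h> d) F"
  unfolding limitin_cone_top [OF assms(1)]
proof (intro conjI ballI allI impI)
  show "fseries \<h> d \<in> cone_alg \<h>" using assms by (simp add: cone_alg_def)
  show "\<forall>\<^sub>F t in F. fseries \<h> (c t) \<in> cone_alg \<h>"
    using assms(3) by eventually_elim (simp add: cone_alg_def)
  fix p :: "('n cvec \<Rightarrow> complex) \<Rightarrow> real" and r :: real assume "p \<in> eps_norm \<h> ` {0<..<1}" "0 < r"
  then obtain \<epsilon> where \<epsilon>: "p = eps_norm \<h> \<epsilon>" "0 < \<epsilon>" "\<epsilon> < 1" by auto
  show "\<forall>\<^sub>F t in F. p (\<lambda>z. fseries \<h> (c t) z - fseries \<h> d z) < r"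
    using assms(3) assms(4) [OF \<epsilon>(2,3) half_gt_zero [OF \<open>0 < r\<close>]]
  proof eventually_elim
    case (elim t)
    then show ?case
      using eps_norm_le [OF assms(1) hat_diff [OF elim(1) assms(2)] elim(2)] \<open>0 < r\<close>
      by (simp add: \<epsilon>(1) fseries_diff [OF elim(1) assms(2)])
  qed
qed

lemma limitin_cone_topD:
  assumes "\<h> \<noteq> 0" "limitin (cone_top \<h>) (\<lambda>t. fseries \<h> (c t)) (fseries \<h> d) F"
    and "d \<in> hat_coeffs" "\<And>t. c t \<in> hat_coeffs" "0 < \<epsilon>" "\<epsilon> < 1" "0 < r"
  shows "\<forall>\<^sub>F t in F. hbound \<epsilon> r (\<lambda>\<tau>. c t \<tau> - d \<tau>)"
proof -
  have "\<forall>\<^sub>F t in F. eps_norm \<h> \<epsilon> (\<lambda>z. fseries \<h> (c t) z - fseries \<h> d z) < r"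
    using assms(2,5-) unfolding limitin_cone_top [OF assms(1)] by auto
  then show ?thesis
  proof eventually_elim
    case (elim t)
    then show ?case
      using hbound_eps_norm [OF assms(1) hat_diff [OF assms(4,3), of t] assms(5,6)]
      by (auto simp: fseries_diff [OF assms(4,3)] intro: hbound_mono)
  qed
qed

text \<open>Point evaluations are continuous already in the seminorm of exponent 1/2, because
  \<open>fbasis\<close> decays like a full factorial. Limits and identities can therefore be tested
  pointwise.\<close>

lemma eval_bound:
  fixes z :: "'n::finite cvec"
  shows "\<exists>C\<ge>0. \<forall>c M. c \<in> hat_coeffs \<and> M \<ge> 0 \<and> hbound (1/2) M c \<longrightarrow> norm (fseries \<h> c z) \<le> C * M"
proof -
  obtain K where K: "K \<ge> 0" "\<And>\<tau>. \<tau> \<in> triples \<Longrightarrow> norm (fbasis \<h> \<tau> z) \<le> K ^ level \<tau> / fact (level \<tau>)"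
    using fbasis_bound [of \<h> z] by blast
  let ?g = "\<lambda>\<tau>::'n triple. K ^ level \<tau> / fact (level \<tau>) powr (1/2)"
  have g: "?g summable_on triples" by (rule summable_on_levels) (use K in auto)
  have "norm (fseries \<h> c z) \<le> infsum ?g triples * M" if "c \<in> hat_coeffs" "M \<ge> 0" "hbound (1/2) M c" for c M
  proof -
    have *: "norm (c \<tau> * fbasis \<h> \<tau> z) \<le> M * ?g \<tau>" if "\<tau> \<in> triples" for \<tau>
    proof -
      have f: "fact (level \<tau>) = fact (level \<tau>) powr (1/2) * (fact (level \<tau>) powr (1/2) :: real)"
        by (simp flip: powr_add)
      have "norm (c \<tau> * fbasis \<h> \<tau> z) \<le> (M * fact (level \<tau>) powr (1/2)) * (K ^ level \<tau> / fact (level \<tau>))"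
        unfolding norm_mult using \<open>M \<ge> 0\<close> \<open>hbound (1/2) M c\<close> K that by (intro mult_mono) (auto simp: hbound_def)
      also have "\<dots> = M * ?g \<tau>" by (subst (2) f) simp
      finally show ?thesis .
    qed
    have "norm (fseries \<h> c z) \<le> infsum (\<lambda>\<tau>. M * ?g \<tau>) triples"
      unfolding fseries_def
      by (rule norm_infsum_le [OF has_sum_infsum [OF hat_summable [OF \<open>c \<in> hat_coeffs\<close>]]
            has_sum_infsum [OF summable_on_cmult_right [OF g]] *])
    then show ?thesis unfolding infsum_cmult_right' by (simp only: mult.commute)
  qed
  moreover have "0 \<le> infsum ?g triples" using K by (intro infsum_nonneg) auto
  ultimately show ?thesis by blast
qed

lemma limitin_cone_top_eval:
  assumes "\<h> \<noteq> 0" "limitin (cone_top \<h>) X b F"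
  shows "((\<lambda>t. X t z) \<longlongrightarrow> b z) F"
proof -
  have b: "b \<in> cone_alg \<h>" and X: "\<forall>\<^sub>F t in F. X t \<in> cone_alg \<h>"
    and ev: "\<And>r. r > 0 \<Longrightarrow> \<forall>\<^sub>F t in F. eps_norm \<h> (1/2) (\<lambda>z. X t z - b z) < r"
    using assms(2) unfolding limitin_cone_top [OF assms(1)] by auto
  obtain d where d: "d \<in> hat_coeffs" "b = fseries \<h> d" using b by (auto simp: cone_alg_def)
  obtain C where C: "C \<ge> 0" "\<And>c M. c \<in> hat_coeffs \<Longrightarrow> M \<ge> 0 \<Longrightarrow> hbound (1/2) M c \<Longrightarrow> norm (fseries \<h> c z) \<le> C * M"
    using eval_bound [of \<h> z] by blast
  show ?thesis
    unfolding tendsto_iff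
  proof (intro allI impI)
    fix e :: real assume e: "e > 0"
    have "e / (C + 1) > 0" using e C by simp
    from X ev [OF this] show "\<forall>\<^sub>F t in F. dist (X t z) (b z) < e"
    proof eventually_elim
      case (elim t)
      obtain c where c: "c \<in> hat_coeffs" "X t = fseries \<h> c" using elim by (auto simp: cone_alg_def)
      have cd: "(\<lambda>\<tau>. c \<tau> - d \<tau>) \<in> hat_coeffs" using c d hat_diff by blast
      have "norm (fseries \<h> (\<lambda>\<tau>. c \<tau> - d \<tau>) z) \<le> C * eps_norm \<h> (1/2) (fseries \<h> (\<lambda>\<tau>. c \<tau> - d \<tau>))"
        by (intro C cd eps_norm_nonneg hbound_eps_norm assms) auto
      also have "\<dots> \<le> C * (e / (C + 1))"
        using elim(2) C(1) by (intro mult_left_mono) (auto simp: c d fseries_diff [OF c(1) d(1)])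
      also have "\<dots> < e" using e C(1) by (simp add: field_simps)
      finally show ?case by (simp add: c d fseries_diff [OF c(1) d(1)] dist_norm)
    qed
  qed
qed

text \<open>The elements are functions, so continuous point evaluations separate them.\<close>

lemma limitin_cone_top_unique:
  assumes "\<h> \<noteq> 0" "limitin (cone_top \<h>) X b F" "limitin (cone_top \<h>) X c F" "F \<noteq> bot"
  shows "b = c"
proof
  fix z
  show "b z = c z"
    using tendsto_unique [OF assms(4) limitin_cone_top_eval [OF assms(1,2)] limitin_cone_top_eval [OF assms(1,3)]] .
qed

lemma hat_fin_trunc: "a \<in> hat_coeffs \<Longrightarrow> trunc N a \<in> fin_coeffs"
  by (rule trunc_fin) (rule hat_outside)

text \<open>A family bounded with exponent \<epsilon>/2 leaves another \<epsilon>/2 of the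
  factorial, which beats \<open>2 ^ n\<close>; the tail beyond level N is therefore of order 2^(-N)
  in the seminorm of exponent \<epsilon>.\<close>

lemma hbound_trunc:
  assumes "a \<in> hat_coeffs" "0 < \<epsilon>" "\<epsilon> < 1" "0 < r"
  shows "\<forall>\<^sub>F N in sequentially. hbound \<epsilon> r (\<lambda>\<tau>. trunc N a \<tau> - a \<tau>)"
proof -
  obtain M where M: "M \<ge> 0" "hbound (\<epsilon> / 2) M a" using hat_bound [OF assms(1), of "\<epsilon> / 2"] assms by auto
  obtain D where D: "D > 0" "\<And>n. (2::real) ^ n \<le> D * fact n powr (\<epsilon> / 2)"
    using power_le_fact_powr [of 2 "\<epsilon> / 2"] assms by auto
  have "(\<lambda>N. M * (D * (1 / 2) ^ N)) \<longlonglongrightarrow> M * (D * 0)"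
    by (intro tendsto_intros LIMSEQ_realpow_zero) auto
  then have "\<forall>\<^sub>F N in sequentially. M * (D * (1 / 2) ^ N) < r"
    using assms(4) by (intro order_tendstoD(2)) auto
  then show ?thesis
  proof eventually_elim
    case (elim N)
    show ?case unfolding hbound_def
    proof
      fix \<tau> :: "'a triple" assume \<tau>: "\<tau> \<in> triples"
      let ?n = "level \<tau>"
      show "norm (trunc N a \<tau> - a \<tau>) \<le> r * fact ?n powr \<epsilon>"
      proof (cases "?n \<le> N")
        case True
        then show ?thesis using assms by (simp add: trunc_def)
      next
        case False
        have "1 \<le> D * (1 / 2) ^ ?n * fact ?n powr (\<epsilon> / 2)"
          using D(2) [of ?n] by (simp add: power_divide field_simps)
        also have "\<dots> \<le> D * (1 / 2) ^ N * fact ?n powr (\<epsilon> / 2)"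
          using D(1) False by (intro mult_right_mono mult_left_mono power_decreasing) auto
        finally have 1: "1 \<le> D * (1 / 2) ^ N * fact ?n powr (\<epsilon> / 2)" .
        have "norm (trunc N a \<tau> - a \<tau>) \<le> M * fact ?n powr (\<epsilon> / 2) * 1"
          using False M(2) \<tau> by (simp add: trunc_def hbound_def)
        also have "\<dots> \<le> M * fact ?n powr (\<epsilon> / 2) * (D * (1 / 2) ^ N * fact ?n powr (\<epsilon> / 2))"
          using M(1) 1 by (intro mult_left_mono) auto
        also have "\<dots> = (M * (D * (1 / 2) ^ N)) * fact ?n powr \<epsilon>"
          by (simp flip: powr_add)
        also have "\<dots> \<le> r * fact ?n powr \<epsilon>" using elim by (intro mult_right_mono) auto
        finally show ?thesis .
      qed
    qed
  qed
qed

lemma trunc_lim: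
  assumes "\<h> \<noteq> 0" "a \<in> hat_coeffs"
  shows "limitin (cone_top \<h>) (\<lambda>N. fseries \<h> (trunc N a)) (fseries \<h> a) sequentially"
  by (rule limitin_cone_topI [OF assms]) (simp_all add: hbound_trunc [OF assms(2)] fin_hat [OF hat_fin_trunc [OF assms(2)]])

text \<open>Joint continuity from bilinearity: xy - ab = (x - a)(y - b) + (x - a) b + a (y - b),
  with every factor measured at exponent \<epsilon>/3.\<close>

lemma cprod_lim:
  assumes "\<h> \<noteq> 0" "a \<in> hat_coeffs" "b \<in> hat_coeffs" "\<And>t. x t \<in> hat_coeffs" "\<And>t. y t \<in> hat_coeffs"
    and "limitin (cone_top \<h>) (\<lambda>t. fseries \<h> (x t)) (fseries \<h> a) F"
    and "limitin (cone_top \<h>) (\<lambda>t. fseries \<h> (y t)) (fseries \<h> (b :: 'n::finite triple \<Rightarrow> complex)) F"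
  shows "limitin (cone_top \<h>) (\<lambda>t. fseries \<h> (cprod (x t) (y t))) (fseries \<h> (cprod a b)) F"
proof (rule limitin_cone_topI [OF assms(1)])
  fix \<epsilon> r :: real assume e: "0 < \<epsilon>" "\<epsilon> < 1" "0 < r"
  define \<delta> where "\<delta> = \<epsilon> / 3"
  have \<delta>: "0 < \<delta>" "\<delta> < 1" "3 * \<delta> = \<epsilon>" using e by (auto simp: \<delta>_def)
  obtain C where C: "C \<ge> 0" "\<And>M N a b. M \<ge> 0 \<Longrightarrow> N \<ge> 0 \<Longrightarrow> hbound \<delta> M a \<Longrightarrow> hbound \<delta> N b \<Longrightarrow>
      hbound \<epsilon> (C * M * N) (cprod a (b :: 'n triple \<Rightarrow> complex))"
    using hbound_cprod [OF \<delta>(1), where ?'n = 'n] \<delta>(3) by (metis (no_types, lifting))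
  obtain M where M: "M \<ge> 0" "hbound \<delta> M a" using hat_bound [OF assms(2) \<delta>(1,2)] .
  obtain N where N: "N \<ge> 0" "hbound \<delta> N b" using hat_bound [OF assms(3) \<delta>(1,2)] .
  \<comment> \<open>For s \<le> 1 the three terms of the decomposition add up to at most s D; the
    final 1 keeps D positive.\<close>
  define D where "D = C * (1 + M + N) + 1"
  define s where "s = min 1 (r / D)"
  have den: "D > 0" using C(1) M(1) N(1) by (simp add: D_def add_nonneg_pos)
  have s: "0 < s" "s \<le> 1" "s \<le> r / D" using e den by (auto simp: s_def)
  then have "s * D \<le> r" using den by (simp add: pos_le_divide_eq)
  then have sr: "C * s * s + C * s * N + C * M * s \<le> r"
    using s C(1) mult_left_mono [OF s(2), of "C * s"] by (simp add: D_def algebra_simps)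
  have X: "\<forall>\<^sub>F t in F. hbound \<delta> s (\<lambda>\<tau>. x t \<tau> - a \<tau>)" "\<forall>\<^sub>F t in F. hbound \<delta> s (\<lambda>\<tau>. y t \<tau> - b \<tau>)"
    using limitin_cone_topD [OF assms(1,6,2,4) \<delta>(1,2) s(1)] limitin_cone_topD [OF assms(1,7,3,5) \<delta>(1,2) s(1)] by auto
  then show "\<forall>\<^sub>F t in F. hbound \<epsilon> r (\<lambda>\<tau>. cprod (x t) (y t) \<tau> - cprod a b \<tau>)"
  proof eventually_elim
    case (elim t)
    have "hbound \<epsilon> (C * s * s + C * s * N + C * M * s)
      (\<lambda>\<tau>. cprod (\<lambda>\<tau>. x t \<tau> - a \<tau>) (\<lambda>\<tau>. y t \<tau> - b \<tau>) \<tau> + cprod (\<lambda>\<tau>. x t \<tau> - a \<tau>) b \<tau> + cprod a (\<lambda>\<tau>. y t \<tau> - b \<tau>) \<tau>)"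
      by (intro hbound_add C) (use s M N elim in auto)
    moreover have "(\<lambda>\<tau>. cprod (\<lambda>\<tau>. x t \<tau> - a \<tau>) (\<lambda>\<tau>. y t \<tau> - b \<tau>) \<tau> + cprod (\<lambda>\<tau>. x t \<tau> - a \<tau>) b \<tau> + cprod a (\<lambda>\<tau>. y t \<tau> - b \<tau>) \<tau>)
      = (\<lambda>\<tau>. cprod (x t) (y t) \<tau> - cprod a b \<tau>)"
      by (simp add: cprod_diff_left cprod_diff_right)
    ultimately show ?case using sr hbound_mono by metis
  qed
qed (simp_all add: cprod_hat assms(2-5))

section \<open>The map \<open>S\<close> and the given product in terms of coefficients\<close>

lemma ebasis_coeffs_unique:
  fixes \<h> :: complex and c d :: "'n::finite triple \<Rightarrow> complex"
  assumes "\<h> \<noteq> 0" "c \<in> fin_coeffs" "d \<in> fin_coeffs" "lincomb ebasis c = lincomb ebasis d"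
  shows "c = d"
proof -
  define s where "s = (\<lambda>(c :: 'n triple \<Rightarrow> complex) \<tau>. ((2 * \<h>) ^ level \<tau> * of_nat (nfac \<tau>)) * (c \<tau> :: complex))"
  have e: "lincomb ebasis c = pw \<h> (s c)" if "c \<in> fin_coeffs" for c
  proof
    fix z
    have f: "finite {\<tau>. c \<tau> \<noteq> 0}" using that by (auto simp: fin_coeffs_def)
    show "lincomb ebasis c z = pw \<h> (s c) z" unfolding pw_def
      by (subst (1 2) lincomb_superset [OF f]) (use assms(1) in \<open>auto simp: s_def intro!: sum.cong\<close>)
  qed
  have "s c \<in> fin_coeffs" "s d \<in> fin_coeffs"
    unfolding s_def using assms by (auto intro: fin_coeffs_scale)
  moreover have "pw \<h> (s c) = pw \<h> (s d)" using e [OF assms(2)] e [OF assms(3)] assms(4) by simp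
  ultimately have "s c = s d" by (rule pw_inj [OF assms(1)])
  then have "s c \<tau> = s d \<tau>" for \<tau> by simp
  then show ?thesis using assms(1) by (simp add: s_def fun_eq_iff)
qed

text \<open>On the cone \<open>sbasis\<close> is \<open>fbasis\<close> times
  \<open>(2 * \<h>) ^ level \<tau> * nfac \<tau>\<close>, the very factor divided out in
  \<open>pw\<close>.\<close>

lemma Smap_pw:
  assumes "\<h> \<noteq> 0" "c \<in> fin_coeffs"
  shows "Smap \<h> (pw \<h> c) = fseries \<h> (c :: 'n::finite triple \<Rightarrow> complex)"
proof -
  define d where "d = (\<lambda>\<tau>. (1 / ((2 * \<h>) ^ level \<tau> * of_nat (nfac \<tau>))) * c \<tau>)"
  have d: "d \<in> fin_coeffs" unfolding d_def by (rule fin_coeffs_scale [OF assms(2)])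
  have f: "finite {\<tau>. c \<tau> \<noteq> 0}" using assms(2) by (auto simp: fin_coeffs_def)
  have sub: "{\<tau>. d \<tau> \<noteq> 0} \<subseteq> {\<tau>. c \<tau> \<noteq> 0}" by (auto simp: d_def)
  have e: "pw \<h> c = lincomb ebasis d"
  proof
    fix z
    show "pw \<h> c z = lincomb ebasis d z"
      unfolding pw_def lincomb_superset [OF f sub] lincomb_def [of _ c] by (rule sum.cong) (auto simp: d_def)
  qed
  have eij_coeffs: "ecoeffs (pw \<h> c) = d"
    unfolding ecoeffs_def e
  proof (rule the_equality)
    fix c' assume "c' \<in> fin_coeffs \<and> lincomb ebasis d = lincomb ebasis c'"
    then show "c' = d" using ebasis_coeffs_unique [OF assms(1) d, of c'] by simp
  qed (use d in simp)
  have "Smap \<h> (pw \<h> c) z = fseries \<h> c z" for z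
    unfolding Smap_def eij_coeffs fseries_fin [OF assms(2)] lincomb_superset [OF f sub] lincomb_def [of _ c]
  proof (rule sum.cong)
    fix \<tau> :: "'n triple"
    obtain P Q \<alpha> where \<tau>: "\<tau> = (P, Q, \<alpha>)" by (cases \<tau>)
    show "d \<tau> * sbasis \<h> \<tau> z = c \<tau> * fbasis \<h> \<tau> z"
    proof (cases "z \<in> pos_cone")
      case True
      then have "sbasis \<h> \<tau> z = (2 * \<h>) ^ level \<tau> * of_nat (nfac \<tau>) * fbasis \<h> \<tau> z"
        by (simp add: fbasis_eq) (simp add: sbasis_def \<tau> level_def)
      then show ?thesis using assms(1) by (simp add: d_def)
    next
      case False
      then show ?thesis by (simp add: sbasis_def \<tau> fbasis_outside)
    qed
  qed simp
  then show ?thesis by auto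
qed

lemma Smap_inverse:
  assumes "\<h> \<noteq> 0" "c \<in> fin_coeffs"
  shows "inv_into inv_polys (Smap \<h>) (fseries \<h> (c :: 'n::finite triple \<Rightarrow> complex)) = pw \<h> c"
proof -
  have "inj_on (Smap \<h>) (inv_polys :: ('n cvec \<Rightarrow> complex) set)"
  proof (rule inj_onI)
    fix f g :: "'n cvec \<Rightarrow> complex" assume fg: "f \<in> inv_polys" "g \<in> inv_polys" "Smap \<h> f = Smap \<h> g"
    obtain a b where ab: "a \<in> fin_coeffs" "f = pw \<h> a" "b \<in> fin_coeffs" "g = pw \<h> b"
      using pw_surj [OF assms(1) fg(1)] pw_surj [OF assms(1) fg(2)] by metis
    then have "fseries \<h> a = fseries \<h> b" using fg(3) by (simp add: Smap_pw [OF assms(1)])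
    then show "f = g" using fseries_inj [OF assms(1) fin_hat fin_hat] ab by blast
  qed
  from inv_into_f_f [OF this pw_inv_polys [OF assms(2), of \<h>]] show ?thesis
    by (simp add: Smap_pw [OF assms])
qed

lemma cone_mult0_fseries:
  assumes "\<h> \<noteq> 0" "a \<in> fin_coeffs" "b \<in> fin_coeffs"
  shows "cone_mult0 \<h> (fseries \<h> a) (fseries \<h> b) = fseries \<h> (cprod a b)"
  unfolding cone_mult0_def Smap_inverse [OF assms(1,2)] Smap_inverse [OF assms(1,3)]
  using wick_pw [OF assms] Smap_pw [OF assms(1)] by metis

lemma cone_alg0_fseries: "cone_alg0 \<h> = fseries \<h> ` fin_coeffs"
  unfolding cone_alg0_def using fseries_fin by (metis (no_types, lifting) image_cong)

text \<open>\<open>cprod_lim\<close> shows that the candidate satisfies the defining condition;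
  uniqueness follows by testing a competitor on one pair of approximating sequences.\<close>

lemma cone_mult_fseries:
  assumes "\<h> \<noteq> 0" "a \<in> hat_coeffs" "b \<in> hat_coeffs"
  shows "cone_mult \<h> (fseries \<h> a) (fseries \<h> b) = fseries \<h> (cprod a b)"
  unfolding cone_mult_def
proof (rule the_equality)
  have "limitin (cone_top \<h>) (\<lambda>k. cone_mult0 \<h> (X k) (Y k)) (fseries \<h> (cprod a b)) sequentially"
    if XY: "range X \<subseteq> cone_alg0 \<h>" "range Y \<subseteq> cone_alg0 \<h>"
      "limitin (cone_top \<h>) X (fseries \<h> a) sequentially" "limitin (cone_top \<h>) Y (fseries \<h> b) sequentially" for X Y
  proof -
    have "\<forall>k. \<exists>x\<in>fin_coeffs. X k = fseries \<h> x" using XY(1) unfolding cone_alg0_fseries by blast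
    then obtain x where x: "\<And>k. x k \<in> fin_coeffs" "\<And>k. X k = fseries \<h> (x k)" by metis
    have "\<forall>k. \<exists>y\<in>fin_coeffs. Y k = fseries \<h> y" using XY(2) unfolding cone_alg0_fseries by blast
    then obtain y where y: "\<And>k. y k \<in> fin_coeffs" "\<And>k. Y k = fseries \<h> (y k)" by metis
    have X: "X = (\<lambda>k. fseries \<h> (x k))" "Y = (\<lambda>k. fseries \<h> (y k))" using x y by auto
    show ?thesis
      using cprod_lim [OF assms fin_hat [OF x(1)] fin_hat [OF y(1)]] XY(3,4)
      unfolding X by (simp add: cone_mult0_fseries [OF assms(1) x(1) y(1)])
  qed
  then show *: "fseries \<h> (cprod a b) \<in> cone_alg \<h> \<and>
    (\<forall>X Y. range X \<subseteq> cone_alg0 \<h> \<and> range Y \<subseteq> cone_alg0 \<h> \<and>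
        limitin (cone_top \<h>) X (fseries \<h> a) sequentially \<and> limitin (cone_top \<h>) Y (fseries \<h> b) sequentially \<longrightarrow>
        limitin (cone_top \<h>) (\<lambda>k. cone_mult0 \<h> (X k) (Y k)) (fseries \<h> (cprod a b)) sequentially)"
    using cprod_hat [OF assms(2,3)] by (auto simp: cone_alg_def)
  \<comment> \<open>Truncations are sequences in the uncompleted algebra with the required limits,
    so the condition on a competitor is not vacuous.\<close>
  let ?X = "\<lambda>N. fseries \<h> (trunc N a)" and ?Y = "\<lambda>N. fseries \<h> (trunc N b)"
  have r: "range ?X \<subseteq> cone_alg0 \<h>" "range ?Y \<subseteq> cone_alg0 \<h>"
    using hat_fin_trunc assms by (auto simp: cone_alg0_fseries)
  fix c
  assume c: "c \<in> cone_alg \<h> \<and>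
    (\<forall>X Y. range X \<subseteq> cone_alg0 \<h> \<and> range Y \<subseteq> cone_alg0 \<h> \<and>
        limitin (cone_top \<h>) X (fseries \<h> a) sequentially \<and> limitin (cone_top \<h>) Y (fseries \<h> b) sequentially \<longrightarrow>
        limitin (cone_top \<h>) (\<lambda>k. cone_mult0 \<h> (X k) (Y k)) c sequentially)"
  have "limitin (cone_top \<h>) (\<lambda>k. cone_mult0 \<h> (?X k) (?Y k)) c sequentially"
    "limitin (cone_top \<h>) (\<lambda>k. cone_mult0 \<h> (?X k) (?Y k)) (fseries \<h> (cprod a b)) sequentially"
    using c * r trunc_lim [OF assms(1,2)] trunc_lim [OF assms(1,3)] by blast+
  then show "c = fseries \<h> (cprod a b)"
    using limitin_cone_top_unique [OF assms(1)] sequentially_bot by blast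
qed

section \<open>Holomorphic families of coefficients\<close>

definition l1 :: "complex ^ 'm::finite \<Rightarrow> real" where
  "l1 x = (\<Sum>i\<in>UNIV. norm (x $ i))"

lemma l1_nonneg [simp]: "0 \<le> l1 x"
  by (simp add: l1_def sum_nonneg)

lemma l1_line: "l1 (x + t *s v) \<le> l1 x + norm t * l1 v"
  unfolding l1_def sum_distrib_left sum.distrib [symmetric]
  by (intro sum_mono) (simp add: norm_mult [symmetric] norm_triangle_ineq)

lemma l1_smult: "l1 (c *s v) = norm c * l1 v"
  by (simp add: l1_def norm_mult sum_distrib_left)

lemma l1_eq_0: "l1 x = 0 \<Longrightarrow> x = 0"
  by (simp add: l1_def sum_nonneg_eq_0_iff vec_eq_iff)

text \<open>Holomorphy along every complex line; the estimates below use only directional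
  derivatives.\<close>

definition hol1 :: "(complex ^ 'm::finite \<Rightarrow> complex) \<Rightarrow> bool" where
  "hol1 F \<longleftrightarrow> (\<forall>x v. (\<lambda>t. F (x + t *s v)) holomorphic_on UNIV)"

text \<open>An entire map into the space of coefficients: holomorphic in each coefficient and
  bounded in every seminorm on bounded sets.\<close>

definition hol_fam :: "(complex ^ 'm::finite \<Rightarrow> 'n::finite triple \<Rightarrow> complex) \<Rightarrow> bool" where
  "hol_fam \<Phi> \<longleftrightarrow> (\<forall>x \<tau>. \<tau> \<notin> triples \<longrightarrow> \<Phi> x \<tau> = 0) \<and> (\<forall>\<tau>. hol1 (\<lambda>x. \<Phi> x \<tau>)) \<and>
     (\<forall>R \<epsilon>. 0 < \<epsilon> \<longrightarrow> \<epsilon> < 1 \<longrightarrow> (\<exists>C\<ge>0. \<forall>x. l1 x \<le> R \<longrightarrow> hbound \<epsilon> C (\<Phi> x)))"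

definition dfam :: "(complex ^ 'm::finite \<Rightarrow> 'n::finite triple \<Rightarrow> complex) \<Rightarrow> complex ^ 'm \<Rightarrow> complex ^ 'm \<Rightarrow> 'n triple \<Rightarrow> complex" where
  "dfam \<Phi> v x \<tau> = deriv (\<lambda>t. \<Phi> (x + t *s v) \<tau>) 0"

text \<open>Cauchy's inequality on circles of radius 1: a bound on the disc of radius 2 controls the
  second derivative on the unit disc by \<open>fact 2 * B\<close>, which gives the quadratic
  remainder.\<close>

lemma entire_taylor2:
  fixes h :: "complex \<Rightarrow> complex"
  assumes "h holomorphic_on UNIV" "\<And>w. norm w \<le> 2 \<Longrightarrow> norm (h w) \<le> B"
  shows "norm (deriv h 0) \<le> B" "norm t \<le> 1 \<Longrightarrow> norm (h t - h 0 - t * deriv h 0) \<le> 2 * B * (norm t)\<^sup>2"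
proof -
  have cont: "continuous_on (cball w 1) h" for w
    using assms(1) holomorphic_on_imp_continuous_on holomorphic_on_subset by blast
  have hol: "h holomorphic_on ball w 1" for w using assms(1) holomorphic_on_subset by blast
  have "norm ((deriv ^^ 1) h 0) \<le> fact 1 * B / 1 ^ 1"
    by (rule Cauchy_inequality [OF hol cont]) (auto intro!: assms(2))
  then show "norm (deriv h 0) \<le> B" by simp
  have d2: "norm ((deriv ^^ 2) h w) \<le> 2 * B" if "w \<in> cball 0 1" for w
  proof -
    have "norm ((deriv ^^ 2) h w) \<le> fact 2 * B / 1 ^ 2"
    proof (rule Cauchy_inequality [OF hol cont])
      fix x assume "norm (w - x) = 1"
      then have "norm x \<le> 2" using that norm_triangle_ineq2 [of x w] by (simp add: norm_minus_commute)
      then show "norm (h x) \<le> B" by (rule assms(2))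
    qed simp
    then show ?thesis by simp
  qed
  have der: "((deriv ^^ i) h has_field_derivative (deriv ^^ Suc i) h x) (at x within cball 0 1)" for i x
  proof -
    have "(deriv ^^ i) h holomorphic_on UNIV" using assms(1) by (intro holomorphic_higher_deriv) auto
    then have "(deriv ^^ i) h field_differentiable at x"
      using holomorphic_on_imp_differentiable_at by blast
    then show ?thesis
      by (simp add: DERIV_deriv_iff_field_differentiable has_field_derivative_at_within)
  qed
  assume t: "norm t \<le> 1"
  have "norm ((deriv ^^ 0) h t - (\<Sum>i\<le>1. (deriv ^^ i) h 0 * (t - 0) ^ i / fact i)) \<le> 2 * B * norm (t - 0) ^ Suc 1 / fact 1"
    by (rule complex_Taylor [where S = "cball 0 1" and f = "\<lambda>i. (deriv ^^ i) h"]) (use d2 der t in \<open>auto simp: numeral_2_eq_2\<close>)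
  then show "norm (h t - h 0 - t * deriv h 0) \<le> 2 * B * (norm t)\<^sup>2"
    by (simp add: power2_eq_square algebra_simps)
qed

lemma hol_famD:
  assumes "hol_fam \<Phi>"
  shows "\<tau> \<notin> triples \<Longrightarrow> \<Phi> x \<tau> = 0" "(\<lambda>t. \<Phi> (x + t *s v) \<tau>) holomorphic_on UNIV"
  using assms unfolding hol_fam_def hol1_def by blast+

lemma hol_fam_bound:
  assumes "hol_fam \<Phi>" "0 < \<epsilon>" "\<epsilon> < 1"
  shows "\<exists>C\<ge>0. \<forall>x. l1 x \<le> R \<longrightarrow> hbound \<epsilon> C (\<Phi> x)"
  using assms unfolding hol_fam_def by blast

lemma hol_fam_hat: "hol_fam \<Phi> \<Longrightarrow> \<Phi> x \<in> hat_coeffs"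
  unfolding hat_coeffs_iff using hol_famD(1) hol_fam_bound [of \<Phi> _ "l1 x"] by (metis order_refl)

text \<open>Cauchy's estimate is applied to each coefficient with the bound supplied by the
  seminorm. The resulting constants are proportional to that bound, so the estimates hold in the
  seminorm itself.\<close>

lemma dfam_estimates:
  assumes "hol_fam \<Phi>" "0 < \<epsilon>" "\<epsilon> < 1"
  obtains C where "C \<ge> 0"
    "\<And>x v. l1 x \<le> R \<Longrightarrow> l1 v \<le> R \<Longrightarrow> hbound \<epsilon> C (dfam \<Phi> v x)"
    "\<And>x v t. l1 x \<le> R \<Longrightarrow> l1 v \<le> R \<Longrightarrow> norm t \<le> 1 \<Longrightarrow>
      hbound \<epsilon> (C * (norm t)\<^sup>2) (\<lambda>\<tau>. \<Phi> (x + t *s v) \<tau> - \<Phi> x \<tau> - t * dfam \<Phi> v x \<tau>)"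
proof -
  \<comment> \<open>The points \<open>x + w *s v\<close> with \<open>norm w \<le> 2\<close> have
    \<open>l1\<close> at most R + 2 R.\<close>
  obtain C where C: "C \<ge> 0" "\<And>x. l1 x \<le> 3 * R \<Longrightarrow> hbound \<epsilon> C (\<Phi> x)"
    using hol_fam_bound [OF assms, of "3 * R"] by blast
  have b: "norm (\<Phi> (x + w *s v) \<tau>) \<le> C * fact (level \<tau>) powr \<epsilon>"
    if "l1 x \<le> R" "l1 v \<le> R" "norm w \<le> 2" "\<tau> \<in> triples" for x v w \<tau>
  proof -
    have "l1 (x + w *s v) \<le> R + 2 * R"
      using l1_line [of x w v] that mult_mono [of "norm w" 2 "l1 v" R] by simp
    then show ?thesis using C(2) [of "x + w *s v"] that by (simp add: hbound_def)
  qed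
  show ?thesis
  proof (rule that [of "2 * C"])
    fix x v :: "complex ^ 'a" assume xv: "l1 x \<le> R" "l1 v \<le> R"
    show "hbound \<epsilon> (2 * C) (dfam \<Phi> v x)"
      unfolding hbound_def
    proof
      fix \<tau> :: "'b triple" assume \<tau>: "\<tau> \<in> triples"
      have "norm (dfam \<Phi> v x \<tau>) \<le> C * fact (level \<tau>) powr \<epsilon>"
        unfolding dfam_def by (rule entire_taylor2(1) [OF hol_famD(2) [OF assms(1)]]) (rule b [OF xv _ \<tau>])
      also have "\<dots> \<le> 2 * C * fact (level \<tau>) powr \<epsilon>" using C(1) by (intro mult_right_mono) auto
      finally show "norm (dfam \<Phi> v x \<tau>) \<le> 2 * C * fact (level \<tau>) powr \<epsilon>" .
    qed
    fix t :: complex assume t: "norm t \<le> 1"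
    show "hbound \<epsilon> (2 * C * (norm t)\<^sup>2) (\<lambda>\<tau>. \<Phi> (x + t *s v) \<tau> - \<Phi> x \<tau> - t * dfam \<Phi> v x \<tau>)"
      unfolding hbound_def
    proof
      fix \<tau> :: "'b triple" assume \<tau>: "\<tau> \<in> triples"
      have "norm (\<Phi> (x + t *s v) \<tau> - \<Phi> (x + 0 *s v) \<tau> - t * deriv (\<lambda>t. \<Phi> (x + t *s v) \<tau>) 0)
        \<le> 2 * (C * fact (level \<tau>) powr \<epsilon>) * (norm t)\<^sup>2"
        by (rule entire_taylor2(2) [OF hol_famD(2) [OF assms(1)] _ t]) (rule b [OF xv _ \<tau>])
      then show "norm (\<Phi> (x + t *s v) \<tau> - \<Phi> x \<tau> - t * dfam \<Phi> v x \<tau>) \<le> 2 * C * (norm t)\<^sup>2 * fact (level \<tau>) powr \<epsilon>"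
        by (simp add: dfam_def mult_ac)
    qed
  qed (use C in auto)
qed

text \<open>The derivative in direction \<open>v\<close> is a locally uniform limit of difference
  quotients with steps 1 / (n + 1), which are holomorphic along every line.\<close>

lemma hol1_dfam:
  assumes "hol_fam \<Phi>"
  shows "hol1 (\<lambda>x. dfam \<Phi> v x \<tau>)"
proof (cases "\<tau> \<in> triples")
  case False
  then have "(\<lambda>t. \<Phi> (x + t *s v) \<tau>) = (\<lambda>t. 0)" for x using hol_famD(1) [OF assms] by auto
  then show ?thesis by (simp add: hol1_def dfam_def)
next
  case True
  show ?thesis
    unfolding hol1_def
  proof (intro allI)
    fix x u
    define f where "f = (\<lambda>n s. (\<Phi> ((x + inverse (of_nat (Suc n)) *s v) + s *s u) \<tau> - \<Phi> (x + s *s u) \<tau>) * of_nat (Suc n))"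
    show "(\<lambda>s. dfam \<Phi> v (x + s *s u) \<tau>) holomorphic_on UNIV"
    proof (rule holomorphic_uniform_sequence [of UNIV f])
      show "f n holomorphic_on UNIV" for n
        unfolding f_def by (intro holomorphic_intros hol_famD(2) [OF assms])
      fix s0 :: complex
      define R where "R = max (l1 v) (l1 x + (norm s0 + 1) * l1 u)"
      obtain C where C: "C \<ge> 0"
        "\<And>x v t. l1 x \<le> R \<Longrightarrow> l1 v \<le> R \<Longrightarrow> norm t \<le> 1 \<Longrightarrow>
          hbound (1/2) (C * (norm t)\<^sup>2) (\<lambda>\<tau>. \<Phi> (x + t *s v) \<tau> - \<Phi> x \<tau> - t * dfam \<Phi> v x \<tau>)"
        by (rule dfam_estimates [OF assms, of "1/2" R]) auto
      define D where "D = C * fact (level \<tau>) powr (1/2)"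
      have est: "norm (f n s - dfam \<Phi> v (x + s *s u) \<tau>) \<le> D * inverse (of_nat (Suc n))" if "s \<in> cball s0 1" for n s
      proof -
        have "norm s \<le> norm s0 + 1"
          using that norm_triangle_ineq2 [of s s0] by (simp add: dist_norm norm_minus_commute)
        then have "norm s * l1 u \<le> (norm s0 + 1) * l1 u" by (intro mult_right_mono) auto
        then have l: "l1 (x + s *s u) \<le> R" "l1 v \<le> R" using l1_line [of x s u] by (auto simp: R_def)
        let ?t = "inverse (of_nat (Suc n)) :: complex"
        have t: "norm ?t = inverse (of_nat (Suc n))" by (simp add: norm_inverse del: of_nat_Suc)
        then have t1: "norm ?t \<le> 1" by (simp add: inverse_le_1_iff del: of_nat_Suc)
        have nz: "of_nat (Suc n) \<noteq> (0::complex)" by (simp del: of_nat_Suc)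
        have "norm (\<Phi> (x + s *s u + ?t *s v) \<tau> - \<Phi> (x + s *s u) \<tau> - ?t * dfam \<Phi> v (x + s *s u) \<tau>) \<le> D * (norm ?t)\<^sup>2"
          using C(2) [OF l t1] True by (simp add: hbound_def D_def mult_ac)
        moreover have "f n s - dfam \<Phi> v (x + s *s u) \<tau> =
          of_nat (Suc n) * (\<Phi> (x + s *s u + ?t *s v) \<tau> - \<Phi> (x + s *s u) \<tau> - ?t * dfam \<Phi> v (x + s *s u) \<tau>)"
          using nz by (simp add: f_def algebra_simps del: of_nat_Suc)
        ultimately have "norm (f n s - dfam \<Phi> v (x + s *s u) \<tau>) \<le> of_nat (Suc n) * (D * (norm ?t)\<^sup>2)"
          by (simp add: norm_mult del: of_nat_Suc)
        also have "\<dots> = D * inverse (of_nat (Suc n))"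
          unfolding t by (simp add: power2_eq_square del: of_nat_Suc)
        finally show ?thesis .
      qed
      have lim: "(\<lambda>n. D * inverse (of_nat (Suc n))) \<longlonglongrightarrow> 0"
        using tendsto_mult_right_zero [OF LIMSEQ_inverse_real_of_nat] by simp
      have "uniform_limit (cball s0 1) f (\<lambda>s. dfam \<Phi> v (x + s *s u) \<tau>) sequentially"
        unfolding uniform_limit_iff
      proof (intro allI impI)
        fix e :: real assume "e > 0"
        then have "\<forall>\<^sub>F n in sequentially. D * inverse (of_nat (Suc n)) < e"
          using order_tendstoD(2) [OF lim] by auto
        then show "\<forall>\<^sub>F n in sequentially. \<forall>s\<in>cball s0 1. dist (f n s) (dfam \<Phi> v (x + s *s u) \<tau>) < e"
        proof eventually_elim
          case (elim n)
          show ?case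
          proof
            fix s assume "s \<in> cball s0 1"
            from est [OF this, of n] elim show "dist (f n s) (dfam \<Phi> v (x + s *s u) \<tau>) < e"
              unfolding dist_norm by (rule le_less_trans)
          qed
        qed
      qed
      then show "\<exists>d>0. cball s0 d \<subseteq> UNIV \<and> uniform_limit (cball s0 d) f (\<lambda>s. dfam \<Phi> v (x + s *s u) \<tau>) sequentially"
        by (intro exI [of _ 1]) auto
    qed simp
  qed
qed

text \<open>The class is closed under directional derivatives, which drives the induction over the
  order of differentiability in \<open>hol_fam_Ck\<close>.\<close>

lemma hol_fam_dfam:
  assumes "hol_fam \<Phi>"
  shows "hol_fam (dfam \<Phi> v)"
  unfolding hol_fam_def
proof (intro conjI allI impI)
  show "dfam \<Phi> v x \<tau> = 0" if "\<tau> \<notin> triples" for x \<tau>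
    using hol_famD(1) [OF assms that] by (simp add: dfam_def)
  show "hol1 (\<lambda>x. dfam \<Phi> v x \<tau>)" for \<tau> by (rule hol1_dfam [OF assms])
  fix R \<epsilon> :: real assume "0 < \<epsilon>" "\<epsilon> < 1"
  then obtain C where "C \<ge> 0"
    "\<And>x w. l1 x \<le> max R (l1 v) \<Longrightarrow> l1 w \<le> max R (l1 v) \<Longrightarrow> hbound \<epsilon> C (dfam \<Phi> w x)"
    by (rule dfam_estimates [OF assms, of \<epsilon> "max R (l1 v)"]) auto
  then show "\<exists>C\<ge>0. \<forall>x. l1 x \<le> R \<longrightarrow> hbound \<epsilon> C (dfam \<Phi> v x)"
    by (intro exI [of _ C]) auto
qed

text \<open>Dividing the quadratic remainder of \<open>dfam_estimates\<close> by \<open>t\<close>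
  leaves a bound of order \<open>t\<close> in every seminorm, so the coefficientwise derivative is a
  derivative in the topology.\<close>

lemma hol_fam_velocity:
  assumes "\<h> \<noteq> 0" "hol_fam \<Phi>"
  shows "limitin (cone_top \<h>)
    (\<lambda>t::real. fseries \<h> (\<lambda>\<tau>. inverse (of_real t) * (\<Phi> (x + of_real t *s v) \<tau> - \<Phi> x \<tau>)))
    (fseries \<h> (dfam \<Phi> v x)) (at 0)"
proof (rule limitin_cone_topI [OF assms(1) hol_fam_hat [OF hol_fam_dfam [OF assms(2)]]])
  show "\<forall>\<^sub>F t::real in at 0. (\<lambda>\<tau>. inverse (of_real t) * (\<Phi> (x + of_real t *s v) \<tau> - \<Phi> x \<tau>)) \<in> hat_coeffs"
    by (intro always_eventually allI hat_scale hat_diff hol_fam_hat assms)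
  fix \<epsilon> r :: real assume e: "0 < \<epsilon>" "\<epsilon> < 1" "0 < r"
  define R where "R = max (l1 x) (l1 v)"
  have R: "l1 x \<le> R" "l1 v \<le> R" by (auto simp: R_def)
  obtain C where C: "C \<ge> 0"
    "\<And>x v t. l1 x \<le> R \<Longrightarrow> l1 v \<le> R \<Longrightarrow> norm t \<le> 1 \<Longrightarrow>
      hbound \<epsilon> (C * (norm t)\<^sup>2) (\<lambda>\<tau>. \<Phi> (x + t *s v) \<tau> - \<Phi> x \<tau> - t * dfam \<Phi> v x \<tau>)"
    by (rule dfam_estimates [OF assms(2) e(1,2), of R]) auto
  have "((\<lambda>t::real. C * \<bar>t\<bar>) \<longlongrightarrow> C * \<bar>0\<bar>) (at 0)" by (intro tendsto_intros)
  then have 1: "\<forall>\<^sub>F t::real in at 0. C * \<bar>t\<bar> < r" using e(3) by (intro order_tendstoD(2)) auto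
  have "((\<lambda>t::real. \<bar>t\<bar>) \<longlongrightarrow> \<bar>0\<bar>) (at 0)" by (intro tendsto_intros)
  then have 2: "\<forall>\<^sub>F t::real in at 0. \<bar>t\<bar> < 1" by (intro order_tendstoD(2)) auto
  show "\<forall>\<^sub>F t::real in at 0. hbound \<epsilon> r
    (\<lambda>\<tau>. inverse (of_real t) * (\<Phi> (x + of_real t *s v) \<tau> - \<Phi> x \<tau>) - dfam \<Phi> v x \<tau>)"
    using 1 2 eventually_neq_at_within [of 0]
  proof eventually_elim
    case (elim t)
    have "hbound \<epsilon> (norm (inverse (of_real t :: complex)) * (C * (norm (of_real t :: complex))\<^sup>2))
      (\<lambda>\<tau>. inverse (of_real t) * (\<Phi> (x + of_real t *s v) \<tau> - \<Phi> x \<tau> - of_real t * dfam \<Phi> v x \<tau>))"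
      using elim by (intro hbound_scale C R) auto
    moreover have "norm (inverse (of_real t :: complex)) * (C * (norm (of_real t :: complex))\<^sup>2) = C * \<bar>t\<bar>"
      using elim by (simp add: norm_inverse power2_eq_square abs_if)
    moreover have "(\<lambda>\<tau>. inverse (of_real t) * (\<Phi> (x + of_real t *s v) \<tau> - \<Phi> x \<tau> - of_real t * dfam \<Phi> v x \<tau>)) =
      (\<lambda>\<tau>. inverse (of_real t) * (\<Phi> (x + of_real t *s v) \<tau> - \<Phi> x \<tau>) - dfam \<Phi> v x \<tau>)"
      using elim by (simp add: fun_eq_iff right_diff_distrib)
    ultimately have "hbound \<epsilon> (C * \<bar>t\<bar>)
      (\<lambda>\<tau>. inverse (of_real t) * (\<Phi> (x + of_real t *s v) \<tau> - \<Phi> x \<tau>) - dfam \<Phi> v x \<tau>)"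
      by (simp only:)
    then show ?case using elim(1) by (rule hbound_mono [OF _ less_imp_le])
  qed
qed

text \<open>The Taylor estimate is used along the unit vector pointing from \<open>x\<close> to
  \<open>y\<close>, so that one constant serves all directions; for distances d \<le> 1 both terms
  are at most C d.\<close>

lemma hol_fam_lipschitz:
  assumes "hol_fam \<Phi>" "0 < \<epsilon>" "\<epsilon> < 1"
  obtains C where "C \<ge> 0" "\<And>y. l1 (y - x) \<le> 1 \<Longrightarrow> hbound \<epsilon> (C * l1 (y - x)) (\<lambda>\<tau>. \<Phi> y \<tau> - \<Phi> x \<tau>)"
proof -
  define R where "R = max (l1 x) 1"
  have R: "l1 x \<le> R" "1 \<le> R" by (auto simp: R_def)
  obtain C where C: "C \<ge> 0" "\<And>x v. l1 x \<le> R \<Longrightarrow> l1 v \<le> R \<Longrightarrow> hbound \<epsilon> C (dfam \<Phi> v x)"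
    "\<And>x v t. l1 x \<le> R \<Longrightarrow> l1 v \<le> R \<Longrightarrow> norm t \<le> 1 \<Longrightarrow>
      hbound \<epsilon> (C * (norm t)\<^sup>2) (\<lambda>\<tau>. \<Phi> (x + t *s v) \<tau> - \<Phi> x \<tau> - t * dfam \<Phi> v x \<tau>)"
    by (rule dfam_estimates [OF assms, of R]) auto
  show ?thesis
  proof (rule that [of "2 * C"])
    fix y assume y: "l1 (y - x) \<le> 1"
    define d where "d = l1 (y - x)"
    show "hbound \<epsilon> (2 * C * l1 (y - x)) (\<lambda>\<tau>. \<Phi> y \<tau> - \<Phi> x \<tau>)"
    proof (cases "d = 0")
      case True
      then have "y = x" using l1_eq_0 [of "y - x"] by (simp add: d_def)
      then show ?thesis by (simp add: hbound_def l1_def)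
    next
      case False
      then have d: "0 < d" "d \<le> 1" using y l1_nonneg [of "y - x"] unfolding d_def by linarith+
      define v where "v = inverse (of_real d) *s (y - x)"
      have "l1 v = inverse d * d"
        unfolding v_def l1_smult using d by (simp add: norm_inverse d_def [symmetric])
      then have v: "l1 v = 1" using d by simp
      have yx: "x + of_real d *s v = y" using d by (simp add: v_def vec_eq_iff)
      have "hbound \<epsilon> (C * (norm (of_real d :: complex))\<^sup>2 + norm (of_real d :: complex) * C)
        (\<lambda>\<tau>. (\<Phi> (x + of_real d *s v) \<tau> - \<Phi> x \<tau> - of_real d * dfam \<Phi> v x \<tau>) + of_real d * dfam \<Phi> v x \<tau>)"
        using d v R by (intro hbound_add hbound_scale C) auto
      then have "hbound \<epsilon> (C * d\<^sup>2 + d * C) (\<lambda>\<tau>. \<Phi> y \<tau> - \<Phi> x \<tau>)" using d by (simp add: yx)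
      moreover have "C * d\<^sup>2 + d * C \<le> 2 * C * d"
        using d C(1) mult_left_mono [OF d(2), of "C * d"] by (simp add: power2_eq_square algebra_simps)
      ultimately show ?thesis unfolding d_def by (rule hbound_mono)
    qed
  qed (use C in auto)
qed

lemma hol_fam_continuous:
  fixes emb :: "'v::euclidean_space \<Rightarrow> complex ^ 'm::finite" and \<Phi> :: "_ \<Rightarrow> 'n::finite triple \<Rightarrow> complex"
  assumes "\<h> \<noteq> 0" "hol_fam \<Phi>" "continuous_on UNIV emb"
  shows "continuous_map (top_of_set S) (cone_top \<h>) (\<lambda>x. fseries \<h> (\<Phi> (emb x)))"
  unfolding cone_top_def
proof (rule continuous_map_into_seminorm)
  fix x and p :: "('n cvec \<Rightarrow> complex) \<Rightarrow> real" and r :: real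
  assume x: "x \<in> topspace (top_of_set S)" and p: "p \<in> eps_norm \<h> ` {0<..<1}" and r: "0 < r"
  obtain \<epsilon> where \<epsilon>: "p = eps_norm \<h> \<epsilon>" "0 < \<epsilon>" "\<epsilon> < 1" using p by auto
  obtain C where C: "C \<ge> 0" "\<And>y. l1 (y - emb x) \<le> 1 \<Longrightarrow> hbound \<epsilon> (C * l1 (y - emb x)) (\<lambda>\<tau>. \<Phi> y \<tau> - \<Phi> (emb x) \<tau>)"
    by (rule hol_fam_lipschitz [OF assms(2) \<epsilon>(2,3), where x = "emb x"]) blast
  define f where "f = (\<lambda>y. l1 (emb y - emb x))"
  have "continuous_on UNIV f" unfolding f_def l1_def by (intro continuous_intros assms(3))
  then have op: "open {y. f y < s}" for s
    by (intro open_Collect_less continuous_intros) auto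
  define s where "s = min 1 (r / (C + 1))"
  have s: "0 < s" "s \<le> 1" "s \<le> r / (C + 1)" using r C(1) by (auto simp: s_def)
  let ?U = "S \<inter> {y. f y < s}"
  show "\<exists>U. openin (top_of_set S) U \<and> x \<in> U \<and>
    (\<forall>y\<in>U. p (\<lambda>z. fseries \<h> (\<Phi> (emb y)) z - fseries \<h> (\<Phi> (emb x)) z) < r)"
  proof (intro exI [of _ ?U] conjI ballI)
    show "openin (top_of_set S) ?U" using op by (auto simp: openin_open)
    show "x \<in> ?U" using x s by (simp add: f_def l1_def)
    fix y assume y: "y \<in> ?U"
    have "hbound \<epsilon> (C * f y) (\<lambda>\<tau>. \<Phi> (emb y) \<tau> - \<Phi> (emb x) \<tau>)"
      using C(2) [of "emb y"] y s by (auto simp: f_def)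
    then have "p (\<lambda>z. fseries \<h> (\<Phi> (emb y)) z - fseries \<h> (\<Phi> (emb x)) z) \<le> C * f y"
      unfolding \<epsilon>(1) fseries_diff [OF hol_fam_hat hol_fam_hat, OF assms(2,2), symmetric]
      by (intro eps_norm_le assms hat_diff hol_fam_hat)
    also have "\<dots> \<le> C * (r / (C + 1))" using y s C(1) by (intro mult_left_mono) auto
    also have "\<dots> < r" using r C(1) by (simp add: field_simps)
    finally show "p (\<lambda>z. fseries \<h> (\<Phi> (emb y)) z - fseries \<h> (\<Phi> (emb x)) z) < r" .
  qed
qed (use cone_topology_facts [OF assms(1)] hol_fam_hat [OF assms(2)] in \<open>auto simp: cone_alg_def\<close>)

text \<open>The map \<open>q\<close> is the identity for the algebra on the cone and the quotient map for the algebra on the disc.\<close>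

lemma hol_fam_Ck:
  fixes emb :: "'v::euclidean_space \<Rightarrow> complex ^ 'm::finite" and q :: "('n::finite cvec \<Rightarrow> complex) \<Rightarrow> 'p \<Rightarrow> complex"
  assumes "\<h> \<noteq> 0" "continuous_on UNIV emb"
    and emb: "\<And>x v t. emb (x + t *\<^sub>R v) = emb x + of_real t *s emb v"
    and q: "continuous_map (cone_top \<h>) T q"
    and q_diff: "\<And>a b z. q (\<lambda>z. a z - b z) z = q a z - q b z"
    and q_scale: "\<And>c a z. q (\<lambda>z. c * a z) z = c * q a z"
    and S: "\<And>x v t. x \<in> S \<Longrightarrow> v \<in> S \<Longrightarrow> x + t *\<^sub>R v \<in> S"
  shows "hol_fam \<Phi> \<Longrightarrow> (\<And>x. x \<in> S \<Longrightarrow> F x = q (fseries \<h> (\<Phi> (emb x)))) \<Longrightarrow> Ck_on k T S S F"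
proof (induction k arbitrary: \<Phi> F)
  case 0
  have "continuous_map (top_of_set S) T (q \<circ> (\<lambda>x. fseries \<h> (\<Phi> (emb x))))"
    by (rule continuous_map_compose [OF hol_fam_continuous [OF assms(1) 0(1) assms(2)] q])
  then show ?case using 0(2) by (auto intro: continuous_map_eq)
next
  case (Suc k)
  have "continuous_map (top_of_set S) T (q \<circ> (\<lambda>x. fseries \<h> (\<Phi> (emb x))))"
    by (rule continuous_map_compose [OF hol_fam_continuous [OF assms(1) Suc.prems(1) assms(2)] q])
  then have 1: "continuous_map (top_of_set S) T F" using Suc.prems(2) by (auto intro: continuous_map_eq)
  have 2: "has_velocity T (\<lambda>t. F (x + t *\<^sub>R v)) (q (fseries \<h> (dfam \<Phi> (emb v) (emb x))))"
    if "x \<in> S" "v \<in> S" for x v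
  proof -
    have eq: "(\<lambda>z. (F (x + t *\<^sub>R v) z - F (x + 0 *\<^sub>R v) z) / of_real t) =
      (q \<circ> (\<lambda>t. fseries \<h> (\<lambda>\<tau>. inverse (of_real t) * (\<Phi> (emb x + of_real t *s emb v) \<tau> - \<Phi> (emb x) \<tau>)))) t" for t
    proof
      fix z
      have "F (x + t *\<^sub>R v) = q (fseries \<h> (\<Phi> (emb x + of_real t *s emb v)))"
        using Suc.prems(2) [OF S [OF that, of t]] by (simp add: emb)
      moreover have "F x = q (fseries \<h> (\<Phi> (emb x)))" using Suc.prems(2) that by simp
      ultimately show "(F (x + t *\<^sub>R v) z - F (x + 0 *\<^sub>R v) z) / of_real t =
        (q \<circ> (\<lambda>t. fseries \<h> (\<lambda>\<tau>. inverse (of_real t) * (\<Phi> (emb x + of_real t *s emb v) \<tau> - \<Phi> (emb x) \<tau>)))) t z"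
        by (simp add: fseries_scale fseries_diff hol_fam_hat [OF Suc.prems(1)] q_scale q_diff divide_inverse mult.commute)
    qed
    show ?thesis
      unfolding has_velocity_def eq
      by (rule continuous_map_limit [OF q hol_fam_velocity [OF assms(1) Suc.prems(1)]])
  qed
  show ?case
    unfolding Ck_on.simps
  proof (intro conjI 1 ballI)
    fix v assume v: "v \<in> S"
    show "\<exists>G. (\<forall>x\<in>S. has_velocity T (\<lambda>t. F (x + t *\<^sub>R v)) (G x)) \<and> Ck_on k T S S G"
      \<comment> \<open>The derivative again has the form covered by the induction hypothesis, with
        the family \<open>dfam \<Phi> (emb v)\<close>.\<close>
      by (intro exI [of _ "\<lambda>x. q (fseries \<h> (dfam \<Phi> (emb v) (emb x)))"] conjI ballI 2 v
          Suc.IH [OF hol_fam_dfam [OF Suc.prems(1)]]) auto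
  qed
qed

section \<open>The matrix exponential\<close>

definition mpw :: "'n::finite cmat \<Rightarrow> nat \<Rightarrow> 'n cmat" where
  "mpw X k = ((\<lambda>Y. X ** Y) ^^ k) (mat 1)"

lemma mpw_simps [simp]: "mpw X 0 = mat 1" "mpw X (Suc k) = X ** mpw X k"
  by (simp_all add: mpw_def)

lemma matrix_mult_nth: "(X ** Y) $ i $ j = (\<Sum>l\<in>UNIV. X $ i $ l * Y $ l $ j)"
  by (simp add: matrix_matrix_mult_def)

lemma row_le_msum: "(\<Sum>l\<in>UNIV. norm (X $ i $ l)) \<le> msum X"
  unfolding msum_def by (rule member_le_sum) (auto intro: sum_nonneg)

lemma mpw_bound: "norm (mpw X k $ i $ j) \<le> msum X ^ k"
proof (induction k arbitrary: i)
  case 0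
  show ?case by (simp add: mat_def)
next
  case (Suc k)
  have "norm (mpw X (Suc k) $ i $ j) \<le> (\<Sum>l\<in>UNIV. norm (X $ i $ l) * msum X ^ k)"
    unfolding mpw_simps matrix_mult_nth
    by (intro order_trans [OF norm_sum] sum_mono) (auto simp: norm_mult intro!: mult_left_mono Suc)
  also have "\<dots> \<le> msum X * msum X ^ k"
    unfolding sum_distrib_right [symmetric] by (intro mult_right_mono row_le_msum) (auto simp: msum_nonneg)
  finally show ?case by simp
qed

lemma norm_matrix_le: "norm (X :: 'n::finite cmat) \<le> msum X"
proof -
  have 1: "norm (x :: 'n cvec) \<le> (\<Sum>i\<in>UNIV. norm (x $ i))" for x
    unfolding norm_vec_def by (rule L2_set_le_sum) auto
  have "norm X \<le> (\<Sum>i\<in>UNIV. norm (X $ i))" unfolding norm_vec_def [of X] by (rule L2_set_le_sum) auto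
  also have "\<dots> \<le> msum X" unfolding msum_def by (intro sum_mono 1)
  finally show ?thesis .
qed

lemma mexp_sums: "(\<lambda>k. (1 / fact k) *\<^sub>R mpw X k) sums mexp (X :: 'n::finite cmat)"
proof -
  let ?N = "real CARD('n option)"
  have b: "norm ((1 / fact k) *\<^sub>R mpw X k) \<le> ?N * ?N * (msum X ^ k /\<^sub>R fact k)" for k
  proof -
    have "norm (mpw X k) \<le> (\<Sum>i\<in>(UNIV :: 'n option set). \<Sum>j\<in>(UNIV :: 'n option set). msum X ^ k)"
      by (rule order_trans [OF norm_matrix_le]) (unfold msum_def [of "mpw X k"], intro sum_mono mpw_bound)
    then have "norm (mpw X k) \<le> ?N * ?N * msum X ^ k" by simp
    then have "norm (mpw X k) / fact k \<le> ?N * ?N * msum X ^ k / fact k" by (rule divide_right_mono) simp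
    then show ?thesis by (simp add: divide_inverse mult_ac)
  qed
  have "summable (\<lambda>k. ?N * ?N * (msum X ^ k /\<^sub>R fact k))"
    by (intro summable_mult summable_exp_generic)
  then have "summable (\<lambda>k. (1 / fact k) *\<^sub>R mpw X k)"
    by (rule summable_comparison_test' [where N = 0]) (rule b)
  then show ?thesis by (simp add: mexp_def mpw_def summable_sums)
qed

lemma mexp_nth_sums: "(\<lambda>k. mpw X k $ i $ j / fact k) sums (mexp X $ i $ j)"
proof -
  have bl: "bounded_linear (\<lambda>X :: 'a cmat. X $ i $ j)"
    by (rule bounded_linear_compose [OF bounded_linear_vec_nth bounded_linear_vec_nth])
  have "((1 / fact k) *\<^sub>R mpw X k) $ i $ j = mpw X k $ i $ j / fact k" for k
    unfolding vector_scaleR_component by (simp add: scaleR_conv_of_real)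
  then show ?thesis using bounded_linear.sums [OF bl mexp_sums [of X]] by simp
qed

lemma norm_mexp_nth: "norm (mexp X $ i $ j) \<le> exp (msum X)"
proof -
  have e: "(\<lambda>k. msum X ^ k /\<^sub>R fact k) sums exp (msum X)" by (rule exp_converges)
  have "norm (mpw X k $ i $ j / fact k) \<le> msum X ^ k /\<^sub>R fact k" for k
    using mpw_bound [of X k i j] by (simp add: norm_divide divide_right_mono field_simps)
  then have "norm (\<Sum>k. mpw X k $ i $ j / fact k) \<le> (\<Sum>k. msum X ^ k /\<^sub>R fact k)"
    by (rule norm_suminf_le) (rule sums_summable [OF e])
  then show ?thesis
    unfolding sums_unique [OF mexp_nth_sums, symmetric] sums_unique [OF e, symmetric] .
qed

lemma msum_mexp: "msum (mexp (X :: 'n::finite cmat)) \<le> (real CARD('n option))\<^sup>2 * exp (msum X)"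
proof -
  have "msum (mexp X) \<le> (\<Sum>i\<in>(UNIV :: 'n option set). \<Sum>j\<in>(UNIV :: 'n option set). exp (msum X))"
    unfolding msum_def [of "mexp X"] by (intro sum_mono norm_mexp_nth)
  then show ?thesis by (simp add: power2_eq_square)
qed

lemma msum_mult: "msum (X ** Y) \<le> msum X * msum Y"
proof -
  have "msum (X ** Y) \<le> (\<Sum>i\<in>UNIV. \<Sum>j\<in>UNIV. \<Sum>l\<in>UNIV. norm (X $ i $ l) * norm (Y $ l $ j))"
    unfolding msum_def [of "X ** Y"] matrix_mult_nth
    by (intro sum_mono order_trans [OF norm_sum]) (simp add: norm_mult)
  also have "\<dots> = (\<Sum>i\<in>UNIV. \<Sum>l\<in>UNIV. norm (X $ i $ l) * (\<Sum>j\<in>UNIV. norm (Y $ l $ j)))"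
    unfolding sum_distrib_left by (intro sum.cong refl sum.swap)
  also have "\<dots> \<le> (\<Sum>i\<in>UNIV. \<Sum>l\<in>UNIV. norm (X $ i $ l) * msum Y)"
    by (intro sum_mono mult_left_mono row_le_msum) auto
  also have "\<dots> = msum X * msum Y" by (simp add: msum_def [of X] sum_distrib_right)
  finally show ?thesis .
qed

lemma hol1_sum: "(\<And>i. i \<in> A \<Longrightarrow> hol1 (F i)) \<Longrightarrow> hol1 (\<lambda>x. \<Sum>i\<in>A. F i x)"
  unfolding hol1_def by (intro allI holomorphic_on_sum) auto

lemma hol1_mult: "hol1 F \<Longrightarrow> hol1 G \<Longrightarrow> hol1 (\<lambda>x. F x * G x)"
  unfolding hol1_def by (intro allI holomorphic_on_mult) auto

lemma hol1_const: "hol1 (\<lambda>x. c)"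
  by (simp add: hol1_def)

lemma hol1_coord: "hol1 (\<lambda>x. x $ i)"
  by (auto simp: hol1_def intro!: holomorphic_intros)

text \<open>A coordinate vector encodes two independent matrices; the boolean selects one of
  them.\<close>

definition pmat :: "bool \<Rightarrow> complex ^ (bool \<times> 'n option \<times> 'n option) \<Rightarrow> 'n::finite cmat" where
  "pmat b x = (\<chi> i j. x $ (b, i, j))"

lemma msum_pmat: "msum (pmat b x) \<le> l1 x"
proof -
  have "msum (pmat b x) = (\<Sum>p\<in>UNIV \<times> UNIV. norm (x $ (b, p)))"
    by (simp add: msum_def pmat_def sum.cartesian_product case_prod_unfold del: UNIV_Times_UNIV)
  also have "\<dots> = (\<Sum>p\<in>Pair b ` (UNIV \<times> UNIV). norm (x $ p))"
    by (simp add: sum.reindex inj_on_def del: UNIV_Times_UNIV)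
  also have "\<dots> \<le> l1 x" unfolding l1_def by (rule sum_mono2) auto
  finally show ?thesis .
qed

lemma hol1_mpw: "hol1 (\<lambda>x. mpw (pmat b x) k $ i $ j)"
proof (induction k arbitrary: i)
  case (Suc k)
  show ?case unfolding mpw_simps matrix_mult_nth pmat_def [of b]
    by (intro hol1_sum hol1_mult) (use Suc in \<open>auto simp: hol1_coord pmat_def\<close>)
qed (simp add: hol1_const)

text \<open>The partial sums are holomorphic and, on discs in the line, dominated by an exponential
  series, so the convergence is locally uniform.\<close>

lemma hol1_mexp: "hol1 (\<lambda>x. mexp (pmat b x) $ i $ j)"
  unfolding hol1_def
proof (intro allI)
  fix x v :: "complex ^ (bool \<times> 'a option \<times> 'a option)"
  let ?g = "\<lambda>k t. mpw (pmat b (x + t *s v)) k $ i $ j / fact k"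
  show "(\<lambda>t. mexp (pmat b (x + t *s v)) $ i $ j) holomorphic_on UNIV"
  proof (rule holomorphic_uniform_sequence [of UNIV "\<lambda>N t. \<Sum>k<N. ?g k t"])
    show "(\<lambda>t. \<Sum>k<N. ?g k t) holomorphic_on UNIV" for N
      using hol1_mpw [of b _ i j] by (auto simp: hol1_def intro!: holomorphic_intros)
    fix t0 :: complex
    define R where "R = l1 x + (norm t0 + 1) * l1 v"
    have "uniform_limit (cball t0 1) (\<lambda>N t. \<Sum>k<N. ?g k t) (\<lambda>t. \<Sum>k. ?g k t) sequentially"
    proof (rule Weierstrass_m_test [OF _ summable_exp_generic [of R]])
      fix k t assume "t \<in> cball t0 1"
      then have "norm t \<le> norm t0 + 1"
        using norm_triangle_ineq2 [of t t0] by (simp add: dist_norm norm_minus_commute)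
      then have "norm t * l1 v \<le> (norm t0 + 1) * l1 v" by (intro mult_right_mono) auto
      then have "msum (pmat b (x + t *s v)) \<le> R"
        using l1_line [of x t v] msum_pmat [of b "x + t *s v"] by (simp add: R_def)
      then have "norm (mpw (pmat b (x + t *s v)) k $ i $ j) \<le> R ^ k"
        using mpw_bound [of "pmat b (x + t *s v)" k i j] power_mono [OF _ msum_nonneg] order_trans by blast
      then show "norm (?g k t) \<le> R ^ k /\<^sub>R fact k"
        by (simp add: norm_divide field_simps)
    qed
    moreover have "(\<lambda>t. \<Sum>k. ?g k t) = (\<lambda>t. mexp (pmat b (x + t *s v)) $ i $ j)"
      by (rule ext) (rule sums_unique [symmetric, OF mexp_nth_sums])
    ultimately show "\<exists>d>0. cball t0 d \<subseteq> UNIV \<and>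
      uniform_limit (cball t0 d) (\<lambda>N t. \<Sum>k<N. ?g k t) (\<lambda>t. mexp (pmat b (x + t *s v)) $ i $ j) sequentially"
      by (intro exI [of _ 1]) auto
  qed simp
qed

text \<open>The exponential chart at \<open>U\<close>, complexified: a real direction \<open>\<xi>\<close> enters through the pair of
  \<open>\<xi>\<close> and its conjugate.\<close>

definition act_fam ::
  "'n::finite cmat \<Rightarrow> ('n triple \<Rightarrow> complex) \<Rightarrow> complex ^ (bool \<times> 'n option \<times> 'n option) \<Rightarrow> 'n triple \<Rightarrow> complex" where
  "act_fam U a x = cact (U ** mexp (pmat True x)) (cnj_mat U ** mexp (pmat False x)) a"

lemma hol1_mprod:
  fixes V :: "_ \<Rightarrow> 'n::finite cmat"
  assumes "\<And>k i. hol1 (\<lambda>x. V x $ k $ i)"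
  shows "hol1 (\<lambda>x. mprod (V x) K I)"
proof (induction K arbitrary: I)
  case (Cons k K)
  then show ?case by (cases I) (auto simp: mprod_def hol1_const intro!: hol1_mult assms)
qed (simp add: mprod_def hol1_const)

text \<open>Each coefficient is a finite sum of products of entries of exponentials, hence entire;
  boundedness on bounded sets comes from the uniform constant in \<open>hbound_cact\<close>.\<close>

lemma hol_fam_act:
  assumes "a \<in> hat_coeffs"
  shows "hol_fam (act_fam U a)"
  unfolding hol_fam_def
proof (intro conjI allI impI)
  show "act_fam U a x \<tau> = 0" if "\<tau> \<notin> triples" for x \<tau>
    using that by (simp add: act_fam_def cact_outside)
  have e: "hol1 (\<lambda>x. (V ** mexp (pmat b x)) $ k $ i)" for V :: "'a cmat" and b k i
    unfolding matrix_mult_nth by (intro hol1_sum hol1_mult hol1_const hol1_mexp)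
  show "hol1 (\<lambda>x. act_fam U a x \<tau>)" for \<tau>
    by (cases "\<tau> \<in> triples") (auto simp: act_fam_def cact_def intro!: hol1_sum hol1_mult hol1_mprod e hol1_const)
  fix R \<epsilon> :: real assume e: "0 < \<epsilon>" "\<epsilon> < 1"
  define N where "N = (real CARD('a option))\<^sup>2"
  \<comment> \<open>A common bound for both matrix arguments: the sum dominates \<open>msum\<close>
    of \<open>U\<close> and of its conjugate, and \<open>N * exp R\<close> dominates the exponential
    by \<open>msum_mexp\<close>.\<close>
  define R' where "R' = (msum U + msum (cnj_mat U)) * (N * exp R)"
  have R': "0 \<le> R'" by (simp add: R'_def N_def msum_nonneg)
  have b: "msum (V ** mexp (pmat b x)) \<le> R'" if "l1 x \<le> R" "V = U \<or> V = cnj_mat U" for V b x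
  proof -
    have "msum (mexp (pmat b x)) \<le> N * exp (msum (pmat b x))" unfolding N_def by (rule msum_mexp)
    also have "\<dots> \<le> N * exp R" using msum_pmat [of b x] that by (intro mult_left_mono) (auto simp: N_def)
    finally have 1: "msum (mexp (pmat b x)) \<le> N * exp R" .
    have 2: "msum V \<le> msum U + msum (cnj_mat U)" using that msum_nonneg [of U] msum_nonneg [of "cnj_mat U"] by auto
    show ?thesis unfolding R'_def
      by (rule order_trans [OF msum_mult mult_mono [OF 2 1]]) (auto simp: msum_nonneg)
  qed
  obtain M where M: "M \<ge> 0" "hbound (\<epsilon> / 2) M a" using hat_bound [OF assms, of "\<epsilon> / 2"] e by auto
  obtain C where C: "C \<ge> 0" "\<forall>V W M a. msum V \<le> R' \<and> msum W \<le> R' \<and> M \<ge> 0 \<and> hbound (\<epsilon> / 2) M a \<longrightarrow>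
       hbound (\<epsilon> / 2 + \<epsilon> / 2) (C * M) (cact V W (a :: 'a triple \<Rightarrow> complex))"
    using hbound_cact [of "\<epsilon> / 2" "\<epsilon> / 2" R', where ?'n = 'a] e R' by auto
  show "\<exists>C\<ge>0. \<forall>x. l1 x \<le> R \<longrightarrow> hbound \<epsilon> C (act_fam U a x)"
  proof (intro exI [of _ "C * M"] conjI allI impI)
    fix x :: "complex ^ (bool \<times> 'a option \<times> 'a option)" assume "l1 x \<le> R"
    then show "hbound \<epsilon> (C * M) (act_fam U a x)"
      using C(2) [rule_format, of "U ** mexp (pmat True x)" "cnj_mat U ** mexp (pmat False x)" M a] b M
      by (simp add: act_fam_def)
  qed (use C M in simp)
qed

section \<open>The pseudo-unitary group and its Lie algebra\<close>

text \<open>The Lie algebra \<open>u(1,n)\<close>; tracelessness plays no role in the arguments, and without it the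
  complexification consists of all matrices.\<close>

definition u_alg :: "'n::finite cmat set" where
  "u_alg = {\<xi>. \<forall>i j. gsign i * \<xi> $ i $ j = - (gsign j * cnj (\<xi> $ j $ i))}"

lemma gmetric_mult: "(gmetric ** X) $ i $ j = gsign i * X $ i $ j" "(X ** gmetric) $ i $ j = X $ i $ j * gsign j"
  unfolding matrix_mult_nth gmetric_gs by (simp_all add: if_distrib if_distribR cong: if_cong)

lemma adjoint_mat_nth: "adjoint_mat X $ i $ j = cnj (X $ j $ i)"
  by (simp add: adjoint_mat_def map_matrix_def transpose_def)

lemma su_uu: "su \<subseteq> u_alg"
proof
  fix \<xi> :: "'a cmat" assume "\<xi> \<in> su"
  then have "adjoint_mat \<xi> ** gmetric + gmetric ** \<xi> = 0" by (simp add: su_def)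
  then have "(adjoint_mat \<xi> ** gmetric + gmetric ** \<xi>) $ i $ j = 0" for i j by simp
  then have e: "cnj (\<xi> $ j $ i) * gsign j + gsign i * \<xi> $ i $ j = 0" for i j
    by (simp add: gmetric_mult adjoint_mat_nth)
  show "\<xi> \<in> u_alg"
    unfolding u_alg_def mem_Collect_eq
  proof (intro allI)
    fix i j
    show "gsign i * \<xi> $ i $ j = - (gsign j * cnj (\<xi> $ j $ i))"
      using e [where i = i and j = j] by (simp add: add_eq_0_iff2 mult.commute)
  qed
qed

lemma su_subspace: "\<xi> \<in> su \<Longrightarrow> \<eta> \<in> su \<Longrightarrow> \<xi> + t *\<^sub>R \<eta> \<in> (su :: 'n::finite cmat set)"
proof -
  assume *: "\<xi> \<in> su" "\<eta> \<in> su"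
  have a: "adjoint_mat (\<xi> + t *\<^sub>R \<eta>) ** gmetric + gmetric ** (\<xi> + t *\<^sub>R \<eta>) =
    (adjoint_mat \<xi> ** gmetric + gmetric ** \<xi>) + t *\<^sub>R (adjoint_mat \<eta> ** gmetric + gmetric ** \<eta>)"
    by (simp add: vec_eq_iff gmetric_mult adjoint_mat_nth scaleR_conv_of_real[where 'a=complex] algebra_simps)
  have b: "trace (\<xi> + t *\<^sub>R \<eta>) = trace \<xi> + t *\<^sub>R trace \<eta>"
    by (simp add: trace_def sum.distrib scaleR_sum_right)
  show ?thesis using * unfolding su_def mem_Collect_eq a b by simp
qed

text \<open>Multiplying the defining equation of the group by \<open>gmetric\<close>, whose square
  is 1, exhibits the inverse; for square matrices a left inverse is a right inverse.\<close>

lemma SU_left: "U \<in> SU \<Longrightarrow> (gmetric ** adjoint_mat U ** gmetric) ** U = mat 1"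
  and SU_right: "U \<in> SU \<Longrightarrow> U ** (gmetric ** adjoint_mat U ** gmetric) = mat 1"
proof -
  have g: "gmetric ** gmetric = (mat 1 :: 'a cmat)"
    by (simp add: vec_eq_iff gmetric_mult gmetric_gs mat_def)
  have "(gmetric ** adjoint_mat U ** gmetric) ** U = mat 1" if "U \<in> SU" for U :: "'a cmat"
    using that g by (simp add: SU_def matrix_mul_assoc [symmetric])
  then show "U \<in> SU \<Longrightarrow> (gmetric ** adjoint_mat U ** gmetric) ** U = mat 1"
    "U \<in> SU \<Longrightarrow> U ** (gmetric ** adjoint_mat U ** gmetric) = mat 1"
    using matrix_left_right_inverse by blast+
qed

lemma SU_inv:
  assumes "U \<in> SU"
  shows "matrix_inv U = gmetric ** adjoint_mat U ** gmetric" "U ** matrix_inv U = mat 1" "matrix_inv U ** U = mat 1"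
proof -
  have inv: "invertible U" using SU_left [OF assms] SU_right [OF assms] invertible_def by blast
  show 1: "U ** matrix_inv U = mat 1" "matrix_inv U ** U = mat 1"
    using inv someI_ex [of "\<lambda>V. U ** V = mat 1 \<and> V ** U = mat 1"]
    unfolding invertible_def matrix_inv_def by auto
  have "matrix_inv U = matrix_inv U ** (U ** (gmetric ** adjoint_mat U ** gmetric))"
    by (simp add: SU_right [OF assms])
  also have "\<dots> = gmetric ** adjoint_mat U ** gmetric"
    unfolding matrix_mul_assoc 1 by (simp add: matrix_mul_assoc)
  finally show "matrix_inv U = gmetric ** adjoint_mat U ** gmetric" .
qed

text \<open>The entries of \<open>U ** matrix_inv U = mat 1\<close>, multiplied by the metric: the
  contravariant invariance demanded by \<open>wick_pullback\<close>.\<close>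

lemma SU_metric:
  assumes "U \<in> SU"
  shows "(\<Sum>i\<in>UNIV. gsign i * U $ j $ i * cnj (U $ l $ i)) = (if j = l then gsign j else 0)"
proof -
  have "(U ** (gmetric ** adjoint_mat U ** gmetric)) $ j $ l = mat 1 $ j $ l"
    by (simp only: SU_right [OF assms])
  then have "(\<Sum>i\<in>UNIV. U $ j $ i * (gsign i * cnj (U $ l $ i) * gsign l)) = (if j = l then 1 else 0)"
    by (simp add: matrix_mult_nth [of U] gmetric_mult adjoint_mat_nth mat_def)
  moreover have "(\<Sum>i\<in>UNIV. U $ j $ i * (gsign i * cnj (U $ l $ i) * gsign l)) =
    (\<Sum>i\<in>UNIV. gsign i * U $ j $ i * cnj (U $ l $ i)) * gsign l"
    unfolding sum_distrib_right by (rule sum.cong) (simp_all add: mult_ac)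
  ultimately have X: "(\<Sum>i\<in>UNIV. gsign i * U $ j $ i * cnj (U $ l $ i)) * gsign l = (if j = l then 1 else 0)" by simp
  have "(\<Sum>i\<in>UNIV. gsign i * U $ j $ i * cnj (U $ l $ i)) = (\<Sum>i\<in>UNIV. gsign i * U $ j $ i * cnj (U $ l $ i)) * gsign l * gsign l"
    by (simp add: mult.assoc)
  also have "\<dots> = (if j = l then gsign j else 0)" by (simp add: X)
  finally show ?thesis .
qed

lemma yfun_complex: "complex_of_real (yfun w) = - (\<Sum>i\<in>UNIV. gsign i * (cnj (w $ i) * w $ i))"
  unfolding yfun_def of_real_diff of_real_sum complex_norm_square
  by (simp add: sum_UNIV_option gsign_def mult.commute)

lemma SU_yfun:
  assumes "U \<in> SU"
  shows "yfun (U *v z) = yfun z"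
proof -
  have m: "(\<Sum>k\<in>UNIV. cnj (U $ k $ i) * gsign k * U $ k $ j) = (if i = j then gsign i else 0)" for i j
  proof -
    have "(adjoint_mat U ** gmetric ** U) $ i $ j = gmetric $ i $ j" using assms by (simp add: SU_def)
    then show ?thesis
      by (simp add: matrix_mult_nth [of "adjoint_mat U ** gmetric"] gmetric_mult adjoint_mat_nth gmetric_gs)
  qed
  have "(\<Sum>k\<in>UNIV. gsign k * (cnj ((U *v z) $ k) * (U *v z) $ k)) =
    (\<Sum>k\<in>UNIV. \<Sum>i\<in>UNIV. \<Sum>j\<in>UNIV. (cnj (U $ k $ i) * gsign k * U $ k $ j) * (cnj (z $ i) * z $ j))"
    by (simp add: matrix_vector_mult_def sum_product sum_distrib_left mult_ac)
  also have "\<dots> = (\<Sum>i\<in>UNIV. \<Sum>j\<in>UNIV. \<Sum>k\<in>UNIV. (cnj (U $ k $ i) * gsign k * U $ k $ j) * (cnj (z $ i) * z $ j))"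
    by (subst sum.swap) (intro sum.cong refl sum.swap)
  also have "\<dots> = (\<Sum>i\<in>UNIV. gsign i * (cnj (z $ i) * z $ i))"
    unfolding sum_distrib_right [symmetric] m by (simp add: if_distribR if_distrib cong: if_cong)
  finally have "complex_of_real (yfun (U *v z)) = complex_of_real (yfun z)" by (simp add: yfun_complex)
  then show ?thesis by simp
qed

lemma mpw_scale: "mpw (t *\<^sub>R X) k = t ^ k *\<^sub>R mpw (X :: 'n::finite cmat) k"
proof (induction k)
  case (Suc k)
  have "(t *\<^sub>R X) ** (t ^ k *\<^sub>R mpw X k) = (t * t ^ k) *\<^sub>R (X ** mpw X k)"
    by (simp add: vec_eq_iff matrix_mult_nth scaleR_conv_of_real[where 'a=complex] sum_distrib_left mult_ac)
  then show ?case using Suc by simp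
qed simp

text \<open>Each entry is an everywhere convergent power series in \<open>t\<close>, which may be
  differentiated term by term.\<close>

lemma mexp_deriv:
  fixes \<xi> :: "'n::finite cmat"
  shows "((\<lambda>t::real. mexp (t *\<^sub>R \<xi>) $ i $ j) has_vector_derivative (\<Sum>l\<in>UNIV. \<xi> $ i $ l * mexp (t *\<^sub>R \<xi>) $ l $ j)) (at t)"
proof -
  define c where "c = (\<lambda>i k. mpw \<xi> k $ i $ j / fact k)"
  have s: "(\<lambda>k. c i k * of_real t ^ k) sums (mexp (t *\<^sub>R \<xi>) $ i $ j)" for i and t :: real
  proof -
    have "mpw (t *\<^sub>R \<xi>) k $ i $ j / fact k = c i k * of_real t ^ k" for k
      unfolding mpw_scale vector_scaleR_component c_def by (simp add: scaleR_conv_of_real)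
    then show ?thesis using mexp_nth_sums [of "t *\<^sub>R \<xi>" i j] by simp
  qed
  have ss: "summable (\<lambda>k. c i k * x ^ k)" for i and x :: complex
  proof (rule summable_comparison_test')
    show "summable (\<lambda>k. (msum \<xi> * norm x) ^ k /\<^sub>R fact k)" by (rule summable_exp_generic)
    show "norm (c i k * x ^ k) \<le> (msum \<xi> * norm x) ^ k /\<^sub>R fact k" if "k \<ge> 0" for k
    proof -
      have "norm (mpw \<xi> k $ i $ j) * norm x ^ k / fact k \<le> msum \<xi> ^ k * norm x ^ k / fact k"
        by (intro divide_right_mono mult_right_mono mpw_bound) auto
      moreover have "norm (c i k * x ^ k) = norm (mpw \<xi> k $ i $ j) * norm x ^ k / fact k"
        by (simp add: c_def norm_mult norm_divide norm_power)
      ultimately show ?thesis by (simp add: power_mult_distrib divide_inverse mult_ac)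
    qed
  qed
  \<comment> \<open>The factor k + 1 cancels against the factorial, and the additional matrix power
    is a left factor \<open>\<xi>\<close>.\<close>
  have d: "diffs (c i) k = (\<Sum>l\<in>UNIV. \<xi> $ i $ l * c l k)" for k
  proof -
    have nz: "of_nat (Suc k) \<noteq> (0::complex)" by (simp del: of_nat_Suc)
    have "diffs (c i) k = (of_nat (Suc k) * mpw \<xi> (Suc k) $ i $ j) / (of_nat (Suc k) * fact k)"
      unfolding diffs_def c_def by (simp del: of_nat_Suc mpw_simps)
    also have "\<dots> = mpw \<xi> (Suc k) $ i $ j / fact k" using nz by (simp del: of_nat_Suc mpw_simps)
    also have "\<dots> = (\<Sum>l\<in>UNIV. \<xi> $ i $ l * c l k)"
      unfolding mpw_simps matrix_mult_nth c_def by (simp add: sum_divide_distrib)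
    finally show ?thesis .
  qed
  have "((\<lambda>x. \<Sum>k. c i k * x ^ k) has_field_derivative (\<Sum>k. diffs (c i) k * of_real t ^ k)) (at (of_real t))"
    by (rule termdiffs_strong_converges_everywhere) (rule ss)
  then have "((\<lambda>t::real. \<Sum>k. c i k * of_real t ^ k) has_vector_derivative (\<Sum>k. diffs (c i) k * of_real t ^ k)) (at t)"
    by (rule has_vector_derivative_real_field)
  moreover have "(\<Sum>k. diffs (c i) k * of_real t ^ k) = (\<Sum>l\<in>UNIV. \<xi> $ i $ l * mexp (t *\<^sub>R \<xi>) $ l $ j)"
  proof -
    have "(\<lambda>k. \<Sum>l\<in>UNIV. \<xi> $ i $ l * (c l k * of_real t ^ k)) sums (\<Sum>l\<in>UNIV. \<xi> $ i $ l * mexp (t *\<^sub>R \<xi>) $ l $ j)"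
      by (intro sums_sum sums_mult s)
    then show ?thesis by (simp add: d sums_iff sum_distrib_right mult.assoc)
  qed
  moreover have "(\<lambda>t::real. \<Sum>k. c i k * of_real t ^ k) = (\<lambda>t. mexp (t *\<^sub>R \<xi>) $ i $ j)"
    using s by (simp add: fun_eq_iff sums_iff)
  ultimately show ?thesis by simp
qed

lemma mexp_0 [simp]: "mexp (0 :: 'n::finite cmat) = mat 1"
proof -
  have "mexp (0 :: 'n cmat) $ i $ j = mat 1 $ i $ j" for i j
  proof -
    have z: "mpw (0 :: 'n cmat) k = 0" if "k \<noteq> 0" for k
      using that by (cases k) (simp_all add: vec_eq_iff matrix_mult_nth)
    have "(\<lambda>k. mpw (0 :: 'n cmat) k $ i $ j / fact k) sums (\<Sum>k\<in>{0}. mpw (0 :: 'n cmat) k $ i $ j / fact k)"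
      by (rule sums_finite) (auto simp: z)
    then have "(\<lambda>k. mpw (0 :: 'n cmat) k $ i $ j / fact k) sums (mat 1 $ i $ j)" by simp
    then show ?thesis using mexp_nth_sums [of 0 i j] sums_unique2 by blast
  qed
  then show ?thesis by (simp add: vec_eq_iff)
qed

lemma mexp_vec_deriv:
  fixes \<xi> :: "'n::finite cmat"
  shows "((\<lambda>t::real. (mexp (t *\<^sub>R \<xi>) *v z) $ i) has_vector_derivative (\<xi> *v (mexp (t *\<^sub>R \<xi>) *v z)) $ i) (at t)"
proof -
  have "((\<lambda>t::real. \<Sum>j\<in>UNIV. mexp (t *\<^sub>R \<xi>) $ i $ j * z $ j) has_vector_derivative
    (\<Sum>j\<in>UNIV. (\<Sum>l\<in>UNIV. \<xi> $ i $ l * mexp (t *\<^sub>R \<xi>) $ l $ j) * z $ j)) (at t)"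
    by (intro has_vector_derivative_sum has_vector_derivative_mult_left mexp_deriv)
  moreover have "(\<Sum>j\<in>UNIV. (\<Sum>l\<in>UNIV. \<xi> $ i $ l * mexp (t *\<^sub>R \<xi>) $ l $ j) * z $ j) = (\<xi> *v (mexp (t *\<^sub>R \<xi>) *v z)) $ i"
    by (simp add: matrix_vector_mult_def sum_distrib_left sum_distrib_right mult.assoc) (rule sum.swap)
  ultimately show ?thesis by (simp add: matrix_vector_mult_def)
qed

lemma uuD: "\<xi> \<in> u_alg \<Longrightarrow> gsign i * \<xi> $ i $ j = - (gsign j * cnj (\<xi> $ j $ i))"
  by (simp add: u_alg_def)

lemma uu_sum_0:
  assumes "\<xi> \<in> u_alg"
  shows "(\<Sum>i\<in>UNIV. gsign i * (cnj ((\<xi> *v w) $ i) * w $ i + cnj (w $ i) * (\<xi> *v w) $ i)) = 0"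
proof -
  have "(\<Sum>i\<in>UNIV. gsign i * (cnj (w $ i) * (\<xi> *v w) $ i)) = (\<Sum>i\<in>UNIV. \<Sum>j\<in>UNIV. (gsign i * \<xi> $ i $ j) * (cnj (w $ i) * w $ j))"
    by (simp add: matrix_vector_mult_def sum_distrib_left mult_ac)
  also have "\<dots> = (\<Sum>i\<in>UNIV. \<Sum>j\<in>UNIV. - (gsign j * cnj (\<xi> $ j $ i) * (cnj (w $ i) * w $ j)))"
    by (simp add: uuD [OF assms])
  also have "\<dots> = (\<Sum>j\<in>UNIV. \<Sum>i\<in>UNIV. - (gsign j * cnj (\<xi> $ j $ i) * (cnj (w $ i) * w $ j)))"
    by (rule sum.swap)
  also have "\<dots> = - (\<Sum>i\<in>UNIV. gsign i * (cnj ((\<xi> *v w) $ i) * w $ i))"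
    by (simp add: matrix_vector_mult_def sum_distrib_left sum_distrib_right sum_negf mult_ac)
  finally show ?thesis by (simp add: distrib_left sum.distrib)
qed

text \<open>Along \<open>mexp (t *\<^sub>R \<xi>) *v z\<close> the derivative of \<open>y\<close> is
  the Hermitian form of \<open>\<xi> *v w\<close> with \<open>w\<close>, symmetrised, which vanishes
  since \<open>\<xi>\<close> is skew for the metric.\<close>

lemma uu_yfun:
  assumes "\<xi> \<in> u_alg"
  shows "yfun (mexp \<xi> *v z) = yfun z"
proof -
  define w where "w = (\<lambda>t::real. mexp (t *\<^sub>R \<xi>) *v z)"
  have "((\<lambda>t. \<Sum>i\<in>UNIV. gsign i * (cnj (w t $ i) * w t $ i)) has_vector_derivative 0) (at t)" for t
  proof -
    have "((\<lambda>t. \<Sum>i\<in>UNIV. gsign i * (cnj (w t $ i) * w t $ i)) has_vector_derivative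
      (\<Sum>i\<in>UNIV. gsign i * (cnj (w t $ i) * (\<xi> *v w t) $ i + cnj ((\<xi> *v w t) $ i) * w t $ i))) (at t)"
      unfolding w_def
      by (intro has_vector_derivative_sum has_vector_derivative_mult_right has_vector_derivative_mult
          has_vector_derivative_cnj mexp_vec_deriv)
    then show ?thesis using uu_sum_0 [OF assms, of "w t"] by (simp add: add.commute)
  qed
  then obtain c where c: "\<And>t. (\<Sum>i\<in>UNIV. gsign i * (cnj (w t $ i) * w t $ i)) = c"
    using has_vector_derivative_zero_constant [of UNIV "\<lambda>t. \<Sum>i\<in>UNIV. gsign i * (cnj (w t $ i) * w t $ i)"] by auto
  have "complex_of_real (yfun (w 1)) = complex_of_real (yfun (w 0))"
    unfolding yfun_complex by (simp only: c)
  then show ?thesis by (simp add: w_def)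
qed

lemma cm_mult: "cnj_mat (U ** V) = cnj_mat U ** cnj_mat V"
  by (simp add: vec_eq_iff cnj_mat_def matrix_mult_nth)

lemma cm_mat1 [simp]: "cnj_mat (mat 1) = mat 1"
  by (simp add: vec_eq_iff cnj_mat_def mat_def)

lemma cm_mexp: "cnj_mat (mexp \<xi>) = mexp (cnj_mat (\<xi> :: 'n::finite cmat))"
proof -
  have p: "mpw (cnj_mat \<xi>) k = cnj_mat (mpw \<xi> k)" for k by (induction k) (simp_all add: cm_mult)
  have "cnj_mat (mexp \<xi>) $ i $ j = mexp (cnj_mat \<xi>) $ i $ j" for i j
  proof -
    have "(\<lambda>k. cnj (mpw \<xi> k $ i $ j / fact k)) sums cnj (mexp \<xi> $ i $ j)"
      using mexp_nth_sums [of \<xi> i j] by (simp only: sums_cnj)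
    moreover have "cnj (mpw \<xi> k $ i $ j / fact k) = mpw (cnj_mat \<xi>) k $ i $ j / fact k" for k
      unfolding p by (simp add: cnj_mat_def)
    ultimately have "(\<lambda>k. mpw (cnj_mat \<xi>) k $ i $ j / fact k) sums (cnj_mat (mexp \<xi>) $ i $ j)" by (simp add: cnj_mat_def)
    then show ?thesis using mexp_nth_sums [of "cnj_mat \<xi>" i j] sums_unique2 by blast
  qed
  then show ?thesis by (simp add: vec_eq_iff)
qed

text \<open>Real linear, but not complex linear. It places the real chart inside the complexified
  one, so that real directions at a point become complex directions of the holomorphic
  family.\<close>

definition emb :: "'n::finite cmat \<Rightarrow> complex ^ (bool \<times> 'n option \<times> 'n option)" where
  "emb \<xi> = (\<chi> p. case p of (b, i, j) \<Rightarrow> if b then \<xi> $ i $ j else cnj (\<xi> $ i $ j))"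

lemma emb_line: "emb (x + t *\<^sub>R v) = emb x + of_real t *s emb v"
  by (auto simp: emb_def vec_eq_iff scaleR_conv_of_real[where 'a=complex])

lemma emb_0 [simp]: "emb 0 = 0"
  by (auto simp: emb_def vec_eq_iff)

lemma continuous_emb: "continuous_on UNIV emb"
  unfolding emb_def
proof (rule continuous_on_vec_lambda)
  fix p :: "bool \<times> 'a option \<times> 'a option"
  obtain b i j where p: "p = (b, i, j)" by (cases p)
  show "continuous_on UNIV (\<lambda>\<xi>. case p of (b, i, j) \<Rightarrow> if b then \<xi> $ i $ j else cnj (\<xi> $ i $ j))"
    by (cases b) (simp_all add: p continuous_intros)
qed

lemma pmat_emb: "pmat True (emb \<xi>) = \<xi>" "pmat False (emb \<xi>) = cnj_mat \<xi>"
  by (auto simp: pmat_def emb_def cnj_mat_def vec_eq_iff)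

lemma act_fam_emb: "act_fam U a (emb \<xi>) = cact (U ** mexp \<xi>) (cnj_mat (U ** mexp \<xi>)) a"
  by (simp add: act_fam_def pmat_emb cm_mult cm_mexp)

section \<open>The infinitesimal action is inner\<close>

text \<open>The preimage of \<open>eij\<close> under \<open>pw\<close>: the constant is
  \<open>(2 * \<h>) ^ 1\<close> times \<open>nfac\<close>, which is 1 here.\<close>

definition eij_coeffs :: "complex \<Rightarrow> 'n option \<Rightarrow> 'n option \<Rightarrow> 'n::finite triple \<Rightarrow> complex" where
  "eij_coeffs \<h> i j \<tau> = (if \<tau> = tri [i] [j] then 2 * \<h> else 0)"

definition mon_coeffs :: "complex \<Rightarrow> 'n option list \<Rightarrow> 'n option list \<Rightarrow> 'n::finite triple \<Rightarrow> complex" where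
  "mon_coeffs \<h> I J \<tau> = (if \<tau> = tri I J then (2 * \<h>) ^ level \<tau> * of_nat (nfac \<tau>) else 0)"

lemma nfac_single: "nfac (tri [i] [j]) = 1"
  by (subst nfac_tri) (simp_all add: prod.neutral)

lemma ec_mc: "eij_coeffs \<h> i j = mon_coeffs \<h> [i] [j]"
  by (auto simp: eij_coeffs_def mon_coeffs_def fun_eq_iff nfac_single)

lemma mc_fin: "length I = length J \<Longrightarrow> mon_coeffs \<h> I J \<in> fin_coeffs"
proof -
  assume l: "length I = length J"
  have "{\<tau>. mon_coeffs \<h> I J \<tau> \<noteq> 0} \<subseteq> {tri I J}" by (auto simp: mon_coeffs_def)
  moreover have "tri I J \<in> triples" using l by simp
  ultimately show ?thesis unfolding fin_coeffs_def using finite_subset by fastforce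
qed

lemma pw_mc:
  assumes "\<h> \<noteq> 0" "length I = length J"
  shows "pw \<h> (mon_coeffs \<h> I J) = mon I J"
proof
  fix z
  have sub: "{\<tau>. mon_coeffs \<h> I J \<tau> \<noteq> 0} \<subseteq> {tri I J}" by (auto simp: mon_coeffs_def)
  show "pw \<h> (mon_coeffs \<h> I J) z = mon I J z"
    unfolding pw_def lincomb_superset [OF finite.insertI [OF finite.emptyI] sub]
    using assms by (simp add: mon_coeffs_def ebasis_tri)
qed

lemma eij_mon: "eij i j = mon [i] [j]"
  by (simp add: eij_def mon_simps fun_eq_iff)

text \<open>The function by which \<open>S\<close> multiplies a polynomial of bidegree (\<alpha>,
  \<alpha>).\<close>

definition sfac :: "complex \<Rightarrow> nat \<Rightarrow> 'n::finite cvec \<Rightarrow> complex" where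
  "sfac \<h> \<alpha> z = (2 * \<h>) ^ \<alpha> * pochhammer (of_real (yfun z) / (2 * \<h>)) \<alpha> / of_real (yfun z) ^ \<alpha>"

lemma fseries_mc:
  assumes "length I = length J" "z \<in> pos_cone"
  shows "fseries \<h> (mon_coeffs \<h> I J) z = sfac \<h> (length I) z * mon I J z"
proof -
  have sub: "{\<tau>. mon_coeffs \<h> I J \<tau> \<noteq> 0} \<subseteq> {tri I J}" by (auto simp: mon_coeffs_def)
  show ?thesis
    unfolding fseries_fin [OF mc_fin [OF assms(1)]] lincomb_superset [OF finite.insertI [OF finite.emptyI] sub]
    using assms by (simp add: mon_coeffs_def fbasis_eq ebasis_tri sfac_def)
qed

section \<open>The momentum map on coefficients\<close>

definition momentum_coeffs :: "complex \<Rightarrow> 'n::finite cmat \<Rightarrow> 'n triple \<Rightarrow> complex" where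
  "momentum_coeffs \<h> \<xi> \<tau> = (\<Sum>k\<in>UNIV. \<Sum>l\<in>UNIV. (\<i> / 2 * gsign k * \<xi> $ k $ l) * eij_coeffs \<h> l k \<tau>)"

definition momentum_pol :: "'n::finite cmat \<Rightarrow> 'n cvec \<Rightarrow> complex" where
  "momentum_pol \<xi> z = (\<Sum>k\<in>UNIV. \<Sum>l\<in>UNIV. (\<i> / 2 * gsign k * \<xi> $ k $ l) * eij l k z)"

lemma jc_support: "{\<tau>. momentum_coeffs \<h> \<xi> \<tau> \<noteq> 0} \<subseteq> levels 1"
proof
  fix \<tau> :: "'a triple" assume "\<tau> \<in> {\<tau>. momentum_coeffs \<h> \<xi> \<tau> \<noteq> 0}"
  then obtain k l where "eij_coeffs \<h> l k \<tau> \<noteq> 0" unfolding momentum_coeffs_def by (auto elim!: sum.not_neutral_contains_not_neutral)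
  then have "\<tau> = tri [l] [k]" by (auto simp: eij_coeffs_def split: if_splits)
  then show "\<tau> \<in> levels 1" by (simp add: levels_def)
qed

lemma jc_fin: "momentum_coeffs \<h> \<xi> \<in> fin_coeffs"
  unfolding fin_coeffs_def mem_Collect_eq
  using finite_subset [OF jc_support finite_levels] jc_support [of \<h> \<xi>] by (auto simp: levels_def)

lemma pw_jc:
  fixes \<xi> :: "'n::finite cmat"
  assumes "\<h> \<noteq> 0"
  shows "pw \<h> (momentum_coeffs \<h> \<xi>) = momentum_pol \<xi>"
proof
  fix z :: "'n cvec"
  have sub: "{\<tau>. eij_coeffs \<h> l k \<tau> \<noteq> 0} \<subseteq> levels 1" for l k :: "'n option" by (auto simp: eij_coeffs_def levels_def)
  have e: "(\<Sum>\<tau>\<in>levels 1. eij_coeffs \<h> l k \<tau> * (ebasis \<tau> z / ((2 * \<h>) ^ level \<tau> * of_nat (nfac \<tau>)))) = eij l k z" for l k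
    using pw_mc [OF assms, of "[l]" "[k]"]
    unfolding pw_def ec_mc [symmetric] fun_eq_iff lincomb_superset [OF finite_levels sub] by (simp add: eij_mon)
  have "pw \<h> (momentum_coeffs \<h> \<xi>) z = (\<Sum>\<tau>\<in>levels 1. \<Sum>k\<in>UNIV. \<Sum>l\<in>UNIV. (\<i> / 2 * gsign k * \<xi> $ k $ l) *
    (eij_coeffs \<h> l k \<tau> * (ebasis \<tau> z / ((2 * \<h>) ^ level \<tau> * of_nat (nfac \<tau>)))))"
    unfolding pw_def lincomb_superset [OF finite_levels jc_support]
    by (simp only: momentum_coeffs_def sum_distrib_right mult.assoc)
  also have "\<dots> = (\<Sum>k\<in>UNIV. \<Sum>\<tau>\<in>levels 1. \<Sum>l\<in>UNIV. (\<i> / 2 * gsign k * \<xi> $ k $ l) *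
    (eij_coeffs \<h> l k \<tau> * (ebasis \<tau> z / ((2 * \<h>) ^ level \<tau> * of_nat (nfac \<tau>)))))" by (rule sum.swap)
  also have "\<dots> = (\<Sum>k\<in>UNIV. \<Sum>l\<in>UNIV. \<Sum>\<tau>\<in>levels 1. (\<i> / 2 * gsign k * \<xi> $ k $ l) *
    (eij_coeffs \<h> l k \<tau> * (ebasis \<tau> z / ((2 * \<h>) ^ level \<tau> * of_nat (nfac \<tau>)))))" by (intro sum.cong refl sum.swap)
  also have "\<dots> = momentum_pol \<xi> z" by (simp only: sum_distrib_left [symmetric] e momentum_pol_def)
  finally show "pw \<h> (momentum_coeffs \<h> \<xi>) z = momentum_pol \<xi> z" .
qed

text \<open>At level one the factor \<open>sfac\<close> equals 1, so \<open>S\<close> does not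
  change the momentum polynomial on the cone.\<close>

lemma momentum_jc:
  assumes "\<h> \<noteq> 0"
  shows "momentum \<xi> = fseries \<h> (momentum_coeffs \<h> \<xi>)"
proof
  fix z
  show "momentum \<xi> z = fseries \<h> (momentum_coeffs \<h> \<xi>) z"
  proof (cases "z \<in> pos_cone")
    case True
    then have y: "yfun z > 0" by (simp add: pos_cone_def)
    have "fbasis \<h> \<tau> z = ebasis \<tau> z / ((2 * \<h>) ^ level \<tau> * of_nat (nfac \<tau>))" if "\<tau> \<in> levels 1" for \<tau>
      using that y by (simp add: fbasis_eq [OF True] levels_def)
    then have "fseries \<h> (momentum_coeffs \<h> \<xi>) z = pw \<h> (momentum_coeffs \<h> \<xi>) z"
      unfolding fseries_fin [OF jc_fin] pw_def lincomb_superset [OF finite_levels jc_support] by simp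
    also have "\<dots> = (\<Sum>k\<in>UNIV. \<Sum>l\<in>UNIV. (\<i> / 2 * gsign k * \<xi> $ k $ l) * eij l k z)"
      by (simp add: pw_jc [OF assms] momentum_pol_def)
    also have "\<dots> = \<i> / 2 * (\<Sum>i\<in>UNIV. \<Sum>j\<in>UNIV. \<Sum>k\<in>UNIV. cnj (z $ k) * gmetric $ k $ i * \<xi> $ i $ j * z $ j)"
      unfolding gmetric_gs by (simp add: sum_distrib_left eij_def if_distrib if_distribR mult_ac cong: if_cong)
    finally show ?thesis using True by (simp add: momentum_def)
  next
    case False
    then show ?thesis by (simp add: momentum_def fseries_def fbasis_outside)
  qed
qed

definition ad :: "complex \<Rightarrow> 'n::finite cmat \<Rightarrow> ('n triple \<Rightarrow> complex) \<Rightarrow> 'n triple \<Rightarrow> complex" where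
  "ad \<h> \<xi> a \<tau> = \<i> / \<h> * (cprod (momentum_coeffs \<h> \<xi>) a \<tau> - cprod a (momentum_coeffs \<h> \<xi>) \<tau>)"

lemma ad_hat: "a \<in> hat_coeffs \<Longrightarrow> ad \<h> \<xi> a \<in> hat_coeffs"
  unfolding ad_def [abs_def] by (intro hat_scale hat_diff cprod_hat) (simp_all add: fin_hat jc_fin)

lemma pw_add: "c \<in> fin_coeffs \<Longrightarrow> d \<in> fin_coeffs \<Longrightarrow> pw \<h> (\<lambda>\<tau>. c \<tau> + d \<tau>) = (\<lambda>z. pw \<h> c z + pw \<h> d z)"
  unfolding pw_def by (rule lincomb_add)

lemma pw_scale: "c \<in> fin_coeffs \<Longrightarrow> pw \<h> (\<lambda>\<tau>. x * c \<tau>) = (\<lambda>z. x * pw \<h> c z)"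
  unfolding pw_def by (rule lincomb_scale)

lemma pw_diff: "c \<in> fin_coeffs \<Longrightarrow> d \<in> fin_coeffs \<Longrightarrow> pw \<h> (\<lambda>\<tau>. c \<tau> - d \<tau>) = (\<lambda>z. pw \<h> c z - pw \<h> d z)"
  using pw_add [OF _ fin_coeffs_scale [of d "\<lambda>\<tau>. -1"], of c \<h>] pw_scale [of d \<h> "-1"] by simp

lemma fin_coeffs_diff: "c \<in> fin_coeffs \<Longrightarrow> d \<in> fin_coeffs \<Longrightarrow> (\<lambda>\<tau>. c \<tau> - d \<tau>) \<in> fin_coeffs"
  using fin_coeffs_add [OF _ fin_coeffs_scale [of d "\<lambda>\<tau>. -1"], of c] by simp

section \<open>Commutators with the momentum map as vector fields\<close>

lemma wick_sum_left:
  "(\<And>x. x \<in> A \<Longrightarrow> pol d k (f x)) \<Longrightarrow> wick \<h> (\<lambda>z. \<Sum>x\<in>A. f x z) g = (\<lambda>z. \<Sum>x\<in>A. wick \<h> (f x) g z)"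
proof (induction A rule: infinite_finite_induct)
  case (insert x F)
  have "pol d k (\<lambda>z. \<Sum>x\<in>F. f x z)" using insert by (auto intro: pol_sum)
  then show ?case using insert by (simp add: wick_add_left [of d k _ d k])
qed auto

lemma wick_sum_right:
  "(\<And>x. x \<in> A \<Longrightarrow> pol d k (f x)) \<Longrightarrow> wick \<h> g (\<lambda>z. \<Sum>x\<in>A. f x z) = (\<lambda>z. \<Sum>x\<in>A. wick \<h> g (f x) z)"
proof (induction A rule: infinite_finite_induct)
  case (insert x F)
  have "pol d k (\<lambda>z. \<Sum>x\<in>F. f x z)" using insert by (auto intro: pol_sum)
  then show ?case using insert by (simp add: wick_add_right [of d k _ d k])
qed auto

text \<open>Products with a level one element have no terms beyond the first order in \<h>, and the
  zeroth order cancels in the commutator. What remains is the linear vector field of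
  \<open>\<xi>\<close>; its conjugate part takes the right form by skewness.\<close>

lemma wick_commutator_jpol:
  assumes "\<h> \<noteq> 0" "\<xi> \<in> u_alg" "pol d k f"
  shows "\<i> / \<h> * (wick \<h> (momentum_pol \<xi>) f z - wick \<h> f (momentum_pol \<xi>) z) =
    (\<Sum>i\<in>UNIV. (\<xi> *v z) $ i * dz i f z + cnj ((\<xi> *v z) $ i) * dzbar i f z)"
proof -
  let ?c = "\<lambda>k l. \<i> / 2 * gsign k * \<xi> $ k $ l"
  have p: "pol 2 0 (\<lambda>z. ?c k l * eij l k z)" for k l by (rule pol_scale [OF pol_eij])
  have p2: "pol 2 0 (\<lambda>z. \<Sum>l\<in>UNIV. ?c k l * eij l k z)" for k by (rule pol_sum) (rule p)
  have 1: "wick \<h> (momentum_pol \<xi>) f z = (\<Sum>k\<in>UNIV. \<Sum>l\<in>UNIV. ?c k l * wick \<h> (eij l k) f z)"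
    unfolding momentum_pol_def [abs_def]
    by (simp only: wick_sum_left [OF p2] wick_sum_left [OF p] wick_scale [OF pol_eij])
  have 2: "wick \<h> f (momentum_pol \<xi>) z = (\<Sum>k\<in>UNIV. \<Sum>l\<in>UNIV. ?c k l * wick \<h> f (eij l k) z)"
    unfolding momentum_pol_def [abs_def]
    by (simp only: wick_sum_right [OF p2] wick_sum_right [OF p] wick_scale [OF pol_eij])
  have 3: "\<i> / \<h> * (?c k l * wick \<h> (eij l k) f z - ?c k l * wick \<h> f (eij l k) z) =
    \<xi> $ k $ l * z $ l * dz k f z + cnj (\<xi> $ l $ k) * cnj (z $ k) * dzbar l f z" for k l
  proof -
    have "\<i> / \<h> * (?c k l * wick \<h> (eij l k) f z - ?c k l * wick \<h> f (eij l k) z) =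
      (\<i> * \<i>) * (gsign k * \<xi> $ k $ l) * (gsign l * cnj (z $ k) * dzbar l f z - gsign k * z $ l * dz k f z)"
      using assms(1) by (simp add: wick_eij_left [OF assms(3)] wick_eij_right [OF assms(3)] field_simps)
    also have "\<dots> = gsign k * gsign k * \<xi> $ k $ l * z $ l * dz k f z - (gsign k * \<xi> $ k $ l) * gsign l * cnj (z $ k) * dzbar l f z"
      by (simp add: algebra_simps del: gs_square)
    also have "\<dots> = \<xi> $ k $ l * z $ l * dz k f z + (gsign l * gsign l) * cnj (\<xi> $ l $ k) * cnj (z $ k) * dzbar l f z"
      unfolding uuD [OF assms(2), of k l] by (simp add: algebra_simps)
    finally show ?thesis by simp
  qed
  have "\<i> / \<h> * (wick \<h> (momentum_pol \<xi>) f z - wick \<h> f (momentum_pol \<xi>) z) =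
    (\<Sum>k\<in>UNIV. \<Sum>l\<in>UNIV. \<xi> $ k $ l * z $ l * dz k f z + cnj (\<xi> $ l $ k) * cnj (z $ k) * dzbar l f z)"
    unfolding 1 2 sum_subtractf [symmetric] sum_distrib_left by (intro sum.cong refl 3)
  also have "\<dots> = (\<Sum>k\<in>UNIV. \<Sum>l\<in>UNIV. \<xi> $ k $ l * z $ l * dz k f z) + (\<Sum>l\<in>UNIV. \<Sum>k\<in>UNIV. cnj (\<xi> $ l $ k) * cnj (z $ k) * dzbar l f z)"
    unfolding sum.distrib by (intro arg_cong2 [where f = "(+)"] refl sum.swap)
  finally show ?thesis
    by (simp add: sum.distrib matrix_vector_mult_def sum_distrib_right)
qed

text \<open>The derivative of \<open>pw \<h> a (mexp (t *\<^sub>R \<xi>) *v z)\<close> at 0 is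
  computed twice: on coefficients, which gives \<open>pw\<close> of the left side, and by the chain
  rule, which gives the vector field and hence the commutator. Injectivity of \<open>pw\<close>
  concludes.\<close>

lemma dfam_fin:
  fixes a :: "'n::finite triple \<Rightarrow> complex"
  assumes "\<h> \<noteq> 0" "\<xi> \<in> u_alg" "a \<in> fin_coeffs"
  shows "dfam (act_fam (mat 1) a) (emb \<xi>) 0 = ad \<h> \<xi> a"
proof -
  define d where "d = dfam (act_fam (mat 1) a) (emb \<xi>) 0"
  obtain N where N: "\<And>\<tau>. a \<tau> \<noteq> 0 \<Longrightarrow> level \<tau> \<le> N" using fin_level_bound [OF assms(3)] by blast
  have hf: "hol_fam (act_fam (mat 1) a)" by (rule hol_fam_act [OF fin_hat [OF assms(3)]])
  \<comment> \<open>The action preserves levels, so no coefficient appears above the top level of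
    \<open>a\<close>; this keeps the derivative finitely supported.\<close>
  have z: "act_fam (mat 1) a x \<sigma> = 0" if "\<sigma> \<notin> levels_upto N" for x \<sigma>
  proof (cases "\<sigma> \<in> triples")
    case True
    then have "level \<sigma> > N" using that by (auto simp: levels_upto_def)
    then have "list_coeff a K L = 0" if "length K = level \<sigma>" for K L
      using N [of "tri K L"] that by (auto simp: list_coeff_def)
    then show ?thesis by (simp add: act_fam_def cact_def)
  qed (use hol_famD(1) [OF hf] in auto)
  have subc: "{\<tau>. act_fam (mat 1) a x \<tau> \<noteq> 0} \<subseteq> levels_upto N" for x using z by blast
  have subd: "{\<tau>. d \<tau> \<noteq> 0} \<subseteq> levels_upto N"
    using z by (auto simp: d_def dfam_def intro: ccontr)
  then have dfin: "d \<in> fin_coeffs"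
    unfolding fin_coeffs_def mem_Collect_eq using finite_subset [OF subd finite_levels_upto] by (auto simp: levels_upto_def)
  obtain D where pol: "pol D 0 (pw \<h> a)" using pol_pw [OF assms(3)] by blast
  have line: "emb (t *\<^sub>R \<xi>) = 0 + of_real t *s emb \<xi>" for t
    using emb_line [of 0 t \<xi>] by simp
  have L: "pw \<h> d z = (\<Sum>i\<in>UNIV. (\<xi> *v z) $ i * dz i (pw \<h> a) z + cnj ((\<xi> *v z) $ i) * dzbar i (pw \<h> a) z)" for z
  proof -
    let ?B = "\<lambda>\<tau>. ebasis \<tau> z / ((2 * \<h>) ^ level \<tau> * of_nat (nfac \<tau>))"
    have vd: "((\<lambda>t::real. act_fam (mat 1) a (0 + of_real t *s emb \<xi>) \<tau>) has_vector_derivative d \<tau>) (at 0)" for \<tau>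
    proof -
      have "(\<lambda>t. act_fam (mat 1) a (0 + t *s emb \<xi>) \<tau>) field_differentiable at 0"
        using hol_famD(2) [OF hf, of 0 "emb \<xi>" \<tau>] holomorphic_on_imp_differentiable_at by blast
      then have "((\<lambda>t. act_fam (mat 1) a (0 + t *s emb \<xi>) \<tau>) has_field_derivative d \<tau>) (at (of_real 0))"
        by (simp add: d_def dfam_def DERIV_deriv_iff_field_differentiable)
      then show ?thesis by (rule has_vector_derivative_real_field)
    qed
    have "((\<lambda>t::real. \<Sum>\<tau>\<in>levels_upto N. act_fam (mat 1) a (0 + of_real t *s emb \<xi>) \<tau> * ?B \<tau>)
      has_vector_derivative (\<Sum>\<tau>\<in>levels_upto N. d \<tau> * ?B \<tau>)) (at 0)"
      by (intro has_vector_derivative_sum has_vector_derivative_mult_left vd)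
    moreover have "(\<Sum>\<tau>\<in>levels_upto N. act_fam (mat 1) a (0 + of_real t *s emb \<xi>) \<tau> * ?B \<tau>) =
      pw \<h> a (mexp (t *\<^sub>R \<xi>) *v z)" for t
    proof -
      have "pw \<h> a (mexp (t *\<^sub>R \<xi>) *v z) = pw \<h> (act_fam (mat 1) a (emb (t *\<^sub>R \<xi>))) z"
        using pullback_pw [OF assms(1,3), of "mexp (t *\<^sub>R \<xi>)"] by (simp add: act_fam_emb pullback_def fun_eq_iff)
      then show ?thesis
        unfolding pw_def lincomb_superset [OF finite_levels_upto subc] line by simp
    qed
    ultimately have v1: "((\<lambda>t::real. pw \<h> a (mexp (t *\<^sub>R \<xi>) *v z)) has_vector_derivative pw \<h> d z) (at 0)"
      unfolding pw_def lincomb_superset [OF finite_levels_upto subd] by (simp add: pw_def)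
    obtain f' where f': "(pw \<h> a has_derivative f') (at z)"
      using pol_differentiable [OF pol] by (auto simp: differentiable_def)
    have "((\<lambda>t::real. mexp (t *\<^sub>R \<xi>) *v z) has_vector_derivative (\<xi> *v z)) (at 0)"
      unfolding has_vector_derivative_def has_derivative_componentwise_within [of "\<lambda>t. mexp (t *\<^sub>R \<xi>) *v z"]
    proof
      fix b :: "'n cvec" assume "b \<in> Basis"
      then obtain i u where b: "b = axis i u" "u \<in> Basis" by (auto simp: Basis_vec_def)
      have "((\<lambda>t::real. (mexp (t *\<^sub>R \<xi>) *v z) $ i) has_derivative (\<lambda>h. h *\<^sub>R (\<xi> *v z) $ i)) (at 0)"
        using mexp_vec_deriv [of \<xi> z i 0] by (simp add: has_vector_derivative_def)
      then have "((\<lambda>t::real. (mexp (t *\<^sub>R \<xi>) *v z) $ i \<bullet> u) has_derivative (\<lambda>h. (h *\<^sub>R (\<xi> *v z) $ i) \<bullet> u)) (at 0)"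
        by (rule has_derivative_inner_left)
      then show "((\<lambda>t::real. (mexp (t *\<^sub>R \<xi>) *v z) \<bullet> b) has_derivative (\<lambda>h. (h *\<^sub>R (\<xi> *v z)) \<bullet> b)) (at 0)"
        by (simp add: b inner_axis)
    qed
    moreover have "(pw \<h> a has_derivative f') (at (mexp (0 *\<^sub>R \<xi>) *v z))" using f' by simp
    ultimately have "((pw \<h> a \<circ> (\<lambda>t::real. mexp (t *\<^sub>R \<xi>) *v z)) has_vector_derivative f' (\<xi> *v z)) (at 0)"
      by (rule vector_derivative_diff_chain_within [OF _ has_derivative_at_withinI])
    then have "((\<lambda>t::real. pw \<h> a (mexp (t *\<^sub>R \<xi>) *v z)) has_vector_derivative f' (\<xi> *v z)) (at 0)"
      by (simp add: o_def)
    with v1 have "pw \<h> d z = f' (\<xi> *v z)" by (rule vector_derivative_unique_at)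
    then show ?thesis by (simp add: derivative_via_dz [OF f'])
  qed
  have "pw \<h> d z = \<i> / \<h> * (wick \<h> (momentum_pol \<xi>) (pw \<h> a) z - wick \<h> (pw \<h> a) (momentum_pol \<xi>) z)" for z
    by (rule trans [OF L wick_commutator_jpol [OF assms(1,2) pol, symmetric]])
  moreover have c: "cprod (momentum_coeffs \<h> \<xi>) a \<in> fin_coeffs" "cprod a (momentum_coeffs \<h> \<xi>) \<in> fin_coeffs"
    "wick \<h> (momentum_pol \<xi>) (pw \<h> a) = pw \<h> (cprod (momentum_coeffs \<h> \<xi>) a)" "wick \<h> (pw \<h> a) (momentum_pol \<xi>) = pw \<h> (cprod a (momentum_coeffs \<h> \<xi>))"
    using wick_pw [OF assms(1) jc_fin [of \<h> \<xi>] assms(3)] wick_pw [OF assms(1,3) jc_fin [of \<h> \<xi>]] by (simp_all add: pw_jc [OF assms(1)])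
  moreover have "pw \<h> (ad \<h> \<xi> a) = (\<lambda>z. \<i> / \<h> * (pw \<h> (cprod (momentum_coeffs \<h> \<xi>) a) z - pw \<h> (cprod a (momentum_coeffs \<h> \<xi>)) z))"
    unfolding ad_def [abs_def] pw_scale [OF fin_coeffs_diff [OF c(1,2)]] pw_diff [OF c(1,2)] ..
  ultimately have "pw \<h> d = pw \<h> (ad \<h> \<xi> a)" by (simp add: fun_eq_iff)
  moreover have "ad \<h> \<xi> a \<in> fin_coeffs"
    unfolding ad_def [abs_def] by (intro fin_coeffs_scale fin_coeffs_diff c)
  ultimately show ?thesis using pw_inj [OF assms(1) dfin] by (simp add: d_def)
qed

text \<open>A coefficient of either side depends only on coefficients of \<open>a\<close> up to its
  own level, so \<open>a\<close> may be replaced by a truncation.\<close>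

lemma dfam_ad:
  fixes a :: "'n::finite triple \<Rightarrow> complex"
  assumes "\<h> \<noteq> 0" "\<xi> \<in> u_alg" "a \<in> hat_coeffs"
  shows "dfam (act_fam (mat 1) a) (emb \<xi>) 0 = ad \<h> \<xi> a"
proof
  fix \<tau> :: "'n triple"
  let ?a = "trunc (level \<tau>) a"
  have "act_fam (mat 1) a x \<tau> = act_fam (mat 1) ?a x \<tau>" for x
    unfolding act_fam_def by (rule cact_cong) (simp add: trunc_def)
  then have "dfam (act_fam (mat 1) a) (emb \<xi>) 0 \<tau> = dfam (act_fam (mat 1) ?a) (emb \<xi>) 0 \<tau>"
    by (simp add: dfam_def)
  also have "\<dots> = ad \<h> \<xi> ?a \<tau>" by (simp only: dfam_fin [OF assms(1,2) hat_fin_trunc [OF assms(3)]])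
  also have "\<dots> = ad \<h> \<xi> a \<tau>" by (simp add: ad_def cprod_trunc)
  finally show "dfam (act_fam (mat 1) a) (emb \<xi>) 0 \<tau> = ad \<h> \<xi> a \<tau>" .
qed

lemma uu_scale: "\<xi> \<in> u_alg \<Longrightarrow> t *\<^sub>R \<xi> \<in> u_alg"
proof -
  assume \<xi>: "\<xi> \<in> u_alg"
  have "gsign i * (t *\<^sub>R \<xi>) $ i $ j = - (gsign j * cnj ((t *\<^sub>R \<xi>) $ j $ i))" for i j
  proof -
    have "gsign i * (t *\<^sub>R \<xi>) $ i $ j = of_real t * (gsign i * \<xi> $ i $ j)"
      unfolding vector_scaleR_component by (simp add: scaleR_conv_of_real)
    also have "\<dots> = - (gsign j * cnj ((t *\<^sub>R \<xi>) $ j $ i))"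
      unfolding uuD [OF \<xi>] vector_scaleR_component by (simp add: scaleR_conv_of_real)
    finally show ?thesis .
  qed
  then show ?thesis by (simp only: u_alg_def mem_Collect_eq) blast
qed

lemma velocity_ad:
  assumes "\<h> \<noteq> 0" "\<xi> \<in> u_alg" "a \<in> hat_coeffs"
  shows "has_velocity (cone_top \<h>) (\<lambda>t. pullback (mexp (t *\<^sub>R \<xi>)) (fseries \<h> a)) (fseries \<h> (ad \<h> \<xi> a))"
proof -
  have hf: "hol_fam (act_fam (mat 1) a)" by (rule hol_fam_act [OF assms(3)])
  have line: "emb (t *\<^sub>R \<xi>) = 0 + of_real t *s emb \<xi>" for t
    using emb_line [of 0 t \<xi>] by simp
  have p: "pullback (mexp (t *\<^sub>R \<xi>)) (fseries \<h> a) = fseries \<h> (act_fam (mat 1) a (0 + of_real t *s emb \<xi>))" for t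
    unfolding line [symmetric] act_fam_emb matrix_mul_lid
    by (rule pullback_fseries [OF assms(1,3) uu_yfun [OF uu_scale [OF assms(2)]]])
  have "(\<lambda>z. (pullback (mexp (t *\<^sub>R \<xi>)) (fseries \<h> a) z - pullback (mexp (0 *\<^sub>R \<xi>)) (fseries \<h> a) z) / of_real t) =
    fseries \<h> (\<lambda>\<tau>. inverse (of_real t) * (act_fam (mat 1) a (0 + of_real t *s emb \<xi>) \<tau> - act_fam (mat 1) a 0 \<tau>))" for t
    using p [of t] p [of 0] by (simp add: fseries_scale fseries_diff hol_fam_hat [OF hf] divide_inverse mult.commute)
  then show ?thesis
    unfolding has_velocity_def
    using hol_fam_velocity [OF assms(1) hf, of 0 "emb \<xi>"] by (simp only: dfam_ad [OF assms(1-3)])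
qed

section \<open>The vanishing ideal\<close>

text \<open>The ways to remove one occurrence of an entry, with multiplicity: the terms of the
  product rule for a monomial.\<close>

fun deletions :: "'a \<Rightarrow> 'a list \<Rightarrow> 'a list list" where
  "deletions i [] = []"
| "deletions i (x # xs) = (if x = i then [xs] else []) @ map ((#) x) (deletions i xs)"

lemma length_rem: "K \<in> set (deletions i I) \<Longrightarrow> Suc (length K) = length I"
  by (induction I arbitrary: K) (auto split: if_splits)

lemma dz_mon: "dz i (mon I J) = (\<lambda>z. \<Sum>I'\<leftarrow>deletions i I. mon I' J z)"
proof (induction I)
  case Nil
  have "dz i (mon [] J) = (\<lambda>z. 0)"
  proof (induction J)
    case Nil
    show ?case using pol_mon [of "[] :: 'a option list" "[]"] by (intro pol_0_dz) simp
  next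
    case (Cons j J)
    then show ?case by (simp add: mon_simps(3) pol_dz_rules [OF pol_mon])
  qed
  then show ?case by simp
next
  case (Cons l I)
  have "(\<Sum>I'\<leftarrow>deletions i I. z $ l * mon I' J z) = z $ l * (\<Sum>I'\<leftarrow>deletions i I. mon I' J z)" for z
    by (simp add: sum_list_const_mult)
  with Cons show ?case
    by (auto simp: mon_simps(2) pol_dz_rules [OF pol_mon] fun_eq_iff o_def)
qed

lemma dzbar_mon: "dzbar i (mon I J) = (\<lambda>z. \<Sum>J'\<leftarrow>deletions i J. mon I J' z)"
proof (induction I)
  case Nil
  show ?case
  proof (induction J)
    case Nil
    have "dzbar i (mon [] []) = (\<lambda>z. 0)" using pol_mon [of "[] :: 'a option list" "[]"] by (intro pol_0_dz) simp
    then show ?case by simp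
  next
    case (Cons l J)
    have "(\<Sum>J'\<leftarrow>deletions i J. cnj (z $ l) * mon [] J' z) = cnj (z $ l) * (\<Sum>J'\<leftarrow>deletions i J. mon [] J' z)" for z
      by (simp add: sum_list_const_mult)
    with Cons show ?case
      by (auto simp: mon_simps(3) pol_dz_rules [OF pol_mon] fun_eq_iff o_def)
  qed
next
  case (Cons l I)
  then show ?case by (simp add: mon_simps(2) pol_dz_rules [OF pol_mon] sum_list_const_mult)
qed

lemma euler_mon: "(\<Sum>k\<in>UNIV. z $ k * dz k (mon I J) z) = of_nat (length I) * mon I J z"
proof (induction I)
  case Nil
  show ?case by (simp add: dz_mon)
next
  case (Cons l I)
  have "(\<Sum>k\<in>UNIV. z $ k * dz k (mon (l # I) J) z) =
    (\<Sum>k\<in>UNIV. (if k = l then z $ k * mon I J z else 0) + z $ l * (z $ k * dz k (mon I J) z))"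
    by (rule sum.cong) (simp_all add: mon_simps(2) pol_dz_rules [OF pol_mon] algebra_simps)
  also have "\<dots> = z $ l * mon I J z + z $ l * (of_nat (length I) * mon I J z)"
    by (simp add: sum.distrib sum_distrib_left [symmetric] Cons)
  finally show ?case by (simp add: mon_simps(2) algebra_simps)
qed

inductive homogeneous :: "complex \<Rightarrow> nat \<Rightarrow> ('n::finite triple \<Rightarrow> complex) \<Rightarrow> bool" for \<h> \<alpha> where
  hc_0: "homogeneous \<h> \<alpha> (\<lambda>\<tau>. 0)"
| hc_mc: "homogeneous \<h> \<alpha> a \<Longrightarrow> length I = \<alpha> \<Longrightarrow> length J = \<alpha> \<Longrightarrow> homogeneous \<h> \<alpha> (\<lambda>\<tau>. x * mon_coeffs \<h> I J \<tau> + a \<tau>)"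

lemma fin_coeffs_0: "(\<lambda>\<tau>. 0) \<in> fin_coeffs"
  by (simp add: fin_coeffs_def)

lemma hc_fin: "homogeneous \<h> \<alpha> a \<Longrightarrow> a \<in> fin_coeffs"
  by (induction rule: homogeneous.induct) (auto intro!: fin_coeffs_0 fin_coeffs_add fin_coeffs_scale mc_fin)

lemma pw_0: "pw \<h> (\<lambda>\<tau>. 0) = (\<lambda>z. 0)"
  by (simp add: pw_def lincomb_def)

lemma fseries_0: "fseries \<h> (\<lambda>\<tau>. 0) = (\<lambda>z. 0)"
  by (simp add: fseries_def)

lemma hc_fseries:
  assumes "\<h> \<noteq> 0" "homogeneous \<h> \<alpha> a" "z \<in> pos_cone"
  shows "fseries \<h> a z = sfac \<h> \<alpha> z * pw \<h> a z"
  using assms(2)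
proof induction
  case hc_0
  show ?case by (simp add: pw_0 fseries_0)
next
  case (hc_mc a I J x)
  then have "mon_coeffs \<h> I J \<in> fin_coeffs" "a \<in> fin_coeffs"
    by (auto intro: mc_fin hc_fin)
  then have f: "mon_coeffs \<h> I J \<in> fin_coeffs" "(\<lambda>\<tau>. x * mon_coeffs \<h> I J \<tau>) \<in> fin_coeffs" "a \<in> fin_coeffs"
    by (auto intro: fin_coeffs_scale)
  show ?case
    unfolding pw_add [OF f(2,3)] pw_scale [OF f(1)] fseries_add [OF fin_hat [OF f(2)] fin_hat [OF f(3)]]
      fseries_scale
    using hc_mc fseries_mc [OF _ assms(3), of I J \<h>] pw_mc [OF assms(1), of I J] by (simp add: algebra_simps)
qed

lemma hc_list:
  assumes "\<h> \<noteq> 0" "\<And>p. p \<in> set L \<Longrightarrow> length (fst p) = \<alpha> \<and> length (snd p) = \<alpha>"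
  shows "\<exists>u. homogeneous \<h> \<alpha> u \<and> pw \<h> u = (\<lambda>z. \<Sum>p\<leftarrow>L. mon (fst p) (snd p) z)"
  using assms(2)
proof (induction L)
  case Nil
  show ?case by (rule exI [of _ "\<lambda>\<tau>. 0"]) (simp add: pw_0 hc_0)
next
  case (Cons p L)
  then obtain u where u: "homogeneous \<h> \<alpha> u" "pw \<h> u = (\<lambda>z. \<Sum>p\<leftarrow>L. mon (fst p) (snd p) z)" by auto
  have l: "length (fst p) = \<alpha>" "length (snd p) = \<alpha>" using Cons.prems by auto
  have f: "mon_coeffs \<h> (fst p) (snd p) \<in> fin_coeffs" "(\<lambda>\<tau>. 1 * mon_coeffs \<h> (fst p) (snd p) \<tau>) \<in> fin_coeffs"
    using l by (auto intro!: mc_fin)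
  show ?case
  proof (intro exI conjI)
    show "homogeneous \<h> \<alpha> (\<lambda>\<tau>. 1 * mon_coeffs \<h> (fst p) (snd p) \<tau> + u \<tau>)" by (rule hc_mc [OF u(1) l])
    show "pw \<h> (\<lambda>\<tau>. 1 * mon_coeffs \<h> (fst p) (snd p) \<tau> + u \<tau>) = (\<lambda>z. \<Sum>p\<leftarrow>p # L. mon (fst p) (snd p) z)"
      unfolding pw_add [OF f(2) hc_fin [OF u(1)]] pw_scale [OF f(1)] u(2)
      using l by (simp add: pw_mc [OF assms(1)])
  qed
qed

text \<open>A product with \<open>eij\<close> raises the level by one in its leading part and keeps
  it in the first order part. The parts are separated because \<open>S\<close> multiplies them by
  different functions of \<open>y\<close>; the leading part is common to both orders.\<close>

lemma cprod_ec_mc: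
  fixes I J :: "'n::finite option list"
  assumes "\<h> \<noteq> 0" "length I = \<alpha>" "length J = \<alpha>"
  shows "\<exists>u v. homogeneous \<h> \<alpha> u \<and> homogeneous \<h> \<alpha> v \<and> pw \<h> u = (\<lambda>z. cnj (z $ j) * dzbar i (mon I J) z) \<and>
    pw \<h> v = (\<lambda>z. z $ i * dz j (mon I J) z) \<and>
    cprod (eij_coeffs \<h> i j) (mon_coeffs \<h> I J) = (\<lambda>\<tau>. mon_coeffs \<h> (i # I) (j # J) \<tau> + 2 * \<h> * gsign i * u \<tau>) \<and>
    cprod (mon_coeffs \<h> I J) (eij_coeffs \<h> i j) = (\<lambda>\<tau>. mon_coeffs \<h> (i # I) (j # J) \<tau> + 2 * \<h> * gsign j * v \<tau>)"
proof -
  have "\<exists>u. homogeneous \<h> \<alpha> u \<and> pw \<h> u = (\<lambda>z. \<Sum>p\<leftarrow>map (\<lambda>J'. (I, j # J')) (deletions i J). mon (fst p) (snd p) z)"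
    by (rule hc_list [OF assms(1)]) (use assms length_rem [of _ i J] in auto)
  then obtain u where u: "homogeneous \<h> \<alpha> u" "pw \<h> u = (\<lambda>z. \<Sum>p\<leftarrow>map (\<lambda>J'. (I, j # J')) (deletions i J). mon (fst p) (snd p) z)"
    by blast
  have "\<exists>v. homogeneous \<h> \<alpha> v \<and> pw \<h> v = (\<lambda>z. \<Sum>p\<leftarrow>map (\<lambda>I'. (i # I', J)) (deletions j I). mon (fst p) (snd p) z)"
    by (rule hc_list [OF assms(1)]) (use assms length_rem [of _ j I] in auto)
  then obtain v where v: "homogeneous \<h> \<alpha> v" "pw \<h> v = (\<lambda>z. \<Sum>p\<leftarrow>map (\<lambda>I'. (i # I', J)) (deletions j I). mon (fst p) (snd p) z)"
    by blast
  have pu: "pw \<h> u = (\<lambda>z. cnj (z $ j) * dzbar i (mon I J) z)"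
    unfolding u(2) dzbar_mon by (simp add: o_def mon_simps(3) sum_list_const_mult)
  have pv: "pw \<h> v = (\<lambda>z. z $ i * dz j (mon I J) z)"
    unfolding v(2) dz_mon by (simp add: o_def mon_simps(2) sum_list_const_mult)
  have f: "mon_coeffs \<h> (i # I) (j # J) \<in> fin_coeffs" "mon_coeffs \<h> I J \<in> fin_coeffs" "eij_coeffs \<h> i j \<in> fin_coeffs"
    "u \<in> fin_coeffs" "v \<in> fin_coeffs"
    using assms hc_fin u(1) v(1) by (auto intro!: mc_fin simp: ec_mc)
  have fs: "(\<lambda>\<tau>. 2 * \<h> * gsign i * u \<tau>) \<in> fin_coeffs" "(\<lambda>\<tau>. 2 * \<h> * gsign j * v \<tau>) \<in> fin_coeffs"
    by (intro fin_coeffs_scale f)+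
  have p: "pw \<h> (mon_coeffs \<h> (i # I) (j # J)) = mon (i # I) (j # J)" "pw \<h> (mon_coeffs \<h> I J) = mon I J"
    "pw \<h> (eij_coeffs \<h> i j) = eij i j"
    using assms by (simp_all add: pw_mc ec_mc eij_mon)
  have m: "mon (i # I) (j # J) z = z $ i * (cnj (z $ j) * mon I J z)" for z
    by (simp add: mon_simps)
  have w: "cprod (eij_coeffs \<h> i j) (mon_coeffs \<h> I J) \<in> fin_coeffs" "cprod (mon_coeffs \<h> I J) (eij_coeffs \<h> i j) \<in> fin_coeffs"
    "pw \<h> (cprod (eij_coeffs \<h> i j) (mon_coeffs \<h> I J)) = wick \<h> (eij i j) (mon I J)"
    "pw \<h> (cprod (mon_coeffs \<h> I J) (eij_coeffs \<h> i j)) = wick \<h> (mon I J) (eij i j)"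
    using wick_pw [OF assms(1) f(3,2)] wick_pw [OF assms(1) f(2,3)] p by auto
  have "cprod (eij_coeffs \<h> i j) (mon_coeffs \<h> I J) = (\<lambda>\<tau>. mon_coeffs \<h> (i # I) (j # J) \<tau> + 2 * \<h> * gsign i * u \<tau>)"
  proof (rule pw_inj [OF assms(1) w(1) fin_coeffs_add [OF f(1) fs(1)]])
    show "pw \<h> (cprod (eij_coeffs \<h> i j) (mon_coeffs \<h> I J)) = pw \<h> (\<lambda>\<tau>. mon_coeffs \<h> (i # I) (j # J) \<tau> + 2 * \<h> * gsign i * u \<tau>)"
      unfolding w pw_add [OF f(1) fs(1)] pw_scale [OF f(4)] pu p m wick_eij_left [OF pol_mon]
      by (simp add: algebra_simps)
  qed
  moreover have "cprod (mon_coeffs \<h> I J) (eij_coeffs \<h> i j) = (\<lambda>\<tau>. mon_coeffs \<h> (i # I) (j # J) \<tau> + 2 * \<h> * gsign j * v \<tau>)"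
  proof (rule pw_inj [OF assms(1) w(2) fin_coeffs_add [OF f(1) fs(2)]])
    show "pw \<h> (cprod (mon_coeffs \<h> I J) (eij_coeffs \<h> i j)) = pw \<h> (\<lambda>\<tau>. mon_coeffs \<h> (i # I) (j # J) \<tau> + 2 * \<h> * gsign j * v \<tau>)"
      unfolding w pw_add [OF f(1) fs(2)] pw_scale [OF f(5)] pv p m wick_eij_right [OF pol_mon]
      by (simp add: algebra_simps)
  qed
  ultimately show ?thesis using u(1) v(1) pu pv by blast
qed

text \<open>The indices of the support are added one at a time; each index in \<open>triples\<close>
  contributes a multiple of the monomial of its representing lists.\<close>

lemma fin_coeffs_induct [consumes 2, case_names 0 step]:
  fixes a :: "'n::finite triple \<Rightarrow> complex"
  assumes "\<h> \<noteq> 0" "a \<in> fin_coeffs" "P (\<lambda>\<tau>. 0)"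
    and step: "\<And>x I J a. a \<in> fin_coeffs \<Longrightarrow> P a \<Longrightarrow> length I = length J \<Longrightarrow> P (\<lambda>\<tau>. x * mon_coeffs \<h> I J \<tau> + a \<tau>)"
  shows "P a"
proof -
  have "P (\<lambda>\<tau>. if \<tau> \<in> S then a \<tau> else 0)" if "finite S" for S
    using that
  proof induction
    case empty
    show ?case using assms(3) by simp
  next
    case (insert \<sigma> S)
    let ?b = "\<lambda>\<tau>. if \<tau> \<in> S then a \<tau> else 0"
    have fb: "?b \<in> fin_coeffs"
    proof -
      have "{\<tau>. ?b \<tau> \<noteq> 0} \<subseteq> {\<tau>. a \<tau> \<noteq> 0}" by auto
      then show ?thesis using assms(2) unfolding fin_coeffs_def by (blast intro: finite_subset)
    qed
    show ?case
    proof (cases "\<sigma> \<in> triples")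
      case True
      have l: "length (repI \<sigma>) = length (repJ \<sigma>)" and t: "tri (repI \<sigma>) (repJ \<sigma>) = \<sigma>"
        using rep [OF True] by auto
      have "(\<lambda>\<tau>. if \<tau> \<in> insert \<sigma> S then a \<tau> else 0) =
        (\<lambda>\<tau>. a \<sigma> / ((2 * \<h>) ^ level \<sigma> * of_nat (nfac \<sigma>)) * mon_coeffs \<h> (repI \<sigma>) (repJ \<sigma>) \<tau> + ?b \<tau>)"
        using insert(2) assms(1) by (auto simp: mon_coeffs_def t fun_eq_iff)
      then show ?thesis by (simp only: step [OF fb insert.IH l])
    next
      case False
      then have "(\<lambda>\<tau>. if \<tau> \<in> insert \<sigma> S then a \<tau> else 0) = ?b"
        using fin_coeffs_outside [OF assms(2) False] by (simp add: fun_eq_iff)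
      then show ?thesis using insert.IH by simp
    qed
  qed
  from this [of "{\<tau>. a \<tau> \<noteq> 0}"] have "P (\<lambda>\<tau>. if \<tau> \<in> {\<tau>. a \<tau> \<noteq> 0} then a \<tau> else 0)"
    using assms(2) by (simp add: fin_coeffs_def)
  moreover have "(\<lambda>\<tau>. if \<tau> \<in> {\<tau>. a \<tau> \<noteq> 0} then a \<tau> else 0) = a" by auto
  ultimately show ?thesis by simp
qed

section \<open>Left multiplication by level one elements through commutators\<close>

definition commutator :: "('n::finite triple \<Rightarrow> complex) \<Rightarrow> ('n triple \<Rightarrow> complex) \<Rightarrow> 'n triple \<Rightarrow> complex" where
  "commutator a b \<tau> = cprod a b \<tau> - cprod b a \<tau>"

lemma com_hat: "a \<in> hat_coeffs \<Longrightarrow> b \<in> hat_coeffs \<Longrightarrow> commutator a b \<in> hat_coeffs"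
  unfolding commutator_def [abs_def] by (intro hat_diff cprod_hat)

lemma ec_hat: "eij_coeffs \<h> i j \<in> hat_coeffs"
  unfolding ec_mc by (intro fin_hat mc_fin) simp

text \<open>Raising the level turns y times \<open>sfac\<close> into \<open>sfac\<close> times y + 2
  \<h> \<alpha>, so the product differs from the pointwise one by a multiple of \<alpha> and a
  \<open>dzbar\<close> term. The weighted sum of commutators reproduces exactly these: the signed
  sum of |z_k|^2 is -y, and Euler's identity gives \<alpha>.\<close>

lemma mult_ec_mc:
  assumes "\<h> \<noteq> 0" "z \<in> pos_cone" "length I = length J"
  shows "of_real (yfun z) * fseries \<h> (cprod (eij_coeffs \<h> i j) (mon_coeffs \<h> I J)) z =
    of_real (yfun z) * eij i j z * fseries \<h> (mon_coeffs \<h> I J) z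
    - (\<Sum>k\<in>UNIV. gsign k * z $ k * cnj (z $ j) * fseries \<h> (commutator (eij_coeffs \<h> i k) (mon_coeffs \<h> I J)) z)"
proof -
  let ?y = "complex_of_real (yfun z)"
  define \<alpha> where "\<alpha> = length I"
  have l: "length I = \<alpha>" "length J = \<alpha>" using assms(3) by (auto simp: \<alpha>_def)
  have y: "?y \<noteq> 0" using assms(2) by (simp add: pos_cone_def)
  have mh: "mon_coeffs \<h> I J \<in> hat_coeffs" "mon_coeffs \<h> (i # I) (k # J) \<in> hat_coeffs" for k
    using assms(3) by (auto intro!: fin_hat mc_fin)
  have s: "sfac \<h> (Suc \<alpha>) z * ?y = sfac \<h> \<alpha> z * (?y + 2 * \<h> * of_nat \<alpha>)"
    using assms(1) y by (simp add: sfac_def pochhammer_Suc field_simps)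
  have A: "fseries \<h> (cprod (eij_coeffs \<h> i k) (mon_coeffs \<h> I J)) z =
      sfac \<h> (Suc \<alpha>) z * (z $ i * (cnj (z $ k) * mon I J z)) + 2 * \<h> * gsign i * sfac \<h> \<alpha> z * (cnj (z $ k) * dzbar i (mon I J) z)"
    and B: "fseries \<h> (cprod (mon_coeffs \<h> I J) (eij_coeffs \<h> i k)) z =
      sfac \<h> (Suc \<alpha>) z * (z $ i * (cnj (z $ k) * mon I J z)) + 2 * \<h> * gsign k * sfac \<h> \<alpha> z * (z $ i * dz k (mon I J) z)" for k
  proof -
    obtain u v where uv: "homogeneous \<h> \<alpha> u" "homogeneous \<h> \<alpha> v" "pw \<h> u = (\<lambda>z. cnj (z $ k) * dzbar i (mon I J) z)"
      "pw \<h> v = (\<lambda>z. z $ i * dz k (mon I J) z)"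
      "cprod (eij_coeffs \<h> i k) (mon_coeffs \<h> I J) = (\<lambda>\<tau>. mon_coeffs \<h> (i # I) (k # J) \<tau> + 2 * \<h> * gsign i * u \<tau>)"
      "cprod (mon_coeffs \<h> I J) (eij_coeffs \<h> i k) = (\<lambda>\<tau>. mon_coeffs \<h> (i # I) (k # J) \<tau> + 2 * \<h> * gsign k * v \<tau>)"
      using cprod_ec_mc [OF assms(1) l, of k i] by blast
    have h: "u \<in> hat_coeffs" "v \<in> hat_coeffs" using uv by (auto intro: fin_hat hc_fin)
    have "fseries \<h> (mon_coeffs \<h> (i # I) (k # J)) z = sfac \<h> (Suc \<alpha>) z * (z $ i * (cnj (z $ k) * mon I J z))"
      using fseries_mc [of "i # I" "k # J" z \<h>] assms l by (simp add: mon_simps)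
    then show "fseries \<h> (cprod (eij_coeffs \<h> i k) (mon_coeffs \<h> I J)) z =
      sfac \<h> (Suc \<alpha>) z * (z $ i * (cnj (z $ k) * mon I J z)) + 2 * \<h> * gsign i * sfac \<h> \<alpha> z * (cnj (z $ k) * dzbar i (mon I J) z)"
      "fseries \<h> (cprod (mon_coeffs \<h> I J) (eij_coeffs \<h> i k)) z =
      sfac \<h> (Suc \<alpha>) z * (z $ i * (cnj (z $ k) * mon I J z)) + 2 * \<h> * gsign k * sfac \<h> \<alpha> z * (z $ i * dz k (mon I J) z)"
      unfolding uv(5,6) fseries_add [OF mh(2) hat_scale [OF h(1)]] fseries_add [OF mh(2) hat_scale [OF h(2)]]
        fseries_scale hc_fseries [OF assms(1) uv(1) assms(2)]
        hc_fseries [OF assms(1) uv(2) assms(2)] uv(3,4) by simp_all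
  qed
  \<comment> \<open>The leading parts of level \<alpha> + 1 cancel, so only
    \<open>sfac \<h> \<alpha>\<close> occurs.\<close>
  have C: "fseries \<h> (commutator (eij_coeffs \<h> i k) (mon_coeffs \<h> I J)) z = 2 * \<h> * sfac \<h> \<alpha> z *
      (gsign i * (cnj (z $ k) * dzbar i (mon I J) z) - gsign k * (z $ i * dz k (mon I J) z))" for k
    unfolding commutator_def [abs_def] fseries_diff [OF cprod_hat [OF ec_hat mh(1)] cprod_hat [OF mh(1) ec_hat]] A B
    by (simp add: algebra_simps)
  let ?D = "2 * \<h> * sfac \<h> \<alpha> z" let ?b = "dzbar i (mon I J) z"
  have "(\<Sum>k\<in>UNIV. gsign k * z $ k * cnj (z $ j) * fseries \<h> (commutator (eij_coeffs \<h> i k) (mon_coeffs \<h> I J)) z) =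
    (\<Sum>k\<in>UNIV. ?D * cnj (z $ j) * gsign i * ?b * (gsign k * (cnj (z $ k) * z $ k)) - ?D * cnj (z $ j) * z $ i * (z $ k * dz k (mon I J) z))"
    unfolding C
  proof (rule sum.cong)
    fix k :: "'a option"
    have "gsign k * gsign k = (1::complex)" by (simp add: gsign_def)
    then have "gsign k * (gsign k * w) = w" for w :: complex by (simp flip: mult.assoc)
    then show "gsign k * z $ k * cnj (z $ j) * (?D * (gsign i * (cnj (z $ k) * ?b) - gsign k * (z $ i * dz k (mon I J) z))) =
      ?D * cnj (z $ j) * gsign i * ?b * (gsign k * (cnj (z $ k) * z $ k)) - ?D * cnj (z $ j) * z $ i * (z $ k * dz k (mon I J) z)"
      by (simp add: algebra_simps)
  qed simp
  also have "\<dots> = - (?D * cnj (z $ j) * gsign i * ?b * ?y) - ?D * cnj (z $ j) * z $ i * (of_nat \<alpha> * mon I J z)"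
    unfolding sum_subtractf sum_distrib_left [symmetric] euler_mon l(1) yfun_complex by simp
  finally have S: "(\<Sum>k\<in>UNIV. gsign k * z $ k * cnj (z $ j) * fseries \<h> (commutator (eij_coeffs \<h> i k) (mon_coeffs \<h> I J)) z) =
    - (?D * cnj (z $ j) * gsign i * ?b * ?y) - ?D * cnj (z $ j) * z $ i * (of_nat \<alpha> * mon I J z)" .
  have F: "fseries \<h> (mon_coeffs \<h> I J) z = sfac \<h> \<alpha> z * mon I J z"
    using fseries_mc [OF assms(3,2)] l by simp
  have T: "?y * (sfac \<h> (Suc \<alpha>) z * X) = sfac \<h> \<alpha> z * (?y + 2 * \<h> * of_nat \<alpha>) * X" for X
    unfolding s [symmetric] by (simp add: mult_ac)
  show ?thesis unfolding A S F distrib_left T by (simp add: eij_def algebra_simps)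
qed

lemma com_lin_right: "commutator c (\<lambda>\<tau>. x * a \<tau> + b \<tau>) = (\<lambda>\<tau>. x * commutator c a \<tau> + commutator c b \<tau>)"
  unfolding commutator_def [abs_def] cprod_add_left cprod_add_right cprod_scale_left cprod_scale_right
  by (simp add: algebra_simps)

lemma fseries_lin:
  "a \<in> hat_coeffs \<Longrightarrow> b \<in> hat_coeffs \<Longrightarrow> fseries \<h> (\<lambda>\<tau>. x * a \<tau> + b \<tau>) z = x * fseries \<h> a z + fseries \<h> b z"
  by (simp add: fseries_add [OF hat_scale] fseries_scale)

lemma mult_ec_fin:
  fixes a :: "'n::finite triple \<Rightarrow> complex"
  assumes "\<h> \<noteq> 0" "z \<in> pos_cone" "a \<in> fin_coeffs"
  shows "of_real (yfun z) * fseries \<h> (cprod (eij_coeffs \<h> i j) a) z =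
    of_real (yfun z) * eij i j z * fseries \<h> a z
    - (\<Sum>k\<in>UNIV. gsign k * z $ k * cnj (z $ j) * fseries \<h> (commutator (eij_coeffs \<h> i k) a) z)"
  using assms(1,3)
proof (induction rule: fin_coeffs_induct)
  case 0
  have z: "cprod (c :: 'n triple \<Rightarrow> complex) (\<lambda>\<tau>. 0) = (\<lambda>\<tau>. 0)" "cprod (\<lambda>\<tau>. 0) c = (\<lambda>\<tau>. 0)" for c
    using cprod_scale_right [of c 0 c] cprod_scale_left [of 0 c c] by simp_all
  show ?case by (simp add: commutator_def [abs_def] z fseries_0)
next
  case (step x I J a)
  have h: "mon_coeffs \<h> I J \<in> hat_coeffs" "a \<in> hat_coeffs" using step by (auto intro: fin_hat mc_fin)
  have 1: "cprod (eij_coeffs \<h> i j) (\<lambda>\<tau>. x * mon_coeffs \<h> I J \<tau> + a \<tau>) = (\<lambda>\<tau>. x * cprod (eij_coeffs \<h> i j) (mon_coeffs \<h> I J) \<tau> + cprod (eij_coeffs \<h> i j) a \<tau>)"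
    unfolding cprod_add_right cprod_scale_right ..
  have 2: "(\<Sum>k\<in>UNIV. c k * (x * F k + G k)) = x * (\<Sum>k\<in>UNIV. c k * F k) + (\<Sum>k\<in>UNIV. c k * G k)"
    for c F G :: "'n option \<Rightarrow> complex"
    by (simp add: sum.distrib sum_distrib_left algebra_simps)
  have 3: "Y * (x * m + n) = Y * E * (x * f + g) - (x * s + t)"
    if "Y * n = Y * E * g - t" "Y * m = Y * E * f - s" for Y E m n f g s t :: complex
    using that by algebra
  show ?case
    unfolding 1 com_lin_right fseries_lin [OF h] fseries_lin [OF cprod_hat [OF ec_hat h(1)] cprod_hat [OF ec_hat h(2)]]
      fseries_lin [OF com_hat [OF ec_hat h(1)] com_hat [OF ec_hat h(2)]] 2
    by (rule 3 [OF step.IH mult_ec_mc [OF assms(1,2) step.hyps(2)]])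
qed

lemma cprod_trunc_lim:
  assumes "\<h> \<noteq> 0" "a \<in> hat_coeffs" "c \<in> hat_coeffs"
  shows "(\<lambda>N. fseries \<h> (cprod c (trunc N a)) z) \<longlonglongrightarrow> fseries \<h> (cprod c a) z"
    "(\<lambda>N. fseries \<h> (cprod (trunc N a) c) z) \<longlonglongrightarrow> fseries \<h> (cprod a c) z"
proof -
  have c: "limitin (cone_top \<h>) (\<lambda>N. fseries \<h> c) (fseries \<h> c) sequentially"
    using assms by (simp add: limitin_def topspace_cone_top cone_alg_def)
  have t: "trunc N a \<in> hat_coeffs" for N by (intro fin_hat hat_fin_trunc assms)
  show "(\<lambda>N. fseries \<h> (cprod c (trunc N a)) z) \<longlonglongrightarrow> fseries \<h> (cprod c a) z"
    by (rule limitin_cone_top_eval [OF assms(1) cprod_lim [OF assms(1,3,2,3) t c trunc_lim [OF assms(1,2)]]])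
  show "(\<lambda>N. fseries \<h> (cprod (trunc N a) c) z) \<longlonglongrightarrow> fseries \<h> (cprod a c) z"
    by (rule limitin_cone_top_eval [OF assms(1) cprod_lim [OF assms(1,2,3) t assms(3) trunc_lim [OF assms(1,2)] c]])
qed

text \<open>On \<open>y = 1\<close> this expresses left multiplication by a degree one element through pointwise
  multiplication and commutators.\<close>

lemma mult_ec:
  fixes a :: "'n::finite triple \<Rightarrow> complex"
  assumes "\<h> \<noteq> 0" "z \<in> pos_cone" "a \<in> hat_coeffs"
  shows "of_real (yfun z) * fseries \<h> (cprod (eij_coeffs \<h> i j) a) z =
    of_real (yfun z) * eij i j z * fseries \<h> a z
    - (\<Sum>k\<in>UNIV. gsign k * z $ k * cnj (z $ j) * fseries \<h> (commutator (eij_coeffs \<h> i k) a) z)"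
proof (rule LIMSEQ_unique)
  have t: "trunc N a \<in> hat_coeffs" for N by (intro fin_hat hat_fin_trunc assms)
  have c: "fseries \<h> (commutator (eij_coeffs \<h> i k) b) z = fseries \<h> (cprod (eij_coeffs \<h> i k) b) z - fseries \<h> (cprod b (eij_coeffs \<h> i k)) z"
    if "b \<in> hat_coeffs" for k b
    unfolding commutator_def [abs_def] fseries_diff [OF cprod_hat [OF ec_hat that] cprod_hat [OF that ec_hat]] ..
  show "(\<lambda>N. of_real (yfun z) * fseries \<h> (cprod (eij_coeffs \<h> i j) (trunc N a)) z) \<longlonglongrightarrow>
    of_real (yfun z) * fseries \<h> (cprod (eij_coeffs \<h> i j) a) z"
    by (intro tendsto_intros cprod_trunc_lim assms ec_hat)
  show "(\<lambda>N. of_real (yfun z) * fseries \<h> (cprod (eij_coeffs \<h> i j) (trunc N a)) z) \<longlonglongrightarrow>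
    of_real (yfun z) * eij i j z * fseries \<h> a z
    - (\<Sum>k\<in>UNIV. gsign k * z $ k * cnj (z $ j) * fseries \<h> (commutator (eij_coeffs \<h> i k) a) z)"
    unfolding mult_ec_fin [OF assms(1,2) hat_fin_trunc [OF assms(3)]] c [OF t] c [OF assms(3)]
    by (intro tendsto_intros cprod_trunc_lim assms ec_hat limitin_cone_top_eval [OF assms(1) trunc_lim])
qed

section \<open>The vanishing ideal is two-sided\<close>

definition vanishing_coeffs :: "complex \<Rightarrow> ('n::finite triple \<Rightarrow> complex) set" where
  "vanishing_coeffs \<h> = {c \<in> hat_coeffs. \<forall>w. yfun w = 1 \<longrightarrow> fseries \<h> c w = 0}"

lemma van_hat: "c \<in> vanishing_coeffs \<h> \<Longrightarrow> c \<in> hat_coeffs"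
  by (simp add: vanishing_coeffs_def)

lemma van_lin: "a \<in> vanishing_coeffs \<h> \<Longrightarrow> b \<in> vanishing_coeffs \<h> \<Longrightarrow> (\<lambda>\<tau>. x * a \<tau> + b \<tau>) \<in> vanishing_coeffs \<h>"
  unfolding vanishing_coeffs_def by (simp add: fseries_lin hat_add hat_scale)

lemma van_0: "(\<lambda>\<tau>. 0) \<in> vanishing_coeffs \<h>"
  by (simp add: vanishing_coeffs_def fseries_0)

lemma van_scale: "a \<in> vanishing_coeffs \<h> \<Longrightarrow> (\<lambda>\<tau>. x * a \<tau>) \<in> vanishing_coeffs \<h>"
  using van_lin [OF _ van_0, of a \<h> x] by simp

text \<open>The flow of \<open>\<xi>\<close> preserves the level set \<open>y = 1\<close>, so all
  difference quotients vanish there, and evaluation is continuous.\<close>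

lemma ad_van:
  assumes "\<h> \<noteq> 0" "\<xi> \<in> u_alg" "a \<in> vanishing_coeffs \<h>"
  shows "ad \<h> \<xi> a \<in> vanishing_coeffs \<h>"
proof -
  have h: "a \<in> hat_coeffs" by (rule van_hat [OF assms(3)])
  have "fseries \<h> (ad \<h> \<xi> a) w = 0" if w: "yfun w = 1" for w
  proof -
    have 0: "pullback (mexp (t *\<^sub>R \<xi>)) (fseries \<h> a) w = 0" for t :: real
      using assms(3) w uu_yfun [OF uu_scale [OF assms(2)], of t w] by (simp add: vanishing_coeffs_def pullback_def)
    have "((\<lambda>t::real. (pullback (mexp (t *\<^sub>R \<xi>)) (fseries \<h> a) w - pullback (mexp (0 *\<^sub>R \<xi>)) (fseries \<h> a) w) / of_real t)
      \<longlongrightarrow> fseries \<h> (ad \<h> \<xi> a) w) (at 0)"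
      by (rule limitin_cone_top_eval [OF assms(1) velocity_ad [OF assms(1,2) h, unfolded has_velocity_def]])
    then have "((\<lambda>t::real. 0) \<longlongrightarrow> fseries \<h> (ad \<h> \<xi> a) w) (at 0)" unfolding 0 by simp
    then show ?thesis by (simp add: tendsto_const_iff)
  qed
  then show ?thesis by (simp add: vanishing_coeffs_def ad_hat [OF h])
qed

lemma com_jc_van:
  assumes "\<h> \<noteq> 0" "\<xi> \<in> u_alg" "a \<in> vanishing_coeffs \<h>"
  shows "commutator (momentum_coeffs \<h> \<xi>) a \<in> vanishing_coeffs \<h>"
proof -
  have "commutator (momentum_coeffs \<h> \<xi>) a = (\<lambda>\<tau>. (\<h> / \<i>) * ad \<h> \<xi> a \<tau>)"
    using assms(1) by (simp add: commutator_def ad_def fun_eq_iff)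
  then show ?thesis by (simp only: van_scale [OF ad_van [OF assms]])
qed

text \<open>Every matrix is \<open>\<xi> + \<i> \<eta>\<close> with \<open>\<xi>, \<eta>\<close> in \<open>u(1,n)\<close>.\<close>

lemma com_jc_van_all:
  fixes M :: "'n::finite cmat"
  assumes "\<h> \<noteq> 0" "a \<in> vanishing_coeffs \<h>"
  shows "commutator (momentum_coeffs \<h> M) a \<in> vanishing_coeffs \<h>"
proof -
  define \<xi> :: "'n cmat" where "\<xi> = (\<chi> i j. (M $ i $ j - gsign i * gsign j * cnj (M $ j $ i)) / 2)"
  define \<eta> :: "'n cmat" where "\<eta> = (\<chi> i j. (M $ i $ j + gsign i * gsign j * cnj (M $ j $ i)) / (2 * \<i>))"
  have g: "gsign j * (gsign i * (gsign j * x)) = gsign i * x" for i j and x :: complex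
    by (metis gs_square(2) mult.left_commute)
  have "\<xi> \<in> u_alg" "\<eta> \<in> u_alg"
    unfolding u_alg_def by (auto simp: \<xi>_def \<eta>_def algebra_simps divide_simps g)
  have "momentum_coeffs \<h> M = (\<lambda>\<tau>. \<i> * momentum_coeffs \<h> \<eta> \<tau> + momentum_coeffs \<h> \<xi> \<tau>)"
  proof
    fix \<tau>
    have "\<i> / 2 * gsign k * M $ k $ l * e = \<i> * (\<i> / 2 * gsign k * \<eta> $ k $ l * e) + \<i> / 2 * gsign k * \<xi> $ k $ l * e" for k l e
      by (simp add: \<xi>_def \<eta>_def field_simps)
    then show "momentum_coeffs \<h> M \<tau> = \<i> * momentum_coeffs \<h> \<eta> \<tau> + momentum_coeffs \<h> \<xi> \<tau>"
      unfolding momentum_coeffs_def sum_distrib_left sum.distrib [symmetric] by (simp only:)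
  qed
  then have "commutator (momentum_coeffs \<h> M) a = (\<lambda>\<tau>. \<i> * commutator (momentum_coeffs \<h> \<eta>) a \<tau> + commutator (momentum_coeffs \<h> \<xi>) a \<tau>)"
    unfolding commutator_def [abs_def] by (simp add: cprod_add_left cprod_add_right cprod_scale_left cprod_scale_right algebra_simps)
  then show ?thesis
    using van_lin [OF com_jc_van [OF assms(1) \<open>\<eta> \<in> u_alg\<close> assms(2)] com_jc_van [OF assms(1) \<open>\<xi> \<in> u_alg\<close> assms(2)]] by simp
qed

lemma com_ec_van:
  assumes "\<h> \<noteq> 0" "a \<in> vanishing_coeffs \<h>"
  shows "commutator (eij_coeffs \<h> i j) a \<in> vanishing_coeffs \<h>"
proof -
  \<comment> \<open>The single nonzero entry cancels the factor \<open>\<i> / 2 * gsign j\<close> in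
    the momentum map.\<close>
  have "eij_coeffs \<h> i j = momentum_coeffs \<h> (\<chi> k l. if k = j \<and> l = i then - 2 * \<i> * gsign j else 0)"
  proof
    fix \<tau>
    have "momentum_coeffs \<h> (\<chi> k l. if k = j \<and> l = i then - 2 * \<i> * gsign j else 0) \<tau> =
      (\<Sum>k\<in>UNIV. \<Sum>l\<in>UNIV. if l = i then (if k = j then eij_coeffs \<h> i j \<tau> else 0) else 0)"
      unfolding momentum_coeffs_def by (intro sum.cong) (auto simp: algebra_simps)
    then show "eij_coeffs \<h> i j \<tau> = momentum_coeffs \<h> (\<chi> k l. if k = j \<and> l = i then - 2 * \<i> * gsign j else 0) \<tau>" by simp
  qed
  then show ?thesis using com_jc_van_all [OF assms] by simp
qed

text \<open>On \<open>y = 1\<close> the identity \<open>mult_ec\<close> writes the product through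
  the values of \<open>a\<close> and of its commutators with the \<open>eij\<close>, all of which
  vanish there.\<close>

lemma cprod_ec_van:
  assumes "\<h> \<noteq> 0" "a \<in> vanishing_coeffs \<h>"
  shows "cprod (eij_coeffs \<h> i j) a \<in> vanishing_coeffs \<h>"
proof -
  have h: "a \<in> hat_coeffs" by (rule van_hat [OF assms(2)])
  have "fseries \<h> (cprod (eij_coeffs \<h> i j) a) w = 0" if w: "yfun w = 1" for w
  proof -
    have "w \<in> pos_cone" using w by (simp add: pos_cone_def)
    moreover have "fseries \<h> (commutator (eij_coeffs \<h> i k) a) w = 0" for k
      using com_ec_van [OF assms] w by (simp add: vanishing_coeffs_def)
    ultimately show ?thesis using mult_ec [OF assms(1) _ h, of w i j] w assms(2) by (simp add: vanishing_coeffs_def)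
  qed
  then show ?thesis by (simp add: vanishing_coeffs_def cprod_hat [OF ec_hat h])
qed

text \<open>Each coefficient can be computed with truncations at its own level, where the identity
  is \<open>wick_eij_assoc\<close>.\<close>

lemma cprod_ec_assoc:
  fixes a b :: "'n::finite triple \<Rightarrow> complex"
  assumes "\<h> \<noteq> 0" "\<And>\<tau>. \<tau> \<notin> triples \<Longrightarrow> a \<tau> = 0" "\<And>\<tau>. \<tau> \<notin> triples \<Longrightarrow> b \<tau> = 0"
  shows "cprod (cprod (eij_coeffs \<h> i j) a) b = cprod (eij_coeffs \<h> i j) (cprod a b)"
proof
  fix \<tau> :: "'n triple"
  let ?N = "level \<tau>" let ?e = "eij_coeffs \<h> i j :: 'n triple \<Rightarrow> complex"
  have e: "?e \<in> fin_coeffs" unfolding ec_mc by (intro mc_fin) simp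
  have pe: "pw \<h> ?e = eij i j" using pw_mc [OF assms(1), of "[i]" "[j]"] by (simp add: ec_mc eij_mon)
  have f: "trunc ?N a \<in> fin_coeffs" "trunc ?N b \<in> fin_coeffs" using assms by (auto intro: trunc_fin)
  obtain d where d1: "pol d 0 (pw \<h> (trunc ?N a))" by (rule pol_pw [OF f(1)])
  obtain d' where d2: "pol d' 0 (pw \<h> (trunc ?N b))" by (rule pol_pw [OF f(2)])
  note w1 = wick_pw [OF assms(1) e f(1)] note w2 = wick_pw [OF assms(1) f]
  note w3 = wick_pw [OF assms(1) conjunct1 [OF w1] f(2)] note w4 = wick_pw [OF assms(1) e conjunct1 [OF w2]]
  have "cprod (cprod ?e (trunc ?N a)) (trunc ?N b) = cprod ?e (cprod (trunc ?N a) (trunc ?N b))"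
    by (rule pw_inj [OF assms(1) conjunct1 [OF w3] conjunct1 [OF w4]])
      (simp only: conjunct2 [OF w3, symmetric] conjunct2 [OF w4, symmetric] conjunct2 [OF w1, symmetric]
        conjunct2 [OF w2, symmetric] pe wick_eij_assoc [OF d1 d2])
  moreover have "cprod (cprod ?e (trunc ?N a)) (trunc ?N b) \<tau> = cprod (cprod ?e a) b \<tau>"
    by (rule cprod_cong) (simp_all add: cprod_trunc trunc_def)
  moreover have "cprod ?e (cprod (trunc ?N a) (trunc ?N b)) \<tau> = cprod ?e (cprod a b) \<tau>"
    by (rule cprod_cong) (simp_all add: cprod_trunc)
  ultimately show "cprod (cprod ?e a) b \<tau> = cprod ?e (cprod a b) \<tau>" by simp
qed

lemma cprod_one_left:
  fixes c :: "'n::finite triple \<Rightarrow> complex"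
  assumes "\<h> \<noteq> 0" "\<And>\<tau>. \<tau> \<notin> triples \<Longrightarrow> c \<tau> = 0"
  shows "cprod (mon_coeffs \<h> [] []) c = c"
proof
  fix \<tau> :: "'n triple"
  let ?c = "trunc (level \<tau>) c"
  have f: "?c \<in> fin_coeffs" "mon_coeffs \<h> [] [] \<in> fin_coeffs" using assms by (auto intro: trunc_fin mc_fin)
  have "cprod (mon_coeffs \<h> [] []) ?c = ?c"
  proof (rule pw_inj [OF assms(1) _ f(1)])
    have "pw \<h> (mon_coeffs \<h> [] []) = (\<lambda>z :: 'n cvec. 1)" using pw_mc [OF assms(1), of "[]" "[]"] by (simp add: mon_simps)
    then show "pw \<h> (cprod (mon_coeffs \<h> [] []) ?c) = pw \<h> ?c" "cprod (mon_coeffs \<h> [] []) ?c \<in> fin_coeffs"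
      using wick_pw [OF assms(1) f(2,1)] wick_const(1) [of \<h> 1 "pw \<h> ?c"] by simp_all
  qed
  then show "cprod (mon_coeffs \<h> [] []) c \<tau> = c \<tau>"
    using cprod_trunc(2) [of \<tau> "level \<tau>" "mon_coeffs \<h> [] []" c] by (simp add: trunc_def)
qed

text \<open>A monomial of level \<alpha> + 1 is a product of some \<open>eij\<close> with a monomial
  of level \<alpha>, up to an element homogeneous of level \<alpha>. The product is handled by
  associativity and \<open>cprod_ec_van\<close>, the correction by the induction hypothesis.\<close>

lemma cprod_mc_van:
  fixes c :: "'n::finite triple \<Rightarrow> complex"
  assumes "\<h> \<noteq> 0" "c \<in> vanishing_coeffs \<h>"
  shows "length I = \<alpha> \<Longrightarrow> length J = \<alpha> \<Longrightarrow> cprod (mon_coeffs \<h> I J) c \<in> vanishing_coeffs \<h>"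
proof (induction \<alpha> arbitrary: I J)
  case 0
  then show ?case using assms by (simp add: cprod_one_left hat_outside [OF van_hat])
next
  case (Suc \<alpha>)
  then obtain i I' j J' where IJ: "I = i # I'" "J = j # J'" "length I' = \<alpha>" "length J' = \<alpha>"
    by (auto simp: length_Suc_conv)
  obtain u where u: "homogeneous \<h> \<alpha> u" "cprod (eij_coeffs \<h> i j) (mon_coeffs \<h> I' J') = (\<lambda>\<tau>. mon_coeffs \<h> (i # I') (j # J') \<tau> + 2 * \<h> * gsign i * u \<tau>)"
    using cprod_ec_mc [OF assms(1) IJ(3,4), of j i] by blast
  have "cprod u c \<in> vanishing_coeffs \<h>" using u(1)
  proof induction
    case hc_0
    then show ?case using cprod_scale_left [of 0 c c] by (simp add: van_0)
  next
    case (hc_mc a I J x)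
    then show ?case unfolding cprod_add_left cprod_scale_left by (intro van_lin Suc.IH)
  qed
  moreover have "cprod (cprod (eij_coeffs \<h> i j) (mon_coeffs \<h> I' J')) c \<in> vanishing_coeffs \<h>"
    by (subst cprod_ec_assoc [OF assms(1)])
      (use IJ in \<open>auto intro!: cprod_ec_van [OF assms(1)] Suc.IH hat_outside [OF van_hat [OF assms(2)]] fin_coeffs_outside mc_fin\<close>)
  ultimately have "(\<lambda>\<tau>. (- (2 * \<h> * gsign i)) * cprod u c \<tau> + cprod (cprod (eij_coeffs \<h> i j) (mon_coeffs \<h> I' J')) c \<tau>) \<in> vanishing_coeffs \<h>"
    by (rule van_lin)
  moreover have "(\<lambda>\<tau>. (- (2 * \<h> * gsign i)) * cprod u c \<tau> + cprod (cprod (eij_coeffs \<h> i j) (mon_coeffs \<h> I' J')) c \<tau>) = cprod (mon_coeffs \<h> I J) c"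
    unfolding u(2) IJ cprod_add_left cprod_scale_left by simp
  ultimately show ?case by simp
qed

text \<open>Finitely supported left factors are combinations of monomials; the general case follows
  since truncations converge and evaluation on \<open>y = 1\<close> is continuous.\<close>

lemma cprod_van_left:
  fixes b c :: "'n::finite triple \<Rightarrow> complex"
  assumes "\<h> \<noteq> 0" "c \<in> vanishing_coeffs \<h>" "b \<in> hat_coeffs"
  shows "cprod b c \<in> vanishing_coeffs \<h>"
proof -
  have f: "cprod b c \<in> vanishing_coeffs \<h>" if "b \<in> fin_coeffs" for b
    using assms(1) that
  proof (induction rule: fin_coeffs_induct)
    case 0
    then show ?case using cprod_scale_left [of 0 c c] by (simp add: van_0)
  next
    case (step x I J a)
    then show ?case
      unfolding cprod_add_left cprod_scale_left by (intro van_lin cprod_mc_van [OF assms(1,2)]) auto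
  qed
  have "fseries \<h> (cprod b c) w = 0" if w: "yfun w = 1" for w
  proof -
    have "fseries \<h> (cprod (trunc N b) c) w = 0" for N
      using f [OF hat_fin_trunc [OF assms(3)], of N] w by (simp add: vanishing_coeffs_def)
    then show ?thesis using cprod_trunc_lim(2) [OF assms(1,3) van_hat [OF assms(2)], of w] by (simp add: LIMSEQ_const_iff)
  qed
  then show ?thesis by (simp add: vanishing_coeffs_def cprod_hat [OF assms(3) van_hat [OF assms(2)]])
qed

text \<open>The length condition makes the number of contractions the same from both sides: |T| -
  |S| = |S'| - |T'|.\<close>

lemma cterm_ctr:
  assumes "length S + length S' = length T + length T'"
  shows "cterm (swap_coeffs b) (swap_coeffs a) S S' T T' = cterm a b T' T S' S"
proof -
  have "length S \<le> length T \<longleftrightarrow> length T' \<le> length S'" "length T - length S = length S' - length T'"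
    using assms by linarith+
  then show ?thesis unfolding cterm_def ctr_al by (simp add: mult_ac)
qed

lemma sum_list_swap: "(\<Sum>x\<leftarrow>xs. \<Sum>y\<leftarrow>ys. F x y) = (\<Sum>y\<leftarrow>ys. \<Sum>x\<leftarrow>xs. (F x y :: complex))"
  by (induction xs) (simp_all add: sum_list_addf)

text \<open>Transposition exchanges \<open>z\<close>-derivatives with conjugate ones, hence the two
  sides of each contraction, so it reverses the order of the factors.\<close>

lemma ctr_cprod:
  fixes a b :: "'n::finite triple \<Rightarrow> complex"
  shows "swap_coeffs (cprod a b) = cprod (swap_coeffs b) (swap_coeffs a)"
proof
  fix \<tau> :: "'n triple"
  obtain P Q \<alpha> where \<tau>: "\<tau> = (P, Q, \<alpha>)" by (cases \<tau>)
  define \<sigma> where "\<sigma> = (Q, P, \<alpha>)"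
  have r: "repI \<sigma> = repJ \<tau>" "repJ \<sigma> = repI \<tau>" by (simp_all add: \<tau> \<sigma>_def repI_def repJ_def)
  have t: "\<sigma> \<in> triples \<longleftrightarrow> \<tau> \<in> triples" by (auto simp: \<tau> \<sigma>_def triples_def)
  have "swap_coeffs (cprod a b) \<tau> = cprod a b \<sigma>" by (simp add: swap_coeffs_def \<tau> \<sigma>_def)
  also have "\<dots> = cprod (swap_coeffs b) (swap_coeffs a) \<tau>"
  proof (cases "\<tau> \<in> triples")
    case True
    have "cprod a b \<sigma> = (\<Sum>(T, T')\<leftarrow>splits (repI \<tau>). \<Sum>(S, S')\<leftarrow>splits (repJ \<tau>). cterm a b S S' T T')"
      using True by (simp add: cprod_def t r)
    also have "\<dots> = (\<Sum>(T, T')\<leftarrow>splits (repI \<tau>). \<Sum>(S, S')\<leftarrow>splits (repJ \<tau>). cterm a b S' S T' T)"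
      by (subst splits_swap, subst splits_swap) simp
    also have "\<dots> = (\<Sum>(S, S')\<leftarrow>splits (repI \<tau>). \<Sum>(T, T')\<leftarrow>splits (repJ \<tau>). cterm (swap_coeffs b) (swap_coeffs a) S S' T T')"
      unfolding split_def
    proof (intro sum_list_cong_set)
      fix p q assume "p \<in> set (splits (repI \<tau>))" "q \<in> set (splits (repJ \<tau>))"
      then have "length (fst p) + length (snd p) = level \<tau>" "length (fst q) + length (snd q) = level \<tau>"
        using splits_length [of "fst p" "snd p"] splits_length [of "fst q" "snd q"] rep [OF True] by auto
      then show "cterm a b (snd q) (fst q) (snd p) (fst p) = cterm (swap_coeffs b) (swap_coeffs a) (fst p) (snd p) (fst q) (snd q)"
        by (subst cterm_ctr) simp_all
    qed
    also have "\<dots> = cprod (swap_coeffs b) (swap_coeffs a) \<tau>"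
      using True unfolding split_def by (simp add: cprod_def split_def) (rule sum_list_swap)
    finally show ?thesis .
  next
    case False
    then show ?thesis by (simp add: cprod_outside t)
  qed
  finally show "swap_coeffs (cprod a b) \<tau> = cprod (swap_coeffs b) (swap_coeffs a) \<tau>" .
qed

lemma ctr_van: "c \<in> vanishing_coeffs \<h> \<Longrightarrow> swap_coeffs c \<in> vanishing_coeffs \<h>"
  by (simp add: vanishing_coeffs_def fseries_ctr ctr_hat)

lemma cprod_van_right:
  assumes "\<h> \<noteq> 0" "c \<in> vanishing_coeffs \<h>" "b \<in> hat_coeffs"
  shows "cprod c b \<in> vanishing_coeffs \<h>"
proof -
  have "cprod (swap_coeffs b) (swap_coeffs c) \<in> vanishing_coeffs \<h>"
    by (rule cprod_van_left [OF assms(1) ctr_van [OF assms(2)] ctr_hat [OF assms(3)]])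
  then show ?thesis using ctr_van [of "cprod (swap_coeffs b) (swap_coeffs c)" \<h>] by (simp add: ctr_cprod)
qed

section \<open>Compatibility of the product with the group and with complex conjugation\<close>

lemma cact_cprod:
  fixes U :: "'n::finite cmat" and \<h> :: complex
  assumes "\<h> \<noteq> 0" "U \<in> SU" "\<And>\<tau>. \<tau> \<notin> triples \<Longrightarrow> a \<tau> = 0" "\<And>\<tau>. \<tau> \<notin> triples \<Longrightarrow> b \<tau> = 0"
  shows "cact U (cnj_mat U) (cprod a b) = cprod (cact U (cnj_mat U) a) (cact U (cnj_mat U) b)"
proof
  fix \<tau> :: "'n triple"
  let ?a = "trunc (level \<tau>) a" and ?b = "trunc (level \<tau>) b" let ?A = "cact U (cnj_mat U)"
  have f: "?a \<in> fin_coeffs" "?b \<in> fin_coeffs" using assms by (auto intro: trunc_fin)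
  obtain d where d1: "pol d 0 (pw \<h> ?a)" by (rule pol_pw [OF f(1)])
  obtain d' where d2: "pol d' 0 (pw \<h> ?b)" by (rule pol_pw [OF f(2)])
  note pa = pullback_pw [OF assms(1) f(1), of U] and pb = pullback_pw [OF assms(1) f(2), of U]
  note w = wick_pw [OF assms(1) f] note pab = pullback_pw [OF assms(1) conjunct1 [OF w], of U]
  note w' = wick_pw [OF assms(1) conjunct1 [OF pa] conjunct1 [OF pb]]
  have "?A (cprod ?a ?b) = cprod (?A ?a) (?A ?b)"
    by (rule pw_inj [OF assms(1) conjunct1 [OF pab] conjunct1 [OF w']])
      (simp only: conjunct2 [OF pab, symmetric] conjunct2 [OF w', symmetric] conjunct2 [OF pa, symmetric]
        conjunct2 [OF pb, symmetric] conjunct2 [OF w, symmetric] wick_pullback [OF SU_metric [OF assms(2)] d1 d2])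
  moreover have "?A (cprod ?a ?b) \<tau> = ?A (cprod a b) \<tau>"
    by (rule cact_cong) (simp add: cprod_trunc)
  moreover have "cprod (?A ?a) (?A ?b) \<tau> = cprod (?A a) (?A b) \<tau>"
    by (rule cprod_cong; rule cact_cong) (simp_all add: trunc_def)
  ultimately show "?A (cprod a b) \<tau> = cprod (?A a) (?A b) \<tau>" by simp
qed

definition cnj_coeffs :: "('n::finite triple \<Rightarrow> complex) \<Rightarrow> 'n triple \<Rightarrow> complex" where
  "cnj_coeffs a \<tau> = cnj (a \<tau>)"

lemma al_cnjc: "list_coeff (cnj_coeffs a) I J = cnj (list_coeff a I J)"
  by (simp add: list_coeff_def cnj_coeffs_def)

lemma cnj_sum_list: "cnj (\<Sum>x\<leftarrow>xs. F x) = (\<Sum>x\<leftarrow>xs. cnj (F x))"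
  by (induction xs) simp_all

text \<open>The structure constants are real, so conjugating the coefficients alone preserves the
  order of the factors; the reversal in the involution comes from
  \<open>swap_coeffs\<close>.\<close>

lemma cnjc_cprod: "cnj_coeffs (cprod a b) = cprod (cnj_coeffs a) (cnj_coeffs b)"
proof
  fix \<tau>
  have "cnj (cterm a b S S' T T') = cterm (cnj_coeffs a) (cnj_coeffs b) S S' T T'" for S S' T T'
    by (simp add: cterm_def al_cnjc)
  then show "cnj_coeffs (cprod a b) \<tau> = cprod (cnj_coeffs a) (cnj_coeffs b) \<tau>"
    by (simp add: cnj_coeffs_def [of "cprod a b"] cprod_def cnj_sum_list split_def)
qed

lemma cnjc_hat: "a \<in> hat_coeffs \<Longrightarrow> cnj_coeffs a \<in> hat_coeffs"
  by (auto simp: hat_coeffs_def cnj_coeffs_def)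

text \<open>For real \<h> the Pochhammer factors are real, and conjugation only exchanges the two
  multi-indices of a basis function.\<close>

lemma fseries_cnjc:
  fixes a :: "'n::finite triple \<Rightarrow> complex"
  assumes "\<h> \<in> \<real>"
  shows "fseries \<h> (swap_coeffs (cnj_coeffs a)) = conj_fun (fseries \<h> a)"
proof
  fix z :: "'n cvec"
  have r: "cnj \<h> = \<h>" using assms by (simp add: Reals_cnj_iff)
  have p: "cnj (pochhammer (of_real y / (2 * \<h>)) \<alpha>) = pochhammer (of_real y / (2 * \<h>)) \<alpha>" for y \<alpha>
    by (simp add: r pochhammer_prod)
  have e: "cnj (ebasis \<tau> z) = ebasis \<tau> (cnj_vec z)" for \<tau> by (cases \<tau>) (simp add: cnj_vec_def)
  have "cnj (fbasis \<h> \<tau> z) = fbasis \<h> \<tau> (cnj_vec z)" for \<tau> :: "'n triple"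
    by (cases \<tau>) (simp add: fbasis_def pos_cone_def p e r del: ebasis.simps)
  then have "cnj (fseries \<h> a z) = fseries \<h> (cnj_coeffs a) (cnj_vec z)"
    unfolding fseries_def infsum_cnj [symmetric] by (simp add: cnj_coeffs_def)
  then show "fseries \<h> (swap_coeffs (cnj_coeffs a)) z = conj_fun (fseries \<h> a) z"
    by (simp add: fseries_ctr conj_fun_def)
qed

section \<open>Continuous maps of the completed algebras\<close>

context
  fixes \<h> :: complex
  assumes nz: "\<h> \<noteq> 0"
begin

lemma cone_algE:
  assumes "a \<in> cone_alg \<h>"
  obtains c where "c \<in> hat_coeffs" "a = fseries \<h> c"
  using assms by (auto simp: cone_alg_def)

lemma fseries_cone: "c \<in> hat_coeffs \<Longrightarrow> fseries \<h> c \<in> cone_alg \<h>"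
  by (simp add: cone_alg_def)

text \<open>The criterion allows the input exponent \<delta> to differ from the output exponent
  \<epsilon>, which accommodates the loss in the bounds for the product and the action.\<close>

lemma cone_continuous_linear:
  fixes F :: "('n::finite cvec \<Rightarrow> complex) \<Rightarrow> 'n cvec \<Rightarrow> complex"
  assumes F: "\<And>c. c \<in> hat_coeffs \<Longrightarrow> F (fseries \<h> c) = fseries \<h> (f c)"
    and hat: "\<And>c. c \<in> hat_coeffs \<Longrightarrow> f c \<in> hat_coeffs"
    and diff: "\<And>c d. f (\<lambda>\<tau>. c \<tau> - d \<tau>) = (\<lambda>\<tau>. f c \<tau> - f d \<tau>)"
    and bound: "\<And>\<epsilon>. 0 < \<epsilon> \<Longrightarrow> \<epsilon> < 1 \<Longrightarrow> \<exists>\<delta> C. 0 < \<delta> \<and> \<delta> < 1 \<and> C \<ge> 0 \<and>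
      (\<forall>M c. M \<ge> 0 \<and> c \<in> hat_coeffs \<and> hbound \<delta> M c \<longrightarrow> hbound \<epsilon> (C * M) (f c))"
  shows "continuous_map (cone_top \<h>) (cone_top \<h>) F"
  unfolding cone_top_def
proof (rule continuous_map_linear_seminorm)
  show "fsubspace (cone_alg \<h> :: ('n cvec \<Rightarrow> complex) set)"
    "(eps_norm \<h> ` {0<..<1} :: (('n cvec \<Rightarrow> complex) \<Rightarrow> real) set) \<noteq> {}"
    using cone_topology_facts [OF nz] by auto
  show "fseminorm (cone_alg \<h> :: ('n cvec \<Rightarrow> complex) set) p" if "p \<in> eps_norm \<h> ` {0<..<1}" for p
    using cone_topology_facts(3) [OF nz that] .
  show "F a \<in> cone_alg \<h>" if "a \<in> cone_alg \<h>" for a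
    using that by (auto simp: cone_alg_def F hat)
  show "F (\<lambda>z. a z - b z) = (\<lambda>z. F a z - F b z)" if ab: "a \<in> cone_alg \<h>" "b \<in> cone_alg \<h>" for a b
  proof -
    obtain c d where c: "c \<in> hat_coeffs" "a = fseries \<h> c" and d: "d \<in> hat_coeffs" "b = fseries \<h> d"
      using ab by (auto simp: cone_alg_def)
    show ?thesis
      unfolding c(2) d(2) fseries_diff [OF c(1) d(1), symmetric] F [OF hat_diff [OF c(1) d(1)]] diff
        fseries_diff [OF hat [OF c(1)] hat [OF d(1)]] F [OF c(1)] F [OF d(1)] ..
  qed
  show "\<exists>q\<in>eps_norm \<h> ` {0<..<1}. \<exists>C\<ge>0. \<forall>a\<in>cone_alg \<h>. p (F a) \<le> C * q a"
    if p: "p \<in> (eps_norm \<h> ` {0<..<1} :: (('n cvec \<Rightarrow> complex) \<Rightarrow> real) set)" for p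
  proof -
    obtain \<epsilon> where \<epsilon>: "p = eps_norm \<h> \<epsilon>" "0 < \<epsilon>" "\<epsilon> < 1" using p by auto
    obtain \<delta> C where \<delta>: "0 < \<delta>" "\<delta> < 1" "C \<ge> 0"
      and b: "\<And>M c. M \<ge> 0 \<and> c \<in> hat_coeffs \<and> hbound \<delta> M c \<Longrightarrow> hbound \<epsilon> (C * M) (f c)"
      using bound [OF \<epsilon>(2,3)] by blast
    have "p (F a) \<le> C * eps_norm \<h> \<delta> a" if a: "a \<in> cone_alg \<h>" for a
    proof -
      obtain c where c: "c \<in> hat_coeffs" "a = fseries \<h> c" by (rule cone_algE [OF a])
      have "hbound \<epsilon> (C * eps_norm \<h> \<delta> a) (f c)"
        unfolding c(2) by (intro b conjI eps_norm_nonneg hbound_eps_norm nz c \<delta>)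
      then show ?thesis using eps_norm_le [OF nz hat [OF c(1)]] by (simp add: \<epsilon>(1) c F)
    qed
    moreover have "eps_norm \<h> \<delta> \<in> eps_norm \<h> ` {0<..<1}" using \<delta> by simp
    ultimately show ?thesis using \<delta>(3) by blast
  qed
qed

lemma pullback_fseries_cm:
  assumes "\<And>z. yfun (U *v z) = yfun z" "c \<in> hat_coeffs"
  shows "pullback U (fseries \<h> c) = fseries \<h> (cact U (cnj_mat U) c)"
  by (rule pullback_fseries [OF nz assms(2,1)])

lemma pullback_cone:
  assumes "\<And>z. yfun (U *v z) = yfun z" "a \<in> cone_alg \<h>"
  shows "pullback U a \<in> cone_alg \<h>"
  using assms(2) by (rule cone_algE) (simp add: pullback_fseries_cm assms(1) fseries_cone cact_hat)

lemma continuous_pullback: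
  fixes U :: "'n::finite cmat"
  assumes "\<And>z. yfun (U *v z) = yfun z"
  shows "continuous_map (cone_top \<h>) (cone_top \<h>) (pullback U)"
proof (rule cone_continuous_linear [where f = "cact U (cnj_mat U)"])
  fix \<epsilon> :: real assume \<epsilon>: "0 < \<epsilon>" "\<epsilon> < 1"
  define R where "R = max (msum U) (msum (cnj_mat U))"
  have R: "R \<ge> 0" "msum U \<le> R" "msum (cnj_mat U) \<le> R" using msum_nonneg [of U] by (auto simp: R_def)
  obtain C where "C \<ge> 0" "\<forall>V W M a. msum V \<le> R \<and> msum W \<le> R \<and> M \<ge> 0 \<and> hbound (\<epsilon>/2) M a \<longrightarrow>
       hbound (\<epsilon>/2 + \<epsilon>/2) (C * M) (cact V W (a :: 'n triple \<Rightarrow> complex))"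
    using hbound_cact [of "\<epsilon>/2" "\<epsilon>/2" R, where ?'n = 'n] \<epsilon> R by auto
  then show "\<exists>\<delta> C. 0 < \<delta> \<and> \<delta> < 1 \<and> C \<ge> 0 \<and>
      (\<forall>M c. M \<ge> 0 \<and> c \<in> hat_coeffs \<and> hbound \<delta> M c \<longrightarrow> hbound \<epsilon> (C * M) (cact U (cnj_mat U) c))"
    using \<epsilon> R by (intro exI [of _ "\<epsilon>/2"] exI [of _ C]) simp
qed (simp_all add: pullback_fseries_cm assms cact_hat cact_diff)

text \<open>The map \<open>L\<close> is specified only through its values on series, so that the
  lemma applies to \<open>lie_deriv\<close>, which is given by a description.\<close>

lemma continuous_ad:
  fixes \<xi> :: "'n::finite cmat"
  assumes L: "\<And>c. c \<in> hat_coeffs \<Longrightarrow> L (fseries \<h> c) = fseries \<h> (ad \<h> \<xi> c)"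
  shows "continuous_map (cone_top \<h>) (cone_top \<h>) L"
proof (rule cone_continuous_linear [where f = "ad \<h> \<xi>"])
  show "ad \<h> \<xi> (\<lambda>\<tau>. c \<tau> - d \<tau>) = (\<lambda>\<tau>. ad \<h> \<xi> c \<tau> - ad \<h> \<xi> d \<tau>)" for c d
    by (simp add: ad_def fun_eq_iff cprod_diff_left cprod_diff_right right_diff_distrib)
  fix \<epsilon> :: real assume \<epsilon>: "0 < \<epsilon>" "\<epsilon> < 1"
  have \<delta>: "0 < \<epsilon>/3" "\<epsilon>/3 < 1" "3 * (\<epsilon>/3) = \<epsilon>" using \<epsilon> by auto
  obtain K where K: "K \<ge> 0" "\<forall>M N a b. M \<ge> 0 \<and> N \<ge> 0 \<and> hbound (\<epsilon>/3) M a \<and> hbound (\<epsilon>/3) N b \<longrightarrow>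
      hbound (3 * (\<epsilon>/3)) (K * M * N) (cprod a (b :: 'n triple \<Rightarrow> complex))"
    using hbound_cprod [OF \<delta>(1), where ?'n = 'n] by blast
  obtain N where N: "N \<ge> 0" "hbound (\<epsilon>/3) N (momentum_coeffs \<h> \<xi>)" using hat_bound [OF fin_hat [OF jc_fin] \<delta>(1,2)] .
  have "hbound \<epsilon> (norm (\<i> / \<h>) * (2 * K * N) * M) (ad \<h> \<xi> c)" if M: "M \<ge> 0" "hbound (\<epsilon>/3) M c" for M c
  proof -
    have 1: "hbound \<epsilon> (K * N * M) (cprod (momentum_coeffs \<h> \<xi>) c)" "hbound \<epsilon> (K * M * N) (cprod c (momentum_coeffs \<h> \<xi>))"
      using K(2) M N unfolding \<delta>(3) by blast+
    have "hbound \<epsilon> (K * N * M + norm (-1 :: complex) * (K * M * N)) (\<lambda>\<tau>. cprod (momentum_coeffs \<h> \<xi>) c \<tau> + (-1) * cprod c (momentum_coeffs \<h> \<xi>) \<tau>)"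
      by (rule hbound_add [OF 1(1) hbound_scale [OF 1(2)]])
    then have "hbound \<epsilon> (norm (\<i> / \<h>) * (K * N * M + norm (-1 :: complex) * (K * M * N)))
      (\<lambda>\<tau>. \<i> / \<h> * (cprod (momentum_coeffs \<h> \<xi>) c \<tau> + (-1) * cprod c (momentum_coeffs \<h> \<xi>) \<tau>))"
      by (rule hbound_scale)
    moreover have "ad \<h> \<xi> c = (\<lambda>\<tau>. \<i> / \<h> * (cprod (momentum_coeffs \<h> \<xi>) c \<tau> + (-1) * cprod c (momentum_coeffs \<h> \<xi>) \<tau>))"
      by (simp add: ad_def fun_eq_iff)
    ultimately show ?thesis by (simp only: norm_minus_cancel norm_one) (simp add: algebra_simps)
  qed
  then show "\<exists>\<delta> C. 0 < \<delta> \<and> \<delta> < 1 \<and> C \<ge> 0 \<and>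
      (\<forall>M c. M \<ge> 0 \<and> c \<in> hat_coeffs \<and> hbound \<delta> M c \<longrightarrow> hbound \<epsilon> (C * M) (ad \<h> \<xi> c))"
    using \<delta> K(1) N(1) by (intro exI [of _ "\<epsilon>/3"] exI [of _ "norm (\<i> / \<h>) * (2 * K * N)"]) simp
qed (simp_all add: L ad_hat)

lemma limitin_id_atin: "x \<in> topspace X \<Longrightarrow> limitin X (\<lambda>a. a) x (atin X x)"
  using continuous_map_id [of X] unfolding id_def by (rule limitin_continuous_map) simp_all

lemma continuous_seminorm_coneI:
  fixes p :: "('n::finite cvec \<Rightarrow> complex) \<Rightarrow> real"
  assumes "fseminorm (cone_alg \<h>) p" "0 < \<epsilon>" "\<epsilon> < 1" "\<And>a. a \<in> cone_alg \<h> \<Longrightarrow> p a \<le> eps_norm \<h> \<epsilon> a"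
  shows "continuous_seminorm (cone_alg \<h>) (cone_top \<h>) p"
  unfolding continuous_seminorm_alt continuous_map_atin
proof (intro conjI ballI assms(1))
  fix x :: "'n cvec \<Rightarrow> complex" assume x: "x \<in> topspace (cone_top \<h>)"
  then have xV: "x \<in> cone_alg \<h>" by (simp add: topspace_cone_top [OF nz])
  have l: "\<forall>\<^sub>F a in atin (cone_top \<h>) x. a \<in> cone_alg \<h>"
    "\<And>r. r > 0 \<Longrightarrow> \<forall>\<^sub>F a in atin (cone_top \<h>) x. eps_norm \<h> \<epsilon> (\<lambda>z. a z - x z) < r"
    using limitin_id_atin [OF x] assms(2,3) unfolding limitin_cone_top [OF nz] by auto
  have "(p \<longlongrightarrow> p x) (atin (cone_top \<h>) x)"
    unfolding tendsto_iff
  proof (intro allI impI)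
    fix e :: real assume "e > 0"
    from l(1) l(2) [OF this] show "\<forall>\<^sub>F a in atin (cone_top \<h>) x. dist (p a) (p x) < e"
    proof eventually_elim
      case (elim a)
      have "\<bar>p a - p x\<bar> \<le> p (\<lambda>z. a z - x z)"
        by (rule fseminorm_diff [OF fsubspace_cone assms(1) elim(1) xV])
      also have "\<dots> \<le> eps_norm \<h> \<epsilon> (\<lambda>z. a z - x z)"
        by (intro assms(4) fsubspaceD [OF fsubspace_cone] elim xV)
      finally show ?case using elim(2) by (simp add: dist_norm)
    qed
  qed
  then show "limitin euclideanreal p (p x) (atin (cone_top \<h>) x)" by simp
qed

text \<open>The seminorms increase as the exponent decreases, so finitely many are dominated by the
  one with the smallest exponent.\<close>

lemma cone_top_ball:
  fixes a :: "'n::finite cvec \<Rightarrow> complex"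
  assumes "openin (cone_top \<h>) U" "a \<in> U"
  shows "\<exists>\<epsilon> r. 0 < \<epsilon> \<and> \<epsilon> < 1 \<and> 0 < r \<and> {x \<in> cone_alg \<h>. eps_norm \<h> \<epsilon> (\<lambda>z. x z - a z) < r} \<subseteq> U"
proof -
  have "\<exists>Q r. finite Q \<and> Q \<subseteq> eps_norm \<h> ` {0<..<1} \<and> 0 < r \<and> {x \<in> cone_alg \<h>. \<forall>p\<in>Q. p (\<lambda>z. x z - a z) < r} \<subseteq> U"
    and aV: "a \<in> cone_alg \<h>"
    using openin_seminormD [OF fsubspace_cone cone_topology_facts(3) [OF nz] assms(1)[unfolded cone_top_def] assms(2)]
    by auto
  then obtain Q r where Q: "finite Q" "Q \<subseteq> eps_norm \<h> ` {0<..<1}" "0 < r"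
    "{x \<in> cone_alg \<h>. \<forall>p\<in>Q. p (\<lambda>z. x z - a z) < r} \<subseteq> U" by blast
  obtain E where E: "E \<subseteq> {0<..<1}" "finite E" "Q = eps_norm \<h> ` E"
    using finite_subset_image [OF Q(1,2)] by blast
  \<comment> \<open>The exponent 1/2 is inserted because the finite set of exponents may be
    empty.\<close>
  define \<epsilon> where "\<epsilon> = Min (insert (1/2) E)"
  have \<epsilon>: "\<epsilon> \<in> insert (1/2) E" "\<And>\<delta>. \<delta> \<in> E \<Longrightarrow> \<epsilon> \<le> \<delta>" using E(2) Min_in [of "insert (1/2) E"] by (auto simp: \<epsilon>_def)
  then have \<epsilon>01: "0 < \<epsilon>" "\<epsilon> < 1" using E(1) by auto
  have "{x \<in> cone_alg \<h>. eps_norm \<h> \<epsilon> (\<lambda>z. x z - a z) < r} \<subseteq> U"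
  proof
    fix x assume x: "x \<in> {x \<in> cone_alg \<h>. eps_norm \<h> \<epsilon> (\<lambda>z. x z - a z) < r}"
    then have "(\<lambda>z. x z - a z) \<in> cone_alg \<h>" by (intro fsubspaceD [OF fsubspace_cone] aV) simp
    then obtain c where c: "c \<in> hat_coeffs" "(\<lambda>z. x z - a z) = fseries \<h> c" by (rule cone_algE)
    have "eps_norm \<h> \<delta> (fseries \<h> c) \<le> eps_norm \<h> \<epsilon> (fseries \<h> c)" if "\<delta> \<in> E" for \<delta>
      by (intro eps_norm_le nz c hbound_mono_exp [OF hbound_eps_norm [OF nz c(1) \<epsilon>01] \<epsilon>(2) [OF that]]
          eps_norm_nonneg \<epsilon>01)
    then have "x \<in> {x \<in> cone_alg \<h>. \<forall>p\<in>Q. p (\<lambda>z. x z - a z) < r}"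
      using x unfolding E(3) c(2) [symmetric] by fastforce
    then show "x \<in> U" using Q(4) by blast
  qed
  then show ?thesis using \<epsilon>01 Q(3) by blast
qed

end

text \<open>Continuity of the Lie derivatives makes every seminorm of the smooth topology
  continuous, so that topology is not finer; the empty list of derivatives yields all continuous
  seminorms, so it is not coarser.\<close>

lemma smooth_topology_eqI:
  assumes V: "fsubspace V" "topspace T = V"
    and trans: "\<And>a. a \<in> V \<Longrightarrow> continuous_map T T (\<lambda>x z. x z - a z)"
    and L: "\<And>\<xi>. \<xi> \<in> su \<Longrightarrow> continuous_map T T (lie_deriv T A \<xi>)"
    and add: "\<And>\<xi> a b. \<xi> \<in> su \<Longrightarrow> a \<in> V \<Longrightarrow> b \<in> V \<Longrightarrow> lie_deriv T A \<xi> (\<lambda>z. a z + b z) = (\<lambda>z. lie_deriv T A \<xi> a z + lie_deriv T A \<xi> b z)"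
    and scale: "\<And>\<xi> a c. \<xi> \<in> su \<Longrightarrow> a \<in> V \<Longrightarrow> lie_deriv T A \<xi> (\<lambda>z. c * a z) = (\<lambda>z. c * lie_deriv T A \<xi> a z)"
    and base: "\<And>U x. openin T U \<Longrightarrow> x \<in> U \<Longrightarrow> \<exists>p r. continuous_seminorm V T p \<and> 0 < r \<and> {y \<in> V. p (\<lambda>z. y z - x z) < r} \<subseteq> U"
  shows "smooth_topology V T A = T"
proof -
  let ?P = "{(\<lambda>a. p (foldr (lie_deriv T A) \<xi>s a)) | p \<xi>s. continuous_seminorm V T p \<and> set \<xi>s \<subseteq> su}"
  have F: "continuous_map T T (foldr (lie_deriv T A) \<xi>s)"
    "a \<in> V \<Longrightarrow> b \<in> V \<Longrightarrow> foldr (lie_deriv T A) \<xi>s (\<lambda>z. a z + b z) = (\<lambda>z. foldr (lie_deriv T A) \<xi>s a z + foldr (lie_deriv T A) \<xi>s b z)"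
    "a \<in> V \<Longrightarrow> foldr (lie_deriv T A) \<xi>s (\<lambda>z. c * a z) = (\<lambda>z. c * foldr (lie_deriv T A) \<xi>s a z)"
    "a \<in> V \<Longrightarrow> foldr (lie_deriv T A) \<xi>s a \<in> V"
    if "set \<xi>s \<subseteq> su" for \<xi>s a b c
  proof -
    have *: "continuous_map T T (foldr (lie_deriv T A) \<xi>s) \<and>
      (\<forall>a\<in>V. foldr (lie_deriv T A) \<xi>s a \<in> V) \<and>
      (\<forall>a\<in>V. \<forall>b\<in>V. foldr (lie_deriv T A) \<xi>s (\<lambda>z. a z + b z) = (\<lambda>z. foldr (lie_deriv T A) \<xi>s a z + foldr (lie_deriv T A) \<xi>s b z)) \<and>
      (\<forall>c. \<forall>a\<in>V. foldr (lie_deriv T A) \<xi>s (\<lambda>z. c * a z) = (\<lambda>z. c * foldr (lie_deriv T A) \<xi>s a z))"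
      using that
    proof (induction \<xi>s)
      case (Cons \<xi> \<xi>s)
      then have \<xi>: "\<xi> \<in> su" and IH: "continuous_map T T (foldr (lie_deriv T A) \<xi>s)"
        "\<And>a. a \<in> V \<Longrightarrow> foldr (lie_deriv T A) \<xi>s a \<in> V"
        "\<And>a b. a \<in> V \<Longrightarrow> b \<in> V \<Longrightarrow> foldr (lie_deriv T A) \<xi>s (\<lambda>z. a z + b z) = (\<lambda>z. foldr (lie_deriv T A) \<xi>s a z + foldr (lie_deriv T A) \<xi>s b z)"
        "\<And>c a. a \<in> V \<Longrightarrow> foldr (lie_deriv T A) \<xi>s (\<lambda>z. c * a z) = (\<lambda>z. c * foldr (lie_deriv T A) \<xi>s a z)" by auto
      have LV: "lie_deriv T A \<xi> a \<in> V" if "a \<in> V" for a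
        using continuous_map_funspace [OF L [OF \<xi>]] that V(2) by auto
      show ?case
        using continuous_map_compose [OF IH(1) L [OF \<xi>]]
        by (simp add: IH(2,3,4) add [OF \<xi>] scale [OF \<xi>] LV o_def)
    qed (simp add: id_def)
    then show "continuous_map T T (foldr (lie_deriv T A) \<xi>s)"
      "a \<in> V \<Longrightarrow> b \<in> V \<Longrightarrow> foldr (lie_deriv T A) \<xi>s (\<lambda>z. a z + b z) = (\<lambda>z. foldr (lie_deriv T A) \<xi>s a z + foldr (lie_deriv T A) \<xi>s b z)"
      "a \<in> V \<Longrightarrow> foldr (lie_deriv T A) \<xi>s (\<lambda>z. c * a z) = (\<lambda>z. c * foldr (lie_deriv T A) \<xi>s a z)"
      "a \<in> V \<Longrightarrow> foldr (lie_deriv T A) \<xi>s a \<in> V" by blast+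
  qed
  have P: "continuous_seminorm V T q" if q: "q \<in> ?P" for q
  proof -
    obtain p \<xi>s where p: "continuous_seminorm V T p" "set \<xi>s \<subseteq> su" "q = (\<lambda>a. p (foldr (lie_deriv T A) \<xi>s a))"
      using q by blast
    have c: "continuous_map T euclideanreal p" and s: "fseminorm V p" using p(1) by (auto simp: continuous_seminorm_alt)
    have "continuous_map T euclideanreal q"
      using continuous_map_compose [OF F(1) [OF p(2)] c] by (simp add: p(3) o_def)
    then show ?thesis
      unfolding continuous_seminorm_alt fseminorm_def
      by (simp add: p(3) F [OF p(2)] fseminormD [OF s])
  qed
  show ?thesis
    unfolding topology_eq
  proof (intro allI iffI)
    fix U assume U: "openin (smooth_topology V T A) U"
    have g: "openin T {x \<in> V. p (\<lambda>z. x z - a z) < r}" if "p \<in> ?P" "a \<in> V" for p a and r :: real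
    proof -
      have "continuous_map T euclideanreal (p \<circ> (\<lambda>x z. x z - a z))"
        using P [OF that(1)] by (intro continuous_map_compose [OF trans [OF that(2)]]) (simp add: continuous_seminorm_alt)
      then have "openin T {x \<in> topspace T. (p \<circ> (\<lambda>x z. x z - a z)) x \<in> {..<r}}"
        by (rule openin_continuous_map_preimage) (simp add: open_openin [symmetric])
      then show ?thesis by (simp add: V(2))
    qed
    show "openin T U"
      using U unfolding smooth_topology_def seminorm_topology_def openin_topology_generated_by_iff
    proof induction
      case Empty show ?case by simp
    next
      case (Int a b) then show ?case by blast
    next
      case (UN K) then show ?case by blast
    next
      case (Basis s) then show ?case using g by blast
    qed
  next
    fix U assume U: "openin T U"
    show "openin (smooth_topology V T A) U"
    proof (subst openin_subopen, intro ballI)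
      fix x assume x: "x \<in> U"
      then have xV: "x \<in> V" using openin_subset [OF U] V(2) by auto
      obtain p r where p: "continuous_seminorm V T p" "0 < r" "{y \<in> V. p (\<lambda>z. y z - x z) < r} \<subseteq> U"
        using base [OF U x] by blast
      \<comment> \<open>The empty list of Lie algebra elements.\<close>
      have "p \<in> ?P"
        unfolding mem_Collect_eq by (rule exI [of _ p], rule exI [of _ "[]"]) (simp add: p(1))
      then have "openin (smooth_topology V T A) {y \<in> V. p (\<lambda>z. y z - x z) < r}"
        unfolding smooth_topology_def by (rule openin_seminorm_ball [OF _ xV p(2)])
      moreover have "x \<in> {y \<in> V. p (\<lambda>z. y z - x z) < r}"
        using xV p(1,2) fseminorm_0 [OF V(1), of p] by (simp add: continuous_seminorm_alt)
      ultimately show "\<exists>S. openin (smooth_topology V T A) S \<and> x \<in> S \<and> S \<subseteq> U" using p(3) by blast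
    qed
  qed
qed

section \<open>The group actions\<close>

lemma disc_class_linear:
  "disc_class (\<lambda>z. a z + b z) = (\<lambda>v. disc_class a v + disc_class b v)"
  "disc_class (\<lambda>z. a z - b z) = (\<lambda>v. disc_class a v - disc_class b v)"
  "disc_class (\<lambda>z. c * a z) = (\<lambda>v. c * disc_class a v)"
  "disc_class (\<lambda>z. a z / c) = (\<lambda>v. disc_class a v / c)"
  "disc_class (\<lambda>z. 0) = (\<lambda>v. 0)"
  by (auto simp: disc_class_def)

lemma conj_fun_disc_class: "conj_fun (disc_class a) = disc_class (conj_fun a)"
  by (auto simp: disc_class_def conj_fun_def)

lemma disc_algE:
  assumes "f \<in> disc_alg \<h>"
  obtains a where "a \<in> cone_alg \<h>" "f = disc_class a"
  using assms by (auto simp: disc_alg_def)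

lemma disc_class_alg: "a \<in> cone_alg \<h> \<Longrightarrow> disc_class a \<in> disc_alg \<h>"
  by (simp add: disc_alg_def)

lemma fsubspace_disc: "fsubspace (disc_alg \<h> :: ((complex, 'n::finite) vec \<Rightarrow> complex) set)"
  unfolding fsubspace_def
proof (intro conjI ballI allI)
  show "(\<lambda>z :: (complex, 'n) vec. 0) \<in> disc_alg \<h>"
    using disc_class_alg [OF fsubspaceD(1) [OF fsubspace_cone]] by (simp only: disc_class_linear)
  fix f :: "(complex, 'n) vec \<Rightarrow> complex" assume "f \<in> disc_alg \<h>"
  then obtain a where a: "a \<in> cone_alg \<h>" "f = disc_class a" by (rule disc_algE)
  show "(\<lambda>z. c * f z) \<in> disc_alg \<h>" for c
    using disc_class_alg [OF fsubspaceD(3) [OF fsubspace_cone a(1)]] by (simp only: disc_class_linear a(2))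
  fix g :: "(complex, 'n) vec \<Rightarrow> complex" assume "g \<in> disc_alg \<h>"
  then obtain b where b: "b \<in> cone_alg \<h>" "g = disc_class b" by (rule disc_algE)
  show "(\<lambda>z. f z + g z) \<in> disc_alg \<h>"
    using disc_class_alg [OF fsubspaceD(2) [OF fsubspace_cone a(1) b(1)]] by (simp only: disc_class_linear a(2) b(2))
qed

lemma disc_rep:
  assumes "a \<in> cone_alg \<h>"
  shows "disc_rep \<h> (disc_class a) \<in> cone_alg \<h>" "disc_class (disc_rep \<h> (disc_class a)) = disc_class a"
  using someI [of "\<lambda>b. b \<in> cone_alg \<h> \<and> disc_class b = disc_class a" a] assms by (auto simp: disc_rep_def)

lemma alg_automorphismI:
  assumes V: "topspace T = V"
    and cont: "continuous_map T T \<phi>" "continuous_map T T \<psi>"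
    and inv: "\<And>a. a \<in> V \<Longrightarrow> \<psi> (\<phi> a) = a" "\<And>a. a \<in> V \<Longrightarrow> \<phi> (\<psi> a) = a"
    and add: "\<And>a b. a \<in> V \<Longrightarrow> b \<in> V \<Longrightarrow> \<phi> (\<lambda>z. a z + b z) = (\<lambda>z. \<phi> a z + \<phi> b z)"
    and scale: "\<And>c a. a \<in> V \<Longrightarrow> \<phi> (\<lambda>z. c * a z) = (\<lambda>z. c * \<phi> a z)"
    and mult: "\<And>a b. a \<in> V \<Longrightarrow> b \<in> V \<Longrightarrow> \<phi> (m a b) = m (\<phi> a) (\<phi> b)"
  shows "alg_automorphism V T m \<phi>"
proof -
  have h: "homeomorphic_map T T \<phi>"
    unfolding homeomorphic_map_maps homeomorphic_maps_def using cont inv V by blast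
  moreover have "bij_betw \<phi> V V"
    using continuous_map_funspace [OF cont(1)] continuous_map_funspace [OF cont(2)] inv V
    by (intro bij_betw_byWitness [where f' = \<psi>]) auto
  ultimately show ?thesis
    unfolding alg_automorphism_def using add scale mult by blast
qed

lemma momentum_alt:
  "momentum \<xi> z = (if z \<in> pos_cone then \<i> / 2 * (\<Sum>k\<in>UNIV. cnj (z $ k) * ((gmetric ** \<xi>) *v z) $ k) else 0)"
proof -
  have "(\<Sum>i\<in>UNIV. \<Sum>j\<in>UNIV. \<Sum>k\<in>UNIV. cnj (z $ k) * gmetric $ k $ i * \<xi> $ i $ j * z $ j) =
    (\<Sum>k\<in>UNIV. cnj (z $ k) * ((gmetric ** \<xi>) *v z) $ k)"
  proof -
    have "cnj (z $ k) * ((gmetric ** \<xi>) *v z) $ k = (\<Sum>j\<in>UNIV. \<Sum>i\<in>UNIV. cnj (z $ k) * gmetric $ k $ i * \<xi> $ i $ j * z $ j)" for k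
      by (simp add: matrix_vector_mult_def matrix_mult_nth sum_distrib_left sum_distrib_right mult_ac)
    then have "(\<Sum>k\<in>UNIV. cnj (z $ k) * ((gmetric ** \<xi>) *v z) $ k) =
      (\<Sum>k\<in>UNIV. \<Sum>j\<in>UNIV. \<Sum>i\<in>UNIV. cnj (z $ k) * gmetric $ k $ i * \<xi> $ i $ j * z $ j)" by simp
    also have "\<dots> = (\<Sum>j\<in>UNIV. \<Sum>k\<in>UNIV. \<Sum>i\<in>UNIV. cnj (z $ k) * gmetric $ k $ i * \<xi> $ i $ j * z $ j)"
      by (rule sum.swap)
    also have "\<dots> = (\<Sum>j\<in>UNIV. \<Sum>i\<in>UNIV. \<Sum>k\<in>UNIV. cnj (z $ k) * gmetric $ k $ i * \<xi> $ i $ j * z $ j)"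
      by (rule sum.cong [OF refl]) (rule sum.swap)
    also have "\<dots> = (\<Sum>i\<in>UNIV. \<Sum>j\<in>UNIV. \<Sum>k\<in>UNIV. cnj (z $ k) * gmetric $ k $ i * \<xi> $ i $ j * z $ j)"
      by (rule sum.swap)
    finally show ?thesis by simp
  qed
  then show ?thesis by (simp add: momentum_def)
qed

lemma adjoint_mat_inner:
  "(\<Sum>k\<in>UNIV. cnj (z $ k) * (adjoint_mat U *v w) $ k) = (\<Sum>k\<in>UNIV. cnj ((U *v z) $ k) * w $ k)"
proof -
  have "(\<Sum>k\<in>UNIV. cnj (z $ k) * (adjoint_mat U *v w) $ k) = (\<Sum>k\<in>UNIV. \<Sum>l\<in>UNIV. cnj (U $ l $ k) * cnj (z $ k) * w $ l)"
    by (simp add: matrix_vector_mult_def adjoint_mat_nth sum_distrib_left mult_ac)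
  also have "\<dots> = (\<Sum>l\<in>UNIV. \<Sum>k\<in>UNIV. cnj (U $ l $ k) * cnj (z $ k) * w $ l)" by (rule sum.swap)
  finally show ?thesis by (simp add: matrix_vector_mult_def sum_distrib_right)
qed

text \<open>In matrix form J is the Hermitian form of \<open>gmetric ** \<xi>\<close>, and
  \<open>gmetric ** matrix_inv U = adjoint_mat U ** gmetric\<close> moves the conjugation from the
  matrix to the point.\<close>

lemma momentum_equivariant:
  assumes "U \<in> SU"
  shows "pullback U (momentum \<xi>) = momentum (matrix_inv U ** \<xi> ** U)"
proof
  fix z
  have "gmetric ** (gmetric ** X) = (X :: 'a cmat)" for X
    by (simp add: vec_eq_iff gmetric_mult)
  then have g: "gmetric ** (matrix_inv U ** \<xi> ** U) = adjoint_mat U ** (gmetric ** \<xi> ** U)"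
    by (simp add: SU_inv(1) [OF assms] matrix_mul_assoc [symmetric])
  have "(gmetric ** (matrix_inv U ** \<xi> ** U)) *v z = adjoint_mat U *v ((gmetric ** \<xi>) *v (U *v z))"
    unfolding g by (simp add: matrix_vector_mul_assoc matrix_mul_assoc)
  then show "pullback U (momentum \<xi>) z = momentum (matrix_inv U ** \<xi> ** U) z"
    by (simp add: pullback_def momentum_alt adjoint_mat_inner pos_cone_def SU_yfun [OF assms])
qed

lemma SU_inv_yfun: "U \<in> SU \<Longrightarrow> yfun (matrix_inv U *v z) = yfun z"
  using SU_yfun [of U "matrix_inv U *v z"] by (simp add: matrix_vector_mul_assoc SU_inv(2))

lemma su_scale: "\<xi> \<in> su \<Longrightarrow> t *\<^sub>R \<xi> \<in> u_alg"
  using su_uu uu_scale by blast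

lemma pullback_compose: "pullback (U ** W) a = pullback W (pullback U a)"
  by (simp add: pullback_def matrix_vector_mul_assoc)

lemma pullback_mat_1 [simp]: "pullback (mat 1) a = a"
  by (simp add: pullback_def)

section \<open>The action on the cone\<close>

context
  fixes \<h> :: complex
  assumes nz: "\<h> \<noteq> 0"
begin

lemma cone_mult_alg: "a \<in> cone_alg \<h> \<Longrightarrow> b \<in> cone_alg \<h> \<Longrightarrow> cone_mult \<h> a b \<in> cone_alg \<h>"
  by (auto elim!: cone_algE [OF nz] simp: cone_mult_fseries [OF nz] cprod_hat fseries_cone [OF nz])

lemma pullback_mult:
  assumes "U \<in> SU" "a \<in> cone_alg \<h>" "b \<in> cone_alg \<h>"
  shows "pullback U (cone_mult \<h> a b) = cone_mult \<h> (pullback U a) (pullback U b)"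
proof -
  obtain c where c: "c \<in> hat_coeffs" "a = fseries \<h> c" by (rule cone_algE [OF nz assms(2)])
  obtain d where d: "d \<in> hat_coeffs" "b = fseries \<h> d" by (rule cone_algE [OF nz assms(3)])
  note p = pullback_fseries_cm [OF nz SU_yfun [OF assms(1)]]
  show ?thesis
    unfolding c(2) d(2) cone_mult_fseries [OF nz c(1) d(1)] p [OF cprod_hat [OF c(1) d(1)]] p [OF c(1)] p [OF d(1)]
      cone_mult_fseries [OF nz cact_hat [OF c(1)] cact_hat [OF d(1)]]
    using cact_cprod [OF nz assms(1) hat_outside [OF c(1)] hat_outside [OF d(1)]] by simp
qed

lemma cone_automorphism:
  assumes "U \<in> SU"
  shows "alg_automorphism (cone_alg \<h>) (cone_top \<h>) (cone_mult \<h>) (pullback U)"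
proof (rule alg_automorphismI)
  show "topspace (cone_top \<h>) = cone_alg \<h>" by (rule topspace_cone_top [OF nz])
  show "continuous_map (cone_top \<h>) (cone_top \<h>) (pullback U)"
    by (rule continuous_pullback [OF nz SU_yfun [OF assms]])
  show "continuous_map (cone_top \<h>) (cone_top \<h>) (pullback (matrix_inv U))"
    by (rule continuous_pullback [OF nz SU_inv_yfun [OF assms]])
  show "pullback (matrix_inv U) (pullback U a) = a" "pullback U (pullback (matrix_inv U) a) = a" for a
    by (simp_all add: pullback_compose [symmetric] SU_inv(2,3) [OF assms])
  show "pullback U (cone_mult \<h> a b) = cone_mult \<h> (pullback U a) (pullback U b)"
    if "a \<in> cone_alg \<h>" "b \<in> cone_alg \<h>" for a b
    by (rule pullback_mult [OF assms that])
qed (simp_all add: pullback_def)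

lemma cone_acts: "acts_by_automorphisms (cone_alg \<h>) (cone_top \<h>) (cone_mult \<h>) pullback"
  unfolding acts_by_automorphisms_def by (auto simp: cone_automorphism pullback_compose)

text \<open>One argument for cone and disc, with \<open>q\<close> the identity or the quotient map.
  The condition on \<open>A\<close> is phrased for matrices preserving \<open>y\<close>, which is
  directly available for \<open>U ** mexp \<xi>\<close> without computing its determinant.\<close>

lemma cone_smooth:
  fixes q :: "('n::finite cvec \<Rightarrow> complex) \<Rightarrow> 'p \<Rightarrow> complex"
  assumes "a \<in> cone_alg \<h>" "continuous_map (cone_top \<h>) T q"
    and "\<And>a b z. q (\<lambda>z. a z - b z) z = q a z - q b z"
    and "\<And>c a z. q (\<lambda>z. c * a z) z = c * q a z"
    and A: "\<And>U. (\<And>z. yfun (U *v z) = yfun z) \<Longrightarrow> A U = q (pullback U a)"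
  shows "smooth_on_SU T A"
  unfolding smooth_on_SU_def
proof (intro ballI exI [of _ UNIV] conjI allI)
  obtain c where c: "c \<in> hat_coeffs" "a = fseries \<h> c" by (rule cone_algE [OF nz assms(1)])
  fix U :: "'n cmat" and k assume U: "U \<in> SU"
  have "Ck_on k T su su (\<lambda>\<xi>. A (U ** mexp \<xi>))"
  proof (rule hol_fam_Ck [OF nz continuous_emb emb_line assms(2-4) su_subspace hol_fam_act [OF c(1)]])
    fix \<xi> :: "'n cmat" assume \<xi>: "\<xi> \<in> su"
    have y: "yfun ((U ** mexp \<xi>) *v z) = yfun z" for z
      by (simp add: matrix_vector_mul_assoc [symmetric] SU_yfun [OF U] uu_yfun [OF subsetD [OF su_uu \<xi>]])
    show "A (U ** mexp \<xi>) = q (fseries \<h> (act_fam U c (emb \<xi>)))"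
      unfolding A [OF y] act_fam_emb c(2) pullback_fseries_cm [OF nz y c(1)] ..
  qed
  then show "Ck_on k T su (UNIV \<inter> su) (\<lambda>\<xi>. A (U ** mexp \<xi>))" by simp
qed simp_all

lemma cone_smooth_action: "smooth_action (cone_alg \<h>) (cone_top \<h>) pullback"
  unfolding smooth_action_def
proof
  fix a :: "'a cvec \<Rightarrow> complex" assume "a \<in> cone_alg \<h>"
  then show "smooth_on_SU (cone_top \<h>) (\<lambda>U. pullback U a)"
    by (rule cone_smooth [where q = "\<lambda>a. a"]) (simp_all add: continuous_map_id [unfolded id_def])
qed

lemma cone_velocity:
  "\<xi> \<in> su \<Longrightarrow> c \<in> hat_coeffs \<Longrightarrow>
    has_velocity (cone_top \<h>) (\<lambda>t. pullback (mexp (t *\<^sub>R \<xi>)) (fseries \<h> c)) (fseries \<h> (ad \<h> \<xi> c))"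
  using su_uu by (intro velocity_ad nz) auto

lemma lie_deriv_cone:
  assumes "\<xi> \<in> su" "c \<in> hat_coeffs"
  shows "lie_deriv (cone_top \<h>) pullback \<xi> (fseries \<h> c) = fseries \<h> (ad \<h> \<xi> c)"
  unfolding lie_deriv_def
proof (rule the_equality)
  show v: "has_velocity (cone_top \<h>) (\<lambda>t. pullback (mexp (t *\<^sub>R \<xi>)) (fseries \<h> c)) (fseries \<h> (ad \<h> \<xi> c))"
    by (rule cone_velocity [OF assms])
  show "b = fseries \<h> (ad \<h> \<xi> c)" if "has_velocity (cone_top \<h>) (\<lambda>t. pullback (mexp (t *\<^sub>R \<xi>)) (fseries \<h> c)) b" for b
    using that v unfolding has_velocity_def by (rule limitin_cone_top_unique [OF nz]) simp
qed

lemma ad_add: "ad \<h> \<xi> (\<lambda>\<tau>. c \<tau> + d \<tau>) = (\<lambda>\<tau>. ad \<h> \<xi> c \<tau> + ad \<h> \<xi> d \<tau>)"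
  and ad_scale: "ad \<h> \<xi> (\<lambda>\<tau>. x * c \<tau>) = (\<lambda>\<tau>. x * ad \<h> \<xi> c \<tau>)"
  by (simp_all add: ad_def fun_eq_iff cprod_add_left cprod_add_right cprod_scale_left cprod_scale_right
      distrib_left right_diff_distrib mult.left_commute add_divide_distrib)

lemma translation_cone: "a \<in> cone_alg \<h> \<Longrightarrow> continuous_map (cone_top \<h>) (cone_top \<h>) (\<lambda>x z. x z - a z)"
  unfolding cone_top_def using cone_topology_facts [OF nz] by (intro continuous_map_translation) auto

lemma cone_smooth_topology:
  "smooth_topology (cone_alg \<h>) (cone_top \<h>) (pullback :: 'n::finite cmat \<Rightarrow> _) = cone_top \<h>"
proof (rule smooth_topology_eqI)
  let ?L = "lie_deriv (cone_top \<h>) (pullback :: 'n::finite cmat \<Rightarrow> _)"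
  show "fsubspace (cone_alg \<h> :: ('n cvec \<Rightarrow> complex) set)" by (rule fsubspace_cone)
  show "topspace (cone_top \<h>) = (cone_alg \<h> :: ('n cvec \<Rightarrow> complex) set)" by (rule topspace_cone_top [OF nz])
  show "continuous_map (cone_top \<h>) (cone_top \<h>) (\<lambda>x z. x z - a z)" if "a \<in> cone_alg \<h>" for a :: "'n cvec \<Rightarrow> complex"
    by (rule translation_cone [OF that])
  fix \<xi> :: "'n cmat" assume \<xi>: "\<xi> \<in> su"
  show "continuous_map (cone_top \<h>) (cone_top \<h>) (?L \<xi>)"
    by (rule continuous_ad [OF nz]) (rule lie_deriv_cone [OF \<xi>])
  show "?L \<xi> (\<lambda>z. a z + b z) = (\<lambda>z. ?L \<xi> a z + ?L \<xi> b z)" if ab: "a \<in> cone_alg \<h>" "b \<in> cone_alg \<h>" for a b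
  proof -
    obtain c where c: "c \<in> hat_coeffs" "a = fseries \<h> c" by (rule cone_algE [OF nz ab(1)])
    obtain d where d: "d \<in> hat_coeffs" "b = fseries \<h> d" by (rule cone_algE [OF nz ab(2)])
    show ?thesis
      unfolding c(2) d(2) fseries_add [OF c(1) d(1), symmetric] lie_deriv_cone [OF \<xi> hat_add [OF c(1) d(1)]]
        lie_deriv_cone [OF \<xi> c(1)] lie_deriv_cone [OF \<xi> d(1)] ad_add fseries_add [OF ad_hat [OF c(1)] ad_hat [OF d(1)]] ..
  qed
  show "?L \<xi> (\<lambda>z. x * a z) = (\<lambda>z. x * ?L \<xi> a z)" if a: "a \<in> cone_alg \<h>" for x a
  proof -
    obtain c where c: "c \<in> hat_coeffs" "a = fseries \<h> c" by (rule cone_algE [OF nz a])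
    show ?thesis
      unfolding c(2) fseries_scale [symmetric] lie_deriv_cone [OF \<xi> hat_scale [OF c(1)]] lie_deriv_cone [OF \<xi> c(1)] ad_scale ..
  qed
next
  fix U and x :: "'n cvec \<Rightarrow> complex" assume "openin (cone_top \<h>) U" "x \<in> U"
  then obtain \<epsilon> r where \<epsilon>: "0 < \<epsilon>" "\<epsilon> < 1" "0 < r" "{y \<in> cone_alg \<h>. eps_norm \<h> \<epsilon> (\<lambda>z. y z - x z) < r} \<subseteq> U"
    using cone_top_ball [OF nz] by blast
  then show "\<exists>p r. continuous_seminorm (cone_alg \<h>) (cone_top \<h>) p \<and> 0 < r \<and> {y \<in> cone_alg \<h>. p (\<lambda>z. y z - x z) < r} \<subseteq> U"
    using continuous_seminorm_coneI [OF nz fseminorm_eps [OF nz \<epsilon>(1,2)] \<epsilon>(1,2)] by blast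
qed

section \<open>Descent to the disc\<close>

lemma topspace_disc_top: "topspace (disc_top \<h>) = disc_alg \<h>"
  by (simp add: disc_top_def disc_alg_def topspace_cone_top [OF nz])

lemma continuous_disc_class: "continuous_map (cone_top \<h>) (disc_top \<h>) disc_class"
  unfolding disc_top_def by (rule quotient_imp_continuous_map [OF quotient_map_quotient_topology])

lemma continuous_disc_lift:
  assumes "continuous_map (cone_top \<h>) T F" "\<And>a. a \<in> cone_alg \<h> \<Longrightarrow> G (disc_class a) = F a"
  shows "continuous_map (disc_top \<h>) T G"
  unfolding disc_top_def
proof (rule continuous_compose_quotient_map [OF quotient_map_quotient_topology])
  show "continuous_map (cone_top \<h>) T (G \<circ> disc_class)"
    by (rule continuous_map_eq [OF assms(1)]) (simp add: assms(2) topspace_cone_top [OF nz])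
qed

lemma continuous_eval_cone:
  "continuous_map (cone_top \<h>) euclidean (\<lambda>a. a (z :: 'n::finite cvec))"
  unfolding continuous_map_atin
proof
  fix a :: "'n cvec \<Rightarrow> complex" assume "a \<in> topspace (cone_top \<h>)"
  from limitin_cone_top_eval [OF nz limitin_id_atin [OF nz this], of z]
  show "limitin euclidean (\<lambda>a. a z) (a z) (atin (cone_top \<h>) a)" by simp
qed

text \<open>Evaluation at a point of the disc is evaluation at its lift, so it is continuous for the
  quotient topology, and such evaluations separate the classes.\<close>

lemma limitin_disc_top_unique:
  assumes "limitin (disc_top \<h>) X b F" "limitin (disc_top \<h>) X c F" "F \<noteq> bot"
  shows "b = c"
proof
  fix v :: "(complex, 'a) vec"
  have "continuous_map (disc_top \<h>) euclidean (\<lambda>f. f v)"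
  proof (cases "v \<in> disc")
    case True
    then show ?thesis by (intro continuous_disc_lift [OF continuous_eval_cone [of "lift_pt v"]]) (simp add: disc_class_def)
  next
    case False
    then show ?thesis by (intro continuous_disc_lift [where F = "\<lambda>a. 0"]) (simp_all add: disc_class_def)
  qed
  then have "limitin euclidean ((\<lambda>f. f v) \<circ> X) (b v) F" "limitin euclidean ((\<lambda>f. f v) \<circ> X) (c v) F"
    using continuous_map_limit assms(1,2) by fastforce+
  then show "b v = c v"
    using tendsto_unique [OF assms(3)] by (simp add: o_def)
qed

text \<open>Independence of the representative: the substitution maps the level set
  \<open>y = 1\<close> to itself, so a difference vanishing there still does after pullback.\<close>

lemma disc_act_class:
  assumes "\<And>z. yfun (U *v z) = yfun z" "a \<in> cone_alg \<h>"
  shows "disc_act \<h> U (disc_class a) = disc_class (pullback U a)"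
  unfolding disc_act_def
    disc_class_eq_iff [OF pullback_cone [OF nz assms(1) disc_rep(1) [OF assms(2)]] pullback_cone [OF nz assms]]
  using disc_class_eq_iff [OF disc_rep(1) [OF assms(2)] assms(2)] disc_rep(2) [OF assms(2)]
  by (simp add: pullback_def assms(1))

text \<open>Independence of both representatives: c'd' - cd = (c' - c) d' + c (d' - d), and both
  terms lie in the two-sided vanishing ideal.\<close>

lemma disc_mult_class:
  assumes "a \<in> cone_alg \<h>" "b \<in> cone_alg \<h>"
  shows "disc_mult \<h> (disc_class a) (disc_class b) = disc_class (cone_mult \<h> a b)"
proof -
  let ?a = "disc_rep \<h> (disc_class a)" and ?b = "disc_rep \<h> (disc_class b)"
  obtain c where c: "c \<in> hat_coeffs" "a = fseries \<h> c" by (rule cone_algE [OF nz assms(1)])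
  obtain d where d: "d \<in> hat_coeffs" "b = fseries \<h> d" by (rule cone_algE [OF nz assms(2)])
  obtain c' where c': "c' \<in> hat_coeffs" "?a = fseries \<h> c'" by (rule cone_algE [OF nz disc_rep(1) [OF assms(1)]])
  obtain d' where d': "d' \<in> hat_coeffs" "?b = fseries \<h> d'" by (rule cone_algE [OF nz disc_rep(1) [OF assms(2)]])
  have va: "(\<lambda>\<tau>. c' \<tau> - c \<tau>) \<in> vanishing_coeffs \<h>"
    using disc_class_eq_iff [OF disc_rep(1) [OF assms(1)] assms(1)] disc_rep(2) [OF assms(1)]
    unfolding c'(2) unfolding c(2) by (simp add: vanishing_coeffs_def hat_diff c(1) c'(1) fseries_diff)
  have vb: "(\<lambda>\<tau>. d' \<tau> - d \<tau>) \<in> vanishing_coeffs \<h>"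
    using disc_class_eq_iff [OF disc_rep(1) [OF assms(2)] assms(2)] disc_rep(2) [OF assms(2)]
    unfolding d'(2) unfolding d(2) by (simp add: vanishing_coeffs_def hat_diff d(1) d'(1) fseries_diff)
  have "(\<lambda>\<tau>. 1 * cprod (\<lambda>\<tau>. c' \<tau> - c \<tau>) d' \<tau> + cprod c (\<lambda>\<tau>. d' \<tau> - d \<tau>) \<tau>) \<in> vanishing_coeffs \<h>"
    by (intro van_lin cprod_van_left cprod_van_right nz va vb c(1) d'(1))
  then have "(\<lambda>\<tau>. cprod c' d' \<tau> - cprod c d \<tau>) \<in> vanishing_coeffs \<h>"
    by (simp add: cprod_diff_left cprod_diff_right)
  then have "\<forall>w. yfun w = 1 \<longrightarrow> fseries \<h> (cprod c' d') w - fseries \<h> (cprod c d) w = 0"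
    by (simp add: vanishing_coeffs_def fseries_diff [OF cprod_hat [OF c'(1) d'(1)] cprod_hat [OF c(1) d(1)]])
  then show ?thesis
    unfolding disc_mult_def disc_class_eq_iff [OF cone_mult_alg [OF disc_rep(1) [OF assms(1)] disc_rep(1) [OF assms(2)]] cone_mult_alg [OF assms]]
    unfolding c'(2) d'(2) unfolding c(2) d(2) cone_mult_fseries [OF nz c(1) d(1)] cone_mult_fseries [OF nz c'(1) d'(1)] .
qed

lemma continuous_disc_act:
  assumes "\<And>z. yfun (U *v z) = yfun z"
  shows "continuous_map (disc_top \<h>) (disc_top \<h>) (disc_act \<h> U)"
  by (rule continuous_disc_lift [OF continuous_map_compose [OF continuous_pullback [OF nz assms] continuous_disc_class]])
    (simp add: disc_act_class assms)

lemma disc_automorphism: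
  fixes U :: "'n::finite cmat"
  assumes "U \<in> SU"
  shows "alg_automorphism (disc_alg \<h>) (disc_top \<h>) (disc_mult \<h>) (disc_act \<h> U)"
proof (rule alg_automorphismI)
  note y = SU_yfun [OF assms] and yi = SU_inv_yfun [OF assms]
  show "topspace (disc_top \<h>) = disc_alg \<h>" by (rule topspace_disc_top)
  show "continuous_map (disc_top \<h>) (disc_top \<h>) (disc_act \<h> U)" by (rule continuous_disc_act [OF y])
  show "continuous_map (disc_top \<h>) (disc_top \<h>) (disc_act \<h> (matrix_inv U))" by (rule continuous_disc_act [OF yi])
  fix f :: "(complex, 'n) vec \<Rightarrow> complex" assume "f \<in> disc_alg \<h>"
  then obtain a where a: "a \<in> cone_alg \<h>" "f = disc_class a" by (rule disc_algE)
  show "disc_act \<h> (matrix_inv U) (disc_act \<h> U f) = f" "disc_act \<h> U (disc_act \<h> (matrix_inv U) f) = f"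
    by (simp_all add: a disc_act_class y yi pullback_cone nz pullback_compose [symmetric] SU_inv(2,3) [OF assms])
  show "disc_act \<h> U (\<lambda>z. c * f z) = (\<lambda>z. c * disc_act \<h> U f z)" for c
    using disc_act_class [OF y fsubspaceD(3) [OF fsubspace_cone a(1)], of c] disc_act_class [OF y a(1)]
    by (simp add: a(2) disc_class_linear pullback_def)
  fix g :: "(complex, 'n) vec \<Rightarrow> complex" assume "g \<in> disc_alg \<h>"
  then obtain b where b: "b \<in> cone_alg \<h>" "g = disc_class b" by (rule disc_algE)
  show "disc_act \<h> U (\<lambda>z. f z + g z) = (\<lambda>z. disc_act \<h> U f z + disc_act \<h> U g z)"
    using disc_act_class [OF y fsubspaceD(2) [OF fsubspace_cone a(1) b(1)]] disc_act_class [OF y a(1)] disc_act_class [OF y b(1)]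
    by (simp add: a(2) b(2) disc_class_linear pullback_def)
  show "disc_act \<h> U (disc_mult \<h> f g) = disc_mult \<h> (disc_act \<h> U f) (disc_act \<h> U g)"
    by (simp add: a b disc_act_class y disc_mult_class cone_mult_alg pullback_cone nz pullback_mult [OF assms])
qed

lemma disc_acts: "acts_by_automorphisms (disc_alg \<h>) (disc_top \<h>) (disc_mult \<h>) (disc_act \<h>)"
  unfolding acts_by_automorphisms_def
proof (intro conjI ballI)
  show "alg_automorphism (disc_alg \<h>) (disc_top \<h>) (disc_mult \<h>) (disc_act \<h> U)" if "U \<in> SU" for U :: "'a cmat"
    by (rule disc_automorphism [OF that])
  fix f :: "(complex, 'a) vec \<Rightarrow> complex" assume "f \<in> disc_alg \<h>"
  then obtain a where a: "a \<in> cone_alg \<h>" "f = disc_class a" by (rule disc_algE)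
  show "disc_act \<h> (mat 1) f = f" by (simp add: a disc_act_class)
  fix U W :: "'a cmat" assume "U \<in> SU" "W \<in> SU"
  then show "disc_act \<h> (U ** W) f = disc_act \<h> W (disc_act \<h> U f)"
    by (simp add: a disc_act_class SU_yfun pullback_cone nz pullback_compose matrix_vector_mul_assoc [symmetric])
qed

lemma disc_smooth_action: "smooth_action (disc_alg \<h>) (disc_top \<h>) (disc_act \<h>)"
  unfolding smooth_action_def
proof
  fix f :: "(complex, 'a) vec \<Rightarrow> complex" assume "f \<in> disc_alg \<h>"
  then obtain a where a: "a \<in> cone_alg \<h>" "f = disc_class a" by (rule disc_algE)
  show "smooth_on_SU (disc_top \<h>) (\<lambda>U. disc_act \<h> U f)"
    unfolding a(2)
    by (rule cone_smooth [OF a(1) continuous_disc_class]) (simp_all add: disc_class_linear disc_act_class a(1))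
qed

lemma disc_velocity:
  assumes "\<xi> \<in> su" "c \<in> hat_coeffs"
  shows "has_velocity (disc_top \<h>) (\<lambda>t. disc_act \<h> (mexp (t *\<^sub>R \<xi>)) (disc_class (fseries \<h> c))) (disc_class (fseries \<h> (ad \<h> \<xi> c)))"
  using continuous_map_limit [OF continuous_disc_class cone_velocity [OF assms, unfolded has_velocity_def]]
  unfolding has_velocity_def o_def disc_class_linear disc_act_class [OF uu_yfun [OF su_scale [OF assms(1)]] fseries_cone [OF nz assms(2)]] .

lemma lie_deriv_disc:
  assumes "\<xi> \<in> su" "c \<in> hat_coeffs"
  shows "lie_deriv (disc_top \<h>) (disc_act \<h>) \<xi> (disc_class (fseries \<h> c)) = disc_class (fseries \<h> (ad \<h> \<xi> c))"
  unfolding lie_deriv_def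
proof (rule the_equality)
  show v: "has_velocity (disc_top \<h>) (\<lambda>t. disc_act \<h> (mexp (t *\<^sub>R \<xi>)) (disc_class (fseries \<h> c))) (disc_class (fseries \<h> (ad \<h> \<xi> c)))"
    by (rule disc_velocity [OF assms])
  show "b = disc_class (fseries \<h> (ad \<h> \<xi> c))"
    if "has_velocity (disc_top \<h>) (\<lambda>t. disc_act \<h> (mexp (t *\<^sub>R \<xi>)) (disc_class (fseries \<h> c))) b" for b
    using that v unfolding has_velocity_def by (rule limitin_disc_top_unique) simp
qed

text \<open>The topology on the disc algebra is given by open sets of the quotient, whereas the
  smooth topology is built from continuous seminorms; the quotient seminorms connect the
  two.\<close>

definition quot_norm :: "real \<Rightarrow> ((complex, 'n::finite) vec \<Rightarrow> complex) \<Rightarrow> real" where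
  "quot_norm \<epsilon> f = (INF a\<in>{a \<in> cone_alg \<h>. disc_class a = f}. eps_norm \<h> \<epsilon> a)"

context
  fixes \<epsilon> :: real
  assumes \<epsilon>: "0 < \<epsilon>" "\<epsilon> < 1"
begin

lemma eps_norm_cone_nonneg: "a \<in> cone_alg \<h> \<Longrightarrow> 0 \<le> eps_norm \<h> \<epsilon> a"
  using fseminormD(1) [OF fseminorm_eps [OF nz \<epsilon>]] .

lemma quot_norm_le: "a \<in> cone_alg \<h> \<Longrightarrow> quot_norm \<epsilon> (disc_class a) \<le> eps_norm \<h> \<epsilon> a"
  unfolding quot_norm_def by (rule cINF_lower) (auto intro!: bdd_belowI [of _ 0] eps_norm_cone_nonneg)

lemma quot_norm_less:
  assumes "f \<in> disc_alg \<h>" "quot_norm \<epsilon> f < r"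
  shows "\<exists>a\<in>cone_alg \<h>. disc_class a = f \<and> eps_norm \<h> \<epsilon> a < r"
proof -
  have "{a \<in> cone_alg \<h>. disc_class a = f} \<noteq> {}" using assms(1) by (auto simp: disc_alg_def)
  then show ?thesis
    using assms(2) unfolding quot_norm_def
    by (subst (asm) cINF_less_iff) (auto intro!: bdd_belowI [of _ 0] eps_norm_cone_nonneg)
qed

lemma quot_norm_nonneg: "f \<in> disc_alg \<h> \<Longrightarrow> 0 \<le> quot_norm \<epsilon> f"
  unfolding quot_norm_def disc_alg_def by (rule cINF_greatest) (auto simp: eps_norm_cone_nonneg)

lemma quot_norm_scale_le:
  assumes "f \<in> disc_alg \<h>"
  shows "quot_norm \<epsilon> (\<lambda>z. c * f z) \<le> cmod c * quot_norm \<epsilon> f"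
proof (rule field_le_epsilon)
  fix e :: real assume e: "e > 0"
  \<comment> \<open>Chosen so that \<open>cmod c * d \<le> e\<close>; the summand 1 covers
    \<open>c = 0\<close>.\<close>
  define d where "d = e / (cmod c + 1)"
  have d: "d > 0" "cmod c * d \<le> e"
    using e by (auto simp: d_def add_nonneg_pos divide_simps mult.commute intro!: mult_right_mono)
  obtain a where a: "a \<in> cone_alg \<h>" "disc_class a = f" "eps_norm \<h> \<epsilon> a < quot_norm \<epsilon> f + d"
    using quot_norm_less [OF assms, of "quot_norm \<epsilon> f + d"] d(1) by auto
  have "quot_norm \<epsilon> (\<lambda>z. c * f z) \<le> eps_norm \<h> \<epsilon> (\<lambda>z. c * a z)"
    using quot_norm_le [OF fsubspaceD(3) [OF fsubspace_cone a(1)], of c] by (simp add: disc_class_linear a(2))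
  also have "\<dots> = cmod c * eps_norm \<h> \<epsilon> a" by (rule fseminormD [OF fseminorm_eps [OF nz \<epsilon>] a(1)])
  also have "\<dots> \<le> cmod c * (quot_norm \<epsilon> f + d)" using a(3) by (intro mult_left_mono) auto
  also have "\<dots> \<le> cmod c * quot_norm \<epsilon> f + e" using d by (simp add: distrib_left)
  finally show "quot_norm \<epsilon> (\<lambda>z. c * f z) \<le> cmod c * quot_norm \<epsilon> f + e" .
qed

lemma fseminorm_quot: "fseminorm (disc_alg \<h>) (quot_norm \<epsilon> :: ((complex, 'n::finite) vec \<Rightarrow> complex) \<Rightarrow> real)"
  unfolding fseminorm_def
proof (intro conjI ballI allI)
  fix f :: "(complex, 'n) vec \<Rightarrow> complex" assume f: "f \<in> disc_alg \<h>"
  show "0 \<le> quot_norm \<epsilon> f" by (rule quot_norm_nonneg [OF f])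
  show "quot_norm \<epsilon> (\<lambda>z. c * f z) = cmod c * quot_norm \<epsilon> f" for c
  proof (cases "c = 0")
    case True
    have "quot_norm \<epsilon> (\<lambda>z :: (complex, 'n) vec. 0) \<le> 0"
      using quot_norm_scale_le [OF f, of 0] by simp
    moreover have "0 \<le> quot_norm \<epsilon> (\<lambda>z :: (complex, 'n) vec. 0)"
      by (rule quot_norm_nonneg [OF fsubspaceD(1) [OF fsubspace_disc]])
    ultimately show ?thesis using True by simp
  next
    case False
    have "quot_norm \<epsilon> f \<le> cmod (inverse c) * quot_norm \<epsilon> (\<lambda>z. c * f z)"
      using quot_norm_scale_le [OF fsubspaceD(3) [OF fsubspace_disc f, of c], of "inverse c"] False
      by (simp add: mult.assoc [symmetric])
    then have "cmod c * quot_norm \<epsilon> f \<le> quot_norm \<epsilon> (\<lambda>z. c * f z)"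
      using False by (simp add: norm_divide field_simps)
    then show ?thesis using quot_norm_scale_le [OF f, of c] by simp
  qed
  fix g :: "(complex, 'n) vec \<Rightarrow> complex" assume g: "g \<in> disc_alg \<h>"
  show "quot_norm \<epsilon> (\<lambda>z. f z + g z) \<le> quot_norm \<epsilon> f + quot_norm \<epsilon> g"
  proof (rule field_le_epsilon)
    fix e :: real assume e: "e > 0"
    obtain a where a: "a \<in> cone_alg \<h>" "disc_class a = f" "eps_norm \<h> \<epsilon> a < quot_norm \<epsilon> f + e/2"
      using quot_norm_less [OF f, of "quot_norm \<epsilon> f + e/2"] e by auto
    obtain b where b: "b \<in> cone_alg \<h>" "disc_class b = g" "eps_norm \<h> \<epsilon> b < quot_norm \<epsilon> g + e/2"
      using quot_norm_less [OF g, of "quot_norm \<epsilon> g + e/2"] e by auto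
    have "quot_norm \<epsilon> (\<lambda>z. f z + g z) \<le> eps_norm \<h> \<epsilon> (\<lambda>z. a z + b z)"
      using quot_norm_le [OF fsubspaceD(2) [OF fsubspace_cone a(1) b(1)]] by (simp add: disc_class_linear a(2) b(2))
    also have "\<dots> \<le> eps_norm \<h> \<epsilon> a + eps_norm \<h> \<epsilon> b" by (rule fseminormD(2) [OF fseminorm_eps [OF nz \<epsilon>] a(1) b(1)])
    finally show "quot_norm \<epsilon> (\<lambda>z. f z + g z) \<le> quot_norm \<epsilon> f + quot_norm \<epsilon> g + e" using a(3) b(3) by simp
  qed
qed

text \<open>Composed with the quotient map it is a seminorm on the cone algebra dominated by
  \<open>eps_norm \<h> \<epsilon>\<close>, hence continuous, and continuity descends to the
  quotient.\<close>

lemma continuous_seminorm_quot: "continuous_seminorm (disc_alg \<h>) (disc_top \<h>) (quot_norm \<epsilon>)"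
proof -
  have s: "fseminorm (cone_alg \<h>) (\<lambda>a :: 'a cvec \<Rightarrow> complex. quot_norm \<epsilon> (disc_class a))"
    unfolding fseminorm_def disc_class_linear
    using fseminormD [OF fseminorm_quot] disc_class_alg by blast
  have "continuous_map (cone_top \<h>) euclideanreal (\<lambda>a :: 'a cvec \<Rightarrow> complex. quot_norm \<epsilon> (disc_class a))"
    using continuous_seminorm_coneI [OF nz s \<epsilon> quot_norm_le] by (simp add: continuous_seminorm_alt)
  then show ?thesis
    unfolding continuous_seminorm_alt by (intro conjI fseminorm_quot continuous_disc_lift) auto
qed

end

lemma disc_smooth_topology:
  "smooth_topology (disc_alg \<h>) (disc_top \<h>) (disc_act \<h> :: 'n::finite cmat \<Rightarrow> _) = disc_top \<h>"
proof (rule smooth_topology_eqI)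
  let ?L = "lie_deriv (disc_top \<h>) (disc_act \<h> :: 'n::finite cmat \<Rightarrow> _)"
  show "fsubspace (disc_alg \<h> :: ((complex, 'n) vec \<Rightarrow> complex) set)" by (rule fsubspace_disc)
  show "topspace (disc_top \<h>) = (disc_alg \<h> :: ((complex, 'n) vec \<Rightarrow> complex) set)" by (rule topspace_disc_top)
  show "continuous_map (disc_top \<h>) (disc_top \<h>) (\<lambda>x z. x z - f z)" if f: "f \<in> disc_alg \<h>" for f :: "(complex, 'n) vec \<Rightarrow> complex"
  proof -
    obtain a where a: "a \<in> cone_alg \<h>" "f = disc_class a" using f by (rule disc_algE)
    show ?thesis
      by (rule continuous_disc_lift [OF continuous_map_compose [OF translation_cone [OF a(1)] continuous_disc_class]])
        (simp add: disc_class_linear a(2))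
  qed
  have E: "\<exists>c\<in>hat_coeffs. f = disc_class (fseries \<h> c)" if "f \<in> disc_alg \<h>" for f :: "(complex, 'n) vec \<Rightarrow> complex"
    using that by (auto simp: disc_alg_def cone_alg_def)
  fix \<xi> :: "'n cmat" assume \<xi>: "\<xi> \<in> su"
  have "continuous_map (cone_top \<h>) (disc_top \<h>) (disc_class \<circ> lie_deriv (cone_top \<h>) pullback \<xi>)"
    by (rule continuous_map_compose [OF continuous_ad [OF nz lie_deriv_cone [OF \<xi>]] continuous_disc_class])
  then show "continuous_map (disc_top \<h>) (disc_top \<h>) (?L \<xi>)"
    by (rule continuous_disc_lift) (auto simp: cone_alg_def lie_deriv_cone [OF \<xi>] lie_deriv_disc [OF \<xi>])
  show "?L \<xi> (\<lambda>z. f z + g z) = (\<lambda>z. ?L \<xi> f z + ?L \<xi> g z)" if fg: "f \<in> disc_alg \<h>" "g \<in> disc_alg \<h>" for f g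
  proof -
    obtain c where c: "c \<in> hat_coeffs" "f = disc_class (fseries \<h> c)" using E [OF fg(1)] by blast
    obtain d where d: "d \<in> hat_coeffs" "g = disc_class (fseries \<h> d)" using E [OF fg(2)] by blast
    show ?thesis
      unfolding c(2) d(2) disc_class_linear(1) [symmetric] fseries_add [OF c(1) d(1), symmetric]
        lie_deriv_disc [OF \<xi> hat_add [OF c(1) d(1)]]
        lie_deriv_disc [OF \<xi> c(1)] lie_deriv_disc [OF \<xi> d(1)] ad_add
        fseries_add [OF ad_hat [OF c(1)] ad_hat [OF d(1)]] ..
  qed
  show "?L \<xi> (\<lambda>z. x * f z) = (\<lambda>z. x * ?L \<xi> f z)" if f: "f \<in> disc_alg \<h>" for x f
  proof -
    obtain c where c: "c \<in> hat_coeffs" "f = disc_class (fseries \<h> c)" using E [OF f] by blast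
    show ?thesis
      unfolding c(2) disc_class_linear(3) [symmetric] fseries_scale [symmetric] lie_deriv_disc [OF \<xi> hat_scale [OF c(1)]]
        lie_deriv_disc [OF \<xi> c(1)] ad_scale ..
  qed
next
  fix U and f :: "(complex, 'n) vec \<Rightarrow> complex" assume U: "openin (disc_top \<h>) U" and f: "f \<in> U"
  then have "f \<in> disc_alg \<h>" using openin_subset [OF U] by (auto simp: topspace_disc_top)
  then obtain a where a: "a \<in> cone_alg \<h>" "f = disc_class a" by (rule disc_algE)
  \<comment> \<open>The neighbourhood is pulled back to the cone algebra, where a ball of a single
    seminorm fits inside.\<close>
  let ?W = "{x \<in> cone_alg \<h>. disc_class x \<in> U}"
  have "openin (cone_top \<h>) ?W"
    using openin_continuous_map_preimage [OF continuous_disc_class U] by (simp add: topspace_cone_top [OF nz])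
  moreover have "a \<in> ?W" using a f by simp
  ultimately obtain \<epsilon> r where \<epsilon>: "0 < \<epsilon>" "\<epsilon> < 1" "0 < r" "{x \<in> cone_alg \<h>. eps_norm \<h> \<epsilon> (\<lambda>z. x z - a z) < r} \<subseteq> ?W"
    using cone_top_ball [OF nz] by blast
  have "{g \<in> disc_alg \<h>. quot_norm \<epsilon> (\<lambda>z. g z - f z) < r} \<subseteq> U"
  proof
    fix g assume g: "g \<in> {g \<in> disc_alg \<h>. quot_norm \<epsilon> (\<lambda>z. g z - f z) < r}"
    then have "(\<lambda>z. g z - f z) \<in> disc_alg \<h>"
      using disc_class_alg [OF a(1)] by (intro fsubspaceD [OF fsubspace_disc]) (auto simp: a(2))
    then obtain b where b: "b \<in> cone_alg \<h>" "disc_class b = (\<lambda>z. g z - f z)" "eps_norm \<h> \<epsilon> b < r"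
      using quot_norm_less [OF \<epsilon>(1,2), of "\<lambda>z. g z - f z" r] g by auto
    \<comment> \<open>A small representative \<open>b\<close> of \<open>g - f\<close> yields a
      representative \<open>a + b\<close> of \<open>g\<close> inside the ball.\<close>
    have "(\<lambda>z. a z + b z) \<in> {x \<in> cone_alg \<h>. eps_norm \<h> \<epsilon> (\<lambda>z. x z - a z) < r}"
      using b fsubspaceD(2) [OF fsubspace_cone a(1) b(1)] by simp
    then have "disc_class (\<lambda>z. a z + b z) \<in> U" using \<epsilon>(4) by blast
    then show "g \<in> U" by (simp add: disc_class_linear b(2) a(2))
  qed
  then show "\<exists>p r. continuous_seminorm (disc_alg \<h>) (disc_top \<h>) p \<and> 0 < r \<and> {g \<in> disc_alg \<h>. p (\<lambda>z. g z - f z) < r} \<subseteq> U"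
    using continuous_seminorm_quot [OF \<epsilon>(1,2)] \<epsilon>(3) by blast
qed

section \<open>Innerness of the infinitesimal action and the involution\<close>

lemma fseries_ad:
  assumes "c \<in> hat_coeffs"
  shows "fseries \<h> (ad \<h> \<xi> c) =
    (\<lambda>z. \<i> / \<h> * (cone_mult \<h> (momentum \<xi>) (fseries \<h> c) z - cone_mult \<h> (fseries \<h> c) (momentum \<xi>) z))"
proof -
  have j: "momentum_coeffs \<h> \<xi> \<in> hat_coeffs" by (rule fin_hat [OF jc_fin])
  show ?thesis
    unfolding ad_def [abs_def] momentum_jc [OF nz] cone_mult_fseries [OF nz j assms] cone_mult_fseries [OF nz assms j]
      fseries_scale fseries_diff [OF cprod_hat [OF j assms] cprod_hat [OF assms j]] ..
qed

lemma momentum_cone: "momentum \<xi> \<in> cone_alg \<h>"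
  unfolding momentum_jc [OF nz] by (intro fseries_cone [OF nz] fin_hat jc_fin)

lemma cone_inner: "inner_via \<h> (cone_alg \<h>) (cone_top \<h>) (cone_mult \<h>) pullback momentum"
  unfolding inner_via_def
proof (intro conjI ballI)
  fix \<xi> :: "'a cmat" and a :: "'a cvec \<Rightarrow> complex" assume "\<xi> \<in> su" "a \<in> cone_alg \<h>"
  then show "has_velocity (cone_top \<h>) (\<lambda>t. pullback (mexp (t *\<^sub>R \<xi>)) a)
      (\<lambda>z. \<i> / \<h> * (cone_mult \<h> (momentum \<xi>) a z - cone_mult \<h> a (momentum \<xi>) z))"
    by (auto elim!: cone_algE [OF nz] simp only: fseries_ad [symmetric] cone_velocity)
qed (simp_all add: momentum_cone momentum_equivariant)

lemma disc_inner:
  "inner_via \<h> (disc_alg \<h>) (disc_top \<h>) (disc_mult \<h>) (disc_act \<h>) (\<lambda>\<xi>. disc_class (momentum \<xi>))"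
  unfolding inner_via_def
proof (intro conjI ballI)
  fix \<xi> :: "'a cmat" assume \<xi>: "\<xi> \<in> su"
  show "disc_class (momentum \<xi>) \<in> disc_alg \<h>" by (rule disc_class_alg [OF momentum_cone])
  show "disc_act \<h> U (disc_class (momentum \<xi>)) = disc_class (momentum (matrix_inv U ** \<xi> ** U))" if "U \<in> SU" for U
    by (simp add: disc_act_class SU_yfun [OF that] momentum_cone momentum_equivariant [OF that])
  fix f :: "(complex, 'a) vec \<Rightarrow> complex" assume "f \<in> disc_alg \<h>"
  then obtain a where a: "a \<in> cone_alg \<h>" "f = disc_class a" by (rule disc_algE)
  obtain c where c: "c \<in> hat_coeffs" "a = fseries \<h> c" by (rule cone_algE [OF nz a(1)])
  show "has_velocity (disc_top \<h>) (\<lambda>t. disc_act \<h> (mexp (t *\<^sub>R \<xi>)) f)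
      (\<lambda>z. \<i> / \<h> * (disc_mult \<h> (disc_class (momentum \<xi>)) f z - disc_mult \<h> f (disc_class (momentum \<xi>)) z))"
    using disc_velocity [OF \<xi> c(1)]
    unfolding fseries_ad [OF c(1)] disc_class_linear a(2) c(2) disc_mult_class [OF momentum_cone fseries_cone [OF nz c(1)]]
      disc_mult_class [OF fseries_cone [OF nz c(1)] momentum_cone] .
qed

lemma vanishing_ideal_pullback:
  assumes "U \<in> SU"
  shows "pullback U ` vanishing_ideal \<h> \<subseteq> vanishing_ideal \<h>"
  using pullback_cone [OF nz SU_yfun [OF assms]] SU_yfun [OF assms]
  by (auto simp: vanishing_ideal_def) (simp add: pullback_def)

lemma conj_fun_mult:
  assumes "\<h> \<in> \<real>" "a \<in> cone_alg \<h>" "b \<in> cone_alg \<h>"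
  shows "conj_fun a \<in> cone_alg \<h>" "conj_fun (cone_mult \<h> a b) = cone_mult \<h> (conj_fun b) (conj_fun a)"
proof -
  obtain c where c: "c \<in> hat_coeffs" "a = fseries \<h> c" by (rule cone_algE [OF nz assms(2)])
  obtain d where d: "d \<in> hat_coeffs" "b = fseries \<h> d" by (rule cone_algE [OF nz assms(3)])
  note f = fseries_cnjc [OF assms(1), symmetric]
  show "conj_fun a \<in> cone_alg \<h>" unfolding c(2) f by (intro fseries_cone nz ctr_hat cnjc_hat c)
  show "conj_fun (cone_mult \<h> a b) = cone_mult \<h> (conj_fun b) (conj_fun a)"
    unfolding c(2) d(2) cone_mult_fseries [OF nz c(1) d(1)] f cnjc_cprod ctr_cprod
      cone_mult_fseries [OF nz ctr_hat [OF cnjc_hat [OF d(1)]] ctr_hat [OF cnjc_hat [OF c(1)]]] ..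
qed

lemma cone_star:
  assumes "\<h> \<in> \<real>"
  shows "acts_by_star_automorphisms (cone_alg \<h>) (cone_top \<h>) (cone_mult \<h>) pullback"
  unfolding acts_by_star_automorphisms_def
  by (auto simp: cone_acts conj_fun_mult [OF assms]) (simp add: pullback_def conj_fun_def)

lemma disc_star:
  assumes "\<h> \<in> \<real>"
  shows "acts_by_star_automorphisms (disc_alg \<h>) (disc_top \<h>) (disc_mult \<h>) (disc_act \<h>)"
  unfolding acts_by_star_automorphisms_def
proof (intro conjI ballI disc_acts)
  fix f :: "(complex, 'a) vec \<Rightarrow> complex" assume "f \<in> disc_alg \<h>"
  then obtain a where a: "a \<in> cone_alg \<h>" "f = disc_class a" by (rule disc_algE)
  have ca: "conj_fun a \<in> cone_alg \<h>" by (rule conj_fun_mult [OF assms a(1) a(1)])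
  show "conj_fun f \<in> disc_alg \<h>" unfolding a(2) conj_fun_disc_class by (rule disc_class_alg [OF ca])
  show "disc_act \<h> U (conj_fun f) = conj_fun (disc_act \<h> U f)" if "U \<in> SU" for U
    unfolding a(2) conj_fun_disc_class disc_act_class [OF SU_yfun [OF that] ca] disc_act_class [OF SU_yfun [OF that] a(1)]
    by (simp add: pullback_def conj_fun_def)
  fix g :: "(complex, 'a) vec \<Rightarrow> complex" assume "g \<in> disc_alg \<h>"
  then obtain b where b: "b \<in> cone_alg \<h>" "g = disc_class b" by (rule disc_algE)
  have cb: "conj_fun b \<in> cone_alg \<h>" by (rule conj_fun_mult [OF assms b(1) b(1)])
  show "conj_fun (disc_mult \<h> f g) = disc_mult \<h> (conj_fun g) (conj_fun f)"
    unfolding a(2) b(2) disc_mult_class [OF a(1) b(1)] conj_fun_disc_class disc_mult_class [OF cb ca]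
      conj_fun_mult(2) [OF assms a(1) b(1)] ..
qed

end

theorem theorem5p8:
  fixes \<h> :: complex
  assumes "allowed \<h>"
  shows
    \<comment> \<open>(i)\<close>
    "(acts_by_automorphisms (cone_alg \<h>) (cone_top \<h>) (cone_mult \<h>)
        (pullback :: 'n::finite cmat \<Rightarrow> _) \<and>
      smooth_action (cone_alg \<h>) (cone_top \<h>) (pullback :: 'n cmat \<Rightarrow> _) \<and>
      smooth_topology (cone_alg \<h>) (cone_top \<h>) (pullback :: 'n cmat \<Rightarrow> _) = cone_top \<h>) \<and>
     \<comment> \<open>(ii)\<close>
     ((\<forall>U\<in>(SU :: 'n cmat set). pullback U ` vanishing_ideal \<h> \<subseteq> vanishing_ideal \<h> \<and>
         (\<forall>a\<in>cone_alg \<h>. disc_act \<h> U (disc_class a) = disc_class (pullback U a))) \<and>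
      acts_by_automorphisms (disc_alg \<h>) (disc_top \<h>) (disc_mult \<h>)
        (disc_act \<h> :: 'n cmat \<Rightarrow> _) \<and>
      smooth_action (disc_alg \<h>) (disc_top \<h>) (disc_act \<h> :: 'n cmat \<Rightarrow> _) \<and>
      smooth_topology (disc_alg \<h>) (disc_top \<h>) (disc_act \<h> :: 'n cmat \<Rightarrow> _) = disc_top \<h>) \<and>
     \<comment> \<open>(iii)\<close>
     (inner_via \<h> (cone_alg \<h>) (cone_top \<h>) (cone_mult \<h>) pullback
        (momentum :: 'n cmat \<Rightarrow> _) \<and>
      inner_via \<h> (disc_alg \<h>) (disc_top \<h>) (disc_mult \<h>) (disc_act \<h>)
        (\<lambda>\<xi> :: 'n cmat. disc_class (momentum \<xi>))) \<and>
     \<comment> \<open>(iv)\<close>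
     (\<h> \<in> \<real> \<longrightarrow>
      acts_by_star_automorphisms (cone_alg \<h>) (cone_top \<h>) (cone_mult \<h>)
        (pullback :: 'n cmat \<Rightarrow> _) \<and>
      acts_by_star_automorphisms (disc_alg \<h>) (disc_top \<h>) (disc_mult \<h>)
        (disc_act \<h> :: 'n cmat \<Rightarrow> _))"
proof -
  have nz: "\<h> \<noteq> 0" using assms by (auto simp: allowed_def)
  show ?thesis
    by (intro conjI ballI impI cone_acts cone_smooth_action cone_smooth_topology vanishing_ideal_pullback
        disc_act_class disc_acts disc_smooth_action disc_smooth_topology cone_inner disc_inner cone_star disc_star
        SU_yfun nz)
qed

end
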